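(* Let $\mathcal K$ be a small pointed category with object set $\mathcal O$, and let $D$ be a natural system (of abelian groups) on $\mathcal K$, regarded also as a module over $\mathcal K$. Then for each $n\ge 1$ the $n$-th Baues-Wirsching cohomology group $H^{n}_{BW}(\mathcal K;D)$ is naturally isomorphic to the $(n-1)$-st $(\mathcal S_*,\mathcal O)$-cohomology group $H^{n-1}_{SO}(\mathcal K;D)$.
   Context: $\mathcal S_*$ is the category of pointed simplicial sets. Natural systems. $\mathrm{Fac}\,\mathcal K$ is the category whose objects are the morphisms of $\mathcal K$ and whose morphisms $f\to g$ are pairs $(\alpha,\beta)$ with $g=\beta f\alpha$. A natural system on $\mathcal K$ with values in a category $\mathcal M$ is a functor $\mathrm{Fac}\,\mathcal K\to\mathcal M$; with no further mention, $\mathcal M$ is the category of abelian groups. Write $\beta_*:D(f)\to D(\beta f)$ and $\alpha^*:D(f)\to D(f\alpha)$ for the induced maps. Baues-Wirsching cohomology. Let $N\mathcal K$ be the nerve and for $\sigma\in N_n\mathcal K$ let $\partial_{\max}(\sigma)$ be the composite of the sequence $\sigma$. Let $\tilde N_n\mathcal K$ be the free natural system of sets on $\mathcal K$ generated by the graded set $f\mapsto\{\sigma\in N_n\mathcal K:\partial_{\max}\sigma=f\}$. Inner face maps and degeneracies of $N\mathcal K$ induce maps of natural systems; the outer ones are given on generators by $\tilde d_0(\sigma)=(d_2\cdots d_n\sigma)^*(d_0\sigma)$ and $\tilde d_n(\sigma)=(d_0\cdots d_{n-2}\sigma)_*(d_n\sigma)$. This makes $\tilde N_\bullet\mathcal K$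 a simplicial object in natural systems of sets. Set $C^n(\mathcal K;D)=\mathrm{Hom}(\tilde N_n\mathcal K,D)$ (maps of natural systems of sets), a cosimplicial abelian group, and $H^n_{BW}(\mathcal K;D)=\pi^n(C^\bullet(\mathcal K;D))$. $(\mathcal S_*,\mathcal O)$-categories and cohomology. An $(\mathcal S_*,\mathcal O)$-category is a category with object set $\mathcal O$ enriched in $(\mathcal S_*,\wedge)$; morphisms are the identity on objects. These form a simplicial model category in which a map is a fibration (weak equivalence) if it is one on every mapping space. The fundamental track category $\hat\pi_1\mathcal Z$ of a fibrant $\mathcal Z$ is obtained by applying the fundamental groupoid to each mapping space. A module over a track category $\Lambda$ is an abelian group object over $\Lambda$ in the category of track categories with object set $\mathcal O$. There are a classifying object $B\Lambda$ ($B\Lambda\simeq P_1B\Lambda$, $\hat\pi_1B\Lambda\cong\Lambda$) and Eilenberg-Mac Lane objects $E^\Lambda(M,n)$ over $B\Lambda$, with a section, such that $\pi_nE^\Lambda(M,n)\cong M$ and $\pi_k=0$ for $k\ne 0,1,n$. One defines $H^n_{SO}(\mathcal Z/\Lambda;M)=[\mathcal Z,E^\Lambda(M,n)]$, homotopy classes of maps over $B\Lambda$. The category $\mathcal K$ is viewed as the constant (discrete) $(\mathcal S_*,\mathcal O)$-category $c(\mathcal K)$, with $\hat\pi_1$ equal to $\mathcal K$ itself (so $B\mathcal K\simeq c(\mathcal K)$). A cofibrant replacement is $\mathcal F_\bullet\mathcal K$, with $\mathcal F_n\mathcal K=(FU)^{n+1}\mathcal K$, where $U$ sends a category to its underlying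 directed graph and $F$ is the free category functor. Then $H^n_{SO}(\mathcal K;D)=[\mathcal F_\bullet\mathcal K,E^{\mathcal K}(D,n)]_{/B\mathcal K}$, which is the $n$-th cohomotopy group of the cosimplicial abelian group $\mathrm{Hom}_{/\mathcal K}(\mathcal F_\bullet\mathcal K,D)$. A natural system $D$ is regarded as an abelian group object over $\mathcal K$ among categories with object set $\mathcal O$: its arrows are pairs $(f,x)$ with $x\in D(f)$, and $(g,y)(f,x)=(gf,\,g_*x+f^*y)$; hence it is a module over $\mathcal K$.
   Formalization: For n = 1 the claimed isomorphism fails in general, since H^0_SO is all derivations while H^1_BW is derivations modulo inner ones; there the result is a natural surjection whose kernel is exactly the classes of inner derivations. The natural isomorphism is proved for all n ≥ 2. *)

theory Defs
  imports "HOL-Algebra.Coset" "HOL-Algebra.FiniteProduct" "Graph_Theory.Arc_Walk"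
begin

section \<open>Small categories\<close>

text \<open>\<^term>\<open>Comp C g f\<close> is the composite ``first f, then g''.\<close>

record ('o, 'a) cat =
  Ob :: "'o set"
  Arr :: "'a set"
  Dom :: "'a \<Rightarrow> 'o"
  Cod :: "'a \<Rightarrow> 'o"
  Idn :: "'o \<Rightarrow> 'a"
  Comp :: "'a \<Rightarrow> 'a \<Rightarrow> 'a"

locale category =
  fixes C :: "('o, 'a) cat"
  assumes Dom_in: "f \<in> Arr C \<Longrightarrow> Dom C f \<in> Ob C"
    and Cod_in: "f \<in> Arr C \<Longrightarrow> Cod C f \<in> Ob C"
    and Idn_in: "a \<in> Ob C \<Longrightarrow> Idn C a \<in> Arr C"
    and Dom_Idn: "a \<in> Ob C \<Longrightarrow> Dom C (Idn C a) = a"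
    and Cod_Idn: "a \<in> Ob C \<Longrightarrow> Cod C (Idn C a) = a"
    and Comp_in: "\<lbrakk>f \<in> Arr C; g \<in> Arr C; Cod C f = Dom C g\<rbrakk> \<Longrightarrow> Comp C g f \<in> Arr C"
    and Dom_Comp: "\<lbrakk>f \<in> Arr C; g \<in> Arr C; Cod C f = Dom C g\<rbrakk> \<Longrightarrow> Dom C (Comp C g f) = Dom C f"
    and Cod_Comp: "\<lbrakk>f \<in> Arr C; g \<in> Arr C; Cod C f = Dom C g\<rbrakk> \<Longrightarrow> Cod C (Comp C g f) = Cod C g"
    and Comp_assoc: "\<lbrakk>f \<in> Arr C; g \<in> Arr C; h \<in> Arr C; Cod C f = Dom C g; Cod C g = Dom C h\<rbrakk>
      \<Longrightarrow> Comp C h (Comp C g f) = Comp C (Comp C h g) f"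
    and Comp_Idn_right: "f \<in> Arr C \<Longrightarrow> Comp C f (Idn C (Dom C f)) = f"
    and Comp_Idn_left: "f \<in> Arr C \<Longrightarrow> Comp C (Idn C (Cod C f)) f = f"

text \<open>A pointed category is one enriched in pointed sets with the smash product, i.e. it has zero
  arrows (necessarily unique). A category with a zero object is a special case.\<close>

definition zero_arrows :: "('o, 'a) cat \<Rightarrow> ('o \<Rightarrow> 'o \<Rightarrow> 'a) \<Rightarrow> bool" where
  "zero_arrows C z \<longleftrightarrow>
     (\<forall>a\<in>Ob C. \<forall>b\<in>Ob C. z a b \<in> Arr C \<and> Dom C (z a b) = a \<and> Cod C (z a b) = b) \<and>
     (\<forall>f\<in>Arr C. \<forall>c\<in>Ob C.
        Comp C (z (Cod C f) c) f = z (Dom C f) c \<and> Comp C f (z c (Dom C f)) = z c (Cod C f))"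

definition pointed_category :: "('o, 'a) cat \<Rightarrow> bool" where
  "pointed_category C \<longleftrightarrow> category C \<and> (\<exists>z. zero_arrows C z)"

text \<open>Functors that are the identity on objects.\<close>

definition functors :: "('o, 'a) cat \<Rightarrow> ('o, 'b) cat \<Rightarrow> ('a \<Rightarrow> 'b) set" where
  "functors C C' = {F. Ob C = Ob C' \<and> F \<in> Arr C \<rightarrow>\<^sub>E Arr C' \<and>
     (\<forall>f\<in>Arr C. Dom C' (F f) = Dom C f \<and> Cod C' (F f) = Cod C f) \<and>
     (\<forall>a\<in>Ob C. F (Idn C a) = Idn C' a) \<and>
     (\<forall>f\<in>Arr C. \<forall>g\<in>Arr C. Cod C f = Dom C g \<longrightarrow> F (Comp C g f) = Comp C' (F g) (F f))}"

definition pointed_functors :: "('o, 'a) cat \<Rightarrow> ('o, 'b) cat \<Rightarrow> ('a \<Rightarrow> 'b) set" where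
  "pointed_functors C C' = {F \<in> functors C C'.
     \<forall>z z'. zero_arrows C z \<longrightarrow> zero_arrows C' z' \<longrightarrow>
       (\<forall>a\<in>Ob C. \<forall>b\<in>Ob C. F (z a b) = z' a b)}"

definition und :: "('o, 'a) cat \<Rightarrow> ('o, 'a) pre_digraph" where
  "und C = \<lparr>verts = Ob C, arcs = Arr C, tail = Dom C, head = Cod C\<rparr>"

text \<open>Composite of a walk starting in x; the first list entry is applied first.\<close>

primrec comp_path :: "('o, 'a) cat \<Rightarrow> 'o \<Rightarrow> 'a list \<Rightarrow> 'a" where
  "comp_path C x [] = Idn C x"
| "comp_path C x (f # fs) = Comp C (comp_path C (Cod C f) fs) f"


section \<open>Natural systems\<close>

text \<open>An arrow (\<alpha>, f, \<beta>) of Fac K goes from f to \<beta> f \<alpha>.\<close>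

definition Fac :: "('o, 'a) cat \<Rightarrow> ('a, 'a \<times> 'a \<times> 'a) cat" where
  "Fac K = \<lparr>Ob = Arr K,
     Arr = {(\<alpha>, f, \<beta>). \<alpha> \<in> Arr K \<and> f \<in> Arr K \<and> \<beta> \<in> Arr K \<and>
                        Cod K \<alpha> = Dom K f \<and> Cod K f = Dom K \<beta>},
     Dom = (\<lambda>(\<alpha>, f, \<beta>). f),
     Cod = (\<lambda>(\<alpha>, f, \<beta>). Comp K \<beta> (Comp K f \<alpha>)),
     Idn = (\<lambda>f. (Idn K (Dom K f), f, Idn K (Cod K f))),
     Comp = (\<lambda>(\<alpha>', g, \<beta>') (\<alpha>, f, \<beta>). (Comp K \<alpha> \<alpha>', f, Comp K \<beta>' \<beta>))\<rparr>"

text \<open>A natural system consists of the values on the objects and on the arrows of Fac K. The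
  abelian groups are written multiplicatively, as everywhere in HOL-Algebra.\<close>

record ('a, 'd) natsys =
  grp :: "'a \<Rightarrow> 'd monoid"
  act :: "'a \<times> 'a \<times> 'a \<Rightarrow> 'd \<Rightarrow> 'd"

definition natural_system :: "('o, 'a) cat \<Rightarrow> ('a, 'd) natsys \<Rightarrow> bool" where
  "natural_system K D \<longleftrightarrow>
     (\<forall>f\<in>Ob (Fac K). comm_group (grp D f)) \<and>
     (\<forall>t\<in>Arr (Fac K). act D t \<in> hom (grp D (Dom (Fac K) t)) (grp D (Cod (Fac K) t))) \<and>
     (\<forall>f\<in>Ob (Fac K). \<forall>x\<in>carrier (grp D f). act D (Idn (Fac K) f) x = x) \<and>
     (\<forall>s\<in>Arr (Fac K). \<forall>t\<in>Arr (Fac K). Cod (Fac K) s = Dom (Fac K) t \<longrightarrow>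
        (\<forall>x\<in>carrier (grp D (Dom (Fac K) s)). act D (Comp (Fac K) t s) x = act D t (act D s x)))"

text \<open>\<beta>_* : D(f) \<rightarrow> D(\<beta> f) and \<alpha>^* : D(f) \<rightarrow> D(f \<alpha>).\<close>

definition push :: "('o, 'a) cat \<Rightarrow> ('a, 'd) natsys \<Rightarrow> 'a \<Rightarrow> 'a \<Rightarrow> 'd \<Rightarrow> 'd" where
  "push K D \<beta> f = act D (Idn K (Dom K f), f, \<beta>)"

definition pull :: "('o, 'a) cat \<Rightarrow> ('a, 'd) natsys \<Rightarrow> 'a \<Rightarrow> 'a \<Rightarrow> 'd \<Rightarrow> 'd" where
  "pull K D \<alpha> f = act D (\<alpha>, f, Idn K (Cod K f))"

text \<open>Maps t from the restriction of D along P : K' \<rightarrow> K to D'. With P the identity these are the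
  maps of natural systems on K.\<close>

definition natsys_maps ::
  "('o, 'a) cat \<Rightarrow> ('a \<Rightarrow> 'b) \<Rightarrow> ('b, 'd) natsys \<Rightarrow> ('a, 'e) natsys \<Rightarrow> ('a \<Rightarrow> 'd \<Rightarrow> 'e) set" where
  "natsys_maps K' P D D' = {t.
     (\<forall>f\<in>Arr K'. t f \<in> hom (grp D (P f)) (grp D' f)) \<and>
     (\<forall>\<alpha> f \<beta>. (\<alpha>, f, \<beta>) \<in> Arr (Fac K') \<longrightarrow> (\<forall>x\<in>carrier (grp D (P f)).
        t (Cod (Fac K') (\<alpha>, f, \<beta>)) (act D (P \<alpha>, P f, P \<beta>) x) = act D' (\<alpha>, f, \<beta>) (t f x)))}"


section \<open>Cohomotopy of cosimplicial abelian groups\<close>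

text \<open>The alternating sum g 0 - g 1 + g 2 - ... of g 0, ..., g n.\<close>

definition alt_sum :: "'d monoid \<Rightarrow> nat \<Rightarrow> (nat \<Rightarrow> 'd) \<Rightarrow> 'd" where
  "alt_sum A n g = finprod A (\<lambda>i. if even i then g i else inv\<^bsub>A\<^esub> (g i)) {..n}"

text \<open>In the following, d n i : C n \<rightarrow> C (n + 1) is the i-th coface; the cohomotopy groups are the
  cohomology groups of the cochain complex with the alternating sum of the cofaces as
  differential, so codegeneracies are not needed.\<close>

definition differential ::
  "(nat \<Rightarrow> 'c monoid) \<Rightarrow> (nat \<Rightarrow> nat \<Rightarrow> 'c \<Rightarrow> 'c) \<Rightarrow> nat \<Rightarrow> 'c \<Rightarrow> 'c" where
  "differential C d n c = alt_sum (C (Suc n)) (Suc n) (\<lambda>i. d n i c)"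

definition cocycles :: "(nat \<Rightarrow> 'c monoid) \<Rightarrow> (nat \<Rightarrow> nat \<Rightarrow> 'c \<Rightarrow> 'c) \<Rightarrow> nat \<Rightarrow> 'c set" where
  "cocycles C d n = kernel (C n) (C (Suc n)) (differential C d n)"

definition coboundaries :: "(nat \<Rightarrow> 'c monoid) \<Rightarrow> (nat \<Rightarrow> nat \<Rightarrow> 'c \<Rightarrow> 'c) \<Rightarrow> nat \<Rightarrow> 'c set" where
  "coboundaries C d n =
     (case n of 0 \<Rightarrow> {\<one>\<^bsub>C 0\<^esub>} | Suc m \<Rightarrow> differential C d m ` carrier (C m))"

definition cohomotopy ::
  "(nat \<Rightarrow> 'c monoid) \<Rightarrow> (nat \<Rightarrow> nat \<Rightarrow> 'c \<Rightarrow> 'c) \<Rightarrow> nat \<Rightarrow> 'c set monoid" where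
  "cohomotopy C d n = ((C n)\<lparr>carrier := cocycles C d n\<rparr>) Mod (coboundaries C d n)"


section \<open>Baues-Wirsching cohomology\<close>

record ('a, 's) set_natsys =
  elts :: "'a \<Rightarrow> 's set"
  sact :: "'a \<times> 'a \<times> 'a \<Rightarrow> 's \<Rightarrow> 's"

text \<open>The free natural system of sets generated by the set X graded by deg : X \<rightarrow> Arr K. The
  element (\<alpha>, x, \<beta>) is the image of the generator x under the arrow (\<alpha>, deg x, \<beta>) of Fac K.\<close>

definition free_natsys :: "('o, 'a) cat \<Rightarrow> 'x set \<Rightarrow> ('x \<Rightarrow> 'a) \<Rightarrow> ('a, 'a \<times> 'x \<times> 'a) set_natsys" where
  "free_natsys K X deg = \<lparr>
     elts = (\<lambda>f. {(\<alpha>, x, \<beta>). x \<in> X \<and> (\<alpha>, deg x, \<beta>) \<in> Arr (Fac K) \<and>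
                              Cod (Fac K) (\<alpha>, deg x, \<beta>) = f}),
     sact = (\<lambda>(\<alpha>', f, \<beta>') (\<alpha>, x, \<beta>). (Comp K \<alpha> \<alpha>', x, Comp K \<beta>' \<beta>))\<rparr>"

text \<open>Maps of natural systems of sets from N to (the underlying sets of) D.\<close>

definition natsys_Hom ::
  "('o, 'a) cat \<Rightarrow> ('a, 's) set_natsys \<Rightarrow> ('a, 'd) natsys \<Rightarrow> ('a \<Rightarrow> 's \<Rightarrow> 'd) set" where
  "natsys_Hom K N D = {c \<in> (\<Pi>\<^sub>E f\<in>Arr K. elts N f \<rightarrow>\<^sub>E carrier (grp D f)).
     \<forall>t\<in>Arr (Fac K). \<forall>s\<in>elts N (Dom (Fac K) t).
       c (Cod (Fac K) t) (sact N t s) = act D t (c (Dom (Fac K) t) s)}"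

definition natsys_Hom_group ::
  "('o, 'a) cat \<Rightarrow> ('a, 's) set_natsys \<Rightarrow> ('a, 'd) natsys \<Rightarrow> ('a \<Rightarrow> 's \<Rightarrow> 'd) monoid" where
  "natsys_Hom_group K N D = \<lparr>
     carrier = natsys_Hom K N D,
     mult = (\<lambda>b c. \<lambda>f\<in>Arr K. \<lambda>s\<in>elts N f. b f s \<otimes>\<^bsub>grp D f\<^esub> c f s),
     one = (\<lambda>f\<in>Arr K. \<lambda>s\<in>elts N f. \<one>\<^bsub>grp D f\<^esub>)\<rparr>"

text \<open>An n-simplex of the nerve is (x, [f1, ..., fn]) with f1 starting in x and each arrow composable
  after the preceding one. In particular the 0-simplex x has composite the identity of x.\<close>

definition nerve :: "('o, 'a) cat \<Rightarrow> nat \<Rightarrow> ('o \<times> 'a list) set" where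
  "nerve K n = {(x, fs). length fs = n \<and> (\<exists>y. pre_digraph.awalk (und K) x fs y)}"

definition max_face :: "('o, 'a) cat \<Rightarrow> 'o \<times> 'a list \<Rightarrow> 'a" where
  "max_face K = (\<lambda>(x, fs). comp_path K x fs)"

definition nerve_face :: "('o, 'a) cat \<Rightarrow> nat \<Rightarrow> nat \<Rightarrow> 'o \<times> 'a list \<Rightarrow> 'o \<times> 'a list" where
  "nerve_face K n i = (\<lambda>(x, fs).
     if i = 0 then (Cod K (hd fs), tl fs)
     else if i = n then (x, butlast fs)
     else (x, take (i - 1) fs @ [Comp K (fs ! i) (fs ! (i - 1))] @ drop (i + 1) fs))"

definition bw_nerve :: "('o, 'a) cat \<Rightarrow> nat \<Rightarrow> ('a, 'a \<times> ('o \<times> 'a list) \<times> 'a) set_natsys" where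
  "bw_nerve K n = free_natsys K (nerve K n) (max_face K)"

text \<open>The maps of natural systems given on generators by the inner faces of the nerve and by
  \<sigma> \<mapsto> (f1)^*(d0 \<sigma>), \<sigma> \<mapsto> (fn)_*(dn \<sigma>) for the outer ones, where \<sigma> = (f1, ..., fn).\<close>

definition bw_face ::
  "('o, 'a) cat \<Rightarrow> nat \<Rightarrow> nat \<Rightarrow> 'a \<times> ('o \<times> 'a list) \<times> 'a \<Rightarrow> 'a \<times> ('o \<times> 'a list) \<times> 'a" where
  "bw_face K n i = (\<lambda>(\<alpha>, \<sigma>, \<beta>).
     (if i = 0 then Comp K (hd (snd \<sigma>)) \<alpha> else \<alpha>,
      nerve_face K n i \<sigma>,
      if i \<noteq> 0 \<and> i = n then Comp K \<beta> (last (snd \<sigma>)) else \<beta>))"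

type_synonym ('o, 'a, 'd) bw_cochain = "'a \<Rightarrow> 'a \<times> ('o \<times> 'a list) \<times> 'a \<Rightarrow> 'd"

definition bw_cochains :: "('o, 'a) cat \<Rightarrow> ('a, 'd) natsys \<Rightarrow> nat \<Rightarrow> ('o, 'a, 'd) bw_cochain monoid" where
  "bw_cochains K D n = natsys_Hom_group K (bw_nerve K n) D"

definition bw_coface ::
  "('o, 'a) cat \<Rightarrow> nat \<Rightarrow> nat \<Rightarrow> ('o, 'a, 'd) bw_cochain \<Rightarrow> ('o, 'a, 'd) bw_cochain" where
  "bw_coface K n i c =
     (\<lambda>f\<in>Arr K. \<lambda>s\<in>elts (bw_nerve K (Suc n)) f. c f (bw_face K (Suc n) i s))"

definition H_BW :: "('o, 'a) cat \<Rightarrow> ('a, 'd) natsys \<Rightarrow> nat \<Rightarrow> ('o, 'a, 'd) bw_cochain set monoid" where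
  "H_BW K D = cohomotopy (bw_cochains K D) (bw_coface K)"

definition bw_pullback ::
  "('o, 'a) cat \<Rightarrow> ('a \<Rightarrow> 'b) \<Rightarrow> ('a \<Rightarrow> 'd \<Rightarrow> 'e) \<Rightarrow> nat \<Rightarrow> ('o, 'b, 'd) bw_cochain \<Rightarrow> ('o, 'a, 'e) bw_cochain"
  where
  "bw_pullback K' P t n c = (\<lambda>f\<in>Arr K'. \<lambda>s\<in>elts (bw_nerve K' n) f.
     case s of (\<alpha>, (x, fs), \<beta>) \<Rightarrow> t f (c (P f) (P \<alpha>, (x, map P fs), P \<beta>)))"

text \<open>The map of cohomology groups induced by a functor P : K' \<rightarrow> K and a map t from P^*D to D'.
  All members of the union are equal, as the image of a coset does not depend on the chosen
  representative c.\<close>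

definition H_BW_map ::
  "('o, 'a) cat \<Rightarrow> ('a \<Rightarrow> 'b) \<Rightarrow> ('a, 'e) natsys \<Rightarrow> ('a \<Rightarrow> 'd \<Rightarrow> 'e) \<Rightarrow> nat \<Rightarrow>
   ('o, 'b, 'd) bw_cochain set \<Rightarrow> ('o, 'a, 'e) bw_cochain set" where
  "H_BW_map K' P D' t n X = (\<Union>c\<in>X.
     coboundaries (bw_cochains K' D') (bw_coface K') n
       #>\<^bsub>bw_cochains K' D' n\<^esub> bw_pullback K' P t n c)"


section \<open>Simplicial categories over a category\<close>

text \<open>A category with object set O enriched in simplicial sets is a simplicial object in
  categories with object set O. The field prj is a map to the constant simplicial category on a
  category; \<open>face X m i\<close> goes from level m + 1 to level m, \<open>degen X m i\<close> from level m to
  level m + 1.\<close>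

record ('o, 'a, 'k) scat =
  lev :: "nat \<Rightarrow> ('o, 'a) cat"
  face :: "nat \<Rightarrow> nat \<Rightarrow> 'a \<Rightarrow> 'a"
  degen :: "nat \<Rightarrow> nat \<Rightarrow> 'a \<Rightarrow> 'a"
  prj :: "'a \<Rightarrow> 'k"

definition scat_maps :: "('o, 'a, 'k) scat \<Rightarrow> ('o, 'b, 'k) scat \<Rightarrow> (nat \<Rightarrow> 'a \<Rightarrow> 'b) set" where
  "scat_maps X Y = {F.
     (\<forall>m. F m \<in> functors (lev X m) (lev Y m)) \<and>
     (\<forall>m. \<forall>x\<in>Arr (lev X m). prj Y (F m x) = prj X x) \<and>
     (\<forall>m. \<forall>i\<le>Suc m. \<forall>x\<in>Arr (lev X (Suc m)). F m (face X m i x) = face Y m i (F (Suc m) x)) \<and>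
     (\<forall>m. \<forall>i\<le>m. \<forall>x\<in>Arr (lev X m). F (Suc m) (degen X m i x) = degen Y m i (F m x))}"

text \<open>A homotopy over the base from F to G, i.e. a map from X to the path object of Y (the
  cotensor of Y with the 1-simplex over the base), given by its components
  \<open>h m j\<close> : \<open>lev X m\<close> \<rightarrow> \<open>lev Y (m + 1)\<close> for 0 \<le> j \<le> m belonging to the
  nondegenerate (m+1)-simplices of the prism. These are the usual identities for simplicial
  homotopies in the category of categories with a fixed object set.\<close>

definition scat_homotopy ::
  "('o, 'a, 'k) scat \<Rightarrow> ('o, 'b, 'k) scat \<Rightarrow> (nat \<Rightarrow> 'a \<Rightarrow> 'b) \<Rightarrow> (nat \<Rightarrow> 'a \<Rightarrow> 'b) \<Rightarrow>
   (nat \<Rightarrow> nat \<Rightarrow> 'a \<Rightarrow> 'b) \<Rightarrow> bool" where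
  "scat_homotopy X Y F G h \<longleftrightarrow>
     (\<forall>m. \<forall>j\<le>m. h m j \<in> functors (lev X m) (lev Y (Suc m)) \<and>
        (\<forall>x\<in>Arr (lev X m). prj Y (h m j x) = prj X x)) \<and>
     (\<forall>m. \<forall>x\<in>Arr (lev X m). face Y m 0 (h m 0 x) = F m x \<and> face Y m (Suc m) (h m m x) = G m x) \<and>
     (\<forall>m i j. \<forall>x\<in>Arr (lev X (Suc m)). i < j \<longrightarrow> j \<le> Suc m \<longrightarrow>
        face Y (Suc m) i (h (Suc m) j x) = h m (j - 1) (face X m i x)) \<and>
     (\<forall>m j. \<forall>x\<in>Arr (lev X m). j < m \<longrightarrow>
        face Y m (Suc j) (h m (Suc j) x) = face Y m (Suc j) (h m j x)) \<and>
     (\<forall>m i j. \<forall>x\<in>Arr (lev X (Suc m)). Suc j < i \<longrightarrow> i \<le> Suc (Suc m) \<longrightarrow>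
        face Y (Suc m) i (h (Suc m) j x) = h m j (face X m (i - 1) x)) \<and>
     (\<forall>m i j. \<forall>x\<in>Arr (lev X m). i \<le> j \<longrightarrow> j \<le> m \<longrightarrow>
        degen Y (Suc m) i (h m j x) = h (Suc m) (Suc j) (degen X m i x)) \<and>
     (\<forall>m i j. \<forall>x\<in>Arr (lev X m). j < i \<longrightarrow> i \<le> Suc m \<longrightarrow>
        degen Y (Suc m) i (h m j x) = h (Suc m) j (degen X m (i - 1) x))"

definition homotopic ::
  "('o, 'a, 'k) scat \<Rightarrow> ('o, 'b, 'k) scat \<Rightarrow> ((nat \<Rightarrow> 'a \<Rightarrow> 'b) \<times> (nat \<Rightarrow> 'a \<Rightarrow> 'b)) set" where
  "homotopic X Y = {(F, G). F \<in> scat_maps X Y \<and> G \<in> scat_maps X Y \<and> (\<exists>h. scat_homotopy X Y F G h)}"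


section \<open>The standard free resolution\<close>

text \<open>\<open>Path x ts\<close> is the walk starting in x along the arcs ts, read as an arrow of a free category.
  As the arcs may be walks themselves, all iterated free categories have the same type of arrows.\<close>

datatype ('o, 'a) walks = Gen 'a | Path (start: 'o) (steps: "('o, 'a) walks list")

definition free_cat :: "('o, ('o, 'a) walks) pre_digraph \<Rightarrow> ('o, ('o, 'a) walks) cat" where
  "free_cat G = \<lparr>Ob = verts G,
     Arr = {Path x ts | x ts. \<exists>y. pre_digraph.awalk G x ts y},
     Dom = start,
     Cod = (\<lambda>p. last (pre_digraph.awalk_verts G (start p) (steps p))),
     Idn = (\<lambda>x. Path x []),
     Comp = (\<lambda>q p. Path (start p) (steps p @ steps q))\<rparr>"

definition FU :: "('o, ('o, 'a) walks) cat \<Rightarrow> ('o, ('o, 'a) walks) cat" where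
  "FU C = free_cat (und C)"

definition FU_map :: "(('o, 'a) walks \<Rightarrow> ('o, 'a) walks) \<Rightarrow> ('o, 'a) walks \<Rightarrow> ('o, 'a) walks" where
  "FU_map h p = Path (start p) (map h (steps p))"

text \<open>Counit FU C \<rightarrow> C and comultiplication FU C \<rightarrow> FU (FU C) of the comonad FU.\<close>

definition FU_counit :: "('o, ('o, 'a) walks) cat \<Rightarrow> ('o, 'a) walks \<Rightarrow> ('o, 'a) walks" where
  "FU_counit C p = comp_path C (start p) (steps p)"

definition FU_comult :: "('o, ('o, 'a) walks) cat \<Rightarrow> ('o, 'a) walks \<Rightarrow> ('o, 'a) walks" where
  "FU_comult C p = Path (start p) (map (\<lambda>e. Path (Dom C e) [e]) (steps p))"

text \<open>A copy of K with arrows \<open>Gen f\<close>.\<close>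

definition gen_cat :: "('o, 'a) cat \<Rightarrow> ('o, ('o, 'a) walks) cat" where
  "gen_cat K = \<lparr>Ob = Ob K, Arr = Gen ` Arr K,
     Dom = (\<lambda>p. case p of Gen f \<Rightarrow> Dom K f),
     Cod = (\<lambda>p. case p of Gen f \<Rightarrow> Cod K f),
     Idn = (\<lambda>x. Gen (Idn K x)),
     Comp = (\<lambda>q p. case q of Gen g \<Rightarrow> (case p of Gen f \<Rightarrow> Gen (Comp K g f)))\<rparr>"

primrec eval_walks :: "('o, 'a) cat \<Rightarrow> ('o, 'a) walks \<Rightarrow> 'a" where
  "eval_walks K (Gen f) = f"
| "eval_walks K (Path x ts) = comp_path K x (map (eval_walks K) ts)"

text \<open>The simplicial category with m-th level (FU)^(m+1) K, faces (FU)^i \<epsilon> (FU)^(m-i) and degeneracies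
  (FU)^i \<delta> (FU)^(m-i) in level m, where \<epsilon> is the counit and \<delta> the comultiplication.\<close>

definition resolution :: "('o, 'a) cat \<Rightarrow> ('o, ('o, 'a) walks, 'a) scat" where
  "resolution K = \<lparr>
     lev = (\<lambda>m. (FU ^^ Suc m) (gen_cat K)),
     face = (\<lambda>m i. (FU_map ^^ i) (FU_counit ((FU ^^ (Suc m - i)) (gen_cat K)))),
     degen = (\<lambda>m i. (FU_map ^^ i) (FU_comult ((FU ^^ (m - i)) (gen_cat K)))),
     prj = eval_walks K\<rparr>"


section \<open>Eilenberg-Mac Lane objects\<close>

text \<open>The n-simplices of the standard m-simplex, as weakly increasing lists of n + 1 vertices. Such a
  list is degenerate iff it has a repetition.\<close>

definition std_simplices :: "nat \<Rightarrow> nat \<Rightarrow> nat list set" where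
  "std_simplices m n = {xs. length xs = Suc n \<and> sorted xs \<and> set xs \<subseteq> {..m}}"

definition delete_nth :: "nat \<Rightarrow> 'b list \<Rightarrow> 'b list" where
  "delete_nth i xs = take i xs @ drop (Suc i) xs"

definition coface :: "nat \<Rightarrow> nat \<Rightarrow> nat" where
  "coface i j = (if j < i then j else Suc j)"

definition codegen :: "nat \<Rightarrow> nat \<Rightarrow> nat" where
  "codegen i j = (if j \<le> i then j else j - 1)"

text \<open>The m-simplices of the Eilenberg-Mac Lane simplicial abelian group K(A, n): normalized
  n-cocycles of the standard m-simplex with coefficients in A.\<close>

definition EM_group :: "'d monoid \<Rightarrow> nat \<Rightarrow> nat \<Rightarrow> (nat list \<Rightarrow> 'd) monoid" where
  "EM_group A n m = \<lparr>
     carrier = {z \<in> std_simplices m n \<rightarrow>\<^sub>E carrier A.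
       (\<forall>xs\<in>std_simplices m n. \<not> distinct xs \<longrightarrow> z xs = \<one>\<^bsub>A\<^esub>) \<and>
       (\<forall>xs\<in>std_simplices m (Suc n). alt_sum A (Suc n) (\<lambda>i. z (delete_nth i xs)) = \<one>\<^bsub>A\<^esub>)},
     mult = (\<lambda>y z. \<lambda>xs\<in>std_simplices m n. y xs \<otimes>\<^bsub>A\<^esub> z xs),
     one = (\<lambda>xs\<in>std_simplices m n. \<one>\<^bsub>A\<^esub>)\<rparr>"

text \<open>Restriction of a cochain along a monotone map \<omega> : [k] \<rightarrow> [m].\<close>

definition EM_restrict :: "nat \<Rightarrow> nat \<Rightarrow> (nat \<Rightarrow> nat) \<Rightarrow> (nat list \<Rightarrow> 'd) \<Rightarrow> nat list \<Rightarrow> 'd" where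
  "EM_restrict n k \<omega> z = (\<lambda>xs\<in>std_simplices k n. z (map \<omega> xs))"

definition EM_natsys :: "('a, 'd) natsys \<Rightarrow> nat \<Rightarrow> nat \<Rightarrow> ('a, nat list \<Rightarrow> 'd) natsys" where
  "EM_natsys D n m = \<lparr>
     grp = (\<lambda>f. EM_group (grp D f) n m),
     act = (\<lambda>t z. \<lambda>xs\<in>std_simplices m n. act D t (z xs))\<rparr>"

text \<open>A natural system as an abelian group object over K among categories with the same objects:
  (g, y) (f, x) = (g f, g_* x + f^* y).\<close>

definition total_cat :: "('o, 'a) cat \<Rightarrow> ('a, 'd) natsys \<Rightarrow> ('o, 'a \<times> 'd) cat" where
  "total_cat K D = \<lparr>Ob = Ob K,
     Arr = {(f, x). f \<in> Arr K \<and> x \<in> carrier (grp D f)},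
     Dom = (\<lambda>(f, x). Dom K f),
     Cod = (\<lambda>(f, x). Cod K f),
     Idn = (\<lambda>a. (Idn K a, \<one>\<^bsub>grp D (Idn K a)\<^esub>)),
     Comp = (\<lambda>(g, y) (f, x). (Comp K g f, push K D g f x \<otimes>\<^bsub>grp D (Comp K g f)\<^esub> pull K D f g y))\<rparr>"

text \<open>The Eilenberg-Mac Lane object over the constant simplicial category K: its mapping space from
  a to b is the disjoint union of the K(D(f), n) over all f : a \<rightarrow> b.\<close>

definition EM :: "('o, 'a) cat \<Rightarrow> ('a, 'd) natsys \<Rightarrow> nat \<Rightarrow> ('o, 'a \<times> (nat list \<Rightarrow> 'd), 'a) scat" where
  "EM K D n = \<lparr>
     lev = (\<lambda>m. total_cat K (EM_natsys D n m)),
     face = (\<lambda>m i (f, z). (f, EM_restrict n m (coface i) z)),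
     degen = (\<lambda>m i (f, z). (f, EM_restrict n (Suc m) (codegen i) z)),
     prj = fst\<rparr>"


section \<open>Cohomology of K as a simplicial category\<close>

type_synonym ('o, 'a, 'd) so_map = "nat \<Rightarrow> ('o, 'a) walks \<Rightarrow> 'a \<times> (nat list \<Rightarrow> 'd)"

definition so_class ::
  "('o, 'a) cat \<Rightarrow> ('a, 'd) natsys \<Rightarrow> nat \<Rightarrow> ('o, 'a, 'd) so_map \<Rightarrow> ('o, 'a, 'd) so_map set" where
  "so_class K D n F = homotopic (resolution K) (EM K D n) `` {F}"

text \<open>The fibrewise addition of maps into the abelian group object EM over K, and the composite of
  the projection with the zero section.\<close>

definition so_add ::
  "('o, 'a) cat \<Rightarrow> ('a, 'd) natsys \<Rightarrow> nat \<Rightarrow>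
   ('o, 'a, 'd) so_map \<Rightarrow> ('o, 'a, 'd) so_map \<Rightarrow> ('o, 'a, 'd) so_map" where
  "so_add K D n F G = (\<lambda>m. \<lambda>x\<in>Arr (lev (resolution K) m).
     (eval_walks K x, snd (F m x) \<otimes>\<^bsub>grp (EM_natsys D n m) (eval_walks K x)\<^esub> snd (G m x)))"

definition so_zero :: "('o, 'a) cat \<Rightarrow> ('a, 'd) natsys \<Rightarrow> nat \<Rightarrow> ('o, 'a, 'd) so_map" where
  "so_zero K D n = (\<lambda>m. \<lambda>x\<in>Arr (lev (resolution K) m).
     (eval_walks K x, \<one>\<^bsub>grp (EM_natsys D n m) (eval_walks K x)\<^esub>))"

text \<open>Homotopy classes over K of maps from the resolution to the Eilenberg-Mac Lane object.\<close>

definition H_SO :: "('o, 'a) cat \<Rightarrow> ('a, 'd) natsys \<Rightarrow> nat \<Rightarrow> ('o, 'a, 'd) so_map set monoid" where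
  "H_SO K D n = \<lparr>
     carrier = scat_maps (resolution K) (EM K D n) // homotopic (resolution K) (EM K D n),
     mult = (\<lambda>X Y. \<Union>F\<in>X. \<Union>G\<in>Y. so_class K D n (so_add K D n F G)),
     one = so_class K D n (so_zero K D n)\<rparr>"

definition so_pullback ::
  "('o, 'a) cat \<Rightarrow> ('a \<Rightarrow> 'b) \<Rightarrow> ('a \<Rightarrow> 'd \<Rightarrow> 'e) \<Rightarrow> nat \<Rightarrow> ('o, 'b, 'd) so_map \<Rightarrow> ('o, 'a, 'e) so_map"
  where
  "so_pullback K' P t n F = (\<lambda>m. \<lambda>x\<in>Arr (lev (resolution K') m).
     (eval_walks K' x,
      \<lambda>xs\<in>std_simplices m n. t (eval_walks K' x) (snd (F m (map_walks id P x)) xs)))"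

definition H_SO_map ::
  "('o, 'a) cat \<Rightarrow> ('a \<Rightarrow> 'b) \<Rightarrow> ('a, 'e) natsys \<Rightarrow> ('a \<Rightarrow> 'd \<Rightarrow> 'e) \<Rightarrow> nat \<Rightarrow>
   ('o, 'b, 'd) so_map set \<Rightarrow> ('o, 'a, 'e) so_map set" where
  "H_SO_map K' P D' t n X = (\<Union>F\<in>X. so_class K' D' n (so_pullback K' P t n F))"

text \<open>The maps into the discrete object \<open>EM K D 0\<close> (the total category of D) given by inner
  derivations f \<mapsto> f_* a(dom f) - f^* a(cod f). Over the resolution, homotopies into this object are
  trivial, so inner derivations represent nonzero classes of \<open>H_SO K D 0\<close> in general, although they
  are coboundaries in the Baues-Wirsching complex.\<close>

definition inner_map :: "('o, 'a) cat \<Rightarrow> ('a, 'd) natsys \<Rightarrow> ('o \<Rightarrow> 'd) \<Rightarrow> ('o, 'a, 'd) so_map" where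
  "inner_map K D a = (\<lambda>m. \<lambda>x\<in>Arr (lev (resolution K) m).
     let f = eval_walks K x in
       (f, \<lambda>xs\<in>std_simplices m 0.
             push K D f (Idn K (Dom K f)) (a (Dom K f)) \<otimes>\<^bsub>grp D f\<^esub>
             inv\<^bsub>grp D f\<^esub> (pull K D f (Idn K (Cod K f)) (a (Cod K f)))))"

definition inner_classes :: "('o, 'a) cat \<Rightarrow> ('a, 'd) natsys \<Rightarrow> ('o, 'a, 'd) so_map set set" where
  "inner_classes K D = {so_class K D 0 (inner_map K D a) | a.
     a \<in> (\<Pi>\<^sub>E x\<in>Ob K. carrier (grp D (Idn K x)))}"

end

theory Submission
  imports Defs "HOL-Algebra.Free_Abelian_Groups"
begin

text \<open>Let \<open>R\<close> be the free resolution of \<open>K\<close>. The comparison runs through the double complex whose \<open>p\<close>-th row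
  consists of the Baues-Wirsching \<open>p\<close>-chains of the levels of \<open>R\<close>. In the simplicial direction the
  augmented complex has an extra degeneracy, which sends an arrow to the path of length one; in the
  Baues-Wirsching direction every level is free, and splitting off the first arrow of a path is a contraction in
  degrees at least two. Zigzagging through the double complex therefore turns simplicial cocycles of
  derivations on \<open>R\<close>, which are the maps into the Eilenberg-Mac Lane object, into Baues-Wirsching
  cocycles one degree higher, and back. A map of simplicial categories into the Eilenberg-Mac Lane object
  is determined by a normalized derivation on level \<open>n\<close> that is a cocycle in the simplicial direction, and
  homotopies correspond to coboundaries. In degree 1 the row contraction stops, and the remaining kernel
  consists of the inner derivations.\<close>

section \<open>Linear extension to free abelian groups\<close>

text \<open>Every chain is supported on generators with one total composite f, so a cochain maps all
  chains over f into the single group D(f). The double complex can therefore be handled with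
  integral chains, and coefficients enter only through their linear extension. The extra degeneracy
  is a map of graphs and not a functor, so it does not commute with the row boundary; the zigzag is
  nontrivial because of this failure. Each of its steps trades one row degree for one simplicial
  degree. Derivations are cocycles of row degree 1, which accounts for the shift by one between the
  two cohomology theories. A second obstacle lies in the target. The zigzag works with unnormalized
  cochains, whereas the simplices of the Eilenberg-Mac Lane object are normalized cocycles. A
  cocycle obtained by the zigzag, and also a cochain that links two cohomologous cocycles, must be
  corrected by a coboundary until it vanishes on degenerate elements, and only then does it define a
  map or a homotopy.\<close>

definition lin :: "('d, 'm) monoid_scheme \<Rightarrow> ('x \<Rightarrow> 'd) \<Rightarrow> ('x \<Rightarrow>\<^sub>0 int) \<Rightarrow> 'd" where
  "lin A g c = finprod A (\<lambda>x. g x [^]\<^bsub>A\<^esub> Poly_Mapping.lookup c x) (Poly_Mapping.keys c)"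

context comm_group
begin

lemma lin_superset:
  assumes "finite S" "Poly_Mapping.keys c \<subseteq> S" "\<And>x. x \<in> S \<Longrightarrow> g x \<in> carrier G"
  shows "lin G g c = finprod G (\<lambda>x. g x [^] Poly_Mapping.lookup c x) S"
  unfolding lin_def
  by (rule finprod_mono_neutral_cong_left) (use assms in \<open>auto simp: in_keys_iff\<close>)

lemma lin_closed [simp]:
  assumes "\<And>x. x \<in> Poly_Mapping.keys c \<Longrightarrow> g x \<in> carrier G"
  shows "lin G g c \<in> carrier G"
  unfolding lin_def by (rule finprod_closed) (use assms in auto)

lemma lin_zero [simp]: "lin G g 0 = \<one>"
  by (simp add: lin_def)

lemma lin_of [simp]: "g x \<in> carrier G \<Longrightarrow> lin G g (frag_of x) = g x"
  by (simp add: lin_def)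

lemma lin_add:
  assumes "\<And>x. x \<in> Poly_Mapping.keys a \<union> Poly_Mapping.keys b \<Longrightarrow> g x \<in> carrier G"
  shows "lin G g (a + b) = lin G g a \<otimes> lin G g b"
proof -
  let ?S = "Poly_Mapping.keys a \<union> Poly_Mapping.keys b"
  have "lin G g (a + b) = finprod G (\<lambda>x. g x [^] Poly_Mapping.lookup (a + b) x) ?S"
    by (rule lin_superset) (use assms keys_add[of a b] in auto)
  also have "\<dots> = finprod G (\<lambda>x. g x [^] Poly_Mapping.lookup a x \<otimes> g x [^] Poly_Mapping.lookup b x) ?S"
    by (rule finprod_cong') (use assms in \<open>auto simp: lookup_add int_pow_mult\<close>)
  also have "\<dots> = finprod G (\<lambda>x. g x [^] Poly_Mapping.lookup a x) ?S
      \<otimes> finprod G (\<lambda>x. g x [^] Poly_Mapping.lookup b x) ?S"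
    by (rule finprod_multf) (use assms in auto)
  also have "\<dots> = lin G g a \<otimes> lin G g b"
    using lin_superset[of ?S a g] lin_superset[of ?S b g] assms by simp
  finally show ?thesis .
qed

lemma lin_minus:
  assumes "\<And>x. x \<in> Poly_Mapping.keys a \<Longrightarrow> g x \<in> carrier G"
  shows "lin G g (- a) = inv (lin G g a)"
proof -
  have "lin G g (- a) \<otimes> lin G g a = \<one>"
    using lin_add[of "- a" a g] assms by (simp add: keys_minus)
  then show ?thesis
    using assms by (intro inv_equality[symmetric] lin_closed) (auto simp: keys_minus)
qed

lemma lin_minus_of [simp]: "g x \<in> carrier G \<Longrightarrow> lin G g (- frag_of x) = inv (g x)"
  using lin_minus[of "frag_of x" g] by simp

lemma lin_diff:
  assumes "\<And>x. x \<in> Poly_Mapping.keys a \<union> Poly_Mapping.keys b \<Longrightarrow> g x \<in> carrier G"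
  shows "lin G g (a - b) = lin G g a \<otimes> inv (lin G g b)"
  using lin_add[of a "- b" g] lin_minus[of b g] assms by (simp add: keys_minus)

lemma lin_sign:
  assumes "\<And>x. x \<in> Poly_Mapping.keys a \<Longrightarrow> g x \<in> carrier G"
  shows "lin G g (frag_cmul ((-1) ^ i) a) = (if even i then lin G g a else inv (lin G g a))"
  using lin_minus[OF assms] by (auto simp: minus_one_power_iff)

lemma lin_sum:
  assumes "finite I" "\<And>i x. i \<in> I \<Longrightarrow> x \<in> Poly_Mapping.keys (a i) \<Longrightarrow> g x \<in> carrier G"
  shows "lin G g (\<Sum>i\<in>I. a i) = finprod G (\<lambda>i. lin G g (a i)) I"
  using assms
proof (induction I rule: finite_induct)
  case (insert i I)
  have "Poly_Mapping.keys (sum a I) \<subseteq> (\<Union>i\<in>I. Poly_Mapping.keys (a i))"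
    by (rule keys_sum)
  then have *: "g x \<in> carrier G" if "x \<in> Poly_Mapping.keys (sum a I)" for x
    using that insert.prems by blast
  show ?case
  proof -
    have "lin G g (a i + sum a I) = lin G g (a i) \<otimes> lin G g (sum a I)"
      by (rule lin_add) (use * insert.prems in auto)
    moreover have "lin G g (sum a I) = finprod G (\<lambda>i. lin G g (a i)) I"
      by (rule insert.IH) (use insert.prems in blast)
    ultimately show ?thesis
      using insert by (subst finprod_insert) (auto simp: Pi_def intro!: lin_closed)
  qed
qed simp

text \<open>Uniqueness of the additive extension. Additivity of \<open>\<phi>\<close> is asked for
  differences, the form that \<open>free_Abelian_group_induct\<close> uses, and only for chains
  supported in \<open>S\<close>, since \<open>g\<close> is controlled only there.\<close>

lemma lin_eqI:
  assumes "Poly_Mapping.keys c \<subseteq> S" "\<And>x. x \<in> S \<Longrightarrow> g x \<in> carrier G"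
    "\<phi> 0 = \<one>" "\<And>x. x \<in> S \<Longrightarrow> \<phi> (frag_of x) = g x"
    "\<And>a b. Poly_Mapping.keys a \<subseteq> S \<Longrightarrow> Poly_Mapping.keys b \<subseteq> S \<Longrightarrow> \<phi> (a - b) = \<phi> a \<otimes> inv (\<phi> b)"
  shows "\<phi> c = lin G g c"
proof (rule free_Abelian_group_induct[OF assms(1)])
  fix a b :: "_ \<Rightarrow>\<^sub>0 int" assume ab: "Poly_Mapping.keys a \<subseteq> S" "Poly_Mapping.keys b \<subseteq> S"
    and eq: "\<phi> a = lin G g a" "\<phi> b = lin G g b"
  have "lin G g (a - b) = lin G g a \<otimes> inv (lin G g b)"
    by (rule lin_diff) (use assms(2) ab in auto)
  then show "\<phi> (a - b) = lin G g (a - b)"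
    using assms(5)[OF ab] eq by simp
qed (use assms in auto)

lemma lin_frag_extend:
  assumes "\<And>x y. x \<in> Poly_Mapping.keys c \<Longrightarrow> y \<in> Poly_Mapping.keys (T x) \<Longrightarrow> g y \<in> carrier G"
  shows "lin G g (frag_extend T c) = lin G (\<lambda>x. lin G g (T x)) c"
proof (rule lin_eqI[where S="Poly_Mapping.keys c" and \<phi>="\<lambda>c. lin G g (frag_extend T c)"])
  fix a b :: "_ \<Rightarrow>\<^sub>0 int" assume ab: "Poly_Mapping.keys a \<subseteq> Poly_Mapping.keys c" "Poly_Mapping.keys b \<subseteq> Poly_Mapping.keys c"
  have "lin G g (frag_extend T a - frag_extend T b)
      = lin G g (frag_extend T a) \<otimes> inv (lin G g (frag_extend T b))"
  proof (rule lin_diff)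
    fix y assume "y \<in> Poly_Mapping.keys (frag_extend T a) \<union> Poly_Mapping.keys (frag_extend T b)"
    then show "g y \<in> carrier G"
      using assms ab keys_frag_extend[of T a] keys_frag_extend[of T b] by blast
  qed
  then show "lin G g (frag_extend T (a - b))
      = lin G g (frag_extend T a) \<otimes> inv (lin G g (frag_extend T b))"
    by (simp add: frag_extend_diff)
qed (use assms in auto)

lemma lin_cong:
  assumes "\<And>x. x \<in> Poly_Mapping.keys c \<Longrightarrow> g x = h x" "\<And>x. x \<in> Poly_Mapping.keys c \<Longrightarrow> h x \<in> carrier G"
  shows "lin G g c = lin G h c"
  unfolding lin_def by (rule finprod_cong') (use assms in auto)

lemma lin_one: "(\<And>x. x \<in> Poly_Mapping.keys c \<Longrightarrow> g x = \<one>) \<Longrightarrow> lin G g c = \<one>"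
  unfolding lin_def by (rule finprod_one_eqI) auto

lemma lin_mult:
  assumes "\<And>x. x \<in> Poly_Mapping.keys c \<Longrightarrow> g x \<in> carrier G" "\<And>x. x \<in> Poly_Mapping.keys c \<Longrightarrow> h x \<in> carrier G"
  shows "lin G (\<lambda>x. g x \<otimes> h x) c = lin G g c \<otimes> lin G h c"
proof -
  have "lin G (\<lambda>x. g x \<otimes> h x) c = finprod G (\<lambda>x. g x [^] Poly_Mapping.lookup c x \<otimes> h x [^] Poly_Mapping.lookup c x) (Poly_Mapping.keys c)"
    unfolding lin_def by (rule finprod_cong') (use assms in \<open>auto simp: int_pow_mult_distrib m_comm\<close>)
  also have "\<dots> = lin G g c \<otimes> lin G h c"
    unfolding lin_def by (rule finprod_multf) (use assms in auto)
  finally show ?thesis .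
qed

lemma lin_inv:
  assumes "\<And>x. x \<in> Poly_Mapping.keys c \<Longrightarrow> g x \<in> carrier G"
  shows "lin G (\<lambda>x. inv (g x)) c = inv (lin G g c)"
proof -
  have "lin G (\<lambda>x. inv (g x)) c \<otimes> lin G g c = lin G (\<lambda>x. inv (g x) \<otimes> g x) c"
    by (rule lin_mult[symmetric]) (use assms in auto)
  also have "\<dots> = \<one>" by (rule lin_one) (use assms in auto)
  finally show ?thesis using assms by (intro inv_equality[symmetric] lin_closed) auto
qed

lemma hom_lin:
  assumes "\<phi> \<in> hom G B" "comm_group B" "\<And>x. x \<in> Poly_Mapping.keys c \<Longrightarrow> g x \<in> carrier G"
  shows "\<phi> (lin G g c) = lin B (\<lambda>x. \<phi> (g x)) c"
proof -
  interpret B: comm_group B by fact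
  interpret group_hom G B \<phi> by unfold_locales (rule assms(1))
  show ?thesis
  proof (rule B.lin_eqI[where S="Poly_Mapping.keys c" and \<phi>="\<lambda>c. \<phi> (lin G g c)"])
    fix a b :: "_ \<Rightarrow>\<^sub>0 int" assume ab: "Poly_Mapping.keys a \<subseteq> Poly_Mapping.keys c" "Poly_Mapping.keys b \<subseteq> Poly_Mapping.keys c"
    have "lin G g (a - b) = lin G g a \<otimes> inv (lin G g b)"
      by (rule lin_diff) (use assms ab in auto)
    moreover have "lin G g a \<in> carrier G" "lin G g b \<in> carrier G"
      using assms ab by (auto intro!: lin_closed)
    ultimately show "\<phi> (lin G g (a - b)) = \<phi> (lin G g a) \<otimes>\<^bsub>B\<^esub> inv\<^bsub>B\<^esub> \<phi> (lin G g b)"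
      by simp
  qed (use assms in auto)
qed

end

text \<open>Identities between alternating sums can be proved for signed integral chains, where
  additive simplification is available, and then be transported to any abelian group.\<close>

lemma alt_sum_lin:
  assumes "comm_group A" "\<And>i. i \<le> n \<Longrightarrow> g (x i) \<in> carrier A"
  shows "alt_sum A n (\<lambda>i. g (x i)) = lin A g (\<Sum>i\<le>n. frag_cmul ((-1) ^ i) (frag_of (x i)))"
proof -
  interpret A: comm_group A by fact
  have "lin A g (\<Sum>i\<le>n. frag_cmul ((-1) ^ i) (frag_of (x i)))
      = finprod A (\<lambda>i. lin A g (frag_cmul ((-1) ^ i) (frag_of (x i)))) {..n}"
    by (rule A.lin_sum) (use assms in auto)
  also have "\<dots> = alt_sum A n (\<lambda>i. g (x i))"
    unfolding alt_sum_def
    by (rule A.finprod_cong') (use assms in \<open>auto simp: A.lin_sign A.lin_minus_of\<close>)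
  finally show ?thesis by simp
qed

section \<open>Free categories and the standard resolution\<close>

text \<open>A recursive form of \<open>awalk\<close> in \<open>und C\<close>, with
  \<open>wend\<close> for the end point, so that inductions follow the list;
  \<open>awalk_wlk\<close> identifies the two notions.\<close>

primrec wlk :: "('o, 'a) cat \<Rightarrow> 'o \<Rightarrow> 'a list \<Rightarrow> bool" where
  "wlk C x [] \<longleftrightarrow> x \<in> Ob C"
| "wlk C x (t # ts) \<longleftrightarrow> t \<in> Arr C \<and> Dom C t = x \<and> wlk C (Cod C t) ts"

primrec wend :: "('o, 'a) cat \<Rightarrow> 'o \<Rightarrow> 'a list \<Rightarrow> 'o" where
  "wend C x [] = x"
| "wend C x (t # ts) = wend C (Cod C t) ts"

lemma wend_append [simp]: "wend C x (ts @ us) = wend C (wend C x ts) us"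
  by (induction ts arbitrary: x) auto

lemma last_awalk_verts: "last (pre_digraph.awalk_verts (und C) x ts) = wend C x ts"
  by (induction ts arbitrary: x)
    (auto simp: pre_digraph.awalk_verts.simps pre_digraph.awalk_verts_non_Nil und_def)

context category
begin

lemma awalk_wlk: "(\<exists>y. pre_digraph.awalk (und C) x ts y) \<longleftrightarrow> wlk C x ts"
proof (induction ts arbitrary: x)
  case Nil
  then show ?case by (simp add: pre_digraph.awalk_def und_def pre_digraph.cas.simps)
next
  case (Cons t ts)
  have "(\<exists>y. pre_digraph.awalk (und C) x (t # ts) y) \<longleftrightarrow>
      t \<in> Arr C \<and> Dom C t = x \<and> (\<exists>y. pre_digraph.awalk (und C) (Cod C t) ts y)"
    using Dom_in Cod_in by (auto simp: pre_digraph.awalk_def und_def pre_digraph.cas.simps)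
  then show ?case using Cons by simp
qed

lemma wlk_Ob: "wlk C x ts \<Longrightarrow> x \<in> Ob C"
  by (cases ts) (auto simp: Dom_in)

lemma wlk_append: "wlk C x (ts @ us) \<longleftrightarrow> wlk C x ts \<and> wlk C (wend C x ts) us"
  by (induction ts arbitrary: x) (auto dest: wlk_Ob)

lemma comp_path_arr:
  "wlk C x ts \<Longrightarrow> comp_path C x ts \<in> Arr C \<and> Dom C (comp_path C x ts) = x \<and> Cod C (comp_path C x ts) = wend C x ts"
  by (induction ts arbitrary: x) (auto simp: Idn_in Dom_Idn Cod_Idn Comp_in Dom_Comp Cod_Comp)

lemma wend_Ob: "wlk C x ts \<Longrightarrow> wend C x ts \<in> Ob C"
  using comp_path_arr Cod_in by metis

lemma comp_path_append:
  "wlk C x (ts @ us) \<Longrightarrow> comp_path C x (ts @ us) = Comp C (comp_path C (wend C x ts) us) (comp_path C x ts)"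
proof (induction ts arbitrary: x)
  case Nil
  then show ?case using comp_path_arr[of x us] Comp_Idn_right[of "comp_path C x us"] by simp
next
  case (Cons t ts)
  then show ?case
    using comp_path_arr[of "Cod C t" ts] comp_path_arr[of "wend C (Cod C t) ts" us]
    by (auto simp: Comp_assoc wlk_append)
qed

lemma comp_path_single: "t \<in> Arr C \<Longrightarrow> comp_path C x [t] = t"
  by (simp add: Comp_Idn_left)

end

text \<open>The laws of \<open>functors\<close> without extensionality. Faces, degeneracies and
  evaluations are given by one formula on all walks, so they are not \<open>undefined\<close>
  outside the arrows of a level.\<close>

definition isfun :: "('o, 'a) cat \<Rightarrow> ('o, 'b) cat \<Rightarrow> ('a \<Rightarrow> 'b) \<Rightarrow> bool" where
  "isfun C C' F \<longleftrightarrow> Ob C = Ob C' \<and>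
     (\<forall>f\<in>Arr C. F f \<in> Arr C' \<and> Dom C' (F f) = Dom C f \<and> Cod C' (F f) = Cod C f) \<and>
     (\<forall>a\<in>Ob C. F (Idn C a) = Idn C' a) \<and>
     (\<forall>f\<in>Arr C. \<forall>g\<in>Arr C. Cod C f = Dom C g \<longrightarrow> F (Comp C g f) = Comp C' (F g) (F f))"

lemma functors_iff: "F \<in> functors C C' \<longleftrightarrow> isfun C C' F \<and> F \<in> extensional (Arr C)"
  by (auto simp: functors_def isfun_def PiE_iff)

lemma isfun_wlk:
  assumes "isfun C C' F"
  shows "wlk C x ts \<Longrightarrow> wlk C' x (map F ts) \<and> wend C' x (map F ts) = wend C x ts"
  by (induction ts arbitrary: x) (use assms in \<open>auto simp: isfun_def\<close>)

lemma isfun_comp_path: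
  assumes "isfun C C' F" "category C"
  shows "wlk C x ts \<Longrightarrow> F (comp_path C x ts) = comp_path C' x (map F ts)"
proof (induction ts arbitrary: x)
  case (Cons t ts)
  then show ?case
    using assms category.comp_path_arr[OF assms(2), of "Cod C t" ts] by (auto simp: isfun_def)
qed (use assms in \<open>auto simp: isfun_def\<close>)

lemma isfun_comp: "isfun C C' F \<Longrightarrow> isfun C' C'' G \<Longrightarrow> isfun C C'' (\<lambda>x. G (F x))"
  by (simp add: isfun_def)

lemma category_gen_cat:
  assumes "category K" shows "category (gen_cat K)"
proof -
  interpret category K by fact
  show ?thesis
    by unfold_locales
      (auto simp: gen_cat_def Dom_in Cod_in Idn_in Dom_Idn Cod_Idn Comp_in Dom_Comp Cod_Comp
        Comp_assoc Comp_Idn_right Comp_Idn_left)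
qed

section \<open>The comonad \<open>FU\<close>: counit, comultiplication and their laws\<close>

lemma FU_simps:
  "Ob (FU C) = Ob C" "Dom (FU C) = start" "Idn (FU C) x = Path x []"
  "Cod (FU C) (Path x ts) = wend C x ts" "Cod (FU C) p = wend C (start p) (steps p)"
  "Comp (FU C) q p = Path (start p) (steps p @ steps q)"
  by (simp_all add: FU_def free_cat_def last_awalk_verts) (simp add: und_def)

lemma Arr_FU: "category C \<Longrightarrow> Arr (FU C) = {Path x ts | x ts. wlk C x ts}"
  by (auto simp: FU_def free_cat_def category.awalk_wlk)

lemma category_FU:
  assumes "category C" shows "category (FU C)"
proof -
  interpret category C by fact
  show ?thesis
    by unfold_locales (auto simp: Arr_FU[OF assms] FU_simps wlk_append wlk_Ob wend_Ob)
qed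

lemma isfun_counit:
  assumes "category C" shows "isfun (FU C) C (FU_counit C)"
proof -
  interpret category C by fact
  show ?thesis
    by (auto simp: isfun_def Arr_FU[OF assms] FU_simps FU_counit_def comp_path_arr comp_path_append wlk_append)
qed

lemma isfun_FU_map:
  assumes "category C" "category C'" "isfun C C' k"
  shows "isfun (FU C) (FU C') (FU_map k)"
  using assms(3) isfun_wlk[OF assms(3)]
  by (auto simp: isfun_def Arr_FU[OF assms(1)] Arr_FU[OF assms(2)] FU_simps FU_map_def)

lemma wlk_comult:
  assumes "category C"
  shows "wlk C x ts \<Longrightarrow> wlk (FU C) x (map (\<lambda>e. Path (Dom C e) [e]) ts) \<and>
     wend (FU C) x (map (\<lambda>e. Path (Dom C e) [e]) ts) = wend C x ts"
  by (induction ts arbitrary: x)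
    (use assms in \<open>auto simp: Arr_FU FU_simps category.Cod_in category.Dom_in\<close>)

lemma isfun_comult:
  assumes "category C" shows "isfun (FU C) (FU (FU C)) (FU_comult C)"
  using wlk_comult[OF assms]
  by (auto simp: isfun_def Arr_FU[OF assms] Arr_FU[OF category_FU[OF assms]] FU_simps FU_comult_def)

lemma FU_map_cong: "category C \<Longrightarrow> u \<in> Arr (FU C) \<Longrightarrow> (\<And>e. e \<in> Arr C \<Longrightarrow> k e = k' e) \<Longrightarrow> FU_map k u = FU_map k' u"
proof -
  assume C: "category C" and u: "u \<in> Arr (FU C)" and k: "\<And>e. e \<in> Arr C \<Longrightarrow> k e = k' e"
  have "wlk C x ts \<Longrightarrow> map k ts = map k' ts" for x ts
    by (induction ts arbitrary: x) (auto simp: k)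
  then show ?thesis using u by (auto simp: Arr_FU[OF C] FU_map_def)
qed

lemma FU_map_comp: "FU_map k (FU_map k' u) = FU_map (\<lambda>x. k (k' x)) u"
  by (simp add: FU_map_def)

lemma FU_map_ident: "category C \<Longrightarrow> u \<in> Arr (FU C) \<Longrightarrow> FU_map (\<lambda>x. x) u = u"
  by (auto simp: FU_map_def Arr_FU)

lemma counit_natural:
  assumes "category C" "isfun C C' k" "u \<in> Arr (FU C)"
  shows "k (FU_counit C u) = FU_counit C' (FU_map k u)"
  using assms by (auto simp: FU_counit_def FU_map_def Arr_FU isfun_comp_path)

lemma comult_natural:
  assumes "category C" "isfun C C' k" "u \<in> Arr (FU C)"
  shows "FU_map (FU_map k) (FU_comult C u) = FU_comult C' (FU_map k u)"
proof -
  have "wlk C x ts \<Longrightarrow> map (FU_map k) (map (\<lambda>e. Path (Dom C e) [e]) ts) = map (\<lambda>e. Path (Dom C' e) [e]) (map k ts)" for x ts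
    by (induction ts arbitrary: x) (use assms(2) in \<open>auto simp: FU_map_def isfun_def\<close>)
  then show ?thesis using assms by (auto simp: FU_comult_def FU_map_def Arr_FU)
qed

lemma counit_comult:
  assumes "category C" "u \<in> Arr (FU C)"
  shows "FU_counit (FU C) (FU_comult C u) = u"
proof -
  have "wlk C x ts \<Longrightarrow> comp_path (FU C) x (map (\<lambda>e. Path (Dom C e) [e]) ts) = Path x ts" for x ts
    by (induction ts arbitrary: x) (auto simp: FU_simps)
  then show ?thesis using assms by (auto simp: FU_counit_def FU_comult_def Arr_FU)
qed

lemma map_counit_comult:
  assumes "category C" "u \<in> Arr (FU C)"
  shows "FU_map (FU_counit C) (FU_comult C u) = u"
proof -
  have "wlk C x ts \<Longrightarrow> map (FU_counit C) (map (\<lambda>e. Path (Dom C e) [e]) ts) = ts" for x ts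
    by (induction ts arbitrary: x) (use assms(1) in \<open>auto simp: FU_counit_def category.Comp_Idn_left\<close>)
  then show ?thesis using assms by (auto simp: FU_map_def FU_comult_def Arr_FU)
qed

lemma comult_comult:
  assumes "category C" "u \<in> Arr (FU C)"
  shows "FU_map (FU_comult C) (FU_comult C u) = FU_comult (FU C) (FU_comult C u)"
  using assms by (auto simp: FU_map_def FU_comult_def Arr_FU FU_simps)

text \<open>The index is shifted: level m of the resolution is \<open>lv K (Suc m)\<close>. This
  makes room for the augmentation, since \<open>lv K 0\<close> is the copy of K and
  \<open>fc K 0 0\<close> maps level 0 of the resolution to it.\<close>

definition lv :: "('o, 'a) cat \<Rightarrow> nat \<Rightarrow> ('o, ('o, 'a) walks) cat" where
  "lv K l = (FU ^^ l) (gen_cat K)"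

definition fc :: "('o, 'a) cat \<Rightarrow> nat \<Rightarrow> nat \<Rightarrow> ('o, 'a) walks \<Rightarrow> ('o, 'a) walks" where
  "fc K l i = (FU_map ^^ i) (FU_counit (lv K (l - i)))"

definition dg :: "('o, 'a) cat \<Rightarrow> nat \<Rightarrow> nat \<Rightarrow> ('o, 'a) walks \<Rightarrow> ('o, 'a) walks" where
  "dg K l i = (FU_map ^^ i) (FU_comult (lv K (l - i)))"

text \<open>\<open>wdom\<close>, \<open>wcmp\<close> and \<open>sg\<close> read domain, composite
  and path of length one off the walk itself, so one formula serves all levels; only
  \<open>Gen\<close> consults K. The link with the levels is made in \<open>ev_facts\<close>,
  \<open>Comp_lv\<close> and \<open>sg_arr\<close>.\<close>

primrec wdom :: "('o, 'a) cat \<Rightarrow> ('o, 'a) walks \<Rightarrow> 'o" where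
  "wdom K (Gen f) = Dom K f"
| "wdom K (Path x ts) = x"

definition wcmp :: "('o, 'a) cat \<Rightarrow> ('o, 'a) walks \<Rightarrow> ('o, 'a) walks \<Rightarrow> ('o, 'a) walks" where
  "wcmp K q p = (case p of Gen f \<Rightarrow> (case q of Gen g \<Rightarrow> Gen (Comp K g f) | Path x ts \<Rightarrow> undefined)
     | Path x ts \<Rightarrow> Path x (ts @ steps q))"

definition sg :: "('o, 'a) cat \<Rightarrow> ('o, 'a) walks \<Rightarrow> ('o, 'a) walks" where
  "sg K e = Path (wdom K e) [e]"

lemma lv_simps [simp]: "lv K 0 = gen_cat K" "lv K (Suc l) = FU (lv K l)"
  by (simp_all add: lv_def)

lemma fc_simps: "fc K l 0 = FU_counit (lv K l)" "fc K (Suc l) (Suc i) = FU_map (fc K l i)"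
  by (simp_all add: fc_def)

lemma dg_simps: "dg K l 0 = FU_comult (lv K l)" "dg K (Suc l) (Suc i) = FU_map (dg K l i)"
  by (simp_all add: dg_def)

lemma resolution_simps:
  "lev (resolution K) m = lv K (Suc m)" "face (resolution K) m i = fc K (Suc m) i"
  "degen (resolution K) m i = dg K m i" "prj (resolution K) = eval_walks K"
  by (simp_all add: resolution_def lv_def fc_def dg_def)

section \<open>The resolution as an augmented simplicial category with an extra degeneracy\<close>

locale small_cat = category K for K :: "('o, 'a) cat"
begin

abbreviation ev where "ev \<equiv> eval_walks K"

lemma cat_lv: "category (lv K l)"
  by (induction l) (auto intro: category_FU category_gen_cat category_axioms)

lemma Arr_lv_Suc: "Arr (lv K (Suc l)) = {Path x ts | x ts. wlk (lv K l) x ts}"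
  using Arr_FU[OF cat_lv] by simp

lemma Ob_lv: "Ob (lv K l) = Ob K"
  by (induction l) (auto simp: FU_simps gen_cat_def)

lemma isfun_ev: "isfun (lv K l) K ev"
proof (induction l)
  case 0
  then show ?case by (auto simp: isfun_def gen_cat_def)
next
  case (Suc l)
  have 1: "ev (Path x ts) \<in> Arr K \<and> Dom K (ev (Path x ts)) = x \<and> Cod K (ev (Path x ts)) = wend (lv K l) x ts"
    if "wlk (lv K l) x ts" for x ts
    using isfun_wlk[OF Suc that] comp_path_arr[of x "map ev ts"] by simp
  have 2: "ev (Path x (ts @ us)) = Comp K (ev (Path (wend (lv K l) x ts) us)) (ev (Path x ts))"
    if "wlk (lv K l) x (ts @ us)" for x ts us
    using isfun_wlk[OF Suc that] that isfun_wlk[OF Suc, of x ts] comp_path_append[of x "map ev ts" "map ev us"]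
    by (simp add: category.wlk_append[OF cat_lv])
  show ?case
    unfolding isfun_def
    using 1 2 Ob_lv[of l]
    by (auto simp: Arr_FU[OF cat_lv] FU_simps category.wlk_append[OF cat_lv] simp del: eval_walks.simps(2))
      (simp add: Ob_lv)
qed

lemma ev_facts:
  assumes "u \<in> Arr (lv K l)"
  shows "ev u \<in> Arr K" "Dom K (ev u) = Dom (lv K l) u" "Cod K (ev u) = Cod (lv K l) u"
    "wdom K u = Dom (lv K l) u"
proof -
  show "ev u \<in> Arr K" "Dom K (ev u) = Dom (lv K l) u" "Cod K (ev u) = Cod (lv K l) u"
    using isfun_ev assms by (auto simp: isfun_def)
  show "wdom K u = Dom (lv K l) u"
    using assms by (cases l) (auto simp: gen_cat_def Arr_FU[OF cat_lv] FU_simps)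
qed

lemma Comp_lv:
  assumes "u \<in> Arr (lv K l)" "v \<in> Arr (lv K l)"
  shows "Comp (lv K l) v u = wcmp K v u"
  using assms by (cases l) (auto simp: gen_cat_def wcmp_def Arr_FU[OF cat_lv] FU_simps)

lemma ev_Comp:
  assumes "u \<in> Arr (lv K l)" "v \<in> Arr (lv K l)" "Cod (lv K l) u = Dom (lv K l) v"
  shows "ev (wcmp K v u) = Comp K (ev v) (ev u)"
  using isfun_ev[of l] assms by (simp add: isfun_def flip: Comp_lv)

lemma fc_fun: "i \<le> l \<Longrightarrow> isfun (lv K (Suc l)) (lv K l) (fc K l i)"
proof (induction i arbitrary: l)
  case 0
  then show ?case using isfun_counit[OF cat_lv] by (simp add: fc_simps)
next
  case (Suc i)
  then obtain l' where "l = Suc l'" "i \<le> l'" by (cases l) auto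
  then show ?case
    using isfun_FU_map[OF cat_lv cat_lv Suc.IH[of l']] by (simp add: fc_simps)
qed

lemma dg_fun: "i \<le> l \<Longrightarrow> isfun (lv K (Suc l)) (lv K (Suc (Suc l))) (dg K l i)"
proof (induction i arbitrary: l)
  case 0
  then show ?case using isfun_comult[OF cat_lv] by (simp add: dg_simps)
next
  case (Suc i)
  then obtain l' where "l = Suc l'" "i \<le> l'" by (cases l) auto
  then show ?case
    using isfun_FU_map[OF cat_lv cat_lv Suc.IH[of l']] by (simp add: dg_simps)
qed

lemma fc_arr: "i \<le> l \<Longrightarrow> u \<in> Arr (lv K (Suc l)) \<Longrightarrow> fc K l i u \<in> Arr (lv K l)"
  using fc_fun by (auto simp: isfun_def)

lemma dg_arr: "i \<le> l \<Longrightarrow> u \<in> Arr (lv K (Suc l)) \<Longrightarrow> dg K l i u \<in> Arr (lv K (Suc (Suc l)))"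
  using dg_fun by (auto simp: isfun_def)

lemma FU_map_eq:
  assumes "u \<in> Arr (lv K (Suc l))" "\<And>e. e \<in> Arr (lv K l) \<Longrightarrow> k e = k' e"
  shows "FU_map k u = FU_map k' u"
  using FU_map_cong[OF cat_lv, of u l k k'] assms by simp

text \<open>The simplicial identities come from the comonad. When the smaller index is 0 they are
  naturality of the counit or of the comultiplication, or a comonad law; otherwise one application
  of \<open>FU_map\<close> is stripped from both sides. The five lemmas that follow have the same
  proof.\<close>

lemma fc_fc:
  "i < j \<Longrightarrow> j \<le> Suc l \<Longrightarrow> u \<in> Arr (lv K (Suc (Suc l))) \<Longrightarrow>
    fc K l i (fc K (Suc l) j u) = fc K l (j - 1) (fc K (Suc l) i u)"
proof (induction i arbitrary: l j u)
  case 0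
  then obtain j' where j: "j = Suc j'" by (cases j) auto
  show ?case
    using counit_natural[OF cat_lv fc_fun[of j' l], of u] 0 by (simp add: j fc_simps)
next
  case (Suc i)
  then obtain j' l' where j: "j = Suc (Suc j')" "l = Suc l'" by (cases j; cases "j - 1"; cases l) auto
  have "FU_map (\<lambda>x. fc K l' i (fc K (Suc l') (Suc j') x)) u = FU_map (\<lambda>x. fc K l' j' (fc K (Suc l') i x)) u"
    by (rule FU_map_eq[where l="Suc (Suc l')"]) (use Suc.IH[of "Suc j'" l'] Suc.prems j in auto)
  then show ?case by (simp add: j fc_simps FU_map_comp)
qed

lemma fc_dg_less:
  "i < j \<Longrightarrow> j \<le> Suc l \<Longrightarrow> u \<in> Arr (lv K (Suc (Suc l))) \<Longrightarrow>
    fc K (Suc (Suc l)) i (dg K (Suc l) j u) = dg K l (j - 1) (fc K (Suc l) i u)"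
proof (induction i arbitrary: l j u)
  case 0
  then obtain j' where j: "j = Suc j'" by (cases j) auto
  show ?case
    using counit_natural[OF cat_lv dg_fun[of j' l], of u] 0 by (simp add: j fc_simps dg_simps)
next
  case (Suc i)
  then obtain j' l' where j: "j = Suc (Suc j')" "l = Suc l'" by (cases j; cases "j - 1"; cases l) auto
  have "FU_map (\<lambda>x. fc K (Suc (Suc l')) i (dg K (Suc l') (Suc j') x)) u = FU_map (\<lambda>x. dg K l' j' (fc K (Suc l') i x)) u"
    by (rule FU_map_eq[where l="Suc (Suc l')"]) (use Suc.IH[of "Suc j'" l'] Suc.prems j in auto)
  then show ?case by (simp add: j fc_simps dg_simps FU_map_comp)
qed

lemma fc_dg_same:
  "j \<le> l \<Longrightarrow> u \<in> Arr (lv K (Suc l)) \<Longrightarrow> fc K (Suc l) j (dg K l j u) = u"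
proof (induction j arbitrary: l u)
  case 0
  then show ?case using counit_comult[OF cat_lv] by (simp add: fc_simps dg_simps)
next
  case (Suc j)
  then obtain l' where l: "l = Suc l'" by (cases l) auto
  have "FU_map (\<lambda>x. fc K (Suc l') j (dg K l' j x)) u = FU_map (\<lambda>x. x) u"
    by (rule FU_map_eq[where l="Suc l'"]) (use Suc.IH[of l'] Suc.prems l in auto)
  then show ?case
    using FU_map_ident[OF cat_lv, of u "Suc l'"] Suc.prems by (simp add: l fc_simps dg_simps FU_map_comp)
qed

lemma fc_dg_Suc:
  "j \<le> l \<Longrightarrow> u \<in> Arr (lv K (Suc l)) \<Longrightarrow> fc K (Suc l) (Suc j) (dg K l j u) = u"
proof (induction j arbitrary: l u)
  case 0
  then show ?case using map_counit_comult[OF cat_lv] by (simp add: fc_simps dg_simps)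
next
  case (Suc j)
  then obtain l' where l: "l = Suc l'" by (cases l) auto
  have "FU_map (\<lambda>x. fc K (Suc l') (Suc j) (dg K l' j x)) u = FU_map (\<lambda>x. x) u"
    by (rule FU_map_eq[where l="Suc l'"]) (use Suc.IH[of l'] Suc.prems l in auto)
  then show ?case
    using FU_map_ident[OF cat_lv, of u "Suc l'"] Suc.prems by (simp add: l fc_simps dg_simps FU_map_comp)
qed

lemma fc_dg_greater:
  "Suc j < i \<Longrightarrow> i \<le> Suc (Suc l) \<Longrightarrow> u \<in> Arr (lv K (Suc (Suc l))) \<Longrightarrow>
    fc K (Suc (Suc l)) i (dg K (Suc l) j u) = dg K l j (fc K (Suc l) (i - 1) u)"
proof (induction j arbitrary: l i u)
  case 0
  then obtain i' where i: "i = Suc (Suc i')" by (cases i; cases "i - 1") auto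
  show ?case
    using comult_natural[OF cat_lv fc_fun[of i' l], of u] 0 by (simp add: i fc_simps dg_simps)
next
  case (Suc j)
  then obtain i' l' where i: "i = Suc (Suc i')" "l = Suc l'" by (cases i; cases "i - 1"; cases l) auto
  have "FU_map (\<lambda>x. fc K (Suc (Suc l')) (Suc i') (dg K (Suc l') j x)) u = FU_map (\<lambda>x. dg K l' j (fc K (Suc l') i' x)) u"
    by (rule FU_map_eq[where l="Suc (Suc l')"]) (use Suc.IH[of "Suc i'" l'] Suc.prems i in auto)
  then show ?case by (simp add: i fc_simps dg_simps FU_map_comp)
qed

lemma dg_dg:
  "i \<le> j \<Longrightarrow> j \<le> l \<Longrightarrow> u \<in> Arr (lv K (Suc l)) \<Longrightarrow>
    dg K (Suc l) i (dg K l j u) = dg K (Suc l) (Suc j) (dg K l i u)"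
proof (induction i arbitrary: l j u)
  case 0
  show ?case
  proof (cases j)
    case 0
    then show ?thesis
      using comult_comult[OF cat_lv, of u l] \<open>u \<in> _\<close> by (simp add: dg_simps)
  next
    case (Suc j')
    then obtain l' where l: "l = Suc l'" using 0 by (cases l) auto
    show ?thesis
      using comult_natural[OF cat_lv dg_fun[of j' l'], of u] 0 by (simp add: l Suc dg_simps)
  qed
next
  case (Suc i)
  then obtain j' l' where j: "j = Suc j'" "l = Suc l'" by (cases j; cases l) auto
  have "FU_map (\<lambda>x. dg K (Suc l') i (dg K l' j' x)) u = FU_map (\<lambda>x. dg K (Suc l') (Suc j') (dg K l' i x)) u"
    by (rule FU_map_eq[where l="Suc l'"]) (use Suc.IH[of j' l'] Suc.prems j in auto)
  then show ?case by (simp add: j dg_simps FU_map_comp)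
qed

lemma ev_FU_map:
  assumes "u \<in> Arr (lv K (Suc l))" "\<And>e. e \<in> Arr (lv K l) \<Longrightarrow> ev (k e) = ev e"
  shows "ev (FU_map k u) = ev u"
proof -
  have "wlk (lv K l) x ts \<Longrightarrow> map (ev \<circ> k) ts = map ev ts" for x ts
    by (induction ts arbitrary: x) (auto simp: assms)
  moreover obtain x ts where "u = Path x ts" "wlk (lv K l) x ts"
    using assms(1) unfolding Arr_lv_Suc by blast
  ultimately show ?thesis
    by (simp only: FU_map_def eval_walks.simps walks.sel map_map)
qed

lemma ev_fc: "i \<le> l \<Longrightarrow> u \<in> Arr (lv K (Suc l)) \<Longrightarrow> ev (fc K l i u) = ev u"
proof (induction i arbitrary: l u)
  case 0
  then show ?case
    using isfun_comp_path[OF isfun_ev cat_lv] by (auto simp: fc_simps FU_counit_def Arr_FU[OF cat_lv])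
next
  case (Suc i)
  then obtain l' where "l = Suc l'" by (cases l) auto
  then show ?case using ev_FU_map[of u "Suc l'" "fc K l' i"] Suc by (simp add: fc_simps)
qed

lemma ev_sg: "e \<in> Arr (lv K l) \<Longrightarrow> ev (sg K e) = ev e"
  using comp_path_single[of "ev e"] ev_facts[of e l] by (simp add: sg_def)

lemma ev_dg: "i \<le> l \<Longrightarrow> u \<in> Arr (lv K (Suc l)) \<Longrightarrow> ev (dg K l i u) = ev u"
proof (induction i arbitrary: l u)
  case 0
  have "wlk (lv K l) x ts \<Longrightarrow> map ev (map (\<lambda>e. Path (Dom (lv K l) e) [e]) ts) = map ev ts" for x ts
    by (induction ts arbitrary: x) (auto simp: ev_facts(1) Comp_Idn_left simp flip: ev_facts(3))
  then show ?case using 0 by (auto simp: dg_simps FU_comult_def Arr_FU[OF cat_lv] simp del: map_map)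
next
  case (Suc i)
  then obtain l' where "l = Suc l'" by (cases l) auto
  then show ?case using ev_FU_map[of u "Suc l'" "dg K l' i"] Suc by (simp add: dg_simps)
qed

lemma sg_arr:
  assumes "e \<in> Arr (lv K l)"
  shows "sg K e \<in> Arr (lv K (Suc l))"
  using assms category.Cod_in[OF cat_lv] by (auto simp: sg_def ev_facts Arr_lv_Suc simp del: lv_simps)

text \<open>With \<open>fc_sg_Suc\<close>, these are the identities of an extra degeneracy. They
  hold arrow by arrow; \<open>sg K\<close> does not respect composition, because it turns a
  composite into a path of length one and not into a concatenation.\<close>

lemma fc_sg_0: "e \<in> Arr (lv K l) \<Longrightarrow> fc K l 0 (sg K e) = e"
  using category.comp_path_single[OF cat_lv] by (simp add: fc_simps FU_counit_def sg_def)

lemma fc_sg_Suc: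
  "e \<in> Arr (lv K (Suc l)) \<Longrightarrow> i \<le> l \<Longrightarrow> fc K (Suc l) (Suc i) (sg K e) = sg K (fc K l i e)"
  using fc_fun[of i l] ev_facts(4)[of e "Suc l"] ev_facts(4)[of "fc K l i e" l] fc_arr[of i l e]
  by (simp add: fc_simps FU_map_def sg_def isfun_def)

end

section \<open>Chains on the bisimplicial bar construction\<close>

definition pmap :: "('x \<Rightarrow> 'y) \<Rightarrow> ('x \<Rightarrow>\<^sub>0 int) \<Rightarrow> ('y \<Rightarrow>\<^sub>0 int)" where
  "pmap h = frag_extend (\<lambda>x. frag_of (h x))"

lemma pmap_simps [simp]:
  "pmap h 0 = 0" "pmap h (frag_of x) = frag_of (h x)" "pmap h (a + b) = pmap h a + pmap h b"
  "pmap h (a - b) = pmap h a - pmap h b" "pmap h (- a) = - pmap h a"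
  "pmap h (frag_cmul k a) = frag_cmul k (pmap h a)"
  by (simp_all add: pmap_def frag_extend_add frag_extend_diff frag_extend_minus frag_extend_cmul)

lemma frag_extend_pmap: "frag_extend T (pmap h c) = frag_extend (\<lambda>x. T (h x)) c"
  using frag_extend_compose[of T "h" c] by (simp add: pmap_def o_def)

lemma pmap_pmap: "pmap g (pmap h c) = pmap (\<lambda>x. g (h x)) c"
  by (simp add: pmap_def[of g] pmap_def[of "\<lambda>x. g (h x)"] frag_extend_pmap)

lemma frag_extend_fun_diff: "frag_extend (\<lambda>x. f x - g x) c = frag_extend f c - frag_extend g c"
  by (rule frag_induction[of c UNIV]) (auto simp: frag_extend_diff)

lemma frag_extend_frag_extend: "frag_extend T (frag_extend S c) = frag_extend (\<lambda>x. frag_extend T (S x)) c"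
  by (rule frag_induction[of c UNIV]) (auto simp: frag_extend_diff)

lemma pmap_frag_extend: "pmap h (frag_extend S c) = frag_extend (\<lambda>x. pmap h (S x)) c"
  by (simp add: pmap_def frag_extend_frag_extend)

definition chn :: "'x set \<Rightarrow> ('x \<Rightarrow>\<^sub>0 int) set" where
  "chn S = {c. Poly_Mapping.keys c \<subseteq> S}"

lemma chn_simps [simp]: "0 \<in> chn S" "frag_of x \<in> chn S \<longleftrightarrow> x \<in> S"
  by (auto simp: chn_def)

lemma chn_add [intro]: "a \<in> chn S \<Longrightarrow> b \<in> chn S \<Longrightarrow> a + b \<in> chn S"
  using keys_add[of a b] by (auto simp: chn_def)

lemma chn_diff [intro]: "a \<in> chn S \<Longrightarrow> b \<in> chn S \<Longrightarrow> a - b \<in> chn S"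
  using keys_diff[of a b] by (auto simp: chn_def)

lemma chn_minus [intro]: "a \<in> chn S \<Longrightarrow> - a \<in> chn S"
  by (auto simp: chn_def keys_minus)

lemma chn_cmul [intro]: "a \<in> chn S \<Longrightarrow> frag_cmul k a \<in> chn S"
  using keys_cmul[of k a] by (auto simp: chn_def)

lemma chn_sum [intro]: "(\<And>i. i \<in> I \<Longrightarrow> a i \<in> chn S) \<Longrightarrow> sum a I \<in> chn S"
  by (induction I rule: infinite_finite_induct) auto

lemma chn_frag_extend: "c \<in> chn S \<Longrightarrow> (\<And>x. x \<in> S \<Longrightarrow> T x \<in> chn S') \<Longrightarrow> frag_extend T c \<in> chn S'"
  using keys_frag_extend[of T c] by (fastforce simp: chn_def)

lemma chn_pmap: "c \<in> chn S \<Longrightarrow> (\<And>x. x \<in> S \<Longrightarrow> h x \<in> S') \<Longrightarrow> pmap h c \<in> chn S'"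
  unfolding pmap_def by (rule chn_frag_extend) auto

lemma frag_extend_cong:
  "c \<in> chn S \<Longrightarrow> (\<And>x. x \<in> S \<Longrightarrow> T x = T' x) \<Longrightarrow> frag_extend T c = frag_extend T' c"
  by (rule frag_extend_eq) (auto simp: chn_def)

lemma chn_ext:
  assumes "c \<in> chn S" "T 0 = T' 0" "\<And>x. x \<in> S \<Longrightarrow> T (frag_of x) = T' (frag_of x)"
    "\<And>a b. T (a - b) = T a - T b" "\<And>a b. T' (a - b) = T' a - T' b"
  shows "T c = T' c"
  by (rule free_Abelian_group_induct[of c S]) (use assms in \<open>auto simp: chn_def\<close>)

lemma pmap_cong: "c \<in> chn S \<Longrightarrow> (\<And>x. x \<in> S \<Longrightarrow> h x = h' x) \<Longrightarrow> pmap h c = pmap h' c"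
  unfolding pmap_def by (rule frag_extend_cong) auto

lemma pmap_sum: "pmap h (sum a I) = (\<Sum>i\<in>I. pmap h (a i))"
  by (induction I rule: infinite_finite_induct) auto

lemma pmap_id: "pmap (\<lambda>x. x) c = c"
  by (simp add: pmap_def flip: frag_expansion)

text \<open>The cancellation behind d d = 0: the pair \<open>(j, i)\<close> with i < j is matched
  with \<open>(i, j - 1)\<close>, where the same term occurs with the opposite sign.\<close>

lemma double_alt_sum_zero:
  fixes a :: "nat \<Rightarrow> nat \<Rightarrow> 'x \<Rightarrow>\<^sub>0 int"
  assumes "\<And>i j. i < j \<Longrightarrow> j \<le> Suc l \<Longrightarrow> a i j = a (j - 1) i"
  shows "(\<Sum>j\<le>Suc l. \<Sum>i\<le>l. frag_cmul ((-1) ^ (i + j)) (a i j)) = 0"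
proof -
  let ?t = "\<lambda>(j, i). frag_cmul ((-1) ^ (i + j)) (a i j)"
  let ?S = "{..Suc l} \<times> {..l}"
  let ?A = "{(j, i) \<in> ?S. i < j}" and ?B = "{(j, i) \<in> ?S. j \<le> i}"
  have fin: "finite ?A" "finite ?B"
    by (rule finite_subset[of _ ?S]; force)+
  have dis: "?A \<inter> ?B = {}" by auto
  have "(\<Sum>j\<le>Suc l. \<Sum>i\<le>l. frag_cmul ((-1) ^ (i + j)) (a i j)) = sum ?t ?S"
    by (rule sum.cartesian_product)
  also have "?S = ?A \<union> ?B" by auto
  also have "sum ?t (?A \<union> ?B) = sum ?t ?A + sum ?t ?B"
    by (rule sum.union_disjoint[OF fin dis])
  also have "sum ?t ?A = sum (\<lambda>x. - ?t x) ?B"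
  proof (rule sum.reindex_bij_witness[of _ "\<lambda>(j, i). (Suc i, j)" "\<lambda>(j, i). (i, j - 1)"])
    fix x assume "x \<in> ?A"
    then obtain j i where x: "x = (j, i)" "i < j" "j \<le> Suc l" by auto
    then obtain j' where j: "j = Suc j'" by (cases j) auto
    show "- ?t (case x of (j, i) \<Rightarrow> (i, j - 1)) = ?t x"
      using assms[of i j] x by (simp add: j add.commute)
  qed auto
  finally show ?thesis by (simp add: sum_negf)
qed

section \<open>Generators of the bar construction over the levels of the resolution\<close>

context small_cat
begin

text \<open>The triple \<open>(\<alpha>, \<sigma>, \<beta>)\<close> is read in this order as a
  string of composable arrows, the entries of \<sigma> through their evaluations in K.
  \<open>okc\<close> and \<open>tot\<close> absorb the evaluated first entry into \<alpha>, so the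
  tail is again such a triple with the same total composite.\<close>

primrec okc :: "nat \<Rightarrow> ('o, 'a) walks list \<Rightarrow> 'a \<Rightarrow> 'a \<Rightarrow> bool" where
  "okc l [] \<alpha> \<beta> \<longleftrightarrow> \<alpha> \<in> Arr K \<and> \<beta> \<in> Arr K \<and> Cod K \<alpha> = Dom K \<beta>"
| "okc l (u # \<tau>) \<alpha> \<beta> \<longleftrightarrow> \<alpha> \<in> Arr K \<and> u \<in> Arr (lv K l) \<and> Cod K \<alpha> = Dom K (ev u) \<and>
     okc l \<tau> (Comp K (ev u) \<alpha>) \<beta>"

primrec tot :: "('o, 'a) walks list \<Rightarrow> 'a \<Rightarrow> 'a \<Rightarrow> 'a" where
  "tot [] \<alpha> \<beta> = Comp K \<beta> \<alpha>"
| "tot (u # \<tau>) \<alpha> \<beta> = tot \<tau> (Comp K (ev u) \<alpha>) \<beta>"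

text \<open>Bidegree \<open>(p, l)\<close> of the augmented double complex: bar degree p and
  simplicial degree l - 1, where l = 0 is the Baues-Wirsching complex of K itself. Splitting by f
  keeps each chain over one coefficient group.\<close>

definition X :: "nat \<Rightarrow> nat \<Rightarrow> 'a \<Rightarrow> ('a \<times> ('o, 'a) walks list \<times> 'a) set" where
  "X p l f = {(\<alpha>, \<sigma>, \<beta>). length \<sigma> = p \<and> okc l \<sigma> \<alpha> \<beta> \<and> tot \<sigma> \<alpha> \<beta> = f}"

abbreviation ch where "ch p l f \<equiv> chn (X p l f)"

definition gact :: "'a \<Rightarrow> 'a \<Rightarrow> 'a \<times> ('o, 'a) walks list \<times> 'a \<Rightarrow> 'a \<times> ('o, 'a) walks list \<times> 'a" where
  "gact \<alpha>' \<beta>' = (\<lambda>(\<alpha>, \<sigma>, \<beta>). (Comp K \<alpha> \<alpha>', \<sigma>, Comp K \<beta>' \<beta>))"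

lemma okc_arr: "okc l \<sigma> \<alpha> \<beta> \<Longrightarrow> \<alpha> \<in> Arr K \<and> \<beta> \<in> Arr K"
  by (induction \<sigma> arbitrary: \<alpha>) auto

lemma tot_facts:
  "okc l \<sigma> \<alpha> \<beta> \<Longrightarrow> tot \<sigma> \<alpha> \<beta> \<in> Arr K \<and> Dom K (tot \<sigma> \<alpha> \<beta>) = Dom K \<alpha> \<and> Cod K (tot \<sigma> \<alpha> \<beta>) = Cod K \<beta>"
  by (induction \<sigma> arbitrary: \<alpha>) (auto simp: Comp_in Dom_Comp Cod_Comp ev_facts(1))

lemma okc_gact:
  assumes "\<alpha>' \<in> Arr K" "\<beta>' \<in> Arr K" "Cod K \<beta> = Dom K \<beta>'"
  shows "okc l \<sigma> \<alpha> \<beta> \<Longrightarrow> Cod K \<alpha>' = Dom K \<alpha> \<Longrightarrow> okc l \<sigma> (Comp K \<alpha> \<alpha>') (Comp K \<beta>' \<beta>) \<and>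
    tot \<sigma> (Comp K \<alpha> \<alpha>') (Comp K \<beta>' \<beta>) = Comp K \<beta>' (Comp K (tot \<sigma> \<alpha> \<beta>) \<alpha>')"
proof (induction \<sigma> arbitrary: \<alpha>)
  case Nil
  then show ?case using assms
    by (simp add: Comp_in Dom_Comp Cod_Comp) (simp add: Comp_assoc Comp_in Dom_Comp Cod_Comp)
next
  case (Cons u \<tau>)
  then show ?case
    using assms by (auto simp: Comp_in Dom_Comp Cod_Comp ev_facts(1) Comp_assoc)
qed

lemma gact_X:
  assumes "s \<in> X p l f" "(\<alpha>', f, \<beta>') \<in> Arr (Fac K)"
  shows "gact \<alpha>' \<beta>' s \<in> X p l (Comp K \<beta>' (Comp K f \<alpha>'))"
proof -
  obtain \<alpha> \<sigma> \<beta> where s: "s = (\<alpha>, \<sigma>, \<beta>)" by (cases s)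
  show ?thesis
    using assms okc_gact[of \<alpha>' \<beta>' \<beta> l \<sigma> \<alpha>] tot_facts[of l \<sigma> \<alpha> \<beta>]
    by (auto simp: s X_def gact_def Fac_def)
qed

lemma X_Arr: "s \<in> X p l f \<Longrightarrow> f \<in> Arr K"
  using tot_facts by (auto simp: X_def)

subsection \<open>The Baues-Wirsching boundary\<close>

text \<open>The alternating sum of all faces except the zeroth, beginning with a plus sign. These
  faces do not involve \<alpha>, which is why it is left out: the last one moves the last entry into
  \<beta>, and the others multiply neighbours.\<close>

primrec rem :: "('o, 'a) walks list \<Rightarrow> 'a \<Rightarrow> (('o, 'a) walks list \<times> 'a) \<Rightarrow>\<^sub>0 int" where
  "rem [] \<beta> = 0"
| "rem (u # \<tau>) \<beta> = (case \<tau> of [] \<Rightarrow> frag_of ([], Comp K \<beta> (ev u))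
     | v # \<rho> \<Rightarrow> frag_of (wcmp K v u # \<rho>, \<beta>) - pmap (\<lambda>x. (u # fst x, snd x)) (rem \<tau> \<beta>))"

declare rem.simps(2) [simp del]

lemma rem_single [simp]: "rem [u] \<beta> = frag_of ([], Comp K \<beta> (ev u))"
  by (simp add: rem.simps)

abbreviation cns :: "('o, 'a) walks \<Rightarrow> (('o, 'a) walks list \<times> 'a \<Rightarrow>\<^sub>0 int) \<Rightarrow> (('o, 'a) walks list \<times> 'a \<Rightarrow>\<^sub>0 int)" where
  "cns u \<equiv> pmap (\<lambda>x. (u # fst x, snd x))"

abbreviation ins :: "'a \<Rightarrow> (('o, 'a) walks list \<times> 'a \<Rightarrow>\<^sub>0 int) \<Rightarrow> ('a \<times> ('o, 'a) walks list \<times> 'a \<Rightarrow>\<^sub>0 int)" where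
  "ins \<alpha> \<equiv> pmap (Pair \<alpha>)"

lemma rem_Cons: "rem (u # v # \<rho>) \<beta> = frag_of (wcmp K v u # \<rho>, \<beta>) - cns u (rem (v # \<rho>) \<beta>)"
  by (simp add: rem.simps(2)[of u])

text \<open>The zeroth face minus \<open>rem\<close>, hence the alternating sum of all faces;
  \<open>bw_face_sum\<close> checks this against the faces of the nerve.\<close>

fun rowg :: "'a \<times> ('o, 'a) walks list \<times> 'a \<Rightarrow> 'a \<times> ('o, 'a) walks list \<times> 'a \<Rightarrow>\<^sub>0 int" where
  "rowg (\<alpha>, [], \<beta>) = 0"
| "rowg (\<alpha>, u # \<tau>, \<beta>) = frag_of (Comp K (ev u) \<alpha>, \<tau>, \<beta>)
     - ins \<alpha> (rem (u # \<tau>) \<beta>)"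

definition rowd where "rowd = frag_extend rowg"

lemma wcmp_facts:
  assumes "u \<in> Arr (lv K l)" "v \<in> Arr (lv K l)" "Cod K (ev u) = Dom K (ev v)"
  shows "wcmp K v u \<in> Arr (lv K l)" "ev (wcmp K v u) = Comp K (ev v) (ev u)"
  using assms ev_Comp[of u l v] category.Comp_in[OF cat_lv, of u l v]
  by (auto simp: ev_facts(2,3) Comp_lv)

lemma wcmp_assoc:
  assumes "u \<in> Arr (lv K l)" "v \<in> Arr (lv K l)" "w \<in> Arr (lv K l)"
    "Cod K (ev u) = Dom K (ev v)" "Cod K (ev v) = Dom K (ev w)"
  shows "wcmp K w (wcmp K v u) = wcmp K (wcmp K w v) u"
  using category.Comp_assoc[OF cat_lv, of u l v w] assms wcmp_facts[of u l v] wcmp_facts[of v l w]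
  by (simp add: ev_facts(2,3) Comp_lv)

lemma okc_wcmp:
  assumes "okc l (u # v # \<rho>) \<alpha> \<beta>"
  shows "okc l (wcmp K v u # \<rho>) \<alpha> \<beta>" "tot (wcmp K v u # \<rho>) \<alpha> \<beta> = tot (u # v # \<rho>) \<alpha> \<beta>"
  using assms by (auto simp: wcmp_facts Dom_Comp Cod_Comp ev_facts(1) Comp_assoc)

text \<open>The description of the support quantifies over \<alpha> because \<open>rem\<close> does
  not see it, and because prefixing an entry changes the \<alpha> at which the induction hypothesis
  is needed.\<close>

lemma rem_keys:
  "\<sigma> \<noteq> [] \<Longrightarrow> okc l \<sigma> \<alpha> \<beta> \<Longrightarrow> rem \<sigma> \<beta> \<in> chn {(\<tau>, \<beta>'). \<forall>\<alpha>. okc l \<sigma> \<alpha> \<beta> \<longrightarrow>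
     okc l \<tau> \<alpha> \<beta>' \<and> length \<sigma> = Suc (length \<tau>) \<and> tot \<tau> \<alpha> \<beta>' = tot \<sigma> \<alpha> \<beta>}"
proof (induction \<sigma> arbitrary: \<alpha>)
  case (Cons u \<tau>)
  show ?case
  proof (cases \<tau>)
    case Nil
    then show ?thesis by (auto simp: ev_facts(1) Comp_in Dom_Comp Cod_Comp Comp_assoc)
  next
    case (Cons v \<rho>)
    have "okc l \<tau> (Comp K (ev u) \<alpha>) \<beta>" using Cons.prems by simp
    note IH = Cons.IH[OF _ this]
    have "cns u (rem \<tau> \<beta>) \<in> chn {(\<tau>', \<beta>'). \<forall>\<alpha>. okc l (u # \<tau>) \<alpha> \<beta> \<longrightarrow>
       okc l \<tau>' \<alpha> \<beta>' \<and> length (u # \<tau>) = Suc (length \<tau>') \<and> tot \<tau>' \<alpha> \<beta>' = tot (u # \<tau>) \<alpha> \<beta>}"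
      by (rule chn_pmap[OF IH]) (use Cons in auto)
    then show ?thesis
      using Cons okc_wcmp by (auto simp: rem_Cons intro!: chn_diff simp del: okc.simps tot.simps)
  qed
qed simp

lemma rowg_ch: "s \<in> X (Suc p) l f \<Longrightarrow> rowg s \<in> ch p l f"
proof -
  assume "s \<in> X (Suc p) l f"
  then obtain \<alpha> u \<tau> \<beta> where s: "s = (\<alpha>, u # \<tau>, \<beta>)" "length \<tau> = p"
    and ok: "okc l (u # \<tau>) \<alpha> \<beta>" "tot (u # \<tau>) \<alpha> \<beta> = f"
    by (cases s) (auto simp: X_def length_Suc_conv)
  have "ins \<alpha> (rem (u # \<tau>) \<beta>) \<in> ch p l f"
    by (rule chn_pmap[OF rem_keys]) (use ok s(2) in \<open>auto simp: X_def\<close>)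
  then show ?thesis
    using ok s(2) by (auto simp: s(1) X_def simp del: rem.simps)
qed

lemma rowd_ch: "\<zeta> \<in> ch (Suc p) l f \<Longrightarrow> rowd \<zeta> \<in> ch p l f"
  unfolding rowd_def by (erule chn_frag_extend) (rule rowg_ch)

abbreviation rem_ext where "rem_ext u \<equiv> frag_extend (\<lambda>x. rem (u # fst x) (snd x))"

lemma rem_ext_cns: "rem_ext u (cns v r) = cns (wcmp K v u) r - cns u (rem_ext v r)"
proof -
  have "rem_ext u (cns v r) = frag_extend (\<lambda>x. frag_of (wcmp K v u # fst x, snd x) - cns u (rem (v # fst x) (snd x))) r"
    by (simp only: frag_extend_pmap fst_conv snd_conv rem_Cons)
  also have "\<dots> = cns (wcmp K v u) r - cns u (rem_ext v r)"
    unfolding frag_extend_fun_diff pmap_frag_extend by (simp only: pmap_def)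
  finally show ?thesis .
qed

text \<open>The remainder of d d = 0: in \<open>rowd_rowg\<close> all terms that absorb an entry
  into \<alpha> cancel in pairs, and what is left is this identity.\<close>

lemma rem_rem: "okc l (u # v # \<rho>) \<alpha> \<beta> \<Longrightarrow> rem_ext u (rem (v # \<rho>) \<beta>) = rem (wcmp K v u # \<rho>) \<beta>"
proof (induction \<rho> arbitrary: u v \<alpha>)
  case Nil
  then have "Comp K \<beta> (ev (wcmp K v u)) = Comp K (Comp K \<beta> (ev v)) (ev u)"
  proof -
    have uv: "u \<in> Arr (lv K l)" "v \<in> Arr (lv K l)" "Cod K (ev u) = Dom K (ev v)" "\<alpha> \<in> Arr K" "Cod K \<alpha> = Dom K (ev u)"
      using Nil by (auto simp: Cod_Comp ev_facts(1))
    have e: "ev u \<in> Arr K" "ev v \<in> Arr K" using uv ev_facts(1) by blast+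
    have "\<beta> \<in> Arr K" "Dom K \<beta> = Cod K (ev v)"
      using Nil uv e by (simp_all add: Cod_Comp Comp_in Dom_Comp)
    then show ?thesis
      using wcmp_facts(2)[OF uv(1-3)] uv(3) e by (simp add: Comp_assoc)
  qed
  then show ?case by simp
next
  case (Cons w \<rho>)
  have [simp]: "wcmp K w (wcmp K v u) = wcmp K (wcmp K w v) u"
    using Cons.prems by (intro wcmp_assoc[of _ l]) (auto simp: Cod_Comp Comp_in ev_facts(1))
  have IH: "rem_ext v (rem (w # \<rho>) \<beta>) = rem (wcmp K w v # \<rho>) \<beta>"
    by (rule Cons.IH[of _ _ "Comp K (ev u) \<alpha>"]) (use Cons.prems in simp)
  show ?case
    by (simp add: rem_Cons[of v w] frag_extend_diff rem_ext_cns IH)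
      (simp add: rem_Cons[of "wcmp K v u"] rem_Cons[of u])
qed

lemma rowd_simps [simp]: "rowd 0 = 0" "rowd (frag_of s) = rowg s" "rowd (a - b) = rowd a - rowd b"
  "rowd (a + b) = rowd a + rowd b" "rowd (- a) = - rowd a" "rowd (frag_cmul k a) = frag_cmul k (rowd a)"
  by (simp_all add: rowd_def frag_extend_diff frag_extend_add frag_extend_minus frag_extend_cmul)

lemma rowd_ins_cns: "rowd (ins \<alpha> (cns u r)) = ins (Comp K (ev u) \<alpha>) r - ins \<alpha> (rem_ext u r)"
proof -
  have "rowd (ins \<alpha> (cns u r)) = frag_extend (\<lambda>x. frag_of (Comp K (ev u) \<alpha>, x) - ins \<alpha> (rem (u # fst x) (snd x))) r"
    by (simp only: rowd_def frag_extend_pmap fst_conv snd_conv rowg.simps prod.collapse)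
  also have "\<dots> = ins (Comp K (ev u) \<alpha>) r - ins \<alpha> (rem_ext u r)"
    unfolding frag_extend_fun_diff pmap_frag_extend by (simp only: pmap_def)
  finally show ?thesis .
qed

lemma Comp_ev_wcmp:
  "okc l (u # v # \<rho>) \<alpha> \<beta> \<Longrightarrow> Comp K (ev v) (Comp K (ev u) \<alpha>) = Comp K (ev (wcmp K v u)) \<alpha>"
  by (auto simp: wcmp_facts Comp_assoc ev_facts(1) Cod_Comp)

lemma rowd_rowg: "s \<in> X p l f \<Longrightarrow> rowd (rowg s) = 0"
proof -
  assume "s \<in> X p l f"
  then obtain \<alpha> \<sigma> \<beta> where s: "s = (\<alpha>, \<sigma>, \<beta>)" and ok: "okc l \<sigma> \<alpha> \<beta>" by (auto simp: X_def)
  consider "\<sigma> = []" | u where "\<sigma> = [u]" | u v \<rho> where "\<sigma> = u # v # \<rho>"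
    by (metis list.exhaust)
  then show ?thesis
  proof cases
    case 3
    then show ?thesis
      using rem_rem[of l u v \<rho> \<alpha> \<beta>] Comp_ev_wcmp[of l u v \<rho> \<alpha> \<beta>] ok
      by (simp add: s rem_Cons rowd_ins_cns)
  qed (simp_all add: s)
qed

lemma rowd_rowd: "\<zeta> \<in> ch p l f \<Longrightarrow> rowd (rowd \<zeta>) = 0"
  by (rule chn_ext[where T="\<lambda>\<zeta>. rowd (rowd \<zeta>)" and T'="\<lambda>_. 0"]) (auto intro: rowd_rowg)

subsection \<open>Contraction of the rows over free categories\<close>

text \<open>Unfolded on a path e_1, ..., e_k, this is a generator with two identities in front of
  \<tau>, minus the sum over i of the generators whose first two entries are the path [e_i] and the
  path after e_i, with e_1, ..., e_(i-1) absorbed into \<alpha>. The two identities are there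
  because chains are not normalized: a generator with an identity entry has to be contracted as
  well.\<close>

primrec hp :: "('o, 'a) walks list \<Rightarrow> 'o \<Rightarrow> 'a \<Rightarrow> ('o, 'a) walks list \<Rightarrow> 'a \<Rightarrow>
    'a \<times> ('o, 'a) walks list \<times> 'a \<Rightarrow>\<^sub>0 int" where
  "hp [] x \<alpha> \<tau> \<beta> = frag_of (\<alpha>, Path x [] # Path x [] # \<tau>, \<beta>)"
| "hp (e # es) x \<alpha> \<tau> \<beta> = hp es (Cod K (ev e)) (Comp K (ev e) \<alpha>) \<tau> \<beta>
     - frag_of (\<alpha>, sg K e # Path (Cod K (ev e)) es # \<tau>, \<beta>)"

fun hg :: "'a \<times> ('o, 'a) walks list \<times> 'a \<Rightarrow> 'a \<times> ('o, 'a) walks list \<times> 'a \<Rightarrow>\<^sub>0 int" where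
  "hg (\<alpha>, [], \<beta>) = 0"
| "hg (\<alpha>, u # \<tau>, \<beta>) = hp (steps u) (start u) \<alpha> \<tau> \<beta>"

definition rowh where "rowh = frag_extend hg"

lemma rowh_simps [simp]: "rowh 0 = 0" "rowh (frag_of s) = hg s" "rowh (a - b) = rowh a - rowh b"
  "rowh (a + b) = rowh a + rowh b" "rowh (- a) = - rowh a" "rowh (frag_cmul k a) = frag_cmul k (rowh a)"
  by (simp_all add: rowh_def frag_extend_diff frag_extend_add frag_extend_minus frag_extend_cmul)

lemma rowh_ins_cns:
  "rowh (ins \<alpha> (cns (Path x (e # es)) r)) = rowh (ins (Comp K (ev e) \<alpha>) (cns (Path (Cod K (ev e)) es) r))
     - ins \<alpha> (cns (sg K e) (cns (Path (Cod K (ev e)) es) r))"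
  unfolding rowh_def frag_extend_pmap pmap_pmap fst_conv snd_conv hg.simps walks.sel hp.simps frag_extend_fun_diff
  by (simp only: pmap_def)

lemma rowh_ins_cns_Nil:
  "rowh (ins \<alpha> (cns (Path x []) r)) = ins \<alpha> (cns (Path x []) (cns (Path x []) r))"
  unfolding rowh_def frag_extend_pmap pmap_pmap fst_conv snd_conv hg.simps walks.sel hp.simps
  by (simp only: pmap_def)

lemma lv_PathE:
  assumes "u \<in> Arr (lv K (Suc l))" obtains x ts where "u = Path x ts"
  using assms unfolding Arr_lv_Suc by blast

lemma okc_Path:
  assumes "okc (Suc l) (Path x (e # es) # \<tau>) \<alpha> \<beta>"
  shows "okc (Suc l) (sg K e # Path (Cod K (ev e)) es # \<tau>) \<alpha> \<beta>"
    "wcmp K (Path (Cod K (ev e)) es) (sg K e) = Path x (e # es)"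
    "ev (sg K e) = ev e" "wdom K e = x" "e \<in> Arr (lv K l)"
    "okc (Suc l) (Path (Cod K (ev e)) es # \<tau>) (Comp K (ev e) \<alpha>) \<beta>"
proof -
  have w: "wlk (lv K l) x (e # es)" using assms unfolding okc.simps Arr_lv_Suc by simp
  then have e: "e \<in> Arr (lv K l)" "wdom K e = x" "Dom K (ev e) = x" and es: "wlk (lv K l) (Cod K (ev e)) es"
    by (auto simp: ev_facts)
  then have u: "Path (Cod K (ev e)) es \<in> Arr (lv K (Suc l))" unfolding Arr_lv_Suc by simp
  show 1: "wcmp K (Path (Cod K (ev e)) es) (sg K e) = Path x (e # es)" "ev (sg K e) = ev e" "wdom K e = x"
    "e \<in> Arr (lv K l)"
    using e ev_sg[OF e(1)] by (simp_all add: wcmp_def sg_def del: eval_walks.simps)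
  have 2: "Dom K (ev (Path (Cod K (ev e)) es)) = Cod K (ev e)"
    using ev_facts(2)[OF u] by (simp add: FU_simps)
  show 3: "okc (Suc l) (sg K e # Path (Cod K (ev e)) es # \<tau>) \<alpha> \<beta>"
  proof -
    have a: "\<alpha> \<in> Arr K" "Cod K \<alpha> = x" "okc (Suc l) \<tau> (Comp K (Comp K (ev (Path (Cod K (ev e)) es)) (ev e)) \<alpha>) \<beta>"
      using assms ev_facts(2)[of "Path x (e # es)" "Suc l"] by (simp_all add: FU_simps)
    have "Comp K (Comp K (ev (Path (Cod K (ev e)) es)) (ev e)) \<alpha>
        = Comp K (ev (Path (Cod K (ev e)) es)) (Comp K (ev e) \<alpha>)"
      using a e 2 ev_facts(1)[OF e(1)] ev_facts(1)[OF u]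
      by (intro Comp_assoc[symmetric]) (simp_all del: eval_walks.simps)
    then show ?thesis
      using a e u sg_arr[OF e(1)] 1(2) 2 ev_facts(1)[OF e(1)]
      by (simp add: Comp_in Cod_Comp del: lv_simps eval_walks.simps)
  qed
  show "okc (Suc l) (Path (Cod K (ev e)) es # \<tau>) (Comp K (ev e) \<alpha>) \<beta>"
    using 3 1(2) by simp
qed

text \<open>Induction on the path. For the empty path the two-identity term returns the generator.
  For a longer path the boundary of the split generator multiplies its two parts back together and
  reduces the claim to the rest of the path. The second entry v matters: for a single entry the
  boundary lies in degree 0, where \<open>hg\<close> vanishes, and the identity fails.\<close>

lemma rowd_hg:
  "okc (Suc l) (Path x es # v # \<rho>) \<alpha> \<beta> \<Longrightarrow>
    rowd (hg (\<alpha>, Path x es # v # \<rho>, \<beta>)) + rowh (rowg (\<alpha>, Path x es # v # \<rho>, \<beta>)) = frag_of (\<alpha>, Path x es # v # \<rho>, \<beta>)"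
proof (induction es arbitrary: x \<alpha>)
  case Nil
  then have x: "x = Cod K \<alpha>" "\<alpha> \<in> Arr K" "v \<in> Arr (lv K (Suc l))" "x \<in> Ob K" "Dom K (ev v) = x"
    by (auto simp: Idn_in Dom_Idn Cod_Idn Cod_in Arr_FU[OF cat_lv] Ob_lv Comp_Idn_left)
  then have "start v = x"
    using ev_facts(2)[of v "Suc l"] by (simp add: FU_simps)
  moreover obtain y ts where "v = Path y ts"
    using x(3) by (rule lv_PathE)
  ultimately have v: "wcmp K v (Path x []) = v" "wcmp K (Path x []) (Path x []) = Path x []"
    by (auto simp: wcmp_def)
  have c: "Comp K (Idn K x) \<alpha> = \<alpha>" using x(1,2) Comp_Idn_left[of \<alpha>] by simp
  show ?case
    by (simp only: rem_Cons v c rowh_ins_cns_Nil rowg.simps hg.simps hp.simps walks.sel rowd_simps rowh_simps pmap_simps fst_conv snd_conv eval_walks.simps list.map comp_path.simps) simp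
next
  case (Cons e es)
  let ?u = "Path (Cod K (ev e)) es"
  note ok = okc_Path[OF Cons.prems]
  have IH: "rowd (hg (Comp K (ev e) \<alpha>, ?u # v # \<rho>, \<beta>)) + rowh (rowg (Comp K (ev e) \<alpha>, ?u # v # \<rho>, \<beta>))
      = frag_of (Comp K (ev e) \<alpha>, ?u # v # \<rho>, \<beta>)"
    by (rule Cons.IH[OF ok(6)])
  have "v \<in> Arr (lv K (Suc l))" using Cons.prems by (simp del: lv_simps)
  then obtain y ts where v: "v = Path y ts" by (rule lv_PathE)
  have w: "wcmp K v (Path x (e # es)) = Path x (e # (es @ ts))" "wcmp K v ?u = Path (Cod K (ev e)) (es @ ts)"
    by (simp_all add: wcmp_def v)
  have c: "Comp K (ev (Path x (e # es))) \<alpha> = Comp K (ev ?u) (Comp K (ev e) \<alpha>)"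
    using Comp_ev_wcmp[OF ok(1)] ok(2,3) by simp
  show ?case
    using IH by (simp add: rem_Cons[of _ v] rem_Cons[of "sg K e"] w ok(2,3) c rowh_ins_cns algebra_simps
      del: eval_walks.simps)
qed

lemma rowd_rowh:
  assumes "\<zeta> \<in> ch (Suc (Suc p)) (Suc l) f"
  shows "rowd (rowh \<zeta>) + rowh (rowd \<zeta>) = \<zeta>"
proof (rule chn_ext[OF assms, where T="\<lambda>\<zeta>. rowd (rowh \<zeta>) + rowh (rowd \<zeta>)" and T'="\<lambda>\<zeta>. \<zeta>"])
  fix s assume "s \<in> X (Suc (Suc p)) (Suc l) f"
  then obtain \<alpha> u v \<rho> \<beta> where s: "s = (\<alpha>, u # v # \<rho>, \<beta>)" "okc (Suc l) (u # v # \<rho>) \<alpha> \<beta>"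
    by (cases s) (auto simp: X_def length_Suc_conv)
  moreover from this have "u \<in> Arr (lv K (Suc l))" by (simp del: lv_simps)
  then obtain x es where "u = Path x es" by (rule lv_PathE)
  ultimately show "rowd (rowh (frag_of s)) + rowh (rowd (frag_of s)) = frag_of s"
    using rowd_hg by simp
qed auto

lemma hp_ch: "okc (Suc l) (Path x es # \<tau>) \<alpha> \<beta> \<Longrightarrow>
    hp es x \<alpha> \<tau> \<beta> \<in> ch (Suc (Suc (length \<tau>))) (Suc l) (tot (Path x es # \<tau>) \<alpha> \<beta>)"
proof (induction es arbitrary: x \<alpha>)
  case Nil
  then have x: "x = Cod K \<alpha>" "\<alpha> \<in> Arr K" "x \<in> Ob K"
    by (auto simp: Idn_in Dom_Idn Cod_Idn Cod_in Arr_FU[OF cat_lv] Ob_lv)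
  then show ?case
    using Nil Comp_Idn_left[of \<alpha>] by (auto simp: X_def)
next
  case (Cons e es)
  note ok = okc_Path[OF Cons.prems]
  have "tot (Path (Cod K (ev e)) es # \<tau>) (Comp K (ev e) \<alpha>) \<beta> = tot (Path x (e # es) # \<tau>) \<alpha> \<beta>"
    using Comp_ev_wcmp[OF ok(1)] ok(2,3) by simp
  then show ?case
    using Cons.IH[OF ok(6)] ok(1,3)
    by (auto simp: X_def intro!: chn_diff simp del: okc.simps(2) eval_walks.simps)
qed

lemma rowh_ch: "\<zeta> \<in> ch (Suc p) (Suc l) f \<Longrightarrow> rowh \<zeta> \<in> ch (Suc (Suc p)) (Suc l) f"
proof (unfold rowh_def, rule chn_frag_extend)
  fix s assume "s \<in> X (Suc p) (Suc l) f"
  then obtain \<alpha> u \<tau> \<beta> where s: "s = (\<alpha>, u # \<tau>, \<beta>)" "okc (Suc l) (u # \<tau>) \<alpha> \<beta>" "length \<tau> = p" "tot (u # \<tau>) \<alpha> \<beta> = f"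
    by (cases s) (auto simp: X_def length_Suc_conv)
  moreover from this have "u \<in> Arr (lv K (Suc l))" by (simp del: lv_simps)
  then obtain x es where "u = Path x es" by (rule lv_PathE)
  ultimately show "hg s \<in> ch (Suc (Suc p)) (Suc l) f"
    using hp_ch[of l x es \<tau> \<alpha> \<beta>] by simp
qed

end

lemma frag_cmul_diff: "frag_cmul k (a - b) = frag_cmul k a - frag_cmul k b"
  using frag_cmul_distrib2[of k "a - b" b] by simp

context small_cat
begin

subsection \<open>The simplicial direction\<close>

definition mapg :: "(('o, 'a) walks \<Rightarrow> ('o, 'a) walks) \<Rightarrow> 'a \<times> ('o, 'a) walks list \<times> 'a \<Rightarrow> 'a \<times> ('o, 'a) walks list \<times> 'a" where
  "mapg k = (\<lambda>(\<alpha>, \<sigma>, \<beta>). (\<alpha>, map k \<sigma>, \<beta>))"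

definition vd :: "nat \<Rightarrow> ('a \<times> ('o, 'a) walks list \<times> 'a \<Rightarrow>\<^sub>0 int) \<Rightarrow> ('a \<times> ('o, 'a) walks list \<times> 'a \<Rightarrow>\<^sub>0 int)" where
  "vd l \<zeta> = (\<Sum>i\<le>l. frag_cmul ((-1) ^ i) (pmap (mapg (fc K l i)) \<zeta>))"

definition sd :: "('a \<times> ('o, 'a) walks list \<times> 'a \<Rightarrow>\<^sub>0 int) \<Rightarrow> ('a \<times> ('o, 'a) walks list \<times> 'a \<Rightarrow>\<^sub>0 int)" where
  "sd = pmap (mapg (sg K))"

text \<open>\<open>okc\<close> and \<open>tot\<close> see entries only through their evaluations, so
  preserving these suffices to act on generators. This admits \<open>sg K\<close>, which is not a
  functor.\<close>

definition lifts :: "nat \<Rightarrow> nat \<Rightarrow> (('o, 'a) walks \<Rightarrow> ('o, 'a) walks) \<Rightarrow> bool" where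
  "lifts l l' k \<longleftrightarrow> (\<forall>e\<in>Arr (lv K l). k e \<in> Arr (lv K l') \<and> ev (k e) = ev e)"

lemma lifts_fc: "i \<le> l \<Longrightarrow> lifts (Suc l) l (fc K l i)"
  unfolding lifts_def using fc_arr ev_fc by blast

lemma lifts_dg: "i \<le> l \<Longrightarrow> lifts (Suc l) (Suc (Suc l)) (dg K l i)"
  unfolding lifts_def using dg_arr ev_dg by blast

lemma lifts_sg: "lifts l (Suc l) (sg K)"
  unfolding lifts_def using sg_arr ev_sg by blast

lemma okc_map:
  "lifts l l' k \<Longrightarrow> okc l \<sigma> \<alpha> \<beta> \<Longrightarrow> okc l' (map k \<sigma>) \<alpha> \<beta> \<and> tot (map k \<sigma>) \<alpha> \<beta> = tot \<sigma> \<alpha> \<beta>"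
  by (induction \<sigma> arbitrary: \<alpha>) (auto simp: lifts_def)

lemma mapg_X: "lifts l l' k \<Longrightarrow> s \<in> X p l f \<Longrightarrow> mapg k s \<in> X p l' f"
  using okc_map by (fastforce simp: X_def mapg_def)

lemma mapg_gact: "mapg k (gact \<alpha>' \<beta>' s) = gact \<alpha>' \<beta>' (mapg k s)"
  by (cases s) (simp add: mapg_def gact_def)

lemma mapg_cong:
  assumes "\<And>e. e \<in> Arr (lv K l) \<Longrightarrow> k e = k' e" "s \<in> X p l f"
  shows "mapg k s = mapg k' s"
proof -
  have "okc l \<sigma> \<alpha> \<beta> \<Longrightarrow> map k \<sigma> = map k' \<sigma>" for \<sigma> \<alpha> \<beta>
    by (induction \<sigma> arbitrary: \<alpha>) (auto simp: assms(1))
  then show ?thesis using assms(2) by (auto simp: X_def mapg_def)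
qed

lemma mapg_mapg: "mapg k (mapg k' s) = mapg (\<lambda>x. k (k' x)) s"
  by (cases s) (simp add: mapg_def)

lemma sd_simps [simp]: "sd 0 = 0" "sd (a - b) = sd a - sd b" "sd (a + b) = sd a + sd b"
  "sd (frag_cmul k a) = frag_cmul k (sd a)"
  by (simp_all add: sd_def)

lemma vd_simps [simp]: "vd l 0 = 0" "vd l (a - b) = vd l a - vd l b" "vd l (a + b) = vd l a + vd l b"
  by (simp_all add: vd_def frag_cmul_distrib2 frag_cmul_diff sum.distrib sum_subtractf)

lemma sd_ch: "\<zeta> \<in> ch p l f \<Longrightarrow> sd \<zeta> \<in> ch p (Suc l) f"
  unfolding sd_def by (erule chn_pmap) (rule mapg_X[OF lifts_sg])

lemma vd_ch: "\<zeta> \<in> ch p (Suc l) f \<Longrightarrow> vd l \<zeta> \<in> ch p l f"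
  unfolding vd_def by (auto intro!: chn_sum chn_cmul intro: chn_pmap mapg_X[OF lifts_fc])

lemma vd_sd_0: "\<zeta> \<in> ch p 0 f \<Longrightarrow> vd 0 (sd \<zeta>) = \<zeta>"
proof -
  assume "\<zeta> \<in> ch p 0 f"
  then have "pmap (\<lambda>s. mapg (fc K 0 0) (mapg (sg K) s)) \<zeta> = pmap (\<lambda>s. s) \<zeta>"
  proof (rule pmap_cong)
    fix s assume "s \<in> X p 0 f"
    then show "mapg (fc K 0 0) (mapg (sg K) s) = s"
      using mapg_cong[of 0 "\<lambda>x. fc K 0 0 (sg K x)" "\<lambda>x. x" s p f] fc_sg_0[of _ 0]
      by (simp add: mapg_mapg) (simp add: mapg_def)
  qed
  then show ?thesis by (simp add: vd_def sd_def pmap_pmap pmap_id)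
qed

text \<open>The zeroth face undoes \<open>sg K\<close>; the other faces commute with it after an
  index shift, which reverses the signs.\<close>

lemma vd_sd: "\<zeta> \<in> ch p (Suc l) f \<Longrightarrow> vd (Suc l) (sd \<zeta>) = \<zeta> - sd (vd l \<zeta>)"
proof -
  assume z: "\<zeta> \<in> ch p (Suc l) f"
  have 0: "pmap (mapg (fc K (Suc l) 0)) (sd \<zeta>) = \<zeta>"
  proof -
    have "pmap (\<lambda>s. mapg (fc K (Suc l) 0) (mapg (sg K) s)) \<zeta> = pmap (\<lambda>s. s) \<zeta>"
    proof (rule pmap_cong[OF z])
      fix s assume "s \<in> X p (Suc l) f"
      then show "mapg (fc K (Suc l) 0) (mapg (sg K) s) = s"
        using mapg_cong[of "Suc l" "\<lambda>x. fc K (Suc l) 0 (sg K x)" "\<lambda>x. x" s p f] fc_sg_0[of _ "Suc l"]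
        by (simp add: mapg_mapg del: lv_simps) (simp add: mapg_def)
    qed
    then show ?thesis by (simp add: sd_def pmap_pmap pmap_id)
  qed
  have 1: "pmap (mapg (fc K (Suc l) (Suc i))) (sd \<zeta>) = sd (pmap (mapg (fc K l i)) \<zeta>)" if "i \<le> l" for i
    unfolding sd_def pmap_pmap mapg_mapg
    by (rule pmap_cong[OF z], rule mapg_cong) (use fc_sg_Suc that in auto)
  have "vd (Suc l) (sd \<zeta>) = \<zeta> + (\<Sum>i\<le>l. frag_cmul ((-1) ^ Suc i) (sd (pmap (mapg (fc K l i)) \<zeta>)))"
    unfolding vd_def by (subst sum.atMost_Suc_shift) (simp add: 0 1)
  also have "\<dots> = \<zeta> - sd (vd l \<zeta>)"
    by (simp add: vd_def sd_def pmap_sum sum_negf[symmetric])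
  finally show ?thesis .
qed

lemma vd_vd: "\<zeta> \<in> ch p (Suc (Suc l)) f \<Longrightarrow> vd l (vd (Suc l) \<zeta>) = 0"
proof -
  assume z: "\<zeta> \<in> ch p (Suc (Suc l)) f"
  let ?a = "\<lambda>i j. pmap (mapg (fc K l i)) (pmap (mapg (fc K (Suc l) j)) \<zeta>)"
  have "(\<Sum>j\<le>Suc l. \<Sum>i\<le>l. frag_cmul ((-1) ^ (i + j)) (?a i j)) = 0"
  proof (rule double_alt_sum_zero)
    fix i j assume "i < j" "j \<le> Suc l"
    then show "?a i j = ?a (j - 1) i"
      unfolding pmap_pmap mapg_mapg
      by (intro pmap_cong[OF z] mapg_cong) (auto simp: fc_fc)
  qed
  then have "(\<Sum>i\<le>l. \<Sum>j\<le>Suc l. frag_cmul ((-1) ^ (i + j)) (?a i j)) = 0"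
    by (subst sum.swap)
  then show ?thesis
    by (simp add: vd_def pmap_sum frag_cmul_sum power_add del: sum.atMost_Suc)
qed

lemma rem_map:
  assumes "lifts l l' k" "\<And>u v. u \<in> Arr (lv K l) \<Longrightarrow> v \<in> Arr (lv K l) \<Longrightarrow> Cod K (ev u) = Dom K (ev v)
    \<Longrightarrow> k (wcmp K v u) = wcmp K (k v) (k u)"
  shows "okc l \<sigma> \<alpha> \<beta> \<Longrightarrow> rem (map k \<sigma>) \<beta> = pmap (\<lambda>x. (map k (fst x), snd x)) (rem \<sigma> \<beta>)"
proof (induction \<sigma> arbitrary: \<alpha>)
  case (Cons u \<tau>)
  show ?case
  proof (cases \<tau>)
    case Nil
    then show ?thesis using Cons.prems assms(1) by (simp add: lifts_def)
  next
    case (Cons v \<rho>)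
    have "okc l \<tau> (Comp K (ev u) \<alpha>) \<beta>" using Cons.prems by simp
    note IH = Cons.IH[OF this]
    have uv: "u \<in> Arr (lv K l)" "v \<in> Arr (lv K l)" "Cod K (ev u) = Dom K (ev v)"
      using Cons Cons.prems by (auto simp: Cod_Comp ev_facts(1))
    then have "k (wcmp K v u) = wcmp K (k v) (k u)" by (rule assms(2))
    then show ?thesis
      using IH by (simp add: Cons rem_Cons pmap_pmap)
  qed
qed simp

lemma pmap_mapg_ins: "pmap (mapg k) (ins \<alpha> r) = ins \<alpha> (pmap (\<lambda>x. (map k (fst x), snd x)) r)"
  unfolding pmap_pmap mapg_def case_prod_unfold fst_conv snd_conv ..

text \<open>The second hypothesis separates faces and degeneracies from \<open>sg K\<close>: the row
  boundary multiplies neighbours, so commuting with it calls for a multiplicative map.\<close>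

lemma rowd_mapg:
  assumes "lifts l l' k" "\<And>u v. u \<in> Arr (lv K l) \<Longrightarrow> v \<in> Arr (lv K l) \<Longrightarrow> Cod K (ev u) = Dom K (ev v)
    \<Longrightarrow> k (wcmp K v u) = wcmp K (k v) (k u)" and z: "\<zeta> \<in> ch p l f"
  shows "rowd (pmap (mapg k) \<zeta>) = pmap (mapg k) (rowd \<zeta>)"
proof (rule chn_ext[OF z, where T="\<lambda>\<zeta>. rowd (pmap (mapg k) \<zeta>)" and T'="\<lambda>\<zeta>. pmap (mapg k) (rowd \<zeta>)"])
  fix s assume "s \<in> X p l f"
  then obtain \<alpha> \<sigma> \<beta> where s: "s = (\<alpha>, \<sigma>, \<beta>)" "okc l \<sigma> \<alpha> \<beta>" by (auto simp: X_def)
  show "rowd (pmap (mapg k) (frag_of s)) = pmap (mapg k) (rowd (frag_of s))"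
  proof (cases \<sigma>)
    case (Cons u \<tau>)
    then have "ev (k u) = ev u" using s assms(1) by (auto simp: lifts_def)
    moreover have "rem (map k \<sigma>) \<beta> = pmap (\<lambda>x. (map k (fst x), snd x)) (rem \<sigma> \<beta>)"
      using assms(1) _ s(2) by (rule rem_map) (rule assms(2))
    ultimately show ?thesis
      by (simp add: s(1) Cons pmap_mapg_ins) (simp add: mapg_def)
  qed (simp add: s(1) mapg_def)
qed auto

lemma isfun_wcmp:
  assumes F: "isfun (lv K l) (lv K l') F" and u: "u \<in> Arr (lv K l)" and v: "v \<in> Arr (lv K l)"
    and uv: "Cod K (ev u) = Dom K (ev v)"
  shows "F (wcmp K v u) = wcmp K (F v) (F u)"
proof -
  have "Cod (lv K l) u = Dom (lv K l) v"
    using uv ev_facts(3)[OF u] ev_facts(2)[OF v] by simp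
  then have "F (Comp (lv K l) v u) = Comp (lv K l') (F v) (F u)" "F u \<in> Arr (lv K l')" "F v \<in> Arr (lv K l')"
    using F u v by (auto simp: isfun_def)
  then show ?thesis
    using Comp_lv[OF u v] Comp_lv[of "F u" l' "F v"] by simp
qed

lemmas fc_wcmp = isfun_wcmp[OF fc_fun]
lemmas dg_wcmp = isfun_wcmp[OF dg_fun]

lemma rowd_sum: "rowd (sum a I) = (\<Sum>i\<in>I. rowd (a i))"
  by (induction I rule: infinite_finite_induct) auto

lemma rowd_vd: "\<zeta> \<in> ch p (Suc l) f \<Longrightarrow> rowd (vd l \<zeta>) = vd l (rowd \<zeta>)"
proof -
  assume z: "\<zeta> \<in> ch p (Suc l) f"
  have "rowd (pmap (mapg (fc K l i)) \<zeta>) = pmap (mapg (fc K l i)) (rowd \<zeta>)" if "i \<le> l" for i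
    using lifts_fc[OF that] _ z by (rule rowd_mapg) (rule fc_wcmp[OF that])
  then show ?thesis by (simp add: vd_def rowd_sum)
qed

lemma okc_ConsD:
  "okc l (u # \<tau>) \<alpha> \<beta> \<Longrightarrow> u \<in> Arr (lv K l) \<and> ev u \<in> Arr K \<and> \<alpha> \<in> Arr K \<and> \<beta> \<in> Arr K \<and>
    Cod K \<alpha> = Dom K (ev u) \<and> Comp K (ev u) \<alpha> \<in> Arr K \<and> Cod K (Comp K (ev u) \<alpha>) = Cod K (ev u) \<and>
    Dom K (Comp K (ev u) \<alpha>) = Dom K \<alpha> \<and> okc l \<tau> (Comp K (ev u) \<alpha>) \<beta>"
  using okc_arr[of l \<tau> "Comp K (ev u) \<alpha>" \<beta>]
  by (auto simp: ev_facts(1) Comp_in Cod_Comp Dom_Comp)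

subsection \<open>Equivariant operators\<close>

lemma rem_gact:
  assumes "\<beta>' \<in> Arr K" "Cod K \<beta> = Dom K \<beta>'"
  shows "okc l \<sigma> \<alpha> \<beta> \<Longrightarrow> rem \<sigma> (Comp K \<beta>' \<beta>) = pmap (\<lambda>x. (fst x, Comp K \<beta>' (snd x))) (rem \<sigma> \<beta>)"
proof (induction \<sigma> arbitrary: \<alpha>)
  case (Cons u \<tau>)
  show ?case
  proof (cases \<tau>)
    case Nil
    have "Comp K \<beta>' (Comp K \<beta> (ev u)) = Comp K (Comp K \<beta>' \<beta>) (ev u)"
      by (rule Comp_assoc) (use okc_ConsD[OF Cons.prems] assms Nil in auto)
    then show ?thesis by (simp add: Nil)
  next
    case (Cons v \<rho>)
    have "okc l \<tau> (Comp K (ev u) \<alpha>) \<beta>" using Cons.prems by simp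
    from Cons.IH[OF this] show ?thesis by (simp add: Cons rem_Cons pmap_pmap)
  qed
qed simp

lemma okc_ends: "okc l \<sigma> \<alpha> \<beta> \<Longrightarrow> tot \<sigma> \<alpha> \<beta> = f \<Longrightarrow> (\<alpha>', f, \<beta>') \<in> Arr (Fac K) \<Longrightarrow>
    \<alpha>' \<in> Arr K \<and> \<beta>' \<in> Arr K \<and> Cod K \<alpha>' = Dom K \<alpha> \<and> Cod K \<beta> = Dom K \<beta>'"
  using tot_facts[of l \<sigma> \<alpha> \<beta>] by (auto simp: Fac_def)

text \<open>What \<open>pb\<close> needs in order to carry cochains to cochains: values over the
  same total composite and compatibility with the action of Fac K.\<close>

definition isop where
  "isop p l p' l' Q \<longleftrightarrow> (\<forall>a b. Q (a - b) = Q a - Q b) \<and> (\<forall>f. \<forall>\<zeta>\<in>ch p l f. Q \<zeta> \<in> ch p' l' f) \<and>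
     (\<forall>f \<alpha>' \<beta>'. \<forall>\<zeta>\<in>ch p l f. (\<alpha>', f, \<beta>') \<in> Arr (Fac K) \<longrightarrow>
        Q (pmap (gact \<alpha>' \<beta>') \<zeta>) = pmap (gact \<alpha>' \<beta>') (Q \<zeta>))"

lemma isop_diff: "isop p l p' l' Q \<Longrightarrow> Q (a - b) = Q a - Q b"
  and isop_ch: "isop p l p' l' Q \<Longrightarrow> \<zeta> \<in> ch p l f \<Longrightarrow> Q \<zeta> \<in> ch p' l' f"
  by (auto simp: isop_def)

lemma isop_zero: "isop p l p' l' Q \<Longrightarrow> Q 0 = 0"
  using isop_diff[of p l p' l' Q 0 0] by simp

lemma isop_comp:
  assumes "isop p l p' l' Q" "isop p' l' p'' l'' Q'"
  shows "isop p l p'' l'' (\<lambda>\<zeta>. Q' (Q \<zeta>))"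
  using assms unfolding isop_def by (metis (no_types, lifting))

lemma isop_cmul:
  assumes "isop p l p' l' Q" shows "isop p l p' l' (\<lambda>\<zeta>. frag_cmul k (Q \<zeta>))"
  using assms unfolding isop_def
  by (auto simp: frag_cmul_diff)

lemma isop_gens:
  assumes "\<And>a b. Q (a - b) = Q a - Q b" "\<And>f \<zeta>. \<zeta> \<in> ch p l f \<Longrightarrow> Q \<zeta> \<in> ch p' l' f"
    "\<And>f s \<alpha>' \<beta>'. s \<in> X p l f \<Longrightarrow> (\<alpha>', f, \<beta>') \<in> Arr (Fac K) \<Longrightarrow>
       Q (frag_of (gact \<alpha>' \<beta>' s)) = pmap (gact \<alpha>' \<beta>') (Q (frag_of s))"
  shows "isop p l p' l' Q"
  unfolding isop_def
proof (intro conjI allI ballI impI)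
  fix f \<alpha>' \<beta>' \<zeta> assume z: "\<zeta> \<in> ch p l f" and F: "(\<alpha>', f, \<beta>') \<in> Arr (Fac K)"
  have "Q 0 = 0" using assms(1)[of 0 0] by simp
  then show "Q (pmap (gact \<alpha>' \<beta>') \<zeta>) = pmap (gact \<alpha>' \<beta>') (Q \<zeta>)"
    by (intro chn_ext[OF z, where T="\<lambda>\<zeta>. Q (pmap (gact \<alpha>' \<beta>') \<zeta>)"]) (use assms F in auto)
qed (use assms in auto)

lemma pmap_gact_ins:
  "pmap (gact \<alpha>' \<beta>') (ins \<alpha> r) = ins (Comp K \<alpha> \<alpha>') (pmap (\<lambda>x. (fst x, Comp K \<beta>' (snd x))) r)"
  unfolding pmap_pmap gact_def case_prod_unfold fst_conv snd_conv ..

lemma isop_rowd: "isop (Suc p) l p l rowd"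
proof (rule isop_gens)
  fix f s \<alpha>' \<beta>' assume s: "s \<in> X (Suc p) l f" and F: "(\<alpha>', f, \<beta>') \<in> Arr (Fac K)"
  obtain \<alpha> u \<tau> \<beta> where e: "s = (\<alpha>, u # \<tau>, \<beta>)" and ok: "okc l (u # \<tau>) \<alpha> \<beta>" "tot (u # \<tau>) \<alpha> \<beta> = f"
    using s by (cases s) (auto simp: X_def length_Suc_conv)
  note en = okc_ends[OF ok F]
  have "Comp K (ev u) (Comp K \<alpha> \<alpha>') = Comp K (Comp K (ev u) \<alpha>) \<alpha>'"
    by (rule Comp_assoc) (use okc_ConsD[OF ok(1)] en in auto)
  then show "rowd (frag_of (gact \<alpha>' \<beta>' s)) = pmap (gact \<alpha>' \<beta>') (rowd (frag_of s))"
    using rem_gact[of \<beta>' \<beta>, OF _ _ ok(1)] en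
    by (simp add: e pmap_gact_ins) (simp add: gact_def pmap_gact_ins)
qed (auto intro: rowd_ch)

lemma hp_gact:
  "okc (Suc l) (Path x es # \<tau>) \<alpha> \<beta> \<Longrightarrow> \<alpha>' \<in> Arr K \<Longrightarrow> Cod K \<alpha>' = Dom K \<alpha> \<Longrightarrow>
    hp es x (Comp K \<alpha> \<alpha>') \<tau> (Comp K \<beta>' \<beta>) = pmap (gact \<alpha>' \<beta>') (hp es x \<alpha> \<tau> \<beta>)"
proof (induction es arbitrary: x \<alpha>)
  case (Cons e es)
  note ok = okc_Path[OF Cons.prems(1)]
  have a: "\<alpha> \<in> Arr K" "Cod K \<alpha> = Dom K (ev e)" "ev e \<in> Arr K"
    using ok(1) ok(3) ev_facts(1)[OF ok(5)] by (auto simp del: lv_simps eval_walks.simps)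
  then have "Comp K (ev e) (Comp K \<alpha> \<alpha>') = Comp K (Comp K (ev e) \<alpha>) \<alpha>'"
    using Cons.prems by (simp add: Comp_assoc)
  then show ?case
    using Cons.IH[OF ok(6) Cons.prems(2)] Cons.prems(3) a by (simp add: gact_def Dom_Comp)
qed (simp add: gact_def)

lemma isop_rowh: "isop (Suc p) (Suc l) (Suc (Suc p)) (Suc l) rowh"
proof (rule isop_gens)
  fix f s \<alpha>' \<beta>' assume s: "s \<in> X (Suc p) (Suc l) f" and F: "(\<alpha>', f, \<beta>') \<in> Arr (Fac K)"
  obtain \<alpha> u \<tau> \<beta> where e: "s = (\<alpha>, u # \<tau>, \<beta>)" and ok: "okc (Suc l) (u # \<tau>) \<alpha> \<beta>" "tot (u # \<tau>) \<alpha> \<beta> = f"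
    using s by (cases s) (auto simp: X_def length_Suc_conv)
  note en = okc_ends[OF ok F]
  have "u \<in> Arr (lv K (Suc l))" using ok by (simp del: lv_simps)
  then obtain x es where "u = Path x es" by (rule lv_PathE)
  then show "rowh (frag_of (gact \<alpha>' \<beta>' s)) = pmap (gact \<alpha>' \<beta>') (rowh (frag_of s))"
    using hp_gact[of l x es \<tau> \<alpha> \<beta> \<alpha>' \<beta>'] ok en by (simp add: e gact_def del: lv_simps)
qed (auto intro: rowh_ch)

lemma isop_mapg: "lifts l l' k \<Longrightarrow> isop p l p l' (pmap (mapg k))"
  by (rule isop_gens) (auto intro: chn_pmap mapg_X simp: mapg_gact)

lemma isop_sd: "isop p l p (Suc l) sd"
  unfolding sd_def by (rule isop_mapg[OF lifts_sg])

lemma isop_vd: "isop p (Suc l) p l (vd l)"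
proof (rule isop_gens)
  show "vd l \<zeta> \<in> ch p l f" if "\<zeta> \<in> ch p (Suc l) f" for f \<zeta> using that by (rule vd_ch)
qed (simp_all add: vd_def pmap_sum mapg_gact frag_cmul_diff sum_subtractf)

subsection \<open>The comparison operators\<close>

text \<open>The zigzag from row degree p + n at \<open>lv K l\<close> to row degree p at
  \<open>lv K (l + Suc n)\<close>. For l = 0 and p = 1 it turns Baues-Wirsching chains into chains
  on which a derivation can be evaluated.\<close>

primrec TT where
  "TT 0 \<zeta> = sd \<zeta>"
| "TT (Suc n) \<zeta> = sd (rowd (TT n \<zeta>))"

text \<open>The zigzag in the opposite direction, with the row contraction in the place of the extra
  degeneracy; it ends at level 0.\<close>

primrec WW where
  "WW 0 \<zeta> = vd 0 \<zeta>"
| "WW (Suc n) \<zeta> = WW n (rowh (vd (Suc n) \<zeta>))"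

lemma isop_TT: "isop (p + n) l p (l + Suc n) (TT n)"
proof (induction n arbitrary: p)
  case 0
  then show ?case using isop_sd[of p l] by (simp add: TT.simps(1)[abs_def])
next
  case (Suc n)
  have "isop (p + Suc n) l (Suc p) (l + Suc n) (TT n)" using Suc[of "Suc p"] by simp
  from isop_comp[OF isop_comp[OF this isop_rowd] isop_sd] show ?case by (simp add: TT.simps(2)[abs_def])
qed

lemma isop_WW: "isop (Suc p) (Suc n) (Suc p + n) 0 (WW n)"
proof (induction n arbitrary: p)
  case 0
  then show ?case using isop_vd[of "Suc p" 0] by (simp add: WW.simps(1)[abs_def])
next
  case (Suc n)
  from isop_comp[OF isop_comp[OF isop_vd isop_rowh] Suc[of "Suc p"]] show ?case
    by (simp add: WW.simps(2)[abs_def])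
qed

text \<open>Each layer of the zigzag is resolved by \<open>vd_sd\<close>, after moving
  \<open>vd\<close> past \<open>rowd\<close>. The double row boundary from the preceding layer
  vanishes, and the other term changes its sign in each layer, which produces the power of
  -1.\<close>

lemma vd_TT_0:
  "\<zeta> \<in> ch (q + Suc n) 0 f \<Longrightarrow>
    vd (Suc n) (TT (Suc n) \<zeta>) = rowd (TT n \<zeta>) - frag_cmul ((-1) ^ n) (TT n (rowd \<zeta>))"
proof (induction n arbitrary: q)
  case 0
  then have z: "\<zeta> \<in> ch (Suc q) 0 f" by simp
  have "vd (Suc 0) (sd (rowd (sd \<zeta>))) = rowd (sd \<zeta>) - sd (vd 0 (rowd (sd \<zeta>)))"
    by (rule vd_sd[OF rowd_ch[OF sd_ch[OF z]]])
  also have "vd 0 (rowd (sd \<zeta>)) = rowd \<zeta>"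
    using rowd_vd[OF sd_ch[OF z]] vd_sd_0[OF z] by simp
  finally show ?case by simp
next
  case (Suc n)
  then have z: "\<zeta> \<in> ch (Suc q + Suc n) 0 f" by simp
  have t: "TT (Suc n) \<zeta> \<in> ch (Suc q) (Suc (Suc n)) f"
    using isop_ch[OF isop_TT z] by simp
  have "TT n \<zeta> \<in> ch (Suc (Suc q)) (Suc n) f"
    using isop_ch[OF isop_TT[of "Suc (Suc q)" n 0], of \<zeta> f] z by simp
  then have r: "rowd (rowd (TT n \<zeta>)) = 0" by (rule rowd_rowd)
  have "vd (Suc (Suc n)) (TT (Suc (Suc n)) \<zeta>) = rowd (TT (Suc n) \<zeta>) - sd (vd (Suc n) (rowd (TT (Suc n) \<zeta>)))"
    unfolding TT.simps(2)[of "Suc n"] by (rule vd_sd[OF rowd_ch[OF t]])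
  also have "vd (Suc n) (rowd (TT (Suc n) \<zeta>)) = rowd (vd (Suc n) (TT (Suc n) \<zeta>))"
    by (rule rowd_vd[OF t, symmetric])
  also have "\<dots> = - frag_cmul ((-1) ^ n) (rowd (TT n (rowd \<zeta>)))"
    unfolding Suc.IH[OF z] by (simp add: r)
  finally show ?case by simp
qed

text \<open>Above level 0 the innermost \<open>sd\<close> contributes the extra term with
  \<open>vd l \<zeta>\<close>; at level 0 it is absent by \<open>vd_sd_0\<close>.\<close>

lemma vd_TT_Suc:
  "\<zeta> \<in> ch (q + Suc n) (Suc l) f \<Longrightarrow>
    vd (l + Suc (Suc n)) (TT (Suc n) \<zeta>) = rowd (TT n \<zeta>) - frag_cmul ((-1) ^ n) (TT n (rowd \<zeta>))
      + frag_cmul ((-1) ^ n) (TT (Suc n) (vd l \<zeta>))"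
proof (induction n arbitrary: q)
  case 0
  then have z: "\<zeta> \<in> ch (Suc q) (Suc l) f" by simp
  have "vd (Suc (Suc l)) (sd (rowd (sd \<zeta>))) = rowd (sd \<zeta>) - sd (vd (Suc l) (rowd (sd \<zeta>)))"
    by (rule vd_sd[OF rowd_ch[OF sd_ch[OF z]]])
  also have "vd (Suc l) (rowd (sd \<zeta>)) = rowd \<zeta> - rowd (sd (vd l \<zeta>))"
    using rowd_vd[OF sd_ch[OF z]] vd_sd[OF z] by simp
  finally show ?case by simp
next
  case (Suc n)
  then have z: "\<zeta> \<in> ch (Suc q + Suc n) (Suc l) f" by simp
  have t: "TT (Suc n) \<zeta> \<in> ch (Suc q) (Suc (l + Suc (Suc n))) f"
    using isop_ch[OF isop_TT z] by simp
  have "TT n \<zeta> \<in> ch (Suc (Suc q)) (Suc l + Suc n) f"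
    using isop_ch[OF isop_TT[of "Suc (Suc q)" n "Suc l"], of \<zeta> f] z by simp
  then have r: "rowd (rowd (TT n \<zeta>)) = 0" by (rule rowd_rowd)
  have "vd (Suc (l + Suc (Suc n))) (TT (Suc (Suc n)) \<zeta>)
      = rowd (TT (Suc n) \<zeta>) - sd (vd (l + Suc (Suc n)) (rowd (TT (Suc n) \<zeta>)))"
    unfolding TT.simps(2)[of "Suc n"] by (rule vd_sd[OF rowd_ch[OF t]])
  also have "vd (l + Suc (Suc n)) (rowd (TT (Suc n) \<zeta>)) = rowd (vd (l + Suc (Suc n)) (TT (Suc n) \<zeta>))"
    by (rule rowd_vd[OF t, symmetric])
  also have "\<dots> = - frag_cmul ((-1) ^ n) (rowd (TT n (rowd \<zeta>))) + frag_cmul ((-1) ^ n) (rowd (TT (Suc n) (vd l \<zeta>)))"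
    unfolding Suc.IH[OF z] by (simp add: r)
  finally show ?case by simp
qed

text \<open>The first operation in \<open>WW n\<close> is \<open>vd n\<close>, and two successive
  simplicial boundaries compose to zero.\<close>

lemma WW_vd: "\<zeta> \<in> ch (Suc p) (Suc (Suc n)) f \<Longrightarrow> WW n (vd (Suc n) \<zeta>) = 0"
  by (cases n) (auto simp: vd_vd isop_zero[OF isop_WW[of 0]])

end

section \<open>Cochains and the comparison of cocycles\<close>

locale nat_sys = small_cat K for K :: "('o, 'a) cat" +
  fixes D :: "('a, 'd) natsys"
  assumes nat_sys: "natural_system K D"
begin

lemma grp_D: "f \<in> Arr K \<Longrightarrow> comm_group (grp D f)"
  using nat_sys by (simp add: natural_system_def Fac_def)

lemma act_hom:
  assumes "(\<alpha>, f, \<beta>) \<in> Arr (Fac K)"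
  shows "act D (\<alpha>, f, \<beta>) \<in> hom (grp D f) (grp D (Comp K \<beta> (Comp K f \<alpha>)))"
  using nat_sys assms by (fastforce simp: natural_system_def Fac_def)

lemma act_Idn: "f \<in> Arr K \<Longrightarrow> x \<in> carrier (grp D f) \<Longrightarrow> act D (Idn K (Dom K f), f, Idn K (Cod K f)) x = x"
  using nat_sys by (simp add: natural_system_def Fac_def)

lemma act_act:
  assumes "(\<alpha>, f, \<beta>) \<in> Arr (Fac K)" "(\<alpha>', Comp K \<beta> (Comp K f \<alpha>), \<beta>') \<in> Arr (Fac K)" "x \<in> carrier (grp D f)"
  shows "act D (Comp K \<alpha> \<alpha>', f, Comp K \<beta>' \<beta>) x = act D (\<alpha>', Comp K \<beta> (Comp K f \<alpha>), \<beta>') (act D (\<alpha>, f, \<beta>) x)"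
proof -
  have "\<forall>s\<in>Arr (Fac K). \<forall>t\<in>Arr (Fac K). Cod (Fac K) s = Dom (Fac K) t \<longrightarrow>
        (\<forall>x\<in>carrier (grp D (Dom (Fac K) s)). act D (Comp (Fac K) t s) x = act D t (act D s x))"
    using nat_sys by (simp add: natural_system_def)
  from this[rule_format, OF assms(1,2)] show ?thesis using assms(3) by (simp add: Fac_def)
qed

lemma Fac_target: "(\<alpha>, f, \<beta>) \<in> Arr (Fac K) \<Longrightarrow> Comp K \<beta> (Comp K f \<alpha>) \<in> Arr K"
  by (auto simp: Fac_def Comp_in Cod_Comp)

text \<open>In contrast to \<open>natsys_Hom\<close>, values off the generators are left open, so
  that constructions need no restriction; cochains are compared on generators, and
  \<open>tobw\<close> restricts at the end.\<close>

definition coch :: "nat \<Rightarrow> nat \<Rightarrow> ('a \<times> ('o, 'a) walks list \<times> 'a \<Rightarrow> 'd) set" where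
  "coch p l = {c. \<forall>f. \<forall>s\<in>X p l f. c s \<in> carrier (grp D f) \<and>
     (\<forall>\<alpha>' \<beta>'. (\<alpha>', f, \<beta>') \<in> Arr (Fac K) \<longrightarrow> c (gact \<alpha>' \<beta>' s) = act D (\<alpha>', f, \<beta>') (c s))}"

abbreviation linD where "linD f \<equiv> lin (grp D f)"

text \<open>The coefficient group is found from the generator through \<open>tot\<close>, so that
  one function covers all f.\<close>

definition pb where "pb Q c s = (case s of (\<alpha>, \<sigma>, \<beta>) \<Rightarrow> linD (tot \<sigma> \<alpha> \<beta>) c (Q (frag_of s)))"

lemma pb_X: "s \<in> X p l f \<Longrightarrow> pb Q c s = linD f c (Q (frag_of s))"
  by (auto simp: X_def pb_def)

lemma coch_carrier: "c \<in> coch p l \<Longrightarrow> s \<in> X p l f \<Longrightarrow> c s \<in> carrier (grp D f)"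
  by (auto simp: coch_def)

lemma coch_keys: "c \<in> coch p l \<Longrightarrow> \<zeta> \<in> ch p l f \<Longrightarrow> s \<in> Poly_Mapping.keys \<zeta> \<Longrightarrow> c s \<in> carrier (grp D f)"
  by (auto simp: chn_def intro: coch_carrier)

lemma coch_gact: "c \<in> coch p l \<Longrightarrow> s \<in> X p l f \<Longrightarrow> (\<alpha>', f, \<beta>') \<in> Arr (Fac K) \<Longrightarrow>
    c (gact \<alpha>' \<beta>' s) = act D (\<alpha>', f, \<beta>') (c s)"
  by (auto simp: coch_def)

lemma linD_closed: "c \<in> coch p l \<Longrightarrow> \<zeta> \<in> ch p l f \<Longrightarrow> f \<in> Arr K \<Longrightarrow> linD f c \<zeta> \<in> carrier (grp D f)"
  by (rule comm_group.lin_closed[OF grp_D]) (auto dest: coch_keys)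

lemma linD_diff: "c \<in> coch p l \<Longrightarrow> a \<in> ch p l f \<Longrightarrow> b \<in> ch p l f \<Longrightarrow> f \<in> Arr K \<Longrightarrow>
    linD f c (a - b) = linD f c a \<otimes>\<^bsub>grp D f\<^esub> inv\<^bsub>grp D f\<^esub> (linD f c b)"
  by (rule comm_group.lin_diff[OF grp_D]) (auto dest: coch_keys)

lemma linD_add: "c \<in> coch p l \<Longrightarrow> a \<in> ch p l f \<Longrightarrow> b \<in> ch p l f \<Longrightarrow> f \<in> Arr K \<Longrightarrow>
    linD f c (a + b) = linD f c a \<otimes>\<^bsub>grp D f\<^esub> linD f c b"
  by (rule comm_group.lin_add[OF grp_D]) (auto dest: coch_keys)

lemma linD_sign: "c \<in> coch p l \<Longrightarrow> a \<in> ch p l f \<Longrightarrow> f \<in> Arr K \<Longrightarrow>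
    linD f c (frag_cmul ((-1) ^ n) a) = (if even n then linD f c a else inv\<^bsub>grp D f\<^esub> (linD f c a))"
  by (rule comm_group.lin_sign[OF grp_D]) (auto dest: coch_keys)

lemma linD_sign_one: "c \<in> coch p l \<Longrightarrow> a \<in> ch p l f \<Longrightarrow> f \<in> Arr K \<Longrightarrow>
    linD f c (frag_cmul ((-1) ^ n) a) = \<one>\<^bsub>grp D f\<^esub> \<Longrightarrow> linD f c a = \<one>\<^bsub>grp D f\<^esub>"
proof -
  assume a: "c \<in> coch p l" "a \<in> ch p l f" "f \<in> Arr K" and 1: "linD f c (frag_cmul ((-1) ^ n) a) = \<one>\<^bsub>grp D f\<^esub>"
  interpret A: comm_group "grp D f" by (rule grp_D[OF a(3)])
  show ?thesis
    using 1 linD_sign[OF a, of n] A.inv_eq_1_iff[OF linD_closed[OF a]] by (cases "even n") simp_all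
qed

lemma linD_of: "c \<in> coch p l \<Longrightarrow> s \<in> X p l f \<Longrightarrow> linD f c (frag_of s) = c s"
  by (rule comm_group.lin_of[OF grp_D[OF X_Arr]]) (auto intro: coch_carrier)

lemma linD_zero: "f \<in> Arr K \<Longrightarrow> linD f c 0 = \<one>\<^bsub>grp D f\<^esub>"
  by (rule comm_group.lin_zero[OF grp_D])

lemma linD_pb:
  assumes Q: "isop p l p' l' Q" and c: "c \<in> coch p' l'" and z: "\<zeta> \<in> ch p l f" and f: "f \<in> Arr K"
  shows "linD f (pb Q c) \<zeta> = linD f c (Q \<zeta>)"
proof -
  interpret A: comm_group "grp D f" by (rule grp_D[OF f])
  have q: "Q a \<in> ch p' l' f" if "Poly_Mapping.keys a \<subseteq> X p l f" for a
    using isop_ch[OF Q, of a f] that by (simp add: chn_def)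
  show ?thesis
  proof (rule A.lin_eqI[symmetric, where S="X p l f" and \<phi>="\<lambda>\<zeta>. linD f c (Q \<zeta>)"])
    show "pb Q c x \<in> carrier (grp D f)" "linD f c (Q (frag_of x)) = pb Q c x" if "x \<in> X p l f" for x
      using linD_closed[OF c q[of "frag_of x"] f] that by (auto simp: pb_X[OF that])
    show "linD f c (Q (a - b)) = linD f c (Q a) \<otimes>\<^bsub>grp D f\<^esub> inv\<^bsub>grp D f\<^esub> linD f c (Q b)"
      if "Poly_Mapping.keys a \<subseteq> X p l f" "Poly_Mapping.keys b \<subseteq> X p l f" for a b
      unfolding isop_diff[OF Q] by (rule linD_diff[OF c q q f]) (use that in auto)
  qed (use z in \<open>auto simp: chn_def isop_zero[OF Q]\<close>)
qed

text \<open>Q commutes with the action on generators, and the action on D is a homomorphism, hence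
  passes through the linear extension.\<close>

lemma pb_coch:
  assumes Q: "isop p l p' l' Q" and c: "c \<in> coch p' l'"
  shows "pb Q c \<in> coch p l"
  unfolding coch_def
proof (intro CollectI allI ballI conjI impI)
  fix f s assume s: "s \<in> X p l f"
  then have f: "f \<in> Arr K" by (rule X_Arr)
  have q: "Q (frag_of s) \<in> ch p' l' f" using isop_ch[OF Q] s by simp
  show "pb Q c s \<in> carrier (grp D f)"
    unfolding pb_X[OF s] by (rule linD_closed[OF c q f])
  fix \<alpha>' \<beta>' assume F: "(\<alpha>', f, \<beta>') \<in> Arr (Fac K)"
  let ?g = "Comp K \<beta>' (Comp K f \<alpha>')"
  have g: "?g \<in> Arr K" using F by (rule Fac_target)
  have "Q (frag_of (gact \<alpha>' \<beta>' s)) = pmap (gact \<alpha>' \<beta>') (Q (frag_of s))"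
    using Q F s unfolding isop_def by (metis chn_simps(2) pmap_simps(2))
  then have "pb Q c (gact \<alpha>' \<beta>' s) = linD ?g c (pmap (gact \<alpha>' \<beta>') (Q (frag_of s)))"
    by (simp only: pb_X[OF gact_X[OF s F]])
  also have "\<dots> = linD ?g (\<lambda>x. linD ?g c (frag_of (gact \<alpha>' \<beta>' x))) (Q (frag_of s))"
    unfolding pmap_def
    by (rule comm_group.lin_frag_extend[OF grp_D[OF g]])
      (use q F in \<open>auto simp: chn_def intro!: coch_carrier[OF c] gact_X\<close>)
  also have "\<dots> = linD ?g (\<lambda>x. act D (\<alpha>', f, \<beta>') (c x)) (Q (frag_of s))"
  proof (rule comm_group.lin_cong[OF grp_D[OF g]])
    fix x assume "x \<in> Poly_Mapping.keys (Q (frag_of s))"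
    then have x: "x \<in> X p' l' f" using q by (auto simp: chn_def)
    show "linD ?g c (frag_of (gact \<alpha>' \<beta>' x)) = act D (\<alpha>', f, \<beta>') (c x)"
      using linD_of[OF c gact_X[OF x F]] coch_gact[OF c x F] by simp
    show "act D (\<alpha>', f, \<beta>') (c x) \<in> carrier (grp D ?g)"
      using act_hom[OF F] coch_carrier[OF c x] by (auto simp: hom_def)
  qed
  also have "\<dots> = act D (\<alpha>', f, \<beta>') (linD f c (Q (frag_of s)))"
    by (rule comm_group.hom_lin[OF grp_D[OF f] act_hom[OF F] grp_D[OF g], symmetric]) (rule coch_keys[OF c q])
  finally show "pb Q c (gact \<alpha>' \<beta>' s) = act D (\<alpha>', f, \<beta>') (pb Q c s)"
    unfolding pb_X[OF s] .
qed

text \<open>The group structure on cochains, with the group at each generator again found through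
  \<open>tot\<close>. The name \<open>cone\<close> stands for the cochain one, the neutral
  element.\<close>

definition cone where "cone s = (case s of (\<alpha>, \<sigma>, \<beta>) \<Rightarrow> \<one>\<^bsub>grp D (tot \<sigma> \<alpha> \<beta>)\<^esub>)"
definition cmult where "cmult b c s = (case s of (\<alpha>, \<sigma>, \<beta>) \<Rightarrow> b s \<otimes>\<^bsub>grp D (tot \<sigma> \<alpha> \<beta>)\<^esub> c s)"
definition cinv where "cinv c s = (case s of (\<alpha>, \<sigma>, \<beta>) \<Rightarrow> inv\<^bsub>grp D (tot \<sigma> \<alpha> \<beta>)\<^esub> c s)"

lemma cone_X: "s \<in> X p l f \<Longrightarrow> cone s = \<one>\<^bsub>grp D f\<^esub>"
  and cmult_X: "s \<in> X p l f \<Longrightarrow> cmult b c s = b s \<otimes>\<^bsub>grp D f\<^esub> c s"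
  and cinv_X: "s \<in> X p l f \<Longrightarrow> cinv c s = inv\<^bsub>grp D f\<^esub> c s"
  by (auto simp: X_def cone_def cmult_def cinv_def)

lemma act_group_hom:
  assumes "(\<alpha>, f, \<beta>) \<in> Arr (Fac K)"
  shows "group_hom (grp D f) (grp D (Comp K \<beta> (Comp K f \<alpha>))) (act D (\<alpha>, f, \<beta>))"
proof -
  have "f \<in> Arr K" using assms by (auto simp: Fac_def)
  then show ?thesis
    using grp_D grp_D[OF Fac_target[OF assms]] act_hom[OF assms]
    by (auto simp: group_hom_def group_hom_axioms_def comm_group_def)
qed

lemma coch_ops:
  "cone \<in> coch p l"
  "b \<in> coch p l \<Longrightarrow> c \<in> coch p l \<Longrightarrow> cmult b c \<in> coch p l"
  "c \<in> coch p l \<Longrightarrow> cinv c \<in> coch p l"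
proof -
  have g: "group (grp D f)" if "s \<in> X p l f" for s f
    using grp_D[OF X_Arr[OF that]] by (simp add: comm_group_def)
  show "cone \<in> coch p l"
    by (auto simp: coch_def cone_X[OF gact_X] cone_X act_group_hom group_hom.hom_one[OF act_group_hom]
      group.is_monoid[OF g] monoid.one_closed)
  show "cmult b c \<in> coch p l" if "b \<in> coch p l" "c \<in> coch p l"
    using that by (auto simp: coch_def cmult_X[OF gact_X] cmult_X group_hom.hom_mult[OF act_group_hom]
      group.is_monoid[OF g] monoid.m_closed)
  show "cinv c \<in> coch p l" if "c \<in> coch p l"
    using that by (auto simp: coch_def cinv_X[OF gact_X] cinv_X group_hom.hom_inv[OF act_group_hom]
      group.inv_closed[OF g])
qed

lemma linD_cmult:
  assumes "b \<in> coch p l" "c \<in> coch p l" "\<zeta> \<in> ch p l f" "f \<in> Arr K"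
  shows "linD f (cmult b c) \<zeta> = linD f b \<zeta> \<otimes>\<^bsub>grp D f\<^esub> linD f c \<zeta>"
proof -
  interpret A: comm_group "grp D f" by (rule grp_D[OF assms(4)])
  have k: "b s \<in> carrier (grp D f)" "c s \<in> carrier (grp D f)" "cmult b c s = b s \<otimes>\<^bsub>grp D f\<^esub> c s"
    if "s \<in> Poly_Mapping.keys \<zeta>" for s
    using assms that by (auto simp: chn_def intro: coch_carrier cmult_X)
  have "linD f (cmult b c) \<zeta> = linD f (\<lambda>s. b s \<otimes>\<^bsub>grp D f\<^esub> c s) \<zeta>"
    by (rule A.lin_cong) (use k in auto)
  also have "\<dots> = linD f b \<zeta> \<otimes>\<^bsub>grp D f\<^esub> linD f c \<zeta>"
    by (rule A.lin_mult) (use k in auto)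
  finally show ?thesis .
qed

lemma linD_cinv:
  assumes "c \<in> coch p l" "\<zeta> \<in> ch p l f" "f \<in> Arr K"
  shows "linD f (cinv c) \<zeta> = inv\<^bsub>grp D f\<^esub> linD f c \<zeta>"
proof -
  interpret A: comm_group "grp D f" by (rule grp_D[OF assms(3)])
  have k: "c s \<in> carrier (grp D f)" "cinv c s = inv\<^bsub>grp D f\<^esub> c s"
    if "s \<in> Poly_Mapping.keys \<zeta>" for s
    using assms that by (auto simp: chn_def intro: coch_carrier cinv_X)
  have "linD f (cinv c) \<zeta> = linD f (\<lambda>s. inv\<^bsub>grp D f\<^esub> c s) \<zeta>"
    by (rule A.lin_cong) (use k in auto)
  also have "\<dots> = inv\<^bsub>grp D f\<^esub> linD f c \<zeta>"
    by (rule A.lin_inv) (use k in auto)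
  finally show ?thesis .
qed

lemma linD_cone: "\<zeta> \<in> ch p l f \<Longrightarrow> f \<in> Arr K \<Longrightarrow> linD f cone \<zeta> = \<one>\<^bsub>grp D f\<^esub>"
  by (rule comm_group.lin_one[OF grp_D]) (auto simp: chn_def intro: cone_X)

section \<open>Cocycles for the row boundary and for the simplicial boundary\<close>

definition rcyc where
  "rcyc p l c \<longleftrightarrow> c \<in> coch p l \<and> (\<forall>f\<in>Arr K. \<forall>\<zeta>\<in>ch (Suc p) l f. linD f c (rowd \<zeta>) = \<one>\<^bsub>grp D f\<^esub>)"

definition vcyc where
  "vcyc p l c \<longleftrightarrow> c \<in> coch p l \<and> (\<forall>f\<in>Arr K. \<forall>\<zeta>\<in>ch p (Suc l) f. linD f c (vd l \<zeta>) = \<one>\<^bsub>grp D f\<^esub>)"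

lemma rcycD: "rcyc p l c \<Longrightarrow> \<zeta> \<in> ch (Suc p) l f \<Longrightarrow> f \<in> Arr K \<Longrightarrow> linD f c (rowd \<zeta>) = \<one>\<^bsub>grp D f\<^esub>"
  and rcyc_coch: "rcyc p l c \<Longrightarrow> c \<in> coch p l"
  and vcycD: "vcyc p l c \<Longrightarrow> \<zeta> \<in> ch p (Suc l) f \<Longrightarrow> f \<in> Arr K \<Longrightarrow> linD f c (vd l \<zeta>) = \<one>\<^bsub>grp D f\<^esub>"
  by (auto simp: rcyc_def vcyc_def)

lemma isop_TT': "isop (Suc n) 0 1 (Suc n) (TT n)"
  using isop_TT[of 1 n 0] by simp

lemma isop_WW': "isop 1 (Suc n) (Suc n) 0 (WW n)"
  using isop_WW[of 0 n] by simp

text \<open>By \<open>vd_TT_0\<close>, the chain \<open>TT n (rowd \<zeta>)\<close> is up to sign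
  the difference of a row boundary and a simplicial boundary, and x kills both.\<close>

lemma TT_cocycle:
  assumes "rcyc 1 (Suc n) x" "vcyc 1 (Suc n) x"
  shows "rcyc (Suc n) 0 (pb (TT n) x)"
  unfolding rcyc_def
proof (intro conjI ballI)
  have x: "x \<in> coch 1 (Suc n)" using assms(1) by (rule rcyc_coch)
  show "pb (TT n) x \<in> coch (Suc n) 0" by (rule pb_coch[OF isop_TT' x])
  fix f \<zeta> assume f: "f \<in> Arr K" and z: "\<zeta> \<in> ch (Suc (Suc n)) 0 f"
  interpret A: comm_group "grp D f" by (rule grp_D[OF f])
  have t: "TT n \<zeta> \<in> ch 2 (Suc n) f" "TT (Suc n) \<zeta> \<in> ch 1 (Suc (Suc n)) f"
    using isop_ch[OF isop_TT[of 2 n 0], of \<zeta> f] isop_ch[OF isop_TT[of 1 "Suc n" 0], of \<zeta> f] z by simp_all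
  have tr: "TT n (rowd \<zeta>) \<in> ch 1 (Suc n) f"
    using isop_ch[OF isop_TT'] rowd_ch[OF z] by blast
  have r: "rowd (TT n \<zeta>) \<in> ch 1 (Suc n) f" "vd (Suc n) (TT (Suc n) \<zeta>) \<in> ch 1 (Suc n) f"
    using rowd_ch[of "TT n \<zeta>" 1] t vd_ch by (simp_all add: numeral_2_eq_2)
  have "frag_cmul ((-1) ^ n) (TT n (rowd \<zeta>)) = rowd (TT n \<zeta>) - vd (Suc n) (TT (Suc n) \<zeta>)"
    using vd_TT_0[of \<zeta> 1 n f] z by simp
  then have "linD f x (frag_cmul ((-1) ^ n) (TT n (rowd \<zeta>))) = \<one>\<^bsub>grp D f\<^esub>"
    using linD_diff[OF x r f] rcycD[OF assms(1) _ f, of "TT n \<zeta>"] vcycD[OF assms(2) t(2) f] t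
    by (simp add: numeral_2_eq_2)
  then have "linD f x (TT n (rowd \<zeta>)) = \<one>\<^bsub>grp D f\<^esub>"
    by (rule linD_sign_one[OF x tr f])
  then show "linD f (pb (TT n) x) (rowd \<zeta>) = \<one>\<^bsub>grp D f\<^esub>"
    using linD_pb[OF isop_TT' x rowd_ch[OF z] f] by simp
qed

text \<open>When y is evaluated on the formula of \<open>vd_TT_0\<close>, the row boundary dies and
  only \<open>TT n (rowd \<zeta>)\<close> with a sign remains. The witness is therefore the pullback
  of y along \<open>TT n\<close> with this sign.\<close>

lemma TT_coboundary:
  assumes y: "rcyc 1 (Suc n) y"
  shows "\<exists>w\<in>coch (Suc n) 0. \<forall>f\<in>Arr K. \<forall>\<zeta>\<in>ch (Suc (Suc n)) 0 f.
    linD f (pb (TT (Suc n)) (pb (vd (Suc n)) y)) \<zeta> = linD f w (rowd \<zeta>)"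
proof (intro bexI ballI)
  let ?Q = "\<lambda>\<zeta>. frag_cmul ((-1) ^ Suc n) (TT n \<zeta>)"
  have yc: "y \<in> coch 1 (Suc n)" using y by (rule rcyc_coch)
  note Q = isop_cmul[OF isop_TT'[of n], of "(-1) ^ Suc n"]
  show "pb ?Q y \<in> coch (Suc n) 0" by (rule pb_coch[OF Q yc])
  fix f \<zeta> assume f: "f \<in> Arr K" and z: "\<zeta> \<in> ch (Suc (Suc n)) 0 f"
  interpret A: comm_group "grp D f" by (rule grp_D[OF f])
  have t: "TT n \<zeta> \<in> ch 2 (Suc n) f" "TT (Suc n) \<zeta> \<in> ch 1 (Suc (Suc n)) f"
    using isop_ch[OF isop_TT[of 2 n 0], of \<zeta> f] isop_ch[OF isop_TT[of 1 "Suc n" 0], of \<zeta> f] z by simp_all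
  have tr: "?Q (rowd \<zeta>) \<in> ch 1 (Suc n) f"
    using isop_ch[OF Q] rowd_ch[OF z] by blast
  have r: "rowd (TT n \<zeta>) \<in> ch 1 (Suc n) f"
    using rowd_ch[of "TT n \<zeta>" 1] t by (simp_all add: numeral_2_eq_2)
  have "linD f (pb (TT (Suc n)) (pb (vd (Suc n)) y)) \<zeta> = linD f (pb (vd (Suc n)) y) (TT (Suc n) \<zeta>)"
    by (rule linD_pb[OF isop_TT' pb_coch[OF isop_vd yc] z f])
  also have "\<dots> = linD f y (vd (Suc n) (TT (Suc n) \<zeta>))"
    by (rule linD_pb[OF isop_vd yc t(2) f])
  also have "vd (Suc n) (TT (Suc n) \<zeta>) = rowd (TT n \<zeta>) + ?Q (rowd \<zeta>)"
    using vd_TT_0[of \<zeta> 1 n f] z by simp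
  also have "linD f y \<dots> = linD f y (?Q (rowd \<zeta>))"
    using linD_add[OF yc r tr f] rcycD[OF y _ f, of "TT n \<zeta>"] t linD_closed[OF yc tr f]
    by (simp add: numeral_2_eq_2)
  also have "\<dots> = linD f (pb ?Q y) (rowd \<zeta>)"
    by (rule linD_pb[OF Q yc rowd_ch[OF z] f, symmetric])
  finally show "linD f (pb (TT (Suc n)) (pb (vd (Suc n)) y)) \<zeta> = linD f (pb ?Q y) (rowd \<zeta>)" .
qed

text \<open>\<open>rowh (rowd _)\<close> is the identity minus \<open>rowd (rowh _)\<close>. Here
  the identity term is a simplicial boundary and dies by \<open>WW_vd\<close>; the other term has
  one more row degree and one level less, and the induction hypothesis covers it.\<close>

lemma WW_rowd:
  "rcyc (Suc p + n) 0 y \<Longrightarrow> \<zeta> \<in> ch (Suc (Suc p)) (Suc n) f \<Longrightarrow> f \<in> Arr K \<Longrightarrow>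
    linD f y (WW n (rowd \<zeta>)) = \<one>\<^bsub>grp D f\<^esub>"
proof (induction n arbitrary: p \<zeta>)
  case 0
  then show ?case using rcycD[OF 0(1), of "vd 0 \<zeta>" f] vd_ch[of \<zeta> "Suc (Suc p)" 0 f]
    by (simp add: rowd_vd[symmetric])
next
  case (Suc n)
  interpret A: comm_group "grp D f" by (rule grp_D[OF Suc.prems(3)])
  let ?z = "vd (Suc n) \<zeta>"
  have z: "?z \<in> ch (Suc (Suc p)) (Suc n) f" by (rule vd_ch[OF Suc.prems(2)])
  have h: "rowh ?z \<in> ch (Suc (Suc (Suc p))) (Suc n) f" by (rule rowh_ch[OF z])
  have y: "y \<in> coch (Suc (Suc p) + n) 0" using rcyc_coch[OF Suc.prems(1)] by simp
  have "WW (Suc n) (rowd \<zeta>) = WW n (rowh (rowd ?z))"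
    using rowd_vd[OF Suc.prems(2)] by simp
  also have "rowh (rowd ?z) = ?z - rowd (rowh ?z)"
    using rowd_rowh[OF z] by (simp add: algebra_simps)
  also have "WW n (?z - rowd (rowh ?z)) = WW n ?z - WW n (rowd (rowh ?z))"
    by (rule isop_diff[OF isop_WW])
  also have "WW n ?z = 0" by (rule WW_vd[OF Suc.prems(2)])
  finally have eq: "WW (Suc n) (rowd \<zeta>) = 0 - WW n (rowd (rowh ?z))" .
  have c: "WW n (rowd (rowh ?z)) \<in> ch (Suc (Suc p) + n) 0 f"
    by (rule isop_ch[OF isop_WW rowd_ch[OF h]])
  have "linD f y (WW n (rowd (rowh ?z))) = \<one>\<^bsub>grp D f\<^esub>"
    by (rule Suc.IH[OF _ h Suc.prems(3)]) (use Suc.prems(1) in simp)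
  then show ?case
    unfolding eq using linD_diff[OF y _ c Suc.prems(3), of 0] by (simp add: linD_zero[OF Suc.prems(3)])
qed

text \<open>\<open>WW\<close> undoes \<open>TT\<close> up to a coboundary. Passing from k to k + 1,
  the contraction produces the previous stage, a term killed by \<open>WW_rowd\<close>, and the term
  \<open>?Q (rowd \<zeta>)\<close>, which is absorbed into w.\<close>

lemma WW_TT:
  assumes y: "rcyc (Suc n) 0 y"
  shows "k \<le> n \<Longrightarrow> \<exists>w\<in>coch n 0. \<forall>f\<in>Arr K. \<forall>\<zeta>\<in>ch (Suc n) 0 f.
    linD f y (WW k (TT k \<zeta>)) = linD f y \<zeta> \<otimes>\<^bsub>grp D f\<^esub> linD f w (rowd \<zeta>)"
proof (induction k)
  case 0
  show ?case
  proof (intro bexI[of _ cone] ballI)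
    fix f \<zeta> assume f: "f \<in> Arr K" and z: "\<zeta> \<in> ch (Suc n) 0 f"
    interpret A: comm_group "grp D f" by (rule grp_D[OF f])
    show "linD f y (WW 0 (TT 0 \<zeta>)) = linD f y \<zeta> \<otimes>\<^bsub>grp D f\<^esub> linD f cone (rowd \<zeta>)"
      using vd_sd_0[OF z] linD_cone[OF rowd_ch[OF z] f] linD_closed[OF rcyc_coch[OF y] z f] by simp
  qed (rule coch_ops)
next
  case (Suc k)
  then obtain q where n: "n = Suc k + q" using le_Suc_ex by blast
  have yc: "y \<in> coch (Suc n) 0" using y by (rule rcyc_coch)
  obtain w where w: "w \<in> coch n 0" and wI: "\<And>f \<zeta>. f \<in> Arr K \<Longrightarrow> \<zeta> \<in> ch (Suc n) 0 f \<Longrightarrow>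
      linD f y (WW k (TT k \<zeta>)) = linD f y \<zeta> \<otimes>\<^bsub>grp D f\<^esub> linD f w (rowd \<zeta>)"
    using Suc by auto
  let ?Q = "\<lambda>\<zeta>. frag_cmul ((-1) ^ Suc k) (WW k (rowh (TT k \<zeta>)))"
  have Tn: "isop n 0 (Suc q) (Suc k) (TT k)" using isop_TT[of "Suc q" k 0] by (simp add: n add.commute)
  have TS: "isop (Suc n) 0 (Suc (Suc q)) (Suc k) (TT k)"
    using isop_TT[of "Suc (Suc q)" k 0] by (simp add: n add.commute)
  have Wn: "isop (Suc (Suc q)) (Suc k) (Suc n) 0 (WW k)" using isop_WW[of "Suc q" k] by (simp add: n add.commute)
  have Q: "isop n 0 (Suc n) 0 ?Q"
    by (rule isop_cmul[OF isop_comp[OF isop_comp[OF Tn isop_rowh] Wn]])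
  show ?case
  proof (intro bexI ballI)
    show "cmult w (pb ?Q y) \<in> coch n 0" by (rule coch_ops(2)[OF w pb_coch[OF Q yc]])
    fix f \<zeta> assume f: "f \<in> Arr K" and z: "\<zeta> \<in> ch (Suc n) 0 f"
    interpret A: comm_group "grp D f" by (rule grp_D[OF f])
    have t: "TT k \<zeta> \<in> ch (Suc (Suc q)) (Suc k) f" by (rule isop_ch[OF TS z])
    have h: "rowh (TT k \<zeta>) \<in> ch (Suc (Suc (Suc q))) (Suc k) f" by (rule rowh_ch[OF t])
    have a: "WW k (TT k \<zeta>) \<in> ch (Suc n) 0 f" by (rule isop_ch[OF Wn t])
    have b: "WW k (rowd (rowh (TT k \<zeta>))) \<in> ch (Suc n) 0 f" by (rule isop_ch[OF Wn rowd_ch[OF h]])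
    have c: "?Q (rowd \<zeta>) \<in> ch (Suc n) 0 f" by (rule isop_ch[OF Q rowd_ch[OF z]])
    have "vd (Suc k) (TT (Suc k) \<zeta>) = rowd (TT k \<zeta>) - frag_cmul ((-1) ^ k) (TT k (rowd \<zeta>))"
      by (rule vd_TT_0[of \<zeta> "Suc q"]) (use z in \<open>simp add: n add.commute\<close>)
    moreover have "rowh (rowd (TT k \<zeta>)) = TT k \<zeta> - rowd (rowh (TT k \<zeta>))"
      using rowd_rowh[OF t] by (simp add: algebra_simps)
    ultimately have "rowh (vd (Suc k) (TT (Suc k) \<zeta>))
        = TT k \<zeta> - rowd (rowh (TT k \<zeta>)) - frag_cmul ((-1) ^ k) (rowh (TT k (rowd \<zeta>)))"
      by (simp only: rowh_simps)
    then have "WW (Suc k) (TT (Suc k) \<zeta>)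
        = WW k (TT k \<zeta> - rowd (rowh (TT k \<zeta>)) - frag_cmul ((-1) ^ k) (rowh (TT k (rowd \<zeta>))))"
      by (simp only: WW.simps)
    also have "\<dots> = WW k (TT k \<zeta>) - WW k (rowd (rowh (TT k \<zeta>))) - WW k (frag_cmul ((-1) ^ k) (rowh (TT k (rowd \<zeta>))))"
      by (simp only: isop_diff[OF Wn])
    also have "WW k (frag_cmul ((-1) ^ k) v) = frag_cmul ((-1) ^ k) (WW k v)" for v
      using isop_diff[OF Wn, of 0 v] isop_zero[OF Wn] by (auto simp: minus_one_power_iff)
    finally have e: "WW (Suc k) (TT (Suc k) \<zeta>) = (WW k (TT k \<zeta>) - WW k (rowd (rowh (TT k \<zeta>)))) + ?Q (rowd \<zeta>)"
      by simp
    have "linD f y (WW k (rowd (rowh (TT k \<zeta>)))) = \<one>\<^bsub>grp D f\<^esub>"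
      by (rule WW_rowd[of "Suc q" k]) (use y h f in \<open>simp_all add: n add.commute\<close>)
    then have "linD f y (WW (Suc k) (TT (Suc k) \<zeta>)) = linD f y (WW k (TT k \<zeta>)) \<otimes>\<^bsub>grp D f\<^esub> linD f y (?Q (rowd \<zeta>))"
      unfolding e using linD_add[OF yc chn_diff[OF a b] c f] linD_diff[OF yc a b f] linD_closed[OF yc a f] by simp
    also have "linD f y (?Q (rowd \<zeta>)) = linD f (pb ?Q y) (rowd \<zeta>)"
      by (rule linD_pb[OF Q yc rowd_ch[OF z] f, symmetric])
    finally show "linD f y (WW (Suc k) (TT (Suc k) \<zeta>))
        = linD f y \<zeta> \<otimes>\<^bsub>grp D f\<^esub> linD f (cmult w (pb ?Q y)) (rowd \<zeta>)"
      using wI[OF f z] linD_cmult[OF w pb_coch[OF Q yc] rowd_ch[OF z] f] linD_closed[OF yc z f]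
        linD_closed[OF w rowd_ch[OF z] f] linD_closed[OF pb_coch[OF Q yc] rowd_ch[OF z] f]
      by (simp add: A.m_assoc)
  qed
qed

text \<open>The preimage is the pullback of y along \<open>WW n\<close>; it is a row cocycle by
  \<open>WW_rowd\<close> and a simplicial cocycle by \<open>WW_vd\<close>.\<close>

lemma TT_surj:
  assumes y: "rcyc (Suc n) 0 y"
  obtains x w where "rcyc 1 (Suc n) x" "vcyc 1 (Suc n) x" "w \<in> coch n 0"
    "\<And>f \<zeta>. f \<in> Arr K \<Longrightarrow> \<zeta> \<in> ch (Suc n) 0 f \<Longrightarrow>
      linD f (pb (TT n) x) \<zeta> = linD f y \<zeta> \<otimes>\<^bsub>grp D f\<^esub> linD f w (rowd \<zeta>)"
proof -
  have yc: "y \<in> coch (Suc n) 0" using y by (rule rcyc_coch)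
  let ?x = "pb (WW n) y"
  have x: "?x \<in> coch 1 (Suc n)" by (rule pb_coch[OF isop_WW' yc])
  have "rcyc 1 (Suc n) ?x"
    unfolding rcyc_def
  proof (intro conjI ballI x)
    fix f \<zeta> assume f: "f \<in> Arr K" and z: "\<zeta> \<in> ch (Suc 1) (Suc n) f"
    show "linD f ?x (rowd \<zeta>) = \<one>\<^bsub>grp D f\<^esub>"
      using linD_pb[OF isop_WW' yc rowd_ch[OF z] f] WW_rowd[of 0 n y \<zeta> f] y z f by simp
  qed
  moreover have "vcyc 1 (Suc n) ?x"
    unfolding vcyc_def
  proof (intro conjI ballI x)
    fix f \<zeta> assume f: "f \<in> Arr K" and z: "\<zeta> \<in> ch 1 (Suc (Suc n)) f"
    show "linD f ?x (vd (Suc n) \<zeta>) = \<one>\<^bsub>grp D f\<^esub>"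
      using linD_pb[OF isop_WW' yc vd_ch[OF z] f] WW_vd[of \<zeta> 0 n f] z linD_zero[OF f] by simp
  qed
  moreover obtain w where w: "w \<in> coch n 0" and wI: "\<And>f \<zeta>. f \<in> Arr K \<Longrightarrow> \<zeta> \<in> ch (Suc n) 0 f \<Longrightarrow>
      linD f y (WW n (TT n \<zeta>)) = linD f y \<zeta> \<otimes>\<^bsub>grp D f\<^esub> linD f w (rowd \<zeta>)"
    using WW_TT[OF y, of n] by auto
  moreover have "linD f (pb (TT n) ?x) \<zeta> = linD f y \<zeta> \<otimes>\<^bsub>grp D f\<^esub> linD f w (rowd \<zeta>)"
    if f: "f \<in> Arr K" and z: "\<zeta> \<in> ch (Suc n) 0 f" for f \<zeta>
    using linD_pb[OF isop_TT' x z f] linD_pb[OF isop_WW' yc isop_ch[OF isop_TT' z] f] wI[OF f z] by simp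
  ultimately show thesis using that by blast
qed

section \<open>Cocycles whose image under the zigzag is a coboundary\<close>

lemma TT_vd_eq:
  assumes x: "rcyc 1 (Suc n) x" "vcyc 1 (Suc n) x" and n: "n = Suc (j + k)"
    and z: "\<zeta> \<in> ch (Suc (Suc j)) (Suc k) f" and f: "f \<in> Arr K"
  shows "linD f x (TT (Suc j) (vd k \<zeta>)) = linD f x (TT j (rowd \<zeta>))"
proof -
  interpret A: comm_group "grp D f" by (rule grp_D[OF f])
  have xc: "x \<in> coch 1 (Suc n)" using x(1) by (rule rcyc_coch)
  have t1: "TT (Suc j) (vd k \<zeta>) \<in> ch 1 (Suc n) f"
    using isop_ch[OF isop_TT[of 1 "Suc j" k], of "vd k \<zeta>" f] vd_ch[OF z] by (simp add: n add.commute)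
  have t2: "TT j (rowd \<zeta>) \<in> ch 1 (Suc n) f"
    using isop_ch[OF isop_TT[of 1 j "Suc k"], of "rowd \<zeta>" f] rowd_ch[OF z] by (simp add: n add.commute)
  have t3: "TT j \<zeta> \<in> ch (Suc 1) (Suc n) f"
    using isop_ch[OF isop_TT[of "Suc 1" j "Suc k"], of \<zeta> f] z by (simp add: n add.commute)
  have t4: "TT (Suc j) \<zeta> \<in> ch 1 (Suc (Suc n)) f"
    using isop_ch[OF isop_TT[of 1 "Suc j" "Suc k"], of \<zeta> f] z by (simp add: n add.commute)
  let ?u = "vd (Suc n) (TT (Suc j) \<zeta>)" and ?r = "rowd (TT j \<zeta>)"
  have "?u = ?r - frag_cmul ((-1) ^ j) (TT j (rowd \<zeta>)) + frag_cmul ((-1) ^ j) (TT (Suc j) (vd k \<zeta>))"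
    using vd_TT_Suc[of \<zeta> 1 j k f] z by (simp add: n add.commute)
  then have "frag_cmul ((-1) ^ j) (TT (Suc j) (vd k \<zeta>)) - frag_cmul ((-1) ^ j) (TT j (rowd \<zeta>)) = ?u - ?r"
    by (simp add: algebra_simps)
  then have "frag_cmul ((-1) ^ j) (TT (Suc j) (vd k \<zeta>) - TT j (rowd \<zeta>)) = ?u - ?r"
    by (simp add: frag_cmul_diff)
  moreover have "linD f x (?u - ?r) = \<one>\<^bsub>grp D f\<^esub>"
    using linD_diff[OF xc vd_ch[OF t4] rowd_ch[OF t3] f] rcycD[OF x(1) t3 f] vcycD[OF x(2) t4 f] by simp
  ultimately have "linD f x (frag_cmul ((-1) ^ j) (TT (Suc j) (vd k \<zeta>) - TT j (rowd \<zeta>))) = \<one>\<^bsub>grp D f\<^esub>"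
    by (simp only:)
  then have "linD f x (TT (Suc j) (vd k \<zeta>) - TT j (rowd \<zeta>)) = \<one>\<^bsub>grp D f\<^esub>"
    by (rule linD_sign_one[OF xc chn_diff[OF t1 t2] f])
  then show ?thesis
    using linD_diff[OF xc t1 t2 f] linD_closed[OF xc t1 f] linD_closed[OF xc t2 f]
      A.inv_solve_right[OF A.one_closed, of "linD f x (TT (Suc j) (vd k \<zeta>))" "linD f x (TT j (rowd \<zeta>))"] by (simp del: TT.simps)
qed

text \<open>Carries w along the staircase, from row degree n at level 0 to row degree 1 at
  \<open>lv K (n - 1)\<close>. In each step the old u makes \<open>g\<close> vanish on the row
  boundary \<open>rowd (rowh ?e)\<close>; by the contraction, the value of \<open>g\<close> at
  \<open>?e\<close> is then that of its pullback along \<open>rowh\<close> at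
  \<open>rowd ?e\<close>, and this pullback is the new u.\<close>

lemma TT_inj_chase:
  assumes x: "rcyc 1 (Suc n) x" "vcyc 1 (Suc n) x" and w: "w \<in> coch n 0"
    and wI: "\<And>f \<zeta>. f \<in> Arr K \<Longrightarrow> \<zeta> \<in> ch (Suc n) 0 f \<Longrightarrow> linD f x (TT n \<zeta>) = linD f w (rowd \<zeta>)"
  shows "n = Suc (j + k) \<Longrightarrow> \<exists>u\<in>coch (Suc j) k. \<forall>f\<in>Arr K. \<forall>\<zeta>\<in>ch (Suc (Suc j)) (Suc k) f.
    linD f x (TT j (rowd \<zeta>)) = linD f u (vd k (rowd \<zeta>))"
proof (induction k arbitrary: j)
  case 0
  show ?case
  proof (intro bexI ballI)
    show "w \<in> coch (Suc j) 0" using w 0 by simp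
    fix f \<zeta> assume f: "f \<in> Arr K" and z: "\<zeta> \<in> ch (Suc (Suc j)) (Suc 0) f"
    show "linD f x (TT j (rowd \<zeta>)) = linD f w (vd 0 (rowd \<zeta>))"
      using TT_vd_eq[OF x 0 z f] wI[of f "vd 0 \<zeta>"] vd_ch[OF z] f rowd_vd[OF z] 0 by simp
  qed
next
  case (Suc k)
  then have "n = Suc (Suc j + k)" by simp
  from Suc.IH[OF this] obtain u where u: "u \<in> coch (Suc (Suc j)) k"
    and uI: "\<And>f \<zeta>. f \<in> Arr K \<Longrightarrow> \<zeta> \<in> ch (Suc (Suc (Suc j))) (Suc k) f \<Longrightarrow>
      linD f x (TT (Suc j) (rowd \<zeta>)) = linD f u (vd k (rowd \<zeta>))" by blast
  have xc: "x \<in> coch 1 (Suc n)" using x(1) by (rule rcyc_coch)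
  have T: "isop (Suc (Suc j)) (Suc k) 1 (Suc n) (TT (Suc j))"
    using isop_TT[of 1 "Suc j" "Suc k"] by (simp add: Suc.prems add.commute)
  define g where "g = cmult (pb (TT (Suc j)) x) (cinv (pb (vd k) u))"
  have a: "pb (TT (Suc j)) x \<in> coch (Suc (Suc j)) (Suc k)" "cinv (pb (vd k) u) \<in> coch (Suc (Suc j)) (Suc k)"
    by (rule pb_coch[OF T xc] coch_ops(3)[OF pb_coch[OF isop_vd u]])+
  have g: "g \<in> coch (Suc (Suc j)) (Suc k)" unfolding g_def by (rule coch_ops(2)[OF a])
  have g_eq: "linD f g \<zeta> = linD f x (TT (Suc j) \<zeta>) \<otimes>\<^bsub>grp D f\<^esub> inv\<^bsub>grp D f\<^esub> linD f u (vd k \<zeta>)"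
    if f: "f \<in> Arr K" and z: "\<zeta> \<in> ch (Suc (Suc j)) (Suc k) f" for f \<zeta>
    unfolding g_def linD_cmult[OF a z f] linD_cinv[OF pb_coch[OF isop_vd u] z f]
    using linD_pb[OF T xc z f] linD_pb[OF isop_vd u z f] by simp
  show ?case
  proof (intro bexI ballI)
    show "pb rowh g \<in> coch (Suc j) (Suc k)" by (rule pb_coch[OF isop_rowh g])
    fix f \<zeta> assume f: "f \<in> Arr K" and z: "\<zeta> \<in> ch (Suc (Suc j)) (Suc (Suc k)) f"
    interpret A: comm_group "grp D f" by (rule grp_D[OF f])
    let ?e = "vd (Suc k) \<zeta>"
    have e: "?e \<in> ch (Suc (Suc j)) (Suc k) f" by (rule vd_ch[OF z])
    have h: "rowh ?e \<in> ch (Suc (Suc (Suc j))) (Suc k) f" by (rule rowh_ch[OF e])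
    have tc: "linD f x (TT (Suc j) ?e) \<in> carrier (grp D f)" "linD f x (TT (Suc j) (rowd (rowh ?e))) \<in> carrier (grp D f)"
      using linD_closed[OF xc isop_ch[OF T e] f] linD_closed[OF xc isop_ch[OF T rowd_ch[OF h]] f] by auto
    have z0: "linD f g (rowd (rowh ?e)) = \<one>\<^bsub>grp D f\<^esub>"
      unfolding g_eq[OF f rowd_ch[OF h]] using uI[OF f h] tc by simp
    have "linD f (pb rowh g) (vd (Suc k) (rowd \<zeta>)) = linD f g (rowh (rowd ?e))"
      using linD_pb[OF isop_rowh g rowd_ch[OF e] f] rowd_vd[OF z] by simp
    also have "rowh (rowd ?e) = ?e - rowd (rowh ?e)"
      using rowd_rowh[OF e] by (simp add: algebra_simps)
    also have "linD f g \<dots> = linD f g ?e"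
      using linD_diff[OF g e rowd_ch[OF h] f] z0 linD_closed[OF g e f] by simp
    also have "\<dots> = linD f x (TT (Suc j) ?e)"
      unfolding g_eq[OF f e] using vd_vd[OF z] linD_zero[OF f] tc by simp
    also have "\<dots> = linD f x (TT j (rowd \<zeta>))"
      by (rule TT_vd_eq[OF x Suc.prems z f])
    finally show "linD f x (TT j (rowd \<zeta>)) = linD f (pb rowh g) (vd (Suc k) (rowd \<zeta>))" by simp
  qed
qed

lemma TT_inj:
  assumes x: "rcyc 1 (Suc (Suc m)) x" "vcyc 1 (Suc (Suc m)) x" and w: "w \<in> coch (Suc m) 0"
    and wI: "\<And>f \<zeta>. f \<in> Arr K \<Longrightarrow> \<zeta> \<in> ch (Suc (Suc m)) 0 f \<Longrightarrow> linD f (pb (TT (Suc m)) x) \<zeta> = linD f w (rowd \<zeta>)"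
  obtains v where "rcyc 1 (Suc m) v"
    "\<And>f \<zeta>. f \<in> Arr K \<Longrightarrow> \<zeta> \<in> ch 1 (Suc (Suc m)) f \<Longrightarrow> linD f x \<zeta> = linD f v (vd (Suc m) \<zeta>)"
proof -
  have xc: "x \<in> coch 1 (Suc (Suc m))" using x(1) by (rule rcyc_coch)
  have wI': "linD f x (TT (Suc m) \<zeta>) = linD f w (rowd \<zeta>)" if "f \<in> Arr K" "\<zeta> \<in> ch (Suc (Suc m)) 0 f" for f \<zeta>
    using wI[OF that] linD_pb[OF isop_TT' xc that(2,1)] by simp
  have "\<exists>u\<in>coch (Suc 0) m. \<forall>f\<in>Arr K. \<forall>\<zeta>\<in>ch (Suc (Suc 0)) (Suc m) f.
      linD f x (TT 0 (rowd \<zeta>)) = linD f u (vd m (rowd \<zeta>))"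
    by (rule TT_inj_chase[OF x w wI']) simp_all
  then obtain u where u: "u \<in> coch 1 m" and uI: "\<And>f \<zeta>. f \<in> Arr K \<Longrightarrow> \<zeta> \<in> ch 2 (Suc m) f \<Longrightarrow>
      linD f x (sd (rowd \<zeta>)) = linD f u (vd m (rowd \<zeta>))"
    unfolding TT.simps One_nat_def numeral_2_eq_2 by blast
  \<comment> \<open>The pullback of x along \<open>sd\<close> need not be a row cocycle, and u is
    the correction supplied by the chase. The correction disappears on simplicial boundaries, where
    x is recovered because it kills \<open>vd (Suc (Suc m)) (sd \<zeta>)\<close>.\<close>
  define v where "v = cmult (pb sd x) (cinv (pb (vd m) u))"
  have a: "pb sd x \<in> coch 1 (Suc m)" "cinv (pb (vd m) u) \<in> coch 1 (Suc m)"
    by (rule pb_coch[OF isop_sd xc] coch_ops(3)[OF pb_coch[OF isop_vd u]])+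
  have v: "v \<in> coch 1 (Suc m)" unfolding v_def by (rule coch_ops(2)[OF a])
  have v_eq: "linD f v \<zeta> = linD f x (sd \<zeta>) \<otimes>\<^bsub>grp D f\<^esub> inv\<^bsub>grp D f\<^esub> linD f u (vd m \<zeta>)"
    if f: "f \<in> Arr K" and z: "\<zeta> \<in> ch 1 (Suc m) f" for f \<zeta>
    unfolding v_def linD_cmult[OF a z f] linD_cinv[OF pb_coch[OF isop_vd u] z f]
    using linD_pb[OF isop_sd xc z f] linD_pb[OF isop_vd u z f] by simp
  have "rcyc 1 (Suc m) v"
    unfolding rcyc_def
  proof (intro conjI ballI v)
    fix f \<zeta> assume f: "f \<in> Arr K" and z: "\<zeta> \<in> ch (Suc 1) (Suc m) f"
    interpret A: comm_group "grp D f" by (rule grp_D[OF f])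
    show "linD f v (rowd \<zeta>) = \<one>\<^bsub>grp D f\<^esub>"
      unfolding v_eq[OF f rowd_ch[OF z]]
      using uI[OF f, of \<zeta>] z linD_closed[OF u vd_ch[OF rowd_ch[OF z]] f] by (simp add: numeral_2_eq_2)
  qed
  moreover have "linD f x \<zeta> = linD f v (vd (Suc m) \<zeta>)"
    if f: "f \<in> Arr K" and z: "\<zeta> \<in> ch 1 (Suc (Suc m)) f" for f \<zeta>
  proof -
    interpret A: comm_group "grp D f" by (rule grp_D[OF f])
    have "linD f x (vd (Suc (Suc m)) (sd \<zeta>)) = \<one>\<^bsub>grp D f\<^esub>" by (rule vcycD[OF x(2) sd_ch[OF z] f])
    moreover have e: "sd (vd (Suc m) \<zeta>) = \<zeta> - vd (Suc (Suc m)) (sd \<zeta>)"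
      using vd_sd[OF z] by simp
    ultimately have "linD f x (sd (vd (Suc m) \<zeta>)) = linD f x \<zeta>"
      unfolding e using linD_diff[OF xc z vd_ch[OF sd_ch[OF z]] f] linD_closed[OF xc z f] by simp
    then show ?thesis
      unfolding v_eq[OF f vd_ch[OF z]] using vd_vd[OF z] linD_zero[OF f] linD_closed[OF xc z f] by simp
  qed
  ultimately show thesis using that by blast
qed

end

section \<open>Normalization\<close>

context nat_sys
begin

definition sdg where "sdg l j = pmap (mapg (dg K l j))"

lemma sdg_ch: "j \<le> l \<Longrightarrow> \<zeta> \<in> ch p (Suc l) f \<Longrightarrow> sdg l j \<zeta> \<in> ch p (Suc (Suc l)) f"
  unfolding sdg_def by (erule chn_pmap) (rule mapg_X[OF lifts_dg])

lemma isop_sdg: "j \<le> l \<Longrightarrow> isop p (Suc l) p (Suc (Suc l)) (sdg l j)"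
  unfolding sdg_def by (rule isop_mapg[OF lifts_dg])

lemma rowd_sdg: "j \<le> l \<Longrightarrow> \<zeta> \<in> ch p (Suc l) f \<Longrightarrow> rowd (sdg l j \<zeta>) = sdg l j (rowd \<zeta>)"
proof -
  assume j: "j \<le> l" and z: "\<zeta> \<in> ch p (Suc l) f"
  show ?thesis
    unfolding sdg_def using lifts_dg[OF j] _ z by (rule rowd_mapg) (rule dg_wcmp[OF j])
qed

text \<open>The chains killed by v. Since they form a subgroup, the normalization can be computed on
  chains modulo this subgroup.\<close>

definition Zt where "Zt v p l f = {\<zeta> \<in> ch p l f. linD f v \<zeta> = \<one>\<^bsub>grp D f\<^esub>}"

lemma Zt_simps:
  assumes "v \<in> coch p l" "f \<in> Arr K"
  shows "0 \<in> Zt v p l f" "a \<in> Zt v p l f \<Longrightarrow> b \<in> Zt v p l f \<Longrightarrow> a + b \<in> Zt v p l f"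
    "a \<in> Zt v p l f \<Longrightarrow> b \<in> Zt v p l f \<Longrightarrow> a - b \<in> Zt v p l f"
    "a \<in> Zt v p l f \<Longrightarrow> frag_cmul ((-1) ^ n) a \<in> Zt v p l f"
    "(\<And>i. i \<in> I \<Longrightarrow> t i \<in> Zt v p l f) \<Longrightarrow> sum t I \<in> Zt v p l f"
proof -
  interpret A: comm_group "grp D f" by (rule grp_D[OF assms(2)])
  show 0: "0 \<in> Zt v p l f" by (simp add: Zt_def linD_zero[OF assms(2)])
  show p: "a + b \<in> Zt v p l f" if "a \<in> Zt v p l f" "b \<in> Zt v p l f" for a b
    using that linD_add[OF assms(1) _ _ assms(2)] by (auto simp: Zt_def)
  show "a - b \<in> Zt v p l f" if "a \<in> Zt v p l f" "b \<in> Zt v p l f" for a b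
    using that linD_diff[OF assms(1) _ _ assms(2)] by (auto simp: Zt_def)
  show "frag_cmul ((-1) ^ n) a \<in> Zt v p l f" if "a \<in> Zt v p l f" for a
    using that linD_sign[OF assms(1) _ assms(2)] by (auto simp: Zt_def)
  show "sum t I \<in> Zt v p l f" if "\<And>i. i \<in> I \<Longrightarrow> t i \<in> Zt v p l f" for t :: "'x \<Rightarrow> _" and I
    using that by (induction I rule: infinite_finite_induct) (auto simp: 0 intro: p)
qed

abbreviation fct where "fct l i \<equiv> pmap (mapg (fc K l i))"

lemma fct_ch: "i \<le> l \<Longrightarrow> \<zeta> \<in> ch p (Suc l) f \<Longrightarrow> fct l i \<zeta> \<in> ch p l f"
  by (erule chn_pmap) (rule mapg_X[OF lifts_fc])

lemma fct_sdg:
  assumes "\<zeta> \<in> ch p (Suc (Suc l)) f" "j \<le> Suc l"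
  shows "i < j \<Longrightarrow> fct (Suc (Suc l)) i (sdg (Suc l) j \<zeta>) = sdg l (j - 1) (fct (Suc l) i \<zeta>)"
    and "Suc j < i \<Longrightarrow> i \<le> Suc (Suc l) \<Longrightarrow> fct (Suc (Suc l)) i (sdg (Suc l) j \<zeta>) = sdg l j (fct (Suc l) (i - 1) \<zeta>)"
  unfolding sdg_def pmap_pmap mapg_mapg
  by (rule pmap_cong[OF assms(1)], rule mapg_cong, use assms(2) in \<open>auto simp: fc_dg_less fc_dg_greater\<close>)+

lemma fct_sdg_same:
  assumes "\<zeta> \<in> ch p (Suc l) f" "j \<le> l" "i = j \<or> i = Suc j"
  shows "fct (Suc l) i (sdg l j \<zeta>) = \<zeta>"
proof -
  have "pmap (\<lambda>s. mapg (fc K (Suc l) i) (mapg (dg K l j) s)) \<zeta> = pmap (\<lambda>s. s) \<zeta>"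
  proof (rule pmap_cong[OF assms(1)])
    fix s assume "s \<in> X p (Suc l) f"
    then show "mapg (fc K (Suc l) i) (mapg (dg K l j) s) = s"
      using mapg_cong[of "Suc l" "\<lambda>x. fc K (Suc l) i (dg K l j x)" "\<lambda>x. x" s p f] assms fc_dg_same[of j l] fc_dg_Suc[of j l]
      by (auto simp add: mapg_mapg simp del: lv_simps) (simp_all add: mapg_def split: prod.splits)
  qed
  then show ?thesis by (simp add: sdg_def pmap_pmap pmap_id)
qed

lemma sdg_sdg:
  assumes "\<zeta> \<in> ch p (Suc l) f" "i \<le> j" "j \<le> l"
  shows "sdg (Suc l) (Suc j) (sdg l i \<zeta>) = sdg (Suc l) i (sdg l j \<zeta>)"
  unfolding sdg_def pmap_pmap mapg_mapg
  by (rule pmap_cong[OF assms(1)], rule mapg_cong) (use assms in \<open>auto simp: dg_dg\<close>)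

lemma sdg_linear: "sdg l j (sum t I) = (\<Sum>i\<in>I. sdg l j (t i))" "sdg l j (frag_cmul c a) = frag_cmul c (sdg l j a)"
  by (simp_all add: sdg_def pmap_sum)

context
  fixes v p l k
  assumes v: "v \<in> coch p (Suc (Suc l))" and k: "k \<le> l"
    and A: "\<And>j f \<zeta>. j < k \<Longrightarrow> f \<in> Arr K \<Longrightarrow> \<zeta> \<in> ch p (Suc l) f \<Longrightarrow> linD f v (sdg l j \<zeta>) = \<one>\<^bsub>grp D f\<^esub>"
    and B: "\<And>f \<zeta>. f \<in> Arr K \<Longrightarrow> \<zeta> \<in> ch p (Suc (Suc l)) f \<Longrightarrow>
      linD f v (vd (Suc (Suc l)) (sdg (Suc l) k \<zeta>)) = \<one>\<^bsub>grp D f\<^esub>"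
begin

lemma A_Zt: "j < k \<Longrightarrow> f \<in> Arr K \<Longrightarrow> \<zeta> \<in> ch p (Suc l) f \<Longrightarrow> sdg l j \<zeta> \<in> Zt v p (Suc (Suc l)) f"
  using A k sdg_ch[of j l] by (simp add: Zt_def)

text \<open>Expand the boundary of s_k \<zeta>, which v kills by \<open>B\<close>. Faces below k
  lead into images of lower degeneracies, killed by \<open>A\<close>; the faces k and k + 1 cancel;
  the later ones give, after an index shift, minus the present sum.\<close>

lemma upper_sum_Zt:
  assumes f: "f \<in> Arr K" and z: "\<zeta> \<in> ch p (Suc (Suc l)) f"
  shows "(\<Sum>i\<in>{k<..Suc l}. frag_cmul ((-1) ^ i) (sdg l k (fct (Suc l) i \<zeta>))) \<in> Zt v p (Suc (Suc l)) f"
proof -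
  note Z = Zt_simps[OF v f]
  let ?t = "\<lambda>i. frag_cmul ((-1) ^ i) (fct (Suc (Suc l)) i (sdg (Suc l) k \<zeta>))"
  have s: "sdg (Suc l) k \<zeta> \<in> ch p (Suc (Suc (Suc l))) f" using k by (intro sdg_ch z) simp
  have "{..Suc (Suc l)} = {..<k} \<union> {k, Suc k} \<union> {Suc k<..Suc (Suc l)}" using k by auto
  then have "vd (Suc (Suc l)) (sdg (Suc l) k \<zeta>) = sum ?t ({..<k} \<union> {k, Suc k} \<union> {Suc k<..Suc (Suc l)})"
    unfolding vd_def by simp
  also have "\<dots> = sum ?t {..<k} + sum ?t {k, Suc k} + sum ?t {Suc k<..Suc (Suc l)}"
    by (subst sum.union_disjoint, simp, simp, force)+ simp
  also have "sum ?t {k, Suc k} = 0"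
    using fct_sdg_same[OF z, of k] k by (simp flip: frag_cmul_distrib)
  also have "sum ?t {Suc k<..Suc (Suc l)} = - (\<Sum>i\<in>{k<..Suc l}. frag_cmul ((-1) ^ i) (sdg l k (fct (Suc l) i \<zeta>)))"
    unfolding sum_negf[symmetric]
    by (rule sum.reindex_bij_witness[of _ Suc "\<lambda>i. i - 1"])
      (use fct_sdg(2)[OF z, of k] k in \<open>auto simp: power_eq_if\<close>)
  finally have e: "(\<Sum>i\<in>{k<..Suc l}. frag_cmul ((-1) ^ i) (sdg l k (fct (Suc l) i \<zeta>)))
      = sum ?t {..<k} - vd (Suc (Suc l)) (sdg (Suc l) k \<zeta>)" by simp
  have "?t i \<in> Zt v p (Suc (Suc l)) f" if "i \<in> {..<k}" for i
    using fct_sdg(1)[OF z, of k i] that k fct_ch[of i "Suc l" \<zeta> p f] z by (auto intro!: Z(4) A_Zt f)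
  then have "sum ?t {..<k} \<in> Zt v p (Suc (Suc l)) f" by (rule Z(5))
  moreover have "vd (Suc (Suc l)) (sdg (Suc l) k \<zeta>) \<in> Zt v p (Suc (Suc l)) f"
    using B[OF f z] vd_ch[OF s] by (simp add: Zt_def)
  ultimately show ?thesis unfolding e by (rule Z(3))
qed

text \<open>The correction v - (-1)^k v s_k d, with d the simplicial boundary, is meant to kill the
  images of s_0, ..., s_k. For j < k, all surviving terms are killed by \<open>A\<close> or by
  \<open>upper_sum_Zt\<close>. For j = k, one term of s_k d s_k is (-1)^k s_k, which cancels the
  leading s_k.\<close>

lemma vd_sdg_Zt:
  assumes f: "f \<in> Arr K" and z: "\<zeta> \<in> ch p (Suc l) f" and j: "j \<le> k"
  shows "sdg l j \<zeta> - frag_cmul ((-1) ^ k) (sdg l k (vd (Suc l) (sdg l j \<zeta>))) \<in> Zt v p (Suc (Suc l)) f"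
proof -
  note Z = Zt_simps[OF v f]
  have s: "sdg l j \<zeta> \<in> ch p (Suc (Suc l)) f" using k j by (intro sdg_ch z) simp
  let ?t = "\<lambda>i. frag_cmul ((-1) ^ i) (sdg l k (fct (Suc l) i (sdg l j \<zeta>)))"
  have "{..Suc l} = {..k} \<union> {k<..Suc l}" using k by auto
  then have "sdg l k (vd (Suc l) (sdg l j \<zeta>)) = sum ?t ({..k} \<union> {k<..Suc l})"
    unfolding vd_def sdg_linear by simp
  also have "\<dots> = sum ?t {..k} + sum ?t {k<..Suc l}"
    by (subst sum.union_disjoint) auto
  finally have e: "sdg l k (vd (Suc l) (sdg l j \<zeta>)) = sum ?t {..k} + sum ?t {k<..Suc l}" .
  have u: "sum ?t {k<..Suc l} \<in> Zt v p (Suc (Suc l)) f" by (rule upper_sum_Zt[OF f s])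
  have lo: "?t i \<in> Zt v p (Suc (Suc l)) f" if i: "i < j" for i
  proof -
    obtain l' where l: "l = Suc l'" using i j k by (cases l) auto
    have d: "fct l i \<zeta> \<in> ch p (Suc l') f" using i j k l z fct_ch[of i l \<zeta> p f] by simp
    have "fct (Suc l) i (sdg l j \<zeta>) = sdg l' (j - 1) (fct l i \<zeta>)"
      using fct_sdg(1)[of \<zeta> p l' f j i] i j k z l by simp
    moreover have "sdg l k (sdg l' (j - 1) (fct l i \<zeta>)) = sdg l (j - 1) (sdg l' (k - 1) (fct l i \<zeta>))"
      using sdg_sdg[OF d, of "j - 1" "k - 1"] i j k l by simp
    moreover have "sdg l' (k - 1) (fct l i \<zeta>) \<in> ch p (Suc l) f"
      using sdg_ch[OF _ d, of "k - 1"] i j k l by simp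
    ultimately show ?thesis using A_Zt[of "j - 1" f] i j f by (auto intro!: Z(4))
  qed
  have hi: "?t i \<in> Zt v p (Suc (Suc l)) f" if i: "Suc j < i" "i \<le> k" for i
  proof -
    obtain l' where l: "l = Suc l'" using i j k by (cases l) auto
    have d: "fct l (i - 1) \<zeta> \<in> ch p (Suc l') f" using i j k l z fct_ch[of "i - 1" l \<zeta> p f] by simp
    have "fct (Suc l) i (sdg l j \<zeta>) = sdg l' j (fct l (i - 1) \<zeta>)"
      using fct_sdg(2)[of \<zeta> p l' f j i] i j k z l by simp
    moreover have "sdg l k (sdg l' j (fct l (i - 1) \<zeta>)) = sdg l j (sdg l' (k - 1) (fct l (i - 1) \<zeta>))"
      using sdg_sdg[OF d, of j "k - 1"] i j k l by simp
    moreover have "sdg l' (k - 1) (fct l (i - 1) \<zeta>) \<in> ch p (Suc l) f"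
      using sdg_ch[OF _ d, of "k - 1"] i j k l by simp
    ultimately show ?thesis using A_Zt[of j f] i j f by (auto intro!: Z(4))
  qed
  show ?thesis
  proof (cases "j = k")
    case True
    have "sum ?t {..k} = sum ?t {..<k} + frag_cmul ((-1) ^ k) (sdg l k \<zeta>)"
      using fct_sdg_same[OF z, of k k] True k by (simp add: lessThan_Suc_atMost[symmetric])
    then have "sdg l j \<zeta> - frag_cmul ((-1) ^ k) (sdg l k (vd (Suc l) (sdg l j \<zeta>)))
        = 0 - frag_cmul ((-1) ^ k) (sum ?t {..<k} + sum ?t {k<..Suc l})"
      unfolding e using True by (simp add: frag_cmul_distrib2 algebra_simps flip: power_add)
    moreover have "sum ?t {..<k} \<in> Zt v p (Suc (Suc l)) f"
      by (rule Z(5)) (use lo True in auto)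
    then have "frag_cmul ((-1) ^ k) (sum ?t {..<k} + sum ?t {k<..Suc l}) \<in> Zt v p (Suc (Suc l)) f"
      by (rule Z(4)[OF Z(2)[OF _ u]])
    ultimately show ?thesis using Z(3)[OF Z(1)] by (simp only:)
  next
    case False
    then have jk: "j < k" using j by simp
    have "{..k} = {..<j} \<union> {j, Suc j} \<union> {Suc j<..k}" using jk by auto
    then have "sum ?t {..k} = sum ?t ({..<j} \<union> {j, Suc j} \<union> {Suc j<..k})" by simp
    also have "\<dots> = sum ?t {..<j} + sum ?t {j, Suc j} + sum ?t {Suc j<..k}"
      by (subst sum.union_disjoint, simp, simp, force)+ simp
    also have "sum ?t {j, Suc j} = 0"
      using fct_sdg_same[OF z, of j] jk k by (simp flip: frag_cmul_distrib)
    finally have t: "sum ?t {..k} = sum ?t {..<j} + sum ?t {Suc j<..k}" by simp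
    have "sum ?t {..<j} \<in> Zt v p (Suc (Suc l)) f" by (rule Z(5)) (use lo in simp)
    moreover have "sum ?t {Suc j<..k} \<in> Zt v p (Suc (Suc l)) f" by (rule Z(5)) (use hi in simp)
    ultimately have "sum ?t {..k} \<in> Zt v p (Suc (Suc l)) f" unfolding t by (rule Z(2))
    then have "frag_cmul ((-1) ^ k) (sum ?t {..k} + sum ?t {k<..Suc l}) \<in> Zt v p (Suc (Suc l)) f"
      by (rule Z(4)[OF Z(2)[OF _ u]])
    then show ?thesis
      unfolding e by (rule Z(3)[OF A_Zt[OF jk f z]])
  qed
qed

end

lemma rcyc_pb_sdg:
  assumes "rcyc p (Suc (Suc l)) v" "j \<le> l"
  shows "rcyc p (Suc l) (pb (sdg l j) v)"
  unfolding rcyc_def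
proof (intro conjI ballI)
  have v: "v \<in> coch p (Suc (Suc l))" using assms(1) by (rule rcyc_coch)
  show "pb (sdg l j) v \<in> coch p (Suc l)" by (rule pb_coch[OF isop_sdg[OF assms(2)] v])
  fix f \<zeta> assume f: "f \<in> Arr K" and z: "\<zeta> \<in> ch (Suc p) (Suc l) f"
  show "linD f (pb (sdg l j) v) (rowd \<zeta>) = \<one>\<^bsub>grp D f\<^esub>"
    using linD_pb[OF isop_sdg[OF assms(2)] v rowd_ch[OF z] f] rowd_sdg[OF assms(2) z]
      rcycD[OF assms(1) sdg_ch[OF assms(2) z] f] by simp
qed

lemma rcyc_pb_vd:
  assumes "rcyc p l v"
  shows "rcyc p (Suc l) (pb (vd l) v)"
  unfolding rcyc_def
proof (intro conjI ballI)
  have v: "v \<in> coch p l" using assms(1) by (rule rcyc_coch)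
  show "pb (vd l) v \<in> coch p (Suc l)" by (rule pb_coch[OF isop_vd v])
  fix f \<zeta> assume f: "f \<in> Arr K" and z: "\<zeta> \<in> ch (Suc p) (Suc l) f"
  show "linD f (pb (vd l) v) (rowd \<zeta>) = \<one>\<^bsub>grp D f\<^esub>"
    using linD_pb[OF isop_vd v rowd_ch[OF z] f] rowd_vd[OF z] rcycD[OF assms(1) vd_ch[OF z] f] by simp
qed

lemma rcyc_ops:
  "rcyc p l cone" "rcyc p l b \<Longrightarrow> rcyc p l c \<Longrightarrow> rcyc p l (cmult b c)" "rcyc p l c \<Longrightarrow> rcyc p l (cinv c)"
proof -
  show "rcyc p l cone" by (simp add: rcyc_def coch_ops(1) linD_cone[OF rowd_ch])
  show "rcyc p l (cmult b c)" if "rcyc p l b" "rcyc p l c"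
    unfolding rcyc_def
  proof (intro conjI ballI)
    fix f \<zeta> assume f: "f \<in> Arr K" and z: "\<zeta> \<in> ch (Suc p) l f"
    interpret A: comm_group "grp D f" by (rule grp_D[OF f])
    show "linD f (cmult b c) (rowd \<zeta>) = \<one>\<^bsub>grp D f\<^esub>"
      using linD_cmult[OF that[THEN rcyc_coch] rowd_ch[OF z] f] rcycD[OF that(1) z f] rcycD[OF that(2) z f] by simp
  qed (rule coch_ops(2)[OF that[THEN rcyc_coch]])
  show "rcyc p l (cinv c)" if "rcyc p l c"
    unfolding rcyc_def
  proof (intro conjI ballI)
    fix f \<zeta> assume f: "f \<in> Arr K" and z: "\<zeta> \<in> ch (Suc p) l f"
    interpret A: comm_group "grp D f" by (rule grp_D[OF f])
    show "linD f (cinv c) (rowd \<zeta>) = \<one>\<^bsub>grp D f\<^esub>"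
      using linD_cinv[OF that[THEN rcyc_coch] rowd_ch[OF z] f] rcycD[OF that z f] by simp
  qed (rule coch_ops(3)[OF that[THEN rcyc_coch]])
qed

text \<open>Repeats the correction for one degeneracy after another and records w, so that the total
  change stays the coboundary of a row cocycle.\<close>

lemma normalize_aux:
  assumes v: "rcyc p (Suc (Suc l)) v"
    and B: "\<And>j f \<zeta>. j \<le> l \<Longrightarrow> f \<in> Arr K \<Longrightarrow> \<zeta> \<in> ch p (Suc (Suc l)) f \<Longrightarrow>
      linD f v (vd (Suc (Suc l)) (sdg (Suc l) j \<zeta>)) = \<one>\<^bsub>grp D f\<^esub>"
  shows "k \<le> Suc l \<Longrightarrow> \<exists>v' w. rcyc p (Suc (Suc l)) v' \<and> rcyc p (Suc l) w \<and>
    (\<forall>f\<in>Arr K. \<forall>\<zeta>\<in>ch p (Suc (Suc l)) f. linD f v' \<zeta> = linD f v \<zeta> \<otimes>\<^bsub>grp D f\<^esub> linD f w (vd (Suc l) \<zeta>)) \<and>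
    (\<forall>j<k. \<forall>f\<in>Arr K. \<forall>\<zeta>\<in>ch p (Suc l) f. linD f v' (sdg l j \<zeta>) = \<one>\<^bsub>grp D f\<^esub>)"
proof (induction k)
  case 0
  have "linD f v \<zeta> = linD f v \<zeta> \<otimes>\<^bsub>grp D f\<^esub> linD f cone (vd (Suc l) \<zeta>)"
    if f: "f \<in> Arr K" and z: "\<zeta> \<in> ch p (Suc (Suc l)) f" for f \<zeta>
  proof -
    interpret A: comm_group "grp D f" by (rule grp_D[OF f])
    show ?thesis using linD_cone[OF vd_ch[OF z] f] linD_closed[OF rcyc_coch[OF v] z f] by simp
  qed
  then show ?case using v rcyc_ops(1) by blast
next
  case (Suc k)
  then have k: "k \<le> l" by simp
  obtain v' w where v': "rcyc p (Suc (Suc l)) v'" and w: "rcyc p (Suc l) w"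
    and e: "\<And>f \<zeta>. f \<in> Arr K \<Longrightarrow> \<zeta> \<in> ch p (Suc (Suc l)) f \<Longrightarrow>
      linD f v' \<zeta> = linD f v \<zeta> \<otimes>\<^bsub>grp D f\<^esub> linD f w (vd (Suc l) \<zeta>)"
    and A: "\<And>j f \<zeta>. j < k \<Longrightarrow> f \<in> Arr K \<Longrightarrow> \<zeta> \<in> ch p (Suc l) f \<Longrightarrow> linD f v' (sdg l j \<zeta>) = \<one>\<^bsub>grp D f\<^esub>"
    using Suc by auto
  have vc: "v \<in> coch p (Suc (Suc l))" and vc': "v' \<in> coch p (Suc (Suc l))" and wc: "w \<in> coch p (Suc l)"
    using v v' w by (simp_all add: rcyc_coch)
  \<comment> \<open>The cochain v' differs from v by a coboundary, so both have the same coboundary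
    and \<open>B\<close> persists.\<close>
  have B': "linD f v' (vd (Suc (Suc l)) (sdg (Suc l) k \<zeta>)) = \<one>\<^bsub>grp D f\<^esub>"
    if f: "f \<in> Arr K" and z: "\<zeta> \<in> ch p (Suc (Suc l)) f" for f \<zeta>
  proof -
    interpret A: comm_group "grp D f" by (rule grp_D[OF f])
    have s: "sdg (Suc l) k \<zeta> \<in> ch p (Suc (Suc (Suc l))) f" using k by (intro sdg_ch z) simp
    show ?thesis using e[OF f vd_ch[OF s]] B[OF k f z] vd_vd[OF s] linD_zero[OF f] by simp
  qed
  let ?w = "pb (sdg l k) v'"
  have w': "rcyc p (Suc l) ?w" by (rule rcyc_pb_sdg[OF v' k])
  \<comment> \<open>The minus sign of the correction and the factor (-1)^k, combined into one
    choice.\<close>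
  define u where "u = (if even k then cinv ?w else ?w)"
  have u: "rcyc p (Suc l) u" using rcyc_ops(3)[OF w'] w' by (simp add: u_def)
  have uc: "u \<in> coch p (Suc l)" using u by (rule rcyc_coch)
  have ue: "linD f u (vd (Suc l) \<zeta>) = inv\<^bsub>grp D f\<^esub> linD f v' (frag_cmul ((-1) ^ k) (sdg l k (vd (Suc l) \<zeta>)))"
    if f: "f \<in> Arr K" and z: "\<zeta> \<in> ch p (Suc (Suc l)) f" for f \<zeta>
  proof -
    interpret A: comm_group "grp D f" by (rule grp_D[OF f])
    have s: "sdg l k (vd (Suc l) \<zeta>) \<in> ch p (Suc (Suc l)) f" by (rule sdg_ch[OF k vd_ch[OF z]])
    show ?thesis
      using linD_cinv[OF rcyc_coch[OF w'] vd_ch[OF z] f] linD_pb[OF isop_sdg[OF k] vc' vd_ch[OF z] f]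
        linD_sign[OF vc' s f, of k] linD_closed[OF vc' s f] by (simp add: u_def)
  qed
  let ?v = "cmult v' (pb (vd (Suc l)) u)"
  have vu: "rcyc p (Suc (Suc l)) (pb (vd (Suc l)) u)" by (rule rcyc_pb_vd[OF u])
  have ve: "linD f ?v \<zeta> = linD f v' \<zeta> \<otimes>\<^bsub>grp D f\<^esub> linD f u (vd (Suc l) \<zeta>)"
    if f: "f \<in> Arr K" and z: "\<zeta> \<in> ch p (Suc (Suc l)) f" for f \<zeta>
    using linD_cmult[OF vc' rcyc_coch[OF vu] z f] linD_pb[OF isop_vd uc z f] by simp
  show ?case
  proof (rule exI[of _ ?v], rule exI[of _ "cmult w u"], intro conjI ballI allI impI)
    show "rcyc p (Suc (Suc l)) ?v" by (rule rcyc_ops(2)[OF v' vu])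
    show "rcyc p (Suc l) (cmult w u)" by (rule rcyc_ops(2)[OF w u])
    fix f assume f: "f \<in> Arr K"
    interpret A: comm_group "grp D f" by (rule grp_D[OF f])
    show "linD f ?v \<zeta> = linD f v \<zeta> \<otimes>\<^bsub>grp D f\<^esub> linD f (cmult w u) (vd (Suc l) \<zeta>)"
      if z: "\<zeta> \<in> ch p (Suc (Suc l)) f" for \<zeta>
      using ve[OF f z] e[OF f z] linD_cmult[OF wc uc vd_ch[OF z] f] linD_closed[OF vc z f]
        linD_closed[OF wc vd_ch[OF z] f] linD_closed[OF uc vd_ch[OF z] f] by (simp add: A.m_assoc)
    fix j \<zeta> assume "j < Suc k" and z: "\<zeta> \<in> ch p (Suc l) f"
    then have j: "j \<le> k" by simp
    have s: "sdg l j \<zeta> \<in> ch p (Suc (Suc l)) f" using k j by (intro sdg_ch z) simp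
    have t: "frag_cmul ((-1) ^ k) (sdg l k (vd (Suc l) (sdg l j \<zeta>))) \<in> ch p (Suc (Suc l)) f"
      by (intro chn_cmul sdg_ch[OF k vd_ch[OF s]])
    have "linD f v' (sdg l j \<zeta> - frag_cmul ((-1) ^ k) (sdg l k (vd (Suc l) (sdg l j \<zeta>)))) = \<one>\<^bsub>grp D f\<^esub>"
      using vd_sdg_Zt[OF vc' k A B' f z j] by (simp add: Zt_def)
    then show "linD f ?v (sdg l j \<zeta>) = \<one>\<^bsub>grp D f\<^esub>"
      using ve[OF f s] ue[OF f s] linD_diff[OF vc' s t f] by simp
  qed
qed

text \<open>\<open>nrm p l c\<close> says that \<open>c\<close>, a cochain on level \<open>l - 1\<close> of the resolution, vanishes on degenerate elements.\<close>

definition nrm where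
  "nrm p l c \<longleftrightarrow> (\<forall>l' j f \<zeta>. l = Suc (Suc l') \<longrightarrow> j \<le> l' \<longrightarrow> f \<in> Arr K \<longrightarrow> \<zeta> \<in> ch p (Suc l') f \<longrightarrow>
     linD f c (sdg l' j \<zeta>) = \<one>\<^bsub>grp D f\<^esub>)"

text \<open>\<open>B\<close> asks for a normalized coboundary and not for a vanishing one, so the
  lemma covers both cocycles and the cochains that link two normalized cocycles.\<close>

lemma normalize:
  assumes v: "rcyc p (Suc (Suc l)) v"
    and B: "nrm p (Suc (Suc (Suc l))) (pb (vd (Suc (Suc l))) v)"
  obtains v' w where "rcyc p (Suc (Suc l)) v'" "rcyc p (Suc l) w" "nrm p (Suc (Suc l)) v'"
    "\<And>f \<zeta>. f \<in> Arr K \<Longrightarrow> \<zeta> \<in> ch p (Suc (Suc l)) f \<Longrightarrow>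
      linD f v' \<zeta> = linD f v \<zeta> \<otimes>\<^bsub>grp D f\<^esub> linD f w (vd (Suc l) \<zeta>)"
proof -
  have B': "linD f v (vd (Suc (Suc l)) (sdg (Suc l) j \<zeta>)) = \<one>\<^bsub>grp D f\<^esub>"
    if "j \<le> l" "f \<in> Arr K" "\<zeta> \<in> ch p (Suc (Suc l)) f" for j f \<zeta>
    using B that linD_pb[OF isop_vd rcyc_coch[OF v] sdg_ch[of j "Suc l" \<zeta> p f] that(2)]
    by (auto simp: nrm_def)
  from normalize_aux[OF v B', of "Suc l"] show thesis
    by (auto simp: nrm_def less_Suc_eq_le intro: that)
qed

end

section \<open>Baues-Wirsching cochains\<close>

context small_cat
begin

text \<open>The start object of the simplex is dropped, being the codomain of \<alpha>;
  \<open>unemb\<close> restores it from there.\<close>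

definition emb :: "'a \<times> ('o \<times> 'a list) \<times> 'a \<Rightarrow> 'a \<times> ('o, 'a) walks list \<times> 'a" where
  "emb = (\<lambda>(\<alpha>, (x, fs), \<beta>). (\<alpha>, map Gen fs, \<beta>))"

definition unemb :: "'a \<times> ('o, 'a) walks list \<times> 'a \<Rightarrow> 'a \<times> ('o \<times> 'a list) \<times> 'a" where
  "unemb = (\<lambda>(\<alpha>, \<sigma>, \<beta>). (\<alpha>, (Cod K \<alpha>, map ev \<sigma>), \<beta>))"

lemma okc_Gen: "okc 0 (map Gen fs) \<alpha> \<beta> \<longleftrightarrow>
    \<alpha> \<in> Arr K \<and> \<beta> \<in> Arr K \<and> wlk K (Cod K \<alpha>) fs \<and> wend K (Cod K \<alpha>) fs = Dom K \<beta>"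
proof (induction fs arbitrary: \<alpha>)
  case (Cons f fs)
  have g: "Gen f \<in> Arr (gen_cat K) \<longleftrightarrow> f \<in> Arr K" by (auto simp: gen_cat_def)
  show ?case
  proof (cases "\<alpha> \<in> Arr K \<and> f \<in> Arr K \<and> Cod K \<alpha> = Dom K f")
    case True
    then show ?thesis using Cons.IH[of "Comp K f \<alpha>"] g by (simp add: Comp_in Cod_Comp)
  next
    case False
    then show ?thesis using g by auto
  qed
qed (auto simp: Dom_in)

lemma tot_Gen: "okc 0 (map Gen fs) \<alpha> \<beta> \<Longrightarrow>
    tot (map Gen fs) \<alpha> \<beta> = Comp K \<beta> (Comp K (comp_path K (Cod K \<alpha>) fs) \<alpha>)"
proof (induction fs arbitrary: \<alpha>)
  case Nil
  then show ?case using Comp_Idn_left[of \<alpha>] by simp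
next
  case (Cons f fs)
  then have a: "\<alpha> \<in> Arr K" "f \<in> Arr K" "Cod K \<alpha> = Dom K f" "wlk K (Cod K f) fs"
    unfolding okc_Gen by auto
  have "Comp K (comp_path K (Cod K f) fs) (Comp K f \<alpha>) = Comp K (Comp K (comp_path K (Cod K f) fs) f) \<alpha>"
    by (rule Comp_assoc) (use a comp_path_arr[OF a(4)] in auto)
  then show ?case using Cons a by (simp add: Cod_Comp)
qed

lemma nerve_iff: "(x, fs) \<in> nerve K p \<longleftrightarrow> length fs = p \<and> wlk K x fs"
  by (simp add: nerve_def awalk_wlk)

lemma bw_elts:
  "s \<in> elts (bw_nerve K p) f \<longleftrightarrow> emb s \<in> X p 0 f \<and> fst (fst (snd s)) = Cod K (fst s)"
proof -
  obtain \<alpha> x fs \<beta> where s: "s = (\<alpha>, (x, fs), \<beta>)" by (cases s) auto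
  have "s \<in> elts (bw_nerve K p) f \<longleftrightarrow> length fs = p \<and> wlk K x fs \<and> \<alpha> \<in> Arr K \<and> \<beta> \<in> Arr K \<and>
      Cod K \<alpha> = x \<and> wend K x fs = Dom K \<beta> \<and> Comp K \<beta> (Comp K (comp_path K x fs) \<alpha>) = f"
    unfolding s bw_nerve_def free_natsys_def
    by (auto simp: nerve_iff max_face_def Fac_def comp_path_arr)
  also have "\<dots> \<longleftrightarrow> emb s \<in> X p 0 f \<and> fst (fst (snd s)) = Cod K (fst s)"
    using okc_Gen[of fs \<alpha> \<beta>] tot_Gen[of fs \<alpha> \<beta>] by (auto simp: s emb_def X_def simp del: lv_simps)
  finally show ?thesis .
qed

lemma X0_Gen: "okc 0 \<sigma> \<alpha> \<beta> \<Longrightarrow> map Gen (map ev \<sigma>) = \<sigma>"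
  by (induction \<sigma> arbitrary: \<alpha>) (auto simp: gen_cat_def)

lemma emb_unemb: "s \<in> X p 0 f \<Longrightarrow> emb (unemb s) = s"
  using X0_Gen by (fastforce simp: X_def emb_def unemb_def simp del: map_map)

lemma unemb_emb: "s \<in> elts (bw_nerve K p) f \<Longrightarrow> unemb (emb s) = s"
  unfolding bw_elts by (cases s) (auto simp: emb_def unemb_def o_def)

lemma unemb_elts: "s \<in> X p 0 f \<Longrightarrow> unemb s \<in> elts (bw_nerve K p) f"
  unfolding bw_elts by (simp add: emb_unemb) (simp add: unemb_def split: prod.splits)

lemma sum_from_1: "sum t {1..Suc n} = t 1 + (\<Sum>i\<in>{1..n}. t (Suc i))"
  using sum.atLeast_Suc_atMost[of 1 "Suc n" t] sum.atLeast_Suc_atMost_Suc_shift[of t 1 n] by simp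

lemma nerve_face_Cons:
  "1 \<le> i \<Longrightarrow> i \<le> Suc (length gs) \<Longrightarrow>
    snd (nerve_face K (Suc (Suc (length gs))) (Suc i) (x, f # g # gs)) = f # snd (nerve_face K (Suc (length gs)) i (x, g # gs))"
  by (cases i) (auto simp: nerve_face_def)

text \<open>Face 1 multiplies the first two arrows when there are two, and face i + 1 of a list is
  its first arrow followed by face i of the tail; this is the recursion of
  \<open>rem\<close>.\<close>

lemma rem_faces:
  "rem (map Gen (f # fs)) \<beta> = (\<Sum>i\<in>{1..Suc (length fs)}. frag_cmul ((-1) ^ (i - 1))
     (frag_of (map Gen (snd (nerve_face K (Suc (length fs)) i (x, f # fs))),
        if i = Suc (length fs) then Comp K \<beta> (last (f # fs)) else \<beta>)))"
proof (induction fs arbitrary: f x)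
  case Nil
  then show ?case by (simp add: nerve_face_def)
next
  case (Cons g gs)
  let ?p = "Suc (length gs)"
  let ?t = "\<lambda>p h hs i. frag_cmul ((-1) ^ (i - 1)) (frag_of (map Gen (snd (nerve_face K p i (x, h # hs))),
        if i = p then Comp K \<beta> (last (h # hs)) else \<beta>))"
  have "(\<Sum>i\<in>{1..Suc ?p}. ?t (Suc ?p) f (g # gs) i)
      = ?t (Suc ?p) f (g # gs) 1 + (\<Sum>i\<in>{1..?p}. ?t (Suc ?p) f (g # gs) (Suc i))"
    by (rule sum_from_1)
  also have "?t (Suc ?p) f (g # gs) 1 = frag_of (Gen (Comp K g f) # map Gen gs, \<beta>)"
    by (simp add: nerve_face_def)
  also have "(\<Sum>i\<in>{1..?p}. ?t (Suc ?p) f (g # gs) (Suc i)) = - cns (Gen f) (\<Sum>i\<in>{1..?p}. ?t ?p g gs i)"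
    unfolding pmap_sum sum_negf[symmetric]
  proof (rule sum.cong[OF refl])
    fix i assume i: "i \<in> {1..?p}"
    then obtain j where j: "i = Suc j" by (cases i) auto
    from i have "snd (nerve_face K (Suc ?p) (Suc i) (x, f # g # gs)) = f # snd (nerve_face K ?p i (x, g # gs))"
      by (intro nerve_face_Cons) auto
    then show "?t (Suc ?p) f (g # gs) (Suc i) = - cns (Gen f) (?t ?p g gs i)"
      using i by (simp add: j)
  qed
  finally show ?case
    using Cons.IH[of g x] by (simp add: rem_Cons wcmp_def del: sum.cl_ivl_Suc)
qed

lemma bw_face_sum:
  assumes "snd (fst (snd s)) = f # fs"
  shows "(\<Sum>i\<le>Suc (length fs). frag_cmul ((-1) ^ i) (frag_of (emb (bw_face K (Suc (length fs)) i s)))) = rowg (emb s)"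
proof -
  obtain \<alpha> x \<beta> where s: "s = (\<alpha>, (x, f # fs), \<beta>)" using assms by (cases s) auto
  let ?p = "Suc (length fs)"
  let ?t = "\<lambda>i. frag_cmul ((-1) ^ i) (frag_of (emb (bw_face K ?p i s)))"
  have "{..?p} = insert 0 {1..?p}" by auto
  then have "sum ?t {..?p} = ?t 0 + sum ?t {1..?p}" by (simp del: sum.cl_ivl_Suc sum.atMost_Suc)
  also have "?t 0 = frag_of (Comp K f \<alpha>, map Gen fs, \<beta>)"
    by (simp add: s bw_face_def emb_def nerve_face_def)
  also have "sum ?t {1..?p} = - ins \<alpha> (rem (map Gen (f # fs)) \<beta>)"
    unfolding rem_faces[of f fs \<beta> x] pmap_sum sum_negf[symmetric]
  proof (rule sum.cong[OF refl])
    fix i assume i: "i \<in> {1..?p}"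
    then obtain j where j: "i = Suc j" by (cases i) auto
    show "?t i = - ins \<alpha> (frag_cmul ((-1) ^ (i - 1)) (frag_of (map Gen (snd (nerve_face K ?p i (x, f # fs))),
        if i = ?p then Comp K \<beta> (last (f # fs)) else \<beta>)))"
      by (simp add: s bw_face_def emb_def case_prod_unfold j)
  qed
  finally show ?thesis by (simp add: s emb_def)
qed

end

section \<open>Cochains at level 0 as Baues-Wirsching cochains\<close>

context nat_sys
begin

definition tobw where
  "tobw p c = (\<lambda>f\<in>Arr K. \<lambda>s\<in>elts (bw_nerve K p) f. c (emb s))"

definition ofbw where "ofbw b = (\<lambda>s. case s of (\<alpha>, \<sigma>, \<beta>) \<Rightarrow> b (tot \<sigma> \<alpha> \<beta>) (unemb s))"

lemma ofbw_X: "s \<in> X p l f \<Longrightarrow> ofbw b s = b f (unemb s)"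
  by (auto simp: ofbw_def X_def)

lemma tobw_app: "f \<in> Arr K \<Longrightarrow> s \<in> elts (bw_nerve K p) f \<Longrightarrow> tobw p c f s = c (emb s)"
  by (simp add: tobw_def)

lemma tobw_eq_iff: "tobw p b = tobw p c \<longleftrightarrow> (\<forall>f. \<forall>s\<in>X p 0 f. b s = c s)"
proof
  assume e: "tobw p b = tobw p c"
  show "\<forall>f. \<forall>s\<in>X p 0 f. b s = c s"
  proof (intro allI ballI)
    fix f s assume s: "s \<in> X p 0 f"
    have "tobw p b f (unemb s) = tobw p c f (unemb s)" by (simp add: e)
    then show "b s = c s"
      by (simp add: tobw_app[OF X_Arr[OF s] unemb_elts[OF s]] emb_unemb[OF s])
  qed
next
  assume "\<forall>f. \<forall>s\<in>X p 0 f. b s = c s"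
  then show "tobw p b = tobw p c"
    by (auto simp: tobw_def bw_elts fun_eq_iff restrict_def)
qed

lemma emb_sact: "emb (sact (bw_nerve K p) (\<alpha>', f, \<beta>') s) = gact \<alpha>' \<beta>' (emb s)"
  by (cases s) (auto simp: emb_def gact_def bw_nerve_def free_natsys_def)

lemma sact_elts:
  assumes "(\<alpha>', f, \<beta>') \<in> Arr (Fac K)" "s \<in> elts (bw_nerve K p) f"
  shows "sact (bw_nerve K p) (\<alpha>', f, \<beta>') s \<in> elts (bw_nerve K p) (Comp K \<beta>' (Comp K f \<alpha>'))"
proof -
  obtain \<alpha> x fs \<beta> where s: "s = (\<alpha>, (x, fs), \<beta>)" by (cases s) auto
  have "emb s \<in> X p 0 f" "x = Cod K \<alpha>" using assms(2) by (auto simp: bw_elts s)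
  moreover have "Cod K (Comp K \<alpha> \<alpha>') = Cod K \<alpha>"
    using calculation(1) okc_arr okc_ends[OF _ _ assms(1)]
    by (force simp: s emb_def X_def intro!: Cod_Comp simp del: lv_simps)
  ultimately show ?thesis
    unfolding bw_elts emb_sact using gact_X[OF _ assms(1)]
    by (auto simp: s bw_nerve_def free_natsys_def)
qed

lemma carrier_bw: "carrier (bw_cochains K D p) = natsys_Hom K (bw_nerve K p) D"
  by (simp add: bw_cochains_def natsys_Hom_group_def)

lemma Fac_Dom_Cod: "Dom (Fac K) (\<alpha>, f, \<beta>) = f" "Cod (Fac K) (\<alpha>, f, \<beta>) = Comp K \<beta> (Comp K f \<alpha>)"
  by (simp_all add: Fac_def)

lemma tobw_carrier: "c \<in> coch p 0 \<Longrightarrow> tobw p c \<in> carrier (bw_cochains K D p)"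
  unfolding carrier_bw natsys_Hom_def
proof (intro CollectI conjI ballI)
  assume c: "c \<in> coch p 0"
  show "tobw p c \<in> (\<Pi>\<^sub>E f\<in>Arr K. elts (bw_nerve K p) f \<rightarrow>\<^sub>E carrier (grp D f))"
    unfolding tobw_def by (intro restrict_PiE_iff[THEN iffD2] ballI) (auto simp: bw_elts intro: coch_carrier[OF c])
  fix t s assume "t \<in> Arr (Fac K)" and s: "s \<in> elts (bw_nerve K p) (Dom (Fac K) t)"
  then obtain \<alpha>' f \<beta>' where t: "t = (\<alpha>', f, \<beta>')" and F: "(\<alpha>', f, \<beta>') \<in> Arr (Fac K)"
    by (cases t) auto
  have f: "f \<in> Arr K" using F by (auto simp: Fac_def)
  have s: "s \<in> elts (bw_nerve K p) f" using s by (simp add: t Fac_Dom_Cod)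
  have "emb s \<in> X p 0 f" using s by (simp add: bw_elts)
  then show "tobw p c (Cod (Fac K) t) (sact (bw_nerve K p) t s) = act D t (tobw p c (Dom (Fac K) t) s)"
    using tobw_app[OF Fac_target[OF F] sact_elts[OF F s], of c] tobw_app[OF f s, of c] coch_gact[OF c _ F]
    by (simp add: t Fac_Dom_Cod emb_sact)
qed

lemma ofbw_coch:
  assumes "b \<in> carrier (bw_cochains K D p)"
  shows "ofbw b \<in> coch p 0" "tobw p (ofbw b) = b"
proof -
  have b: "b \<in> (\<Pi>\<^sub>E f\<in>Arr K. elts (bw_nerve K p) f \<rightarrow>\<^sub>E carrier (grp D f))"
    and bn: "\<And>t s. t \<in> Arr (Fac K) \<Longrightarrow> s \<in> elts (bw_nerve K p) (Dom (Fac K) t) \<Longrightarrow>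
      b (Cod (Fac K) t) (sact (bw_nerve K p) t s) = act D t (b (Dom (Fac K) t) s)"
    using assms unfolding carrier_bw natsys_Hom_def by auto
  show "ofbw b \<in> coch p 0"
    unfolding coch_def
  proof (intro CollectI allI ballI conjI impI)
    fix f s assume s: "s \<in> X p 0 f"
    show "ofbw b s \<in> carrier (grp D f)"
      unfolding ofbw_X[OF s] using b X_Arr[OF s] unemb_elts[OF s] by (auto simp: PiE_iff)
    fix \<alpha>' \<beta>' assume F: "(\<alpha>', f, \<beta>') \<in> Arr (Fac K)"
    have u: "unemb s \<in> elts (bw_nerve K p) f" by (rule unemb_elts[OF s])
    have "unemb (gact \<alpha>' \<beta>' s) = unemb (emb (sact (bw_nerve K p) (\<alpha>', f, \<beta>') (unemb s)))"
      by (simp add: emb_sact emb_unemb[OF s])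
    also have "\<dots> = sact (bw_nerve K p) (\<alpha>', f, \<beta>') (unemb s)"
      by (rule unemb_emb[OF sact_elts[OF F u]])
    finally show "ofbw b (gact \<alpha>' \<beta>' s) = act D (\<alpha>', f, \<beta>') (ofbw b s)"
      unfolding ofbw_X[OF s] ofbw_X[OF gact_X[OF s F]]
      using bn[OF F, of "unemb s"] u by (simp add: Fac_Dom_Cod)
  qed
  have "tobw p (ofbw b) f s = b f s" for f s
  proof (cases "f \<in> Arr K")
    case True
    have bf: "b f \<in> elts (bw_nerve K p) f \<rightarrow>\<^sub>E carrier (grp D f)" using b True by (auto simp: PiE_iff)
    show ?thesis
    proof (cases "s \<in> elts (bw_nerve K p) f")
      case s: True
      then have "emb s \<in> X p 0 f" by (simp add: bw_elts)
      then show ?thesis by (simp add: tobw_app[OF True s] ofbw_X unemb_emb[OF s])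
    next
      case False
      then show ?thesis using PiE_arb[OF bf False] True by (simp add: tobw_def)
    qed
  next
    case False
    then show ?thesis using PiE_arb[OF b False] by (simp add: tobw_def)
  qed
  then show "tobw p (ofbw b) = b" by (simp add: fun_eq_iff)
qed

text \<open>This lets group laws, cocycles and coboundaries of the Baues-Wirsching complex be
  computed on representatives in \<open>coch p 0\<close>.\<close>

lemma carrier_bw_tobw: "carrier (bw_cochains K D p) = tobw p ` coch p 0"
proof (intro equalityI subsetI)
  fix b assume "b \<in> carrier (bw_cochains K D p)"
  then show "b \<in> tobw p ` coch p 0" by (intro image_eqI[of _ _ "ofbw b"]) (simp_all add: ofbw_coch)
qed (auto intro: tobw_carrier)

lemma tobw_one: "tobw p cone = \<one>\<^bsub>bw_cochains K D p\<^esub>"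
  by (auto simp: tobw_def bw_cochains_def natsys_Hom_group_def fun_eq_iff restrict_def bw_elts cone_X)

lemma tobw_mult: "tobw p (cmult b c) = tobw p b \<otimes>\<^bsub>bw_cochains K D p\<^esub> tobw p c"
  by (auto simp: tobw_def bw_cochains_def natsys_Hom_group_def fun_eq_iff restrict_def bw_elts cmult_X)

lemma grp_X: "s \<in> X p l f \<Longrightarrow> comm_group (grp D f)"
  by (rule grp_D[OF X_Arr])

lemma coch_laws:
  assumes "s \<in> X p l f" "a \<in> coch p l" "b \<in> coch p l" "c \<in> coch p l"
  shows "cmult (cmult a b) c s = cmult a (cmult b c) s" "cmult a b s = cmult b a s"
    "cmult cone a s = a s" "cmult (cinv a) a s = cone s"
proof -
  interpret A: comm_group "grp D f" by (rule grp_X[OF assms(1)])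
  have "a s \<in> carrier (grp D f)" "b s \<in> carrier (grp D f)" "c s \<in> carrier (grp D f)"
    using assms by (auto intro: coch_carrier)
  then show "cmult (cmult a b) c s = cmult a (cmult b c) s" "cmult a b s = cmult b a s"
    "cmult cone a s = a s" "cmult (cinv a) a s = cone s"
    by (simp_all add: cmult_X[OF assms(1)] cone_X[OF assms(1)] cinv_X[OF assms(1)] A.m_ac)
qed

lemma comm_group_bw: "comm_group (bw_cochains K D p)"
proof (rule comm_groupI)
  let ?C = "bw_cochains K D p"
  fix x assume "x \<in> carrier ?C"
  then obtain a where x: "x = tobw p a" and a: "a \<in> coch p 0"
    unfolding carrier_bw_tobw by blast
  show "\<one>\<^bsub>?C\<^esub> \<otimes>\<^bsub>?C\<^esub> x = x"
    unfolding x tobw_one[symmetric] tobw_mult[symmetric] tobw_eq_iff using coch_laws(3)[OF _ a a a] by blast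
  show "\<exists>y\<in>carrier ?C. y \<otimes>\<^bsub>?C\<^esub> x = \<one>\<^bsub>?C\<^esub>"
  proof (rule bexI[OF _ tobw_carrier[OF coch_ops(3)[OF a]]])
    show "tobw p (cinv a) \<otimes>\<^bsub>?C\<^esub> x = \<one>\<^bsub>?C\<^esub>"
      unfolding x tobw_one[symmetric] tobw_mult[symmetric] tobw_eq_iff using coch_laws(4)[OF _ a a a] by blast
  qed
  fix y assume "y \<in> carrier ?C"
  then obtain b where y: "y = tobw p b" and b: "b \<in> coch p 0"
    unfolding carrier_bw_tobw by blast
  show "x \<otimes>\<^bsub>?C\<^esub> y \<in> carrier ?C"
    unfolding x y tobw_mult[symmetric] by (rule tobw_carrier[OF coch_ops(2)[OF a b]])
  show "x \<otimes>\<^bsub>?C\<^esub> y = y \<otimes>\<^bsub>?C\<^esub> x"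
    unfolding x y tobw_mult[symmetric] tobw_eq_iff using coch_laws(2)[OF _ a b a] by blast
  fix z assume "z \<in> carrier ?C"
  then obtain c where z: "z = tobw p c" and c: "c \<in> coch p 0"
    unfolding carrier_bw_tobw by blast
  show "x \<otimes>\<^bsub>?C\<^esub> y \<otimes>\<^bsub>?C\<^esub> z = x \<otimes>\<^bsub>?C\<^esub> (y \<otimes>\<^bsub>?C\<^esub> z)"
    unfolding x y z tobw_mult[symmetric] tobw_eq_iff using coch_laws(1)[OF _ a b c] by blast
next
  show "\<one>\<^bsub>bw_cochains K D p\<^esub> \<in> carrier (bw_cochains K D p)"
    using tobw_carrier[OF coch_ops(1)] by (simp add: tobw_one)
qed

lemma tobw_inv: "c \<in> coch p 0 \<Longrightarrow> tobw p (cinv c) = inv\<^bsub>bw_cochains K D p\<^esub> (tobw p c)"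
proof -
  assume c: "c \<in> coch p 0"
  interpret C: comm_group "bw_cochains K D p" by (rule comm_group_bw)
  have "tobw p (cinv c) \<otimes>\<^bsub>bw_cochains K D p\<^esub> tobw p c = \<one>\<^bsub>bw_cochains K D p\<^esub>"
    unfolding tobw_one[symmetric] tobw_mult[symmetric] tobw_eq_iff using coch_laws(4)[OF _ c c c] by blast
  then show ?thesis
    using C.inv_equality[OF _ tobw_carrier[OF c] tobw_carrier[OF coch_ops(3)[OF c]]] by simp
qed

text \<open>The finite products defining the differential are evaluated pointwise, where they become
  products in the fixed group of the total composite.\<close>

lemma bw_pointwise:
  assumes f: "f \<in> Arr K" and s: "s \<in> elts (bw_nerve K p) f"
  shows "(\<lambda>b. b f s) \<in> hom (bw_cochains K D p) (grp D f)"
proof (rule homI)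
  fix b c assume b: "b \<in> carrier (bw_cochains K D p)" and c: "c \<in> carrier (bw_cochains K D p)"
  show "b f s \<in> carrier (grp D f)"
    using b f s by (auto simp: carrier_bw natsys_Hom_def PiE_iff)
  show "(b \<otimes>\<^bsub>bw_cochains K D p\<^esub> c) f s = b f s \<otimes>\<^bsub>grp D f\<^esub> c f s"
    using f s by (simp add: bw_cochains_def natsys_Hom_group_def)
qed

lemma alt_sum_hom:
  assumes "\<phi> \<in> hom A B" "comm_group A" "comm_group B" "\<And>i. i \<le> n \<Longrightarrow> g i \<in> carrier A"
  shows "\<phi> (alt_sum A n g) = alt_sum B n (\<lambda>i. \<phi> (g i))"
proof -
  interpret A: comm_group A by fact
  interpret B: comm_group B by fact
  interpret group_hom A B \<phi> by unfold_locales (rule assms(1))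
  have "\<phi> (finprod A h {..n}) = finprod B (\<lambda>i. \<phi> (h i)) {..n}" if "\<And>i. i \<le> n \<Longrightarrow> h i \<in> carrier A" for h and n :: nat
    using that
  proof (induction n)
    case 0
    then have "h 0 \<in> carrier A" by simp
    then show ?case by simp
  next
    case (Suc n)
    have "finprod A h {..n} \<in> carrier A" "h (Suc n) \<in> carrier A" using Suc.prems by (auto intro: A.finprod_closed)
    moreover have "h \<in> {..n} \<rightarrow> carrier A" "(\<lambda>i. \<phi> (h i)) \<in> {..n} \<rightarrow> carrier B" using Suc.prems by auto
    ultimately show ?case using Suc by (simp add: atMost_Suc)
  qed
  then have "\<phi> (alt_sum A n g) = finprod B (\<lambda>i. \<phi> (if even i then g i else inv\<^bsub>A\<^esub> g i)) {..n}"
    unfolding alt_sum_def using assms(4) by auto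
  also have "\<dots> = alt_sum B n (\<lambda>i. \<phi> (g i))"
    unfolding alt_sum_def by (rule B.finprod_cong') (use assms(4) in auto)
  finally show ?thesis .
qed

lemma okc_face:
  "1 \<le> i \<Longrightarrow> i \<le> Suc (length fs) \<Longrightarrow> okc 0 (map Gen (f # fs)) \<alpha> \<beta> \<Longrightarrow>
    (let hs = snd (nerve_face K (Suc (length fs)) i (x, f # fs));
         \<beta>' = (if i = Suc (length fs) then Comp K \<beta> (last (f # fs)) else \<beta>)
     in okc 0 (map Gen hs) \<alpha> \<beta>' \<and> tot (map Gen hs) \<alpha> \<beta>' = tot (map Gen (f # fs)) \<alpha> \<beta> \<and> length hs = length fs)"
proof (induction fs arbitrary: f i \<alpha>)
  case Nil
  then have "i = 1" by simp
  moreover note ok = okc_ConsD[of 0 "Gen f" "[]" \<alpha> \<beta>] Nil(3)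
  moreover have "Comp K \<beta> (Comp K f \<alpha>) = Comp K (Comp K \<beta> f) \<alpha>"
    by (rule Comp_assoc) (use ok in auto)
  ultimately show ?case
    by (auto simp: nerve_face_def Comp_in Dom_Comp simp del: lv_simps)
next
  case (Cons g gs)
  have ok: "okc 0 (Gen f # Gen g # map Gen gs) \<alpha> \<beta>" using Cons.prems(3) by simp
  show ?case
  proof (cases "i = 1")
    case True
    have "nerve_face K (Suc (length (g # gs))) 1 (x, f # g # gs) = (x, Comp K g f # gs)"
      by (simp add: nerve_face_def)
    then show ?thesis using okc_wcmp[OF ok] by (simp add: True wcmp_def Let_def)
  next
    case False
    then obtain j where j: "i = Suc j" "1 \<le> j" "j \<le> Suc (length gs)"
      using Cons.prems by (cases i) auto
    have "okc 0 (map Gen (g # gs)) (Comp K f \<alpha>) \<beta>" using ok by simp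
    note IH = Cons.IH[OF j(2,3) this]
    define h where "h = snd (nerve_face K (Suc (length gs)) j (x, g # gs))"
    define b where "b = (if j = Suc (length gs) then Comp K \<beta> (last (g # gs)) else \<beta>)"
    have "snd (nerve_face K (Suc (length (g # gs))) i (x, f # g # gs)) = f # h"
      using nerve_face_Cons[OF j(2,3), of x f g] by (simp add: j(1) h_def)
    moreover have "(if i = Suc (length (g # gs)) then Comp K \<beta> (last (f # g # gs)) else \<beta>) = b"
      by (simp add: j(1) b_def)
    moreover have "okc 0 (map Gen h) (Comp K f \<alpha>) b \<and> tot (map Gen h) (Comp K f \<alpha>) b = tot (map Gen (g # gs)) (Comp K f \<alpha>) \<beta> \<and> length h = length gs"
      using IH by (simp only: Let_def h_def b_def)
    ultimately show ?thesis
      using ok by (simp only: Let_def) simp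
  qed
qed

lemma bw_face_elts:
  assumes "s \<in> elts (bw_nerve K (Suc p)) f" "i \<le> Suc p"
  shows "bw_face K (Suc p) i s \<in> elts (bw_nerve K p) f"
proof -
  obtain \<alpha> x g fs \<beta> where s: "s = (\<alpha>, (x, g # fs), \<beta>)"
    using assms(1) by (cases s) (auto simp: bw_elts emb_def X_def length_Suc_conv)
  have ok: "length fs = p" "okc 0 (map Gen (g # fs)) \<alpha> \<beta>" "tot (map Gen (g # fs)) \<alpha> \<beta> = f" "x = Cod K \<alpha>"
    using assms(1) by (auto simp: bw_elts s emb_def X_def)
  have fst: "fst (nerve_face K (Suc p) i (x, g # fs)) = (if i = 0 then Cod K g else x)"
    by (simp add: nerve_face_def)
  show ?thesis
  proof (cases "i = 0")
    case True
    have "okc 0 (map Gen fs) (Comp K g \<alpha>) \<beta>" "Cod K (Comp K g \<alpha>) = Cod K g"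
      using okc_ConsD[of 0 "Gen g" "map Gen fs" \<alpha> \<beta>] ok(2) by (simp_all del: lv_simps)
    then show ?thesis
      using True ok(1,3) by (simp add: s bw_elts bw_face_def nerve_face_def emb_def X_def)
  next
    case False
    then show ?thesis
      using okc_face[of i fs g \<alpha> \<beta> x] ok fst assms(2)
      unfolding s bw_elts bw_face_def emb_def X_def case_prod_unfold Let_def
      by (cases "i = Suc p") (simp_all del: okc.simps tot.simps lv_simps list.map last.simps)
  qed
qed

lemma bw_face_sact:
  assumes F: "(\<alpha>', f, \<beta>') \<in> Arr (Fac K)" and s: "s \<in> elts (bw_nerve K (Suc p)) f"
  shows "emb (bw_face K (Suc p) i (sact (bw_nerve K (Suc p)) (\<alpha>', f, \<beta>') s)) = gact \<alpha>' \<beta>' (emb (bw_face K (Suc p) i s))"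
proof -
  obtain \<alpha> x g fs \<beta> where e: "s = (\<alpha>, (x, g # fs), \<beta>)"
    using s by (cases s) (auto simp: bw_elts emb_def X_def length_Suc_conv)
  have ok: "okc 0 (map Gen (g # fs)) \<alpha> \<beta>" "tot (map Gen (g # fs)) \<alpha> \<beta> = f"
    using s by (auto simp: bw_elts e emb_def X_def)
  note en = okc_ends[OF ok F]
  have "Comp K g (Comp K \<alpha> \<alpha>') = Comp K (Comp K g \<alpha>) \<alpha>'"
    by (rule Comp_assoc) (use en okc_ConsD[of 0 "Gen g" "map Gen fs" \<alpha> \<beta>] ok in auto)
  moreover have "Comp K (Comp K \<beta>' \<beta>) (last (g # fs)) = Comp K \<beta>' (Comp K \<beta> (last (g # fs)))"
  proof -
    have "wlk K (Cod K \<alpha>) (g # fs)" "wend K (Cod K \<alpha>) (g # fs) = Dom K \<beta>" "\<beta> \<in> Arr K"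
      using ok(1) unfolding okc_Gen by auto
    moreover have "wlk K y hs \<Longrightarrow> hs \<noteq> [] \<Longrightarrow> last hs \<in> Arr K \<and> Cod K (last hs) = wend K y hs" for y hs
      by (induction hs arbitrary: y) auto
    ultimately have "last (g # fs) \<in> Arr K" "Cod K (last (g # fs)) = Dom K \<beta>" by (metis list.distinct(1))+
    then show ?thesis using \<open>\<beta> \<in> Arr K\<close> en by (intro Comp_assoc[symmetric]) auto
  qed
  ultimately show ?thesis
    by (simp add: e bw_face_def emb_def gact_def bw_nerve_def free_natsys_def case_prod_unfold)
qed

text \<open>The i-th coface on representatives in \<open>coch p 0\<close>, matched with
  \<open>bw_coface\<close> in \<open>bw_coface_tobw\<close>.\<close>

definition fcoch where "fcoch p i c s = c (emb (bw_face K (Suc p) i (unemb s)))"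

lemma fcoch_coch:
  assumes c: "c \<in> coch p 0" and i: "i \<le> Suc p"
  shows "fcoch p i c \<in> coch (Suc p) 0"
  unfolding coch_def
proof (intro CollectI allI ballI conjI impI)
  fix f s assume s: "s \<in> X (Suc p) 0 f"
  have u: "unemb s \<in> elts (bw_nerve K (Suc p)) f" by (rule unemb_elts[OF s])
  have x: "emb (bw_face K (Suc p) i (unemb s)) \<in> X p 0 f"
    using bw_face_elts[OF u i] by (simp add: bw_elts)
  show "fcoch p i c s \<in> carrier (grp D f)" unfolding fcoch_def by (rule coch_carrier[OF c x])
  fix \<alpha>' \<beta>' assume F: "(\<alpha>', f, \<beta>') \<in> Arr (Fac K)"
  have "unemb (gact \<alpha>' \<beta>' s) = unemb (emb (sact (bw_nerve K (Suc p)) (\<alpha>', f, \<beta>') (unemb s)))"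
    by (simp add: emb_sact emb_unemb[OF s])
  also have "\<dots> = sact (bw_nerve K (Suc p)) (\<alpha>', f, \<beta>') (unemb s)"
    by (rule unemb_emb[OF sact_elts[OF F u]])
  finally show "fcoch p i c (gact \<alpha>' \<beta>' s) = act D (\<alpha>', f, \<beta>') (fcoch p i c s)"
    unfolding fcoch_def using bw_face_sact[OF F u] coch_gact[OF c x F] by simp
qed

lemma bw_coface_tobw:
  assumes i: "i \<le> Suc p"
  shows "bw_coface K p i (tobw p c) = tobw (Suc p) (fcoch p i c)"
proof -
  have "tobw p c f (bw_face K (Suc p) i s) = fcoch p i c (emb s)"
    if "f \<in> Arr K" "s \<in> elts (bw_nerve K (Suc p)) f" for f s
    unfolding fcoch_def unemb_emb[OF that(2)] by (rule tobw_app[OF that(1) bw_face_elts[OF that(2) i]])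
  then show ?thesis
    unfolding bw_coface_def tobw_def[of "Suc p"] by (auto simp: fun_eq_iff restrict_def)
qed

lemma differential_tobw:
  assumes c: "c \<in> coch p 0"
  shows "differential (bw_cochains K D) (bw_coface K) p (tobw p c) = tobw (Suc p) (pb rowd c)"
proof -
  let ?C = "bw_cochains K D (Suc p)"
  interpret C: comm_group ?C by (rule comm_group_bw)
  let ?d = "differential (bw_cochains K D) (bw_coface K) p (tobw p c)"
  have cf: "bw_coface K p i (tobw p c) \<in> carrier ?C" if "i \<le> Suc p" for i
    unfolding bw_coface_tobw[OF that] by (rule tobw_carrier[OF fcoch_coch[OF c that]])
  have dc: "?d \<in> carrier ?C"
    unfolding differential_def alt_sum_def using cf by (intro C.finprod_closed) auto
  have "ofbw ?d s = pb rowd c s" if s: "s \<in> X (Suc p) 0 f" for f s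
  proof -
    have f: "f \<in> Arr K" by (rule X_Arr[OF s])
    have u: "unemb s \<in> elts (bw_nerve K (Suc p)) f" by (rule unemb_elts[OF s])
    obtain g fs where "snd (fst (snd (unemb s))) = g # fs" "length fs = p"
      using s by (cases s) (auto simp: unemb_def X_def length_Suc_conv)
    note sum = bw_face_sum[OF this(1)] this(2)
    have e: "bw_coface K p i (tobw p c) f (unemb s) = c (emb (bw_face K (Suc p) i (unemb s)))" if "i \<le> Suc p" for i
      using tobw_app[OF f u, of "fcoch p i c"] by (simp add: bw_coface_tobw[OF that] fcoch_def emb_unemb[OF s])
    have x: "emb (bw_face K (Suc p) i (unemb s)) \<in> X p 0 f" if "i \<le> Suc p" for i
      using bw_face_elts[OF u that] by (simp add: bw_elts)
    have "ofbw ?d s = ?d f (unemb s)" by (rule ofbw_X[OF s])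
    also have "\<dots> = alt_sum (grp D f) (Suc p) (\<lambda>i. bw_coface K p i (tobw p c) f (unemb s))"
      unfolding differential_def
      using alt_sum_hom[OF bw_pointwise[OF f u] comm_group_bw grp_D[OF f], of "Suc p" "\<lambda>i. bw_coface K p i (tobw p c)"] cf
      by simp
    also have "\<dots> = alt_sum (grp D f) (Suc p) (\<lambda>i. c (emb (bw_face K (Suc p) i (unemb s))))"
      unfolding alt_sum_def
      by (rule comm_monoid.finprod_cong')
        (use grp_D[OF f] e coch_carrier[OF c x] in \<open>auto simp: comm_group_def group.inv_closed\<close>)
    also have "\<dots> = linD f c (\<Sum>i\<le>Suc p. frag_cmul ((-1) ^ i) (frag_of (emb (bw_face K (Suc p) i (unemb s)))))"
      by (rule alt_sum_lin[OF grp_D[OF f]]) (rule coch_carrier[OF c x])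
    also have "\<dots> = pb rowd c s"
      using sum by (simp add: pb_X[OF s] emb_unemb[OF s] del: sum.atMost_Suc)
    finally show ?thesis .
  qed
  then have "tobw (Suc p) (ofbw ?d) = tobw (Suc p) (pb rowd c)"
    unfolding tobw_eq_iff by blast
  then show ?thesis using ofbw_coch(2)[OF dc] by simp
qed

lemma cocycles_bw:
  "cocycles (bw_cochains K D) (bw_coface K) p = tobw p ` {c. rcyc p 0 c}"
proof -
  have "tobw (Suc p) (pb rowd c) = tobw (Suc p) cone \<longleftrightarrow> rcyc p 0 c" if c: "c \<in> coch p 0" for c
  proof
    assume e: "tobw (Suc p) (pb rowd c) = tobw (Suc p) cone"
    show "rcyc p 0 c"
      unfolding rcyc_def
    proof (intro conjI ballI c)
      fix f \<zeta> assume f: "f \<in> Arr K" and z: "\<zeta> \<in> ch (Suc p) 0 f"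
      have "linD f c (rowd \<zeta>) = linD f (pb rowd c) \<zeta>" by (rule linD_pb[OF isop_rowd c z f, symmetric])
      also have "\<dots> = \<one>\<^bsub>grp D f\<^esub>"
        by (rule comm_group.lin_one[OF grp_D[OF f]])
          (use e z in \<open>auto simp: tobw_eq_iff chn_def cone_X subset_iff\<close>)
      finally show "linD f c (rowd \<zeta>) = \<one>\<^bsub>grp D f\<^esub>" .
    qed
  next
    assume "rcyc p 0 c"
    then have "linD f c (rowd (frag_of s)) = \<one>\<^bsub>grp D f\<^esub>" if "s \<in> X (Suc p) 0 f" for f s
      using rcycD[of p 0 c "frag_of s" f] X_Arr that by simp
    then show "tobw (Suc p) (pb rowd c) = tobw (Suc p) cone"
      unfolding tobw_eq_iff by (auto simp: pb_X cone_X)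
  qed
  then show ?thesis
    unfolding cocycles_def kernel_def carrier_bw_tobw
    by (auto simp: differential_tobw rcyc_coch simp flip: tobw_one)
qed

lemma coboundaries_bw:
  "coboundaries (bw_cochains K D) (bw_coface K) (Suc p) = (\<lambda>w. tobw (Suc p) (pb rowd w)) ` coch p 0"
  by (auto simp: coboundaries_def carrier_bw_tobw differential_tobw image_image)

end

section \<open>Derivations\<close>

text \<open>The bracketing is the one in which \<open>linD_rowg_two\<close> delivers the three faces
  of a 2-simplex; the right-hand side is the product rule of a derivation.\<close>

lemma (in comm_group) three_term_iff:
  assumes "a \<in> carrier G" "b \<in> carrier G" "w \<in> carrier G"
  shows "a \<otimes> inv (w \<otimes> inv b) = \<one> \<longleftrightarrow> w = b \<otimes> a"
  using inv_solve_right[OF one_closed assms(1), of "w \<otimes> inv b"] inv_solve_right[OF assms(1) assms(3) assms(2)]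
    assms m_comm[of a b] by auto

context nat_sys
begin

text \<open>The condition that sending u to the pair of \<open>ev u\<close> and \<open>x u\<close>
  respects composition in \<open>total_cat K D\<close>. Preservation of identities follows in
  \<open>der_Idn\<close>.\<close>

definition der where
  "der l x \<longleftrightarrow> (\<forall>u\<in>Arr (lv K l). x u \<in> carrier (grp D (ev u))) \<and>
     (\<forall>u\<in>Arr (lv K l). \<forall>v\<in>Arr (lv K l). Cod K (ev u) = Dom K (ev v) \<longrightarrow>
        x (wcmp K v u) = push K D (ev v) (ev u) (x u) \<otimes>\<^bsub>grp D (Comp K (ev v) (ev u))\<^esub> pull K D (ev u) (ev v) (x v))"

text \<open>Every generator with one entry arises from some \<open>iota u\<close> by the action of
  Fac K, so a 1-cochain amounts to its values on these; \<open>toc\<close> rebuilds the cochain from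
  the values.\<close>

fun toc where
  "toc x (\<alpha>, u # \<sigma>, \<beta>) = act D (\<alpha>, ev u, \<beta>) (x u)"
| "toc x (\<alpha>, [], \<beta>) = undefined"

definition iota where "iota u = (Idn K (Dom K (ev u)), [u], Idn K (Cod K (ev u)))"

lemma derD: "der l x \<Longrightarrow> u \<in> Arr (lv K l) \<Longrightarrow> x u \<in> carrier (grp D (ev u))"
  by (simp add: der_def)

lemma FacI:
  "\<alpha> \<in> Arr K \<Longrightarrow> f \<in> Arr K \<Longrightarrow> \<beta> \<in> Arr K \<Longrightarrow> Cod K \<alpha> = Dom K f \<Longrightarrow> Cod K f = Dom K \<beta> \<Longrightarrow> (\<alpha>, f, \<beta>) \<in> Arr (Fac K)"
  by (simp add: Fac_def)

lemma X1E:
  assumes "s \<in> X 1 l f"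
  obtains \<alpha> u \<beta> where "s = (\<alpha>, [u], \<beta>)" "u \<in> Arr (lv K l)" "ev u \<in> Arr K" "(\<alpha>, ev u, \<beta>) \<in> Arr (Fac K)"
    "f = Comp K \<beta> (Comp K (ev u) \<alpha>)"
proof -
  obtain \<alpha> u \<beta> where s: "s = (\<alpha>, [u], \<beta>)" "okc l [u] \<alpha> \<beta>" "tot [u] \<alpha> \<beta> = f"
    using assms by (cases s) (auto simp: X_def length_Suc_conv)
  then show thesis using okc_ConsD[OF s(2)] by (intro that[of \<alpha> u \<beta>]) (auto intro!: FacI)
qed

lemma X1I:
  assumes "u \<in> Arr (lv K l)" "(\<alpha>, ev u, \<beta>) \<in> Arr (Fac K)"
  shows "(\<alpha>, [u], \<beta>) \<in> X 1 l (Comp K \<beta> (Comp K (ev u) \<alpha>))"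
  using assms by (auto simp: X_def Fac_def Comp_in Cod_Comp)

lemma iota_Fac: "f \<in> Arr K \<Longrightarrow> (Idn K (Dom K f), f, Idn K (Cod K f)) \<in> Arr (Fac K)"
  by (simp add: Fac_def Dom_in Cod_in Idn_in Dom_Idn Cod_Idn)

lemma iota_X: "u \<in> Arr (lv K l) \<Longrightarrow> iota u \<in> X 1 l (ev u)"
  using X1I[of u l, OF _ iota_Fac] ev_facts(1)[of u l] by (simp add: iota_def Comp_Idn_left Comp_Idn_right)

lemma gact_iota: "(\<alpha>, ev u, \<beta>) \<in> Arr (Fac K) \<Longrightarrow> gact \<alpha> \<beta> (iota u) = (\<alpha>, [u], \<beta>)"
  using Comp_Idn_left[of \<alpha>] Comp_Idn_right[of \<beta>] by (auto simp: gact_def iota_def Fac_def)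

lemma coch1_gact:
  assumes "c \<in> coch 1 l" "u \<in> Arr (lv K l)" "(\<alpha>, ev u, \<beta>) \<in> Arr (Fac K)"
  shows "c (\<alpha>, [u], \<beta>) = act D (\<alpha>, ev u, \<beta>) (c (iota u))"
  using coch_gact[OF assms(1) iota_X[OF assms(2)] assms(3)] gact_iota[OF assms(3)] by simp

lemma toc_iota: "ev u \<in> Arr K \<Longrightarrow> x u \<in> carrier (grp D (ev u)) \<Longrightarrow> toc x (iota u) = x u"
  by (simp add: iota_def act_Idn)

lemma toc_coch:
  assumes x: "\<And>u. u \<in> Arr (lv K l) \<Longrightarrow> x u \<in> carrier (grp D (ev u))"
  shows "toc x \<in> coch 1 l"
  unfolding coch_def
proof (intro CollectI allI ballI conjI impI)
  fix f s assume s: "s \<in> X 1 l f"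
  then obtain \<alpha> u \<beta> where e: "s = (\<alpha>, [u], \<beta>)" and u: "u \<in> Arr (lv K l)" and F: "(\<alpha>, ev u, \<beta>) \<in> Arr (Fac K)"
    and f: "f = Comp K \<beta> (Comp K (ev u) \<alpha>)" by (rule X1E)
  show "toc x s \<in> carrier (grp D f)"
    using act_hom[OF F] x[OF u] by (auto simp: e f hom_def)
  fix \<alpha>' \<beta>' assume F': "(\<alpha>', f, \<beta>') \<in> Arr (Fac K)"
  show "toc x (gact \<alpha>' \<beta>' s) = act D (\<alpha>', f, \<beta>') (toc x s)"
    using act_act[OF F F'[unfolded f] x[OF u]] by (simp add: e gact_def f)
qed

lemma coch1_ext:
  assumes "b \<in> coch 1 l" "c \<in> coch 1 l" "\<And>u. u \<in> Arr (lv K l) \<Longrightarrow> b (iota u) = c (iota u)" "s \<in> X 1 l f"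
  shows "b s = c s"
proof -
  obtain \<alpha> u \<beta> where e: "s = (\<alpha>, [u], \<beta>)" and u: "u \<in> Arr (lv K l)" and F: "(\<alpha>, ev u, \<beta>) \<in> Arr (Fac K)"
    using assms(4) by (rule X1E)
  show ?thesis unfolding e coch1_gact[OF assms(1) u F] coch1_gact[OF assms(2) u F] assms(3)[OF u] ..
qed

lemma linD_cong:
  assumes "f \<in> Arr K" "\<zeta> \<in> ch p l f" "c \<in> coch p l" "\<And>s. s \<in> X p l f \<Longrightarrow> b s = c s"
  shows "linD f b \<zeta> = linD f c \<zeta>"
  by (rule comm_group.lin_cong[OF grp_D[OF assms(1)]])
    (use assms(2,4) in \<open>auto simp: chn_def intro!: coch_carrier[OF assms(3)]\<close>)

lemma linD_ext:
  assumes "f \<in> Arr K" "\<zeta> \<in> ch 1 l f" "b \<in> coch 1 l" "c \<in> coch 1 l"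
    "\<And>u. u \<in> Arr (lv K l) \<Longrightarrow> b (iota u) = c (iota u)"
  shows "linD f b \<zeta> = linD f c \<zeta>"
  by (rule linD_cong[OF assms(1,2,4)]) (rule coch1_ext[OF assms(3-5)])

lemma vd_iota:
  assumes u: "u \<in> Arr (lv K (Suc l))"
  shows "vd l (frag_of (iota u)) = (\<Sum>i\<le>l. frag_cmul ((-1) ^ i) (frag_of (iota (fc K l i u))))"
  unfolding vd_def
proof (rule sum.cong[OF refl])
  fix i assume "i \<in> {..l}"
  then have "ev (fc K l i u) = ev u" using ev_fc u by simp
  then show "frag_cmul ((-1) ^ i) (pmap (mapg (fc K l i)) (frag_of (iota u)))
      = frag_cmul ((-1) ^ i) (frag_of (iota (fc K l i u)))"
    by (simp add: mapg_def iota_def)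
qed

lemma linD_vd_iota:
  assumes c: "c \<in> coch 1 l" and u: "u \<in> Arr (lv K (Suc l))"
  shows "linD (ev u) c (vd l (frag_of (iota u))) = alt_sum (grp D (ev u)) l (\<lambda>i. c (iota (fc K l i u)))"
  unfolding vd_iota[OF u]
proof (rule alt_sum_lin[symmetric])
  show "comm_group (grp D (ev u))" by (rule grp_D[OF ev_facts(1)[OF u]])
  show "c (iota (fc K l i u)) \<in> carrier (grp D (ev u))" if "i \<le> l" for i
    using coch_carrier[OF c iota_X[OF fc_arr[OF that u]]] ev_fc[OF that u] by simp
qed

lemma rcyc_gens:
  assumes c: "c \<in> coch p l" and g: "\<And>f s. s \<in> X (Suc p) l f \<Longrightarrow> linD f c (rowg s) = \<one>\<^bsub>grp D f\<^esub>"
  shows "rcyc p l c"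
  unfolding rcyc_def
proof (intro conjI ballI c)
  fix f \<zeta> assume f: "f \<in> Arr K" and z: "\<zeta> \<in> ch (Suc p) l f"
  have "linD f c (rowd \<zeta>) = linD f (pb rowd c) \<zeta>" by (rule linD_pb[OF isop_rowd c z f, symmetric])
  also have "\<dots> = \<one>\<^bsub>grp D f\<^esub>"
  proof (rule comm_group.lin_one[OF grp_D[OF f]])
    fix s assume "s \<in> Poly_Mapping.keys \<zeta>"
    then have "s \<in> X (Suc p) l f" using z by (auto simp: chn_def)
    then show "pb rowd c s = \<one>\<^bsub>grp D f\<^esub>" using g by (simp add: pb_X)
  qed
  finally show "linD f c (rowd \<zeta>) = \<one>\<^bsub>grp D f\<^esub>" .
qed

lemma rowg_two: "rowg (\<alpha>, [u, v], \<beta>) = frag_of (Comp K (ev u) \<alpha>, [v], \<beta>)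
    - (frag_of (\<alpha>, [wcmp K v u], \<beta>) - frag_of (\<alpha>, [u], Comp K \<beta> (ev v)))"
  by (simp add: rem_Cons)

lemma linD_rowg_two:
  assumes c: "c \<in> coch 1 l" and s: "(\<alpha>, [u, v], \<beta>) \<in> X 2 l f"
  shows "linD f c (rowg (\<alpha>, [u, v], \<beta>)) = c (Comp K (ev u) \<alpha>, [v], \<beta>) \<otimes>\<^bsub>grp D f\<^esub>
    inv\<^bsub>grp D f\<^esub> (c (\<alpha>, [wcmp K v u], \<beta>) \<otimes>\<^bsub>grp D f\<^esub> inv\<^bsub>grp D f\<^esub> c (\<alpha>, [u], Comp K \<beta> (ev v)))"
    "(Comp K (ev u) \<alpha>, [v], \<beta>) \<in> X 1 l f" "(\<alpha>, [wcmp K v u], \<beta>) \<in> X 1 l f" "(\<alpha>, [u], Comp K \<beta> (ev v)) \<in> X 1 l f"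
proof -
  have f: "f \<in> Arr K" by (rule X_Arr[OF s])
  have ok: "okc l [u, v] \<alpha> \<beta>" "tot [u, v] \<alpha> \<beta> = f" using s by (auto simp: X_def)
  show 1: "(Comp K (ev u) \<alpha>, [v], \<beta>) \<in> X 1 l f" using ok by (simp add: X_def)
  show 2: "(\<alpha>, [wcmp K v u], \<beta>) \<in> X 1 l f" using okc_wcmp[OF ok(1)] ok(2) by (simp add: X_def)
  have "rem [v] \<beta> \<in> chn {(\<tau>, \<beta>'). \<forall>\<alpha>. okc l [v] \<alpha> \<beta> \<longrightarrow>
     okc l \<tau> \<alpha> \<beta>' \<and> length [v] = Suc (length \<tau>) \<and> tot \<tau> \<alpha> \<beta>' = tot [v] \<alpha> \<beta>}"
    using ok(1) by (intro rem_keys[of _ _ "Comp K (ev u) \<alpha>"]) auto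
  then show 3: "(\<alpha>, [u], Comp K \<beta> (ev v)) \<in> X 1 l f"
    using ok by (auto simp: X_def)
  show "linD f c (rowg (\<alpha>, [u, v], \<beta>)) = c (Comp K (ev u) \<alpha>, [v], \<beta>) \<otimes>\<^bsub>grp D f\<^esub>
    inv\<^bsub>grp D f\<^esub> (c (\<alpha>, [wcmp K v u], \<beta>) \<otimes>\<^bsub>grp D f\<^esub> inv\<^bsub>grp D f\<^esub> c (\<alpha>, [u], Comp K \<beta> (ev v)))"
    unfolding rowg_two
    using linD_diff[OF c, of "frag_of (\<alpha>, [wcmp K v u], \<beta>)" f "frag_of (\<alpha>, [u], Comp K \<beta> (ev v))"]
      linD_diff[OF c, of "frag_of (Comp K (ev u) \<alpha>, [v], \<beta>)" f "frag_of (\<alpha>, [wcmp K v u], \<beta>) - frag_of (\<alpha>, [u], Comp K \<beta> (ev v))"]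
      linD_of[OF c 1] linD_of[OF c 2] linD_of[OF c 3] 1 2 3 f by (simp add: chn_diff)
qed

lemma X2E:
  assumes "s \<in> X 2 l f"
  obtains \<alpha> u v \<beta> where "s = (\<alpha>, [u, v], \<beta>)" "u \<in> Arr (lv K l)" "v \<in> Arr (lv K l)" "Cod K (ev u) = Dom K (ev v)"
    "(\<alpha>, Comp K (ev v) (ev u), \<beta>) \<in> Arr (Fac K)" "f = Comp K \<beta> (Comp K (Comp K (ev v) (ev u)) \<alpha>)"
proof -
  obtain \<alpha> u v \<beta> where s: "s = (\<alpha>, [u, v], \<beta>)" "okc l [u, v] \<alpha> \<beta>" "tot [u, v] \<alpha> \<beta> = f"
    using assms by (cases s) (auto simp: X_def length_Suc_conv numeral_2_eq_2)
  have uv: "u \<in> Arr (lv K l)" "v \<in> Arr (lv K l)" "Cod K (ev u) = Dom K (ev v)"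
    using s(2) okc_ConsD[OF s(2)] by auto
  have w: "(\<alpha>, [wcmp K v u], \<beta>) \<in> X 1 l f" using okc_wcmp[OF s(2)] s(3) by (simp add: X_def)
  show thesis
    using w
  proof (rule X1E)
    fix \<alpha>' w \<beta>' assume "(\<alpha>, [wcmp K v u], \<beta>) = (\<alpha>', [w], \<beta>')" "(\<alpha>', ev w, \<beta>') \<in> Arr (Fac K)"
      "f = Comp K \<beta>' (Comp K (ev w) \<alpha>')"
    then show thesis
      using that[OF s(1) uv] wcmp_facts(2)[OF uv] by simp
  qed
qed

text \<open>The three faces of a \<open>2\<close>-simplex give the three terms of the derivation rule, each acted upon
  by the ends.\<close>

lemma act_push_pull:
  assumes f: "f \<in> Arr K" and g: "g \<in> Arr K" and fg: "Cod K f = Dom K g"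
    and F: "(\<alpha>, Comp K g f, \<beta>) \<in> Arr (Fac K)"
  shows "x \<in> carrier (grp D f) \<Longrightarrow> act D (\<alpha>, Comp K g f, \<beta>) (push K D g f x) = act D (\<alpha>, f, Comp K \<beta> g) x"
    and "y \<in> carrier (grp D g) \<Longrightarrow> act D (\<alpha>, Comp K g f, \<beta>) (pull K D f g y) = act D (Comp K f \<alpha>, g, \<beta>) y"
    and "x \<in> carrier (grp D f) \<Longrightarrow> push K D g f x \<in> carrier (grp D (Comp K g f))"
    and "y \<in> carrier (grp D g) \<Longrightarrow> pull K D f g y \<in> carrier (grp D (Comp K g f))"
proof -
  have a: "\<alpha> \<in> Arr K" "\<beta> \<in> Arr K" "Cod K \<alpha> = Dom K f" "Dom K \<beta> = Cod K g"
    using F f g fg by (auto simp: Fac_def Dom_Comp Cod_Comp)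
  have 1: "(Idn K (Dom K f), f, g) \<in> Arr (Fac K)" "(f, g, Idn K (Cod K g)) \<in> Arr (Fac K)"
    using f g fg by (auto simp: Fac_def Dom_in Cod_in Idn_in Dom_Idn Cod_Idn)
  have e: "Comp K g (Comp K f (Idn K (Dom K f))) = Comp K g f" "Comp K (Idn K (Cod K g)) (Comp K g f) = Comp K g f"
    using f g fg Comp_Idn_right[of f] Comp_Idn_left[of "Comp K g f"] by (simp_all add: Comp_in Cod_Comp)
  have i: "Comp K (Idn K (Dom K f)) \<alpha> = \<alpha>" "Comp K \<beta> (Idn K (Cod K g)) = \<beta>"
    using a Comp_Idn_left[of \<alpha>] Comp_Idn_right[of \<beta>] by simp_all
  show "act D (\<alpha>, Comp K g f, \<beta>) (push K D g f x) = act D (\<alpha>, f, Comp K \<beta> g) x" if "x \<in> carrier (grp D f)"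
    using act_act[OF 1(1) _ that, of \<alpha> \<beta>] F by (simp add: e i push_def)
  show "act D (\<alpha>, Comp K g f, \<beta>) (pull K D f g y) = act D (Comp K f \<alpha>, g, \<beta>) y" if "y \<in> carrier (grp D g)"
    using act_act[OF 1(2) _ that, of \<alpha> \<beta>] F by (simp add: e i pull_def)
  show "push K D g f x \<in> carrier (grp D (Comp K g f))" if "x \<in> carrier (grp D f)"
    using act_hom[OF 1(1)] that by (auto simp: e push_def hom_def)
  show "pull K D f g y \<in> carrier (grp D (Comp K g f))" if "y \<in> carrier (grp D g)"
    using act_hom[OF 1(2)] that by (auto simp: e pull_def hom_def)
qed

lemma toc_rcyc:
  assumes "der l x" shows "rcyc 1 l (toc x)"
proof (rule rcyc_gens)
  show c: "toc x \<in> coch 1 l" using derD[OF assms] by (rule toc_coch)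
  fix f s assume "s \<in> X (Suc 1) l f"
  then have s2: "s \<in> X 2 l f" by (simp add: numeral_2_eq_2)
  then obtain \<alpha> u v \<beta> where s: "s = (\<alpha>, [u, v], \<beta>)" and uv: "u \<in> Arr (lv K l)" "v \<in> Arr (lv K l)" "Cod K (ev u) = Dom K (ev v)"
    and F: "(\<alpha>, Comp K (ev v) (ev u), \<beta>) \<in> Arr (Fac K)" and f: "f = Comp K \<beta> (Comp K (Comp K (ev v) (ev u)) \<alpha>)"
    by (rule X2E)
  have fA: "f \<in> Arr K" by (rule X_Arr[OF s2])
  interpret A: comm_group "grp D f" by (rule grp_D[OF fA])
  note e = ev_facts(1)[OF uv(1)] ev_facts(1)[OF uv(2)] uv(3)
  note pp = act_push_pull[OF e F]
  have xu: "x u \<in> carrier (grp D (ev u))" "x v \<in> carrier (grp D (ev v))" using derD[OF assms] uv by auto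
  note s2' = s2[unfolded s]
  have "toc x (\<alpha>, [wcmp K v u], \<beta>) = act D (\<alpha>, Comp K (ev v) (ev u), \<beta>)
      (push K D (ev v) (ev u) (x u) \<otimes>\<^bsub>grp D (Comp K (ev v) (ev u))\<^esub> pull K D (ev u) (ev v) (x v))"
    using assms uv wcmp_facts(2)[OF uv] by (simp add: der_def)
  also have "\<dots> = toc x (\<alpha>, [u], Comp K \<beta> (ev v)) \<otimes>\<^bsub>grp D f\<^esub> toc x (Comp K (ev u) \<alpha>, [v], \<beta>)"
    using act_hom[OF F] pp xu by (simp add: hom_def f)
  finally show "linD f (toc x) (rowg s) = \<one>\<^bsub>grp D f\<^esub>"
    using coch_carrier[OF c linD_rowg_two(2)[OF c s2']] coch_carrier[OF c linD_rowg_two(4)[OF c s2']]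
      coch_carrier[OF c linD_rowg_two(3)[OF c s2']]
    unfolding s linD_rowg_two(1)[OF c s2'] by (simp only: A.three_term_iff)
qed

lemma rcyc_der:
  assumes c: "rcyc 1 l c" shows "der l (\<lambda>u. c (iota u))"
  unfolding der_def
proof (intro conjI ballI impI)
  note cc = rcyc_coch[OF c]
  show "c (iota u) \<in> carrier (grp D (ev u))" if "u \<in> Arr (lv K l)" for u
    by (rule coch_carrier[OF cc iota_X[OF that]])
  fix u v assume uv: "u \<in> Arr (lv K l)" "v \<in> Arr (lv K l)" "Cod K (ev u) = Dom K (ev v)"
  note e = ev_facts(1)[OF uv(1)] ev_facts(1)[OF uv(2)] uv(3)
  let ?f = "Comp K (ev v) (ev u)" and ?a = "Idn K (Dom K (ev u))" and ?b = "Idn K (Cod K (ev v))"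
  have f: "?f \<in> Arr K" "Dom K ?f = Dom K (ev u)" "Cod K ?f = Cod K (ev v)" using e by (auto simp: Comp_in Dom_Comp Cod_Comp)
  interpret A: comm_group "grp D ?f" by (rule grp_D[OF f(1)])
  have i: "Comp K (ev u) ?a = ev u" "Comp K ?b (ev v) = ev v" "Comp K ?b ?f = ?f"
    using e f Comp_Idn_right[of "ev u"] Comp_Idn_left[of "ev v"] Comp_Idn_left[of ?f] by auto
  have ab: "?a \<in> Arr K" "?b \<in> Arr K" "Cod K ?a = Dom K (ev u)" "Dom K ?b = Cod K (ev v)"
    using e by (auto simp: Dom_in Cod_in Idn_in Dom_Idn Cod_Idn)
  have "okc l [u, v] ?a ?b" "tot [u, v] ?a ?b = ?f"
    using uv ab e i f by simp_all
  then have s: "(?a, [u, v], ?b) \<in> X 2 l ?f" by (simp add: X_def)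
  note two = linD_rowg_two[OF cc s, unfolded i]
  have k: "c (ev u, [v], ?b) = pull K D (ev u) (ev v) (c (iota v))" "c (?a, [u], ev v) = push K D (ev v) (ev u) (c (iota u))"
    using coch1_gact[OF cc uv(2), of "ev u" ?b] coch1_gact[OF cc uv(1), of ?a "ev v"] ab e
    by (simp_all add: FacI push_def pull_def)
  have w: "(?a, [wcmp K v u], ?b) = iota (wcmp K v u)"
    using wcmp_facts(2)[OF uv] f by (simp add: iota_def)
  have "linD ?f c (rowg (?a, [u, v], ?b)) = \<one>\<^bsub>grp D ?f\<^esub>"
    using rcycD[OF c, of "frag_of (?a, [u, v], ?b)" ?f] s f(1) by (simp add: numeral_2_eq_2 del: rowg.simps)
  then have "pull K D (ev u) (ev v) (c (iota v)) \<otimes>\<^bsub>grp D ?f\<^esub>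
    inv\<^bsub>grp D ?f\<^esub> (c (iota (wcmp K v u)) \<otimes>\<^bsub>grp D ?f\<^esub> inv\<^bsub>grp D ?f\<^esub> push K D (ev v) (ev u) (c (iota u))) = \<one>\<^bsub>grp D ?f\<^esub>"
    using two(1) by (simp add: k w del: rowg.simps)
  moreover have "pull K D (ev u) (ev v) (c (iota v)) \<in> carrier (grp D ?f)" "c (iota (wcmp K v u)) \<in> carrier (grp D ?f)"
    "push K D (ev v) (ev u) (c (iota u)) \<in> carrier (grp D ?f)"
    using coch_carrier[OF cc two(2)] coch_carrier[OF cc two(3)] coch_carrier[OF cc two(4)] by (simp_all add: k w)
  ultimately show "c (iota (wcmp K v u)) = push K D (ev v) (ev u) (c (iota u)) \<otimes>\<^bsub>grp D ?f\<^esub> pull K D (ev u) (ev v) (c (iota v))"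
    by (simp only: A.three_term_iff)
qed

text \<open>An identity is idempotent and acts trivially from both sides, so the value there equals
  its own double.\<close>

lemma der_Idn:
  assumes x: "der l x" and a: "a \<in> Ob K"
  shows "x (Idn (lv K l) a) = \<one>\<^bsub>grp D (Idn K a)\<^esub>"
proof -
  let ?e = "Idn (lv K l) a"
  have e: "?e \<in> Arr (lv K l)" "ev ?e = Idn K a" "Comp (lv K l) ?e ?e = ?e"
    using category.Idn_in[OF cat_lv] isfun_ev[of l] a category.Comp_Idn_right[OF cat_lv, of ?e l] category.Dom_Idn[OF cat_lv]
    by (auto simp: isfun_def Ob_lv)
  have i: "Idn K a \<in> Arr K" "Dom K (Idn K a) = a" "Cod K (Idn K a) = a" "Comp K (Idn K a) (Idn K a) = Idn K a"
    using a Comp_Idn_left[of "Idn K a"] by (auto simp: Idn_in Dom_Idn Cod_Idn)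
  interpret A: comm_group "grp D (Idn K a)" by (rule grp_D[OF i(1)])
  have xe: "x ?e \<in> carrier (grp D (Idn K a))" using derD[OF x e(1)] e(2) by simp
  have "x (wcmp K ?e ?e) = push K D (Idn K a) (Idn K a) (x ?e) \<otimes>\<^bsub>grp D (Idn K a)\<^esub> pull K D (Idn K a) (Idn K a) (x ?e)"
    using x e i unfolding der_def by simp
  moreover have "wcmp K ?e ?e = ?e" using Comp_lv[OF e(1) e(1)] e(3) by simp
  moreover have "act D (Idn K a, Idn K a, Idn K a) (x ?e) = x ?e"
    using act_Idn[OF i(1) xe] i by simp
  ultimately have "x ?e = x ?e \<otimes>\<^bsub>grp D (Idn K a)\<^esub> x ?e"
    using i by (simp add: push_def pull_def)
  then show ?thesis using xe A.l_cancel_one' by metis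
qed

end

section \<open>Maps into Eilenberg-Mac Lane objects\<close>

definition good :: "nat \<Rightarrow> nat list \<Rightarrow> bool" where
  "good m xs \<longleftrightarrow> sorted_wrt (<) xs \<and> set xs \<subseteq> {..m}"

lemma std_good: "xs \<in> std_simplices m n \<and> distinct xs \<longleftrightarrow> good m xs \<and> length xs = Suc n"
  by (auto simp: std_simplices_def good_def strict_sorted_iff)

lemma std_goodD: "xs \<in> std_simplices m n \<Longrightarrow> distinct xs \<Longrightarrow> good m xs \<and> length xs = Suc n \<and> xs \<noteq> []"
  by (auto simp: std_simplices_def good_def strict_sorted_iff)

lemma good_full: "good m xs \<Longrightarrow> {..m} \<subseteq> set xs \<Longrightarrow> xs = [0..<Suc m]"
proof (rule sorted_distinct_set_unique)
  assume g: "good m xs" "{..m} \<subseteq> set xs"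
  show "sorted xs" "distinct xs" using g(1) by (simp_all add: good_def strict_sorted_iff)
  have "set xs = {..m}" using g by (simp add: good_def subset_antisym)
  then show "set xs = set [0..<Suc m]" by (simp add: atLeast0LessThan lessThan_Suc_atMost del: upt_Suc)
qed (rule sorted_upt distinct_upt)+

lemma codegen_mono: "x \<noteq> j \<Longrightarrow> y \<noteq> j \<Longrightarrow> x < y \<Longrightarrow> codegen j x < codegen j y"
  by (auto simp: codegen_def)

lemma good_codegen:
  assumes "good (Suc m) xs" "j \<notin> set xs" "j \<le> Suc m"
  shows "good m (map (codegen j) xs)" "map (coface j) (map (codegen j) xs) = xs"
proof -
  have "sorted_wrt (\<lambda>x y. codegen j x < codegen j y) xs"
    by (rule sorted_wrt_mono_rel[of _ "(<)"]) (use assms in \<open>auto simp: good_def intro!: codegen_mono\<close>)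
  moreover have "codegen j y \<le> m" if "y \<in> set xs" for y
    using assms that by (cases "y = j") (auto simp: good_def codegen_def)
  ultimately show "good m (map (codegen j) xs)" by (auto simp: good_def sorted_wrt_map)
  show "map (coface j) (map (codegen j) xs) = xs"
    using assms(2) by (induction xs) (auto simp: coface_def codegen_def)
qed

lemma good_coface:
  assumes "good m xs"
  shows "good (Suc m) (map (coface i) xs)" "i \<notin> set (map (coface i) xs)" "map (codegen i) (map (coface i) xs) = xs"
proof -
  have "sorted_wrt (\<lambda>x y. coface i x < coface i y) xs"
    by (rule sorted_wrt_mono_rel[of _ "(<)"]) (use assms in \<open>auto simp: good_def coface_def\<close>)
  then show "good (Suc m) (map (coface i) xs)"
    using assms by (auto simp: good_def sorted_wrt_map coface_def)
  show "i \<notin> set (map (coface i) xs)" "map (codegen i) (map (coface i) xs) = xs"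
    by (induction xs) (auto simp: coface_def codegen_def)
qed

lemma codegen_codegen: "i < j \<Longrightarrow> y \<noteq> i \<Longrightarrow> y \<noteq> j \<Longrightarrow> codegen i (codegen j y) = codegen (j - 1) (codegen i y)"
  by (auto simp: codegen_def)

lemma delete_nth_map: "delete_nth i (map f xs) = map f (delete_nth i xs)"
  by (simp add: delete_nth_def take_map drop_map)

lemma set_delete_nth: "set (delete_nth i xs) \<subseteq> set xs"
  by (auto simp: delete_nth_def dest: in_set_takeD in_set_dropD)

lemma length_delete_nth: "i < length xs \<Longrightarrow> length (delete_nth i xs) = length xs - 1"
  by (simp add: delete_nth_def)

lemma good_delete_nth: "good m xs \<Longrightarrow> good m (delete_nth i xs)"
proof -
  assume g: "good m xs"
  then have "sorted_wrt (<) (take i xs @ drop i xs)" by (simp add: good_def)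
  then have "sorted_wrt (<) (take i xs @ drop (Suc i) xs)"
    using set_drop_subset_set_drop[of i "Suc i" xs] sorted_wrt_drop[of "(<)" xs "Suc i"] g
    unfolding sorted_wrt_append good_def by auto
  then show ?thesis
    using g set_delete_nth[of i xs] by (auto simp: good_def delete_nth_def)
qed

lemma isfun_cong:
  assumes "isfun C C' F" "category C" "\<And>u. u \<in> Arr C \<Longrightarrow> G u = F u"
  shows "isfun C C' G"
  using assms(1) category.Idn_in[OF assms(2)] category.Comp_in[OF assms(2)] unfolding isfun_def by (simp add: assms(3))

context small_cat
begin

text \<open>\<open>res m xs u\<close> is the face of the \<open>m\<close>-simplex \<open>u\<close> of the resolution spanned by the vertices \<open>xs\<close>.\<close>

primrec res :: "nat \<Rightarrow> nat list \<Rightarrow> ('o, 'a) walks \<Rightarrow> ('o, 'a) walks" where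
  "res 0 xs u = u"
| "res (Suc m) xs u = (if {..Suc m} \<subseteq> set xs then u
     else let j = (LEAST j. j \<notin> set xs) in res m (map (codegen j) xs) (fc K (Suc m) j u))"

lemma least_missing:
  assumes "\<not> {..Suc m} \<subseteq> set xs"
  shows "(LEAST j. j \<notin> set xs) \<notin> set xs" "(LEAST j. j \<notin> set xs) \<le> Suc m" "j \<notin> set xs \<Longrightarrow> (LEAST j. j \<notin> set xs) \<le> j"
proof -
  obtain i where i: "i \<notin> set xs" "i \<le> Suc m" using assms by auto
  show "(LEAST j. j \<notin> set xs) \<notin> set xs" by (rule LeastI) (rule i)
  show "(LEAST j. j \<notin> set xs) \<le> Suc m" using Least_le[of "\<lambda>j. j \<notin> set xs" i] i by simp
  show "j \<notin> set xs \<Longrightarrow> (LEAST j. j \<notin> set xs) \<le> j" by (rule Least_le)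
qed

lemma codegen_notin: "j \<notin> set xs \<Longrightarrow> i \<noteq> j \<Longrightarrow> i \<notin> set xs \<Longrightarrow> codegen j i \<notin> set (map (codegen j) xs)"
proof
  assume j: "j \<notin> set xs" and i: "i \<noteq> j" "i \<notin> set xs" and "codegen j i \<in> set (map (codegen j) xs)"
  then obtain y where y: "y \<in> set xs" "codegen j y = codegen j i" by auto
  then have "y \<noteq> i" "y \<noteq> j" using i j by auto
  then show False
    using codegen_mono[of y j i] codegen_mono[of i j y] i(1) y(2) by (cases y i rule: linorder_cases) auto
qed

text \<open>\<open>res\<close> removes the least missing vertex first, but by \<open>fc_fc\<close>
  the order is irrelevant. Later proofs use the freedom to choose the vertex.\<close>

lemma res_any:
  "good (Suc m) xs \<Longrightarrow> xs \<noteq> [] \<Longrightarrow> j \<le> Suc m \<Longrightarrow> j \<notin> set xs \<Longrightarrow> u \<in> Arr (lv K (Suc (Suc m))) \<Longrightarrow>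
    res (Suc m) xs u = res m (map (codegen j) xs) (fc K (Suc m) j u)"
proof (induction m arbitrary: xs j u)
  case 0
  have nf: "\<not> {..Suc 0} \<subseteq> set xs" using 0 by auto
  \<comment> \<open>A nonempty xs contains one of the vertices 0 and 1, so at most one of them is
    missing.\<close>
  have "i = j" if "i \<notin> set xs" "i \<le> Suc 0" for i
  proof (rule ccontr)
    assume "i \<noteq> j"
    then have "{..Suc 0} = {i, j}" using that 0(3) by auto
    then show False using 0(1,2,4) that(1) by (cases xs) (auto simp: good_def)
  qed
  then have "(LEAST j. j \<notin> set xs) = j" using least_missing[OF nf] by blast
  then show ?case using nf by simp
next
  case (Suc m)
  define i where "i = (LEAST j. j \<notin> set xs)"
  have nf: "\<not> {..Suc (Suc m)} \<subseteq> set xs" using Suc.prems by auto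
  note i = least_missing[OF nf, folded i_def]
  have e: "res (Suc (Suc m)) xs u = res (Suc m) (map (codegen i) xs) (fc K (Suc (Suc m)) i u)"
    using nf by (simp add: i_def Let_def del: res.simps) (simp add: Let_def)
  show ?case
  proof (cases "i = j")
    case True
    then show ?thesis using e by simp
  next
    case False
    then have ij: "i < j" using i(3)[OF Suc.prems(4)] by simp
    have a: "res (Suc m) (map (codegen i) xs) (fc K (Suc (Suc m)) i u)
        = res m (map (codegen (j - 1)) (map (codegen i) xs)) (fc K (Suc m) (j - 1) (fc K (Suc (Suc m)) i u))"
    proof (rule Suc.IH)
      show "good (Suc m) (map (codegen i) xs)" by (rule good_codegen(1)[OF Suc.prems(1) i(1,2)])
      show "j - 1 \<notin> set (map (codegen i) xs)"
        using codegen_notin[OF i(1), of j] False Suc.prems(4) ij by (simp add: codegen_def)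
      show "fc K (Suc (Suc m)) i u \<in> Arr (lv K (Suc (Suc m)))" by (rule fc_arr[OF i(2) Suc.prems(5)])
    qed (use Suc.prems ij in auto)
    have b: "res (Suc m) (map (codegen j) xs) (fc K (Suc (Suc m)) j u)
        = res m (map (codegen i) (map (codegen j) xs)) (fc K (Suc m) i (fc K (Suc (Suc m)) j u))"
    proof (rule Suc.IH)
      show "good (Suc m) (map (codegen j) xs)" by (rule good_codegen(1)[OF Suc.prems(1,4,3)])
      show "i \<notin> set (map (codegen j) xs)"
        using codegen_notin[OF Suc.prems(4), of i] False i(1) ij by (simp add: codegen_def)
      show "fc K (Suc (Suc m)) j u \<in> Arr (lv K (Suc (Suc m)))" by (rule fc_arr[OF Suc.prems(3,5)])
    qed (use Suc.prems ij in auto)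
    have "map (codegen i) (map (codegen j) xs) = map (codegen (j - 1)) (map (codegen i) xs)"
      unfolding map_map o_def
      by (rule map_cong[OF refl], rule codegen_codegen[OF ij]) (use i(1) Suc.prems(4) in auto)
    moreover have "fc K (Suc m) i (fc K (Suc (Suc m)) j u) = fc K (Suc m) (j - 1) (fc K (Suc (Suc m)) i u)"
      by (rule fc_fc[OF ij Suc.prems(3,5)])
    ultimately show ?thesis unfolding e a b by (simp only:)
  qed
qed

lemma res_full: "good m xs \<Longrightarrow> {..m} \<subseteq> set xs \<Longrightarrow> res m xs u = u"
  by (cases m) auto

text \<open>A nonempty \<open>good\<close> list becomes the full simplex by removing missing
  vertices one at a time. This matches \<open>res_any\<close>, so statements about
  \<open>res\<close> reduce to statements about single faces.\<close>

lemma good_induct [consumes 2, case_names full miss]: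
  assumes "good m xs" "xs \<noteq> []"
    and full: "\<And>m xs. good m xs \<Longrightarrow> {..m} \<subseteq> set xs \<Longrightarrow> xs = [0..<Suc m] \<Longrightarrow> P m xs"
    and miss: "\<And>m xs j. good (Suc m) xs \<Longrightarrow> xs \<noteq> [] \<Longrightarrow> j \<le> Suc m \<Longrightarrow> j \<notin> set xs \<Longrightarrow> good m (map (codegen j) xs) \<Longrightarrow>
      P m (map (codegen j) xs) \<Longrightarrow> P (Suc m) xs"
  shows "P m xs"
proof -
  have "good m xs \<Longrightarrow> xs \<noteq> [] \<Longrightarrow> P m xs" for m xs
  proof (induction m arbitrary: xs)
    case 0
    then have "hd xs \<in> set xs" by simp
    then have "0 \<in> set xs" using 0(1) by (auto simp: good_def)
    then have f: "{..0} \<subseteq> set xs" by simp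
    show ?case by (rule full[OF 0(1) f good_full[OF 0(1) f]])
  next
    case (Suc m)
    show ?case
    proof (cases "{..Suc m} \<subseteq> set xs")
      case True
      show ?thesis by (rule full[OF Suc.prems(1) True good_full[OF Suc.prems(1) True]])
    next
      case False
      then obtain j where j: "j \<le> Suc m" "j \<notin> set xs" by auto
      have "good m (map (codegen j) xs)" by (rule good_codegen(1)[OF Suc.prems(1) j(2,1)])
      then show ?thesis using miss[OF Suc.prems j] Suc.IH Suc.prems(2) by simp
    qed
  qed
  then show ?thesis using assms(1,2) .
qed

lemma res_fun: "good m xs \<Longrightarrow> xs \<noteq> [] \<Longrightarrow> isfun (lv K (Suc m)) (lv K (length xs)) (res m xs) \<and>
    (\<forall>u\<in>Arr (lv K (Suc m)). ev (res m xs u) = ev u)"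
proof (induction rule: good_induct)
  case (full m xs)
  have "res m xs u = u" for u by (rule res_full[OF full(1,2)])
  then have "res m xs = (\<lambda>u. u)" "length xs = Suc m" using full(3) by auto
  then show ?case by (simp add: isfun_def del: lv_simps)
next
  case (miss m xs j)
  have e: "res (Suc m) xs u = res m (map (codegen j) xs) (fc K (Suc m) j u)" if "u \<in> Arr (lv K (Suc (Suc m)))" for u
    by (rule res_any[OF miss(1-4) that])
  have f: "isfun (lv K (Suc (Suc m))) (lv K (length xs)) (\<lambda>u. res m (map (codegen j) xs) (fc K (Suc m) j u))"
    by (rule isfun_comp[OF fc_fun[OF miss(3)]]) (use miss(6) in \<open>simp del: lv_simps\<close>)
  have "isfun (lv K (Suc (Suc m))) (lv K (length xs)) (res (Suc m) xs)"
    by (rule isfun_cong[OF f cat_lv e])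
  moreover have "ev (res (Suc m) xs u) = ev u" if u: "u \<in> Arr (lv K (Suc (Suc m)))" for u
    using miss(6) fc_arr[OF miss(3) u] ev_fc[OF miss(3) u] e[OF u] by simp
  ultimately show ?case by blast
qed

lemma res_arr: "good m xs \<Longrightarrow> length xs = Suc n \<Longrightarrow> u \<in> Arr (lv K (Suc m)) \<Longrightarrow>
    res m xs u \<in> Arr (lv K (Suc n)) \<and> ev (res m xs u) = ev u"
  using res_fun[of m xs] by (cases xs) (auto simp: isfun_def simp del: lv_simps)

lemma res_wcmp:
  assumes "good m xs" "xs \<noteq> []" "u \<in> Arr (lv K (Suc m))" "v \<in> Arr (lv K (Suc m))" "Cod K (ev u) = Dom K (ev v)"
  shows "res m xs (wcmp K v u) = wcmp K (res m xs v) (res m xs u)"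
  using isfun_wcmp[of "Suc m" "length xs" "res m xs", OF _ assms(3-5)] res_fun[OF assms(1,2)] by blast

text \<open>The vertices i and i + 1 that the degeneracy identifies both occur in xs. Removing a
  missing vertex, which is neither of them, commutes with the degeneracy up to index shifts, until
  no vertex is missing.\<close>

lemma res_deg:
  "good m' xs \<Longrightarrow> xs \<noteq> [] \<Longrightarrow> \<forall>m i u. m' = Suc m \<longrightarrow> i \<le> m \<longrightarrow> i \<in> set xs \<longrightarrow> Suc i \<in> set xs \<longrightarrow> u \<in> Arr (lv K (Suc m)) \<longrightarrow>
    (\<exists>l j w. length xs = Suc (Suc l) \<and> j \<le> l \<and> w \<in> Arr (lv K (Suc l)) \<and> ev w = ev u \<and> res m' xs (dg K m i u) = dg K l j w)"
proof (induction rule: good_induct)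
  case (full m' xs)
  then show ?case by (auto simp: res_full simp del: lv_simps)
next
  case (miss m' xs p)
  show ?case
  proof (intro allI impI)
    fix m i u assume m: "Suc m' = Suc m" and i: "i \<le> m" "i \<in> set xs" "Suc i \<in> set xs" and u: "u \<in> Arr (lv K (Suc m))"
    have pi: "p \<noteq> i" "p \<noteq> Suc i" using i miss(4) by auto
    then obtain k where k: "m = Suc k" using i miss(3) m by (cases m) auto
    have e: "res (Suc m') xs (dg K m i u) = res m' (map (codegen p) xs) (fc K (Suc m') p (dg K m i u))"
      by (rule res_any[OF miss(1-4)]) (use dg_arr[OF i(1) u] m in simp)
    show "\<exists>l j w. length xs = Suc (Suc l) \<and> j \<le> l \<and> w \<in> Arr (lv K (Suc l)) \<and> ev w = ev u \<and> res (Suc m') xs (dg K m i u) = dg K l j w"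
    proof (cases "p < i")
      case True
      have u': "fc K (Suc k) p u \<in> Arr (lv K (Suc k))" "ev (fc K (Suc k) p u) = ev u"
        using fc_arr[of p "Suc k" u] ev_fc[of p "Suc k" u] True i u k by auto
      have c: "codegen p i = i - 1" "codegen p (Suc i) = i" using True by (auto simp: codegen_def)
      have "i - 1 \<in> set (map (codegen p) xs)" "Suc (i - 1) \<in> set (map (codegen p) xs)"
        using i c True by (force simp: image_iff)+
      moreover have "fc K (Suc m') p (dg K m i u) = dg K k (i - 1) (fc K (Suc k) p u)"
        using fc_dg_less[OF True, of k u] i u k m by simp
      ultimately show ?thesis
        using miss(6)[rule_format, of k "i - 1" "fc K (Suc k) p u"] u' i k m e True by auto
    next
      case False
      then have p: "Suc i < p" using pi by simp
      have u': "fc K (Suc k) (p - 1) u \<in> Arr (lv K (Suc k))" "ev (fc K (Suc k) (p - 1) u) = ev u"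
        using fc_arr[of "p - 1" "Suc k" u] ev_fc[of "p - 1" "Suc k" u] p miss(3) u k m by auto
      have c: "codegen p i = i" "codegen p (Suc i) = Suc i" using p by (auto simp: codegen_def)
      have "i \<in> set (map (codegen p) xs)" "Suc i \<in> set (map (codegen p) xs)"
        using i c by (force simp: image_iff)+
      moreover have "fc K (Suc m') p (dg K m i u) = dg K k i (fc K (Suc k) (p - 1) u)"
        using fc_dg_greater[OF p, of k u] miss(3) u k m by simp
      ultimately show ?thesis
        using miss(6)[rule_format, of k i "fc K (Suc k) (p - 1) u"] u' i k m e p miss(3) by auto
    qed
  qed
qed

text \<open>In the full simplex deleting the i-th entry removes the vertex i, which is a single
  face. Otherwise a missing vertex is removed on both sides first.\<close>

lemma res_delete_nth:
  "good m xs \<Longrightarrow> xs \<noteq> [] \<Longrightarrow> \<forall>n i u. length xs = Suc (Suc n) \<longrightarrow> i \<le> Suc n \<longrightarrow> u \<in> Arr (lv K (Suc m)) \<longrightarrow>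
    res m (delete_nth i xs) u = fc K (Suc n) i (res m xs u)"
proof (induction rule: good_induct)
  case (full m xs)
  show ?case
  proof (intro allI impI)
    fix n i u assume n: "length xs = Suc (Suc n)" and i: "i \<le> Suc n" and u: "u \<in> Arr (lv K (Suc m))"
    have m: "m = Suc n" using full(3) n by simp
    have d: "delete_nth i xs = map (coface i) [0..<Suc n]"
      using i unfolding full(3) m
      by (intro nth_equalityI) (auto simp: delete_nth_def nth_append coface_def simp del: upt_Suc)
    have g: "good n [0..<Suc n]" by (auto simp: good_def strict_sorted_iff simp del: upt_Suc)
    have "res (Suc n) (map (coface i) [0..<Suc n]) u = res n (map (codegen i) (map (coface i) [0..<Suc n])) (fc K (Suc n) i u)"
      by (rule res_any) (use good_coface[OF g, of i] i u m in \<open>simp_all del: lv_simps upt_Suc\<close>)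
    also have "\<dots> = fc K (Suc n) i u"
      unfolding good_coface(3)[OF g] by (rule res_full[OF g]) (simp del: upt_Suc add: atLeast0LessThan lessThan_Suc_atMost)
    finally show "res m (delete_nth i xs) u = fc K (Suc n) i (res m xs u)"
      using res_full[OF full(1,2), of u] d m by (simp only:)
  qed
next
  case (miss m xs p)
  show ?case
  proof (intro allI impI)
    fix n i u assume n: "length xs = Suc (Suc n)" and i: "i \<le> Suc n" and u: "u \<in> Arr (lv K (Suc (Suc m)))"
    have ne: "delete_nth i xs \<noteq> []" using length_delete_nth[of i xs] n i by (cases "delete_nth i xs") auto
    have pn: "p \<notin> set (delete_nth i xs)" using set_delete_nth[of i xs] miss(4) by blast
    show "res (Suc m) (delete_nth i xs) u = fc K (Suc n) i (res (Suc m) xs u)"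
      unfolding res_any[OF good_delete_nth[OF miss(1)] ne miss(3) pn u] res_any[OF miss(1-4) u]
      using miss(6)[rule_format, of n i "fc K (Suc m) p u"] n i fc_arr[OF miss(3) u]
      by (simp add: delete_nth_map)
  qed
qed

declare res.simps(2) [simp del]

end

section \<open>Simplices of the standard simplex with a repeated vertex\<close>

lemma delete_nth_notdistinct:
  assumes "k \<noteq> i" "Suc k \<noteq> i" "Suc k < length xs" "xs ! k = xs ! Suc k"
  shows "\<not> distinct (delete_nth i xs)"
proof (cases "i < k")
  case True
  then have "delete_nth i xs ! (k - 1) = delete_nth i xs ! k" "k < length (delete_nth i xs)"
    using assms by (auto simp: delete_nth_def nth_append)
  then show ?thesis using True by (metis One_nat_def Suc_pred distinct_conv_nth lessI less_Suc_eq less_imp_diff_less less_nat_zero_code n_not_Suc_n not_gr_zero)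
next
  case False
  then have "delete_nth i xs ! k = delete_nth i xs ! Suc k" "Suc k < length (delete_nth i xs)"
    using assms by (auto simp: delete_nth_def nth_append)
  then show ?thesis by (metis Suc_lessD distinct_conv_nth n_not_Suc_n)
qed

lemma delete_nth_same:
  assumes "Suc k < length xs" "xs ! k = xs ! Suc k"
  shows "delete_nth k xs = delete_nth (Suc k) xs"
  using assms by (simp add: delete_nth_def take_Suc_conv_app_nth flip: Cons_nth_drop_Suc)

lemma std_delete_nth:
  assumes "xs \<in> std_simplices m (Suc n)" "i \<le> Suc n"
  shows "delete_nth i xs \<in> std_simplices m n"
proof -
  have "sorted (take i xs @ drop i xs)" using assms by (simp add: std_simplices_def)
  then have "sorted (take i xs @ drop (Suc i) xs)"
    using set_drop_subset_set_drop[of i "Suc i" xs] sorted_wrt_drop[of "(\<le>)" xs "Suc i"] assms(1)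
    unfolding sorted_append std_simplices_def by auto
  then show ?thesis
    using assms set_delete_nth[of i xs] by (auto simp: std_simplices_def delete_nth_def)
qed

lemma std_map:
  assumes "xs \<in> std_simplices k n" "mono_on {..k} w" "\<And>j. j \<le> k \<Longrightarrow> w j \<le> m"
  shows "map w xs \<in> std_simplices m n"
proof -
  have "sorted_wrt (\<lambda>x y. w x \<le> w y) xs"
    by (rule sorted_wrt_mono_rel[of _ "(\<le>)"])
      (use assms in \<open>auto simp: std_simplices_def mono_on_def subset_iff\<close>)
  then show ?thesis using assms by (auto simp: std_simplices_def sorted_map)
qed

lemma std_coface: "xs \<in> std_simplices m n \<Longrightarrow> map (coface i) xs \<in> std_simplices (Suc m) n"
  by (rule std_map) (auto simp: mono_on_def coface_def)

lemma std_codegen: "xs \<in> std_simplices (Suc m) n \<Longrightarrow> i \<le> m \<Longrightarrow> map (codegen i) xs \<in> std_simplices m n"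
  by (rule std_map) (auto simp: mono_on_def codegen_def)

lemma sorted_not_distinct:
  assumes "sorted xs" "\<not> distinct xs"
  obtains k where "Suc k < length xs" "xs ! k = xs ! Suc k"
proof -
  obtain i j where ij: "i < j" "j < length xs" "xs ! i = xs ! j"
    using assms(2) unfolding distinct_conv_nth by (metis nat_neq_iff)
  then have "xs ! i \<le> xs ! Suc i" "xs ! Suc i \<le> xs ! j"
    using sorted_nth_mono[OF assms(1), of i "Suc i"] sorted_nth_mono[OF assms(1), of "Suc i" j] by auto
  then show thesis using ij that[of i] by auto
qed

text \<open>Made for degenerate simplices: deleting either copy of a repeated vertex gives the same
  face with opposite signs, and the other faces keep the repetition.\<close>

lemma alt_sum_one_pair:
  assumes A: "comm_group A" and k: "k < n" and g: "g k \<in> carrier A" "g (Suc k) = g k"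
    and one: "\<And>i. i \<le> n \<Longrightarrow> i \<noteq> k \<Longrightarrow> i \<noteq> Suc k \<Longrightarrow> g i = \<one>\<^bsub>A\<^esub>"
  shows "alt_sum A n g = \<one>\<^bsub>A\<^esub>"
proof -
  interpret A: comm_group A by fact
  have c: "g i \<in> carrier A" if "i \<le> n" for i
    using that g one[of i] by (cases "i = k \<or> i = Suc k") auto
  have "alt_sum A n g = finprod A (\<lambda>i. if even i then g i else inv\<^bsub>A\<^esub> (g i)) {k, Suc k}"
    unfolding alt_sum_def
    by (rule A.finprod_mono_neutral_cong_right) (use k c one in auto)
  also have "\<dots> = \<one>\<^bsub>A\<^esub>" using g by simp
  finally show ?thesis .
qed

context nat_sys
begin

text \<open>Here x lives on degree n of the resolution, that is on \<open>lv K (Suc n)\<close>;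
  degenerate elements are present only for positive n.\<close>

definition nml where
  "nml n x \<longleftrightarrow> (\<forall>l. n = Suc l \<longrightarrow> (\<forall>j\<le>l. \<forall>w\<in>Arr (lv K (Suc l)). x (dg K l j w) = \<one>\<^bsub>grp D (ev w)\<^esub>))"

text \<open>The cocycle on the m-simplex that x attaches to u, each nondegenerate n-face being sent
  to the value of x at the corresponding face of u. It is normalized by construction, so
  compatibility with degeneracies turns into a condition on x, see \<open>VV_degen\<close>.\<close>

definition VV where
  "VV n x m u = (\<lambda>xs\<in>std_simplices m n. if distinct xs then x (res m xs u) else \<one>\<^bsub>grp D (ev u)\<^esub>)"

lemma VV_app: "xs \<in> std_simplices m n \<Longrightarrow> VV n x m u xs = (if distinct xs then x (res m xs u) else \<one>\<^bsub>grp D (ev u)\<^esub>)"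
  by (simp add: VV_def)

lemma VV_out: "xs \<notin> std_simplices m n \<Longrightarrow> VV n x m u xs = undefined"
  by (simp add: VV_def)

lemma VV_face:
  assumes u: "u \<in> Arr (lv K (Suc (Suc m)))" and i: "i \<le> Suc m" and xs: "xs \<in> std_simplices m n"
  shows "VV n x m (fc K (Suc m) i u) xs = VV n x (Suc m) u (map (coface i) xs)"
proof -
  have "inj_on (coface i) (set xs)" by (auto simp: inj_on_def coface_def split: if_splits)
  then have d: "distinct (map (coface i) xs) = distinct xs" by (simp add: distinct_map)
  have "res (Suc m) (map (coface i) xs) u = res m xs (fc K (Suc m) i u)" if "distinct xs"
  proof -
    have g: "good m xs" "xs \<noteq> []" using std_goodD[OF xs that] by auto
    show ?thesis
      using res_any[OF good_coface(1)[OF g(1)] _ i good_coface(2)[OF g(1)] u] g(2) good_coface(3)[OF g(1), of i] by simp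
  qed
  then show ?thesis
    using ev_fc[OF i u] by (simp add: VV_app[OF xs] VV_app[OF std_coface[OF xs]] d)
qed

text \<open>If xs contains both i and i + 1, the degeneracy makes them equal on one side, and on the
  other side \<open>res_deg\<close> yields a degenerate element, where x is one. If one of the two
  is missing, it can be removed first, and this face undoes the degeneracy.\<close>

lemma VV_degen:
  assumes x: "nml n x" and u: "u \<in> Arr (lv K (Suc m))" and i: "i \<le> m" and xs: "xs \<in> std_simplices (Suc m) n"
  shows "VV n x (Suc m) (dg K m i u) xs = VV n x m u (map (codegen i) xs)"
proof -
  note VV = VV_app[OF xs] VV_app[OF std_codegen[OF xs i]] ev_dg[OF i u]
  have su: "dg K m i u \<in> Arr (lv K (Suc (Suc m)))" by (rule dg_arr[OF i u])
  consider "\<not> distinct xs" | "distinct xs" "i \<in> set xs" "Suc i \<in> set xs" | p where "distinct xs" "p \<notin> set xs" "p = i \<or> p = Suc i"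
    by blast
  then show ?thesis
  proof cases
    case 1
    then have "\<not> distinct (map (codegen i) xs)" by (simp add: distinct_map)
    then show ?thesis using 1 by (simp add: VV)
  next
    case 2
    then have g: "good (Suc m) xs" "length xs = Suc n" "xs \<noteq> []" using std_goodD[OF xs] 2 by auto
    have "codegen i i = codegen i (Suc i)" by (simp add: codegen_def)
    then have "\<not> inj_on (codegen i) (set xs)"
      using inj_onD[of "codegen i" "set xs" i "Suc i"] 2 by auto
    then have "\<not> distinct (map (codegen i) xs)" by (simp add: distinct_map)
    moreover obtain l j w where l: "length xs = Suc (Suc l)" "j \<le> l" "w \<in> Arr (lv K (Suc l))" and e: "ev w = ev u"
      "res (Suc m) xs (dg K m i u) = dg K l j w"
      using res_deg[OF g(1,3), rule_format, of m i u] 2 i u by auto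
    have "x (dg K l j w) = \<one>\<^bsub>grp D (ev w)\<^esub>"
      using x l g(2) unfolding nml_def by auto
    with calculation show ?thesis using 2(1) e by (simp add: VV)
  next
    case 3
    then have g: "good (Suc m) xs" "xs \<noteq> []" using std_goodD[OF xs] 3 by auto
    have pm: "p \<le> Suc m" using 3(3) i by auto
    have c: "map (codegen p) xs = map (codegen i) xs"
    proof (rule map_cong[OF refl])
      fix y assume "y \<in> set xs"
      then have "y \<noteq> p" using 3(2) by auto
      then show "codegen p y = codegen i y" using 3(3) by (auto simp: codegen_def)
    qed
    have "good m (map (codegen p) xs)" by (rule good_codegen(1)[OF g(1) 3(2) pm])
    then have "distinct (map (codegen i) xs)" unfolding c by (simp add: good_def strict_sorted_iff)
    moreover have "res (Suc m) xs (dg K m i u) = res m (map (codegen i) xs) u"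
      using res_any[OF g pm 3(2) su] 3(3) fc_dg_same[OF i u] fc_dg_Suc[OF i u] c by auto
    ultimately show ?thesis using 3(1) by (simp add: VV)
  qed
qed

lemma VV_carrier:
  assumes x: "der (Suc n) x" and u: "u \<in> Arr (lv K (Suc m))" and xs: "xs \<in> std_simplices m n"
  shows "VV n x m u xs \<in> carrier (grp D (ev u))"
proof -
  interpret A: comm_group "grp D (ev u)" by (rule grp_D[OF ev_facts(1)[OF u]])
  have "x (res m xs u) \<in> carrier (grp D (ev u))" if "distinct xs"
    using res_arr[of m xs n u] std_goodD[OF xs that] u derD[OF x, of "res m xs u"] by simp
  then show ?thesis by (simp add: VV_app[OF xs])
qed

lemma push_pull_hom:
  assumes "f \<in> Arr K" "g \<in> Arr K" "Cod K f = Dom K g"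
  shows "group_hom (grp D f) (grp D (Comp K g f)) (push K D g f)"
    "group_hom (grp D g) (grp D (Comp K g f)) (pull K D f g)"
proof -
  have 1: "(Idn K (Dom K f), f, g) \<in> Arr (Fac K)" "(f, g, Idn K (Cod K g)) \<in> Arr (Fac K)"
    using assms by (auto simp: Fac_def Dom_in Cod_in Idn_in Dom_Idn Cod_Idn)
  have e: "Comp K g (Comp K f (Idn K (Dom K f))) = Comp K g f" "Comp K (Idn K (Cod K g)) (Comp K g f) = Comp K g f"
    using assms Comp_Idn_right[of f] Comp_Idn_left[of "Comp K g f"] by (simp_all add: Comp_in Cod_Comp)
  show "group_hom (grp D f) (grp D (Comp K g f)) (push K D g f)" "group_hom (grp D g) (grp D (Comp K g f)) (pull K D f g)"
    using act_group_hom[OF 1(1)] act_group_hom[OF 1(2)] by (simp_all add: e push_def pull_def)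
qed

lemma VV_wcmp:
  assumes x: "der (Suc n) x" and u: "u \<in> Arr (lv K (Suc m))" and v: "v \<in> Arr (lv K (Suc m))"
    and uv: "Cod K (ev u) = Dom K (ev v)" and xs: "xs \<in> std_simplices m n"
  shows "VV n x m (wcmp K v u) xs = push K D (ev v) (ev u) (VV n x m u xs)
    \<otimes>\<^bsub>grp D (Comp K (ev v) (ev u))\<^esub> pull K D (ev u) (ev v) (VV n x m v xs)"
proof (cases "distinct xs")
  case True
  then have g: "good m xs" "length xs = Suc n" "xs \<noteq> []" using std_goodD[OF xs] True by auto
  note ru = res_arr[OF g(1,2) u] and rv = res_arr[OF g(1,2) v]
  have "x (wcmp K (res m xs v) (res m xs u)) = push K D (ev v) (ev u) (x (res m xs u))
      \<otimes>\<^bsub>grp D (Comp K (ev v) (ev u))\<^esub> pull K D (ev u) (ev v) (x (res m xs v))"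
    using x ru rv uv unfolding der_def by metis
  then show ?thesis
    using True by (simp add: VV_app[OF xs] res_wcmp[OF g(1,3) u v uv])
next
  case False
  note e = ev_facts(1)[OF u] ev_facts(1)[OF v] uv
  interpret P: group_hom "grp D (ev u)" "grp D (Comp K (ev v) (ev u))" "push K D (ev v) (ev u)" by (rule push_pull_hom(1)[OF e])
  interpret Q: group_hom "grp D (ev v)" "grp D (Comp K (ev v) (ev u))" "pull K D (ev u) (ev v)" by (rule push_pull_hom(2)[OF e])
  show ?thesis using False wcmp_facts(2)[OF u v uv] by (simp add: VV_app[OF xs])
qed

definition clo where
  "clo n x \<longleftrightarrow> (\<forall>u\<in>Arr (lv K (Suc (Suc n))). alt_sum (grp D (ev u)) (Suc n) (\<lambda>i. x (fc K (Suc n) i u)) = \<one>\<^bsub>grp D (ev u)\<^esub>)"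

lemma alt_sum_cong:
  assumes A: "comm_group A" and "\<And>i. i \<le> n \<Longrightarrow> g i = h i" "\<And>i. i \<le> n \<Longrightarrow> h i \<in> carrier A"
  shows "alt_sum A n g = alt_sum A n h"
proof -
  interpret A: comm_group A by fact
  show ?thesis unfolding alt_sum_def by (rule A.finprod_cong') (use assms in auto)
qed

text \<open>On a nondegenerate simplex of the standard simplex the coboundary of \<open>VV n x m u\<close> is that of \<open>x\<close>
  at a face of \<open>u\<close>; on a degenerate one two adjacent terms cancel and the others are trivial.\<close>

lemma VV_delete:
  assumes x: "der (Suc n) x" and u: "u \<in> Arr (lv K (Suc m))" and xs: "xs \<in> std_simplices m (Suc n)"
  shows "alt_sum (grp D (ev u)) (Suc n) (\<lambda>i. VV n x m u (delete_nth i xs)) =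
    (if distinct xs then alt_sum (grp D (ev u)) (Suc n) (\<lambda>i. x (fc K (Suc n) i (res m xs u))) else \<one>\<^bsub>grp D (ev u)\<^esub>)"
proof (cases "distinct xs")
  case True
  then have g: "good m xs" "length xs = Suc (Suc n)" "xs \<noteq> []" using std_goodD[OF xs] True by auto
  note r = res_arr[OF g(1,2) u]
  have "VV n x m u (delete_nth i xs) = x (fc K (Suc n) i (res m xs u))" if i: "i \<le> Suc n" for i
  proof -
    have "distinct (delete_nth i xs)"
      using good_delete_nth[OF g(1), of i] by (simp add: good_def strict_sorted_iff)
    then show ?thesis
      using res_delete_nth[OF g(1,3), rule_format, OF g(2) i u] by (simp add: VV_app[OF std_delete_nth[OF xs i]])
  qed
  moreover have "x (fc K (Suc n) i (res m xs u)) \<in> carrier (grp D (ev u))" if "i \<le> Suc n" for i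
    using derD[OF x fc_arr[OF that conjunct1[OF r]]] ev_fc[OF that conjunct1[OF r]] r by simp
  ultimately show ?thesis
    by (simp only: True if_True) (rule alt_sum_cong[OF grp_D[OF ev_facts(1)[OF u]]])
next
  case False
  have s: "sorted xs" "length xs = Suc (Suc n)" using xs by (auto simp: std_simplices_def)
  obtain k where k: "Suc k < length xs" "xs ! k = xs ! Suc k" using s(1) False by (rule sorted_not_distinct)
  have "alt_sum (grp D (ev u)) (Suc n) (\<lambda>i. VV n x m u (delete_nth i xs)) = \<one>\<^bsub>grp D (ev u)\<^esub>"
  proof (rule alt_sum_one_pair[OF grp_D[OF ev_facts(1)[OF u]], of k])
    show "VV n x m u (delete_nth k xs) \<in> carrier (grp D (ev u))"
      using k s by (intro VV_carrier[OF x u] std_delete_nth[OF xs]) simp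
    show "VV n x m u (delete_nth i xs) = \<one>\<^bsub>grp D (ev u)\<^esub>" if "i \<le> Suc n" "i \<noteq> k" "i \<noteq> Suc k" for i
      using delete_nth_notdistinct[OF _ _ k, of i] that by (simp add: VV_app[OF std_delete_nth[OF xs that(1)]])
  qed (use k s delete_nth_same[OF k] in auto)
  then show ?thesis using False by simp
qed

lemma VV_closed:
  assumes x: "der (Suc n) x" and c: "clo n x" and u: "u \<in> Arr (lv K (Suc m))" and xs: "xs \<in> std_simplices m (Suc n)"
  shows "alt_sum (grp D (ev u)) (Suc n) (\<lambda>i. VV n x m u (delete_nth i xs)) = \<one>\<^bsub>grp D (ev u)\<^esub>"
proof (cases "distinct xs")
  case True
  then have g: "good m xs" "length xs = Suc (Suc n)" using std_goodD[OF xs] True by auto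
  have "res m xs u \<in> Arr (lv K (Suc (Suc n)))" "ev (res m xs u) = ev u" using res_arr[OF g u] by auto
  then have "alt_sum (grp D (ev u)) (Suc n) (\<lambda>i. x (fc K (Suc n) i (res m xs u))) = \<one>\<^bsub>grp D (ev u)\<^esub>"
    using c unfolding clo_def by metis
  then show ?thesis unfolding VV_delete[OF x u xs] by simp
qed (simp add: VV_delete[OF x u xs])

lemma VV_EM:
  assumes x: "der (Suc n) x" "clo n x" and u: "u \<in> Arr (lv K (Suc m))"
  shows "VV n x m u \<in> carrier (EM_group (grp D (ev u)) n m)"
  unfolding EM_group_def
  using VV_carrier[OF x(1) u] VV_closed[OF x u] by (auto simp: VV_def)

text \<open>The normalized cocycles among the derivations in degree n. Through \<open>mk\<close> and
  \<open>xF\<close> they correspond to the maps into the Eilenberg-Mac Lane object.\<close>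

definition NZ where "NZ n x \<longleftrightarrow> der (Suc n) x \<and> nml n x \<and> clo n x"

definition mk where "mk n x = (\<lambda>m. \<lambda>u\<in>Arr (lv K (Suc m)). (ev u, VV n x m u))"

lemma EM_simps:
  "lev (EM K D n) m = total_cat K (EM_natsys D n m)"
  "face (EM K D n) m i (f, z) = (f, EM_restrict n m (coface i) z)"
  "degen (EM K D n) m i (f, z) = (f, EM_restrict n (Suc m) (codegen i) z)"
  "prj (EM K D n) = fst"
  by (simp_all add: EM_def)

lemma total_simps:
  "Ob (total_cat K E) = Ob K" "(f, z) \<in> Arr (total_cat K E) \<longleftrightarrow> f \<in> Arr K \<and> z \<in> carrier (grp E f)"
  "Dom (total_cat K E) (f, z) = Dom K f" "Cod (total_cat K E) (f, z) = Cod K f"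
  "Idn (total_cat K E) a = (Idn K a, \<one>\<^bsub>grp E (Idn K a)\<^esub>)"
  "Comp (total_cat K E) (g, y) (f, z) = (Comp K g f, push K E g f z \<otimes>\<^bsub>grp E (Comp K g f)\<^esub> pull K E f g y)"
  by (simp_all add: total_cat_def)

lemma grp_EM: "grp (EM_natsys D n m) f = EM_group (grp D f) n m"
  by (simp add: EM_natsys_def)

lemma push_EM: "push K (EM_natsys D n m) g f z = (\<lambda>xs\<in>std_simplices m n. push K D g f (z xs))"
  and pull_EM: "pull K (EM_natsys D n m) f g z = (\<lambda>xs\<in>std_simplices m n. pull K D f g (z xs))"
  by (simp_all add: push_def pull_def EM_natsys_def)

lemma EM_group_simps:
  "y \<otimes>\<^bsub>EM_group A n m\<^esub> z = (\<lambda>xs\<in>std_simplices m n. y xs \<otimes>\<^bsub>A\<^esub> z xs)"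
  "\<one>\<^bsub>EM_group A n m\<^esub> = (\<lambda>xs\<in>std_simplices m n. \<one>\<^bsub>A\<^esub>)"
  by (simp_all add: EM_group_def)

text \<open>Functors from a level of the resolution to the total category are the same as derivations
  into the value groups, evaluated simplexwise.\<close>

lemma functor_EM:
  assumes z: "\<And>u. u \<in> Arr (lv K l) \<Longrightarrow> z u \<in> carrier (EM_group (grp D (ev u)) n m)"
    and w: "\<And>u v xs. u \<in> Arr (lv K l) \<Longrightarrow> v \<in> Arr (lv K l) \<Longrightarrow> Cod K (ev u) = Dom K (ev v) \<Longrightarrow> xs \<in> std_simplices m n \<Longrightarrow>
      z (wcmp K v u) xs = push K D (ev v) (ev u) (z u xs) \<otimes>\<^bsub>grp D (Comp K (ev v) (ev u))\<^esub> pull K D (ev u) (ev v) (z v xs)"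
  shows "(\<lambda>u\<in>Arr (lv K l). (ev u, z u)) \<in> functors (lv K l) (total_cat K (EM_natsys D n m))"
  unfolding functors_iff isfun_def
proof (intro conjI ballI impI)
  have out: "z u xs = undefined" if "u \<in> Arr (lv K l)" "xs \<notin> std_simplices m n" for u xs
    using z[OF that(1)] that(2) by (auto simp: EM_group_def PiE_iff extensional_def)
  fix a assume "a \<in> Ob (lv K l)"
  then have a: "a \<in> Ob K" by (simp add: Ob_lv)
  let ?e = "Idn (lv K l) a"
  have e: "?e \<in> Arr (lv K l)" "ev ?e = Idn K a"
    using category.Idn_in[OF cat_lv] isfun_ev[of l] a by (auto simp: isfun_def Ob_lv)
  have "z ?e xs = \<one>\<^bsub>grp D (Idn K a)\<^esub>" if xs: "xs \<in> std_simplices m n" for xs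
    by (rule der_Idn[OF _ a, of l "\<lambda>u. z u xs"])
      (use z w xs in \<open>auto simp: der_def EM_group_def PiE_iff\<close>)
  then show "(\<lambda>u\<in>Arr (lv K l). (ev u, z u)) ?e = Idn (total_cat K (EM_natsys D n m)) a"
    using e out[OF e(1)] by (auto simp: total_simps grp_EM EM_group_simps fun_eq_iff)
next
  have out: "z u xs = undefined" if "u \<in> Arr (lv K l)" "xs \<notin> std_simplices m n" for u xs
    using z[OF that(1)] that(2) by (auto simp: EM_group_def PiE_iff extensional_def)
  fix u v assume u: "u \<in> Arr (lv K l)" and v: "v \<in> Arr (lv K l)" and "Cod (lv K l) u = Dom (lv K l) v"
  then have uv: "Cod K (ev u) = Dom K (ev v)" by (simp add: ev_facts(2)[OF v] ev_facts(3)[OF u])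
  have "z (wcmp K v u) = (\<lambda>xs\<in>std_simplices m n. push K D (ev v) (ev u) (z u xs) \<otimes>\<^bsub>grp D (Comp K (ev v) (ev u))\<^esub> pull K D (ev u) (ev v) (z v xs))"
    using out[OF wcmp_facts(1)[OF u v uv]] w[OF u v uv] by (auto simp: fun_eq_iff)
  then show "(\<lambda>u\<in>Arr (lv K l). (ev u, z u)) (Comp (lv K l) v u) = Comp (total_cat K (EM_natsys D n m))
      ((\<lambda>u\<in>Arr (lv K l). (ev u, z u)) v) ((\<lambda>u\<in>Arr (lv K l). (ev u, z u)) u)"
    using u v wcmp_facts[OF u v uv]
    by (auto simp: Comp_lv total_simps push_EM pull_EM grp_EM EM_group_simps fun_eq_iff restrict_def)
qed (use z ev_facts in \<open>auto simp: total_simps grp_EM Ob_lv\<close>)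

lemma mk_scat:
  assumes "NZ n x"
  shows "mk n x \<in> scat_maps (resolution K) (EM K D n)"
  unfolding scat_maps_def mem_Collect_eq resolution_simps EM_simps(1,4)
proof (intro conjI allI ballI impI)
  have x: "der (Suc n) x" "nml n x" "clo n x" using assms by (auto simp: NZ_def)
  show "mk n x m \<in> functors (lv K (Suc m)) (total_cat K (EM_natsys D n m))" for m
    unfolding mk_def by (rule functor_EM) (use VV_EM[OF x(1,3)] VV_wcmp[OF x(1)] in auto)
  show "fst (mk n x m u) = ev u" if "u \<in> Arr (lv K (Suc m))" for m u
    using that by (simp add: mk_def)
  show "mk n x m (fc K (Suc m) i u) = face (EM K D n) m i (mk n x (Suc m) u)"
    if i: "i \<le> Suc m" and u: "u \<in> Arr (lv K (Suc (Suc m)))" for m i u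
  proof -
    have "VV n x m (fc K (Suc m) i u) = EM_restrict n m (coface i) (VV n x (Suc m) u)"
      by (rule ext) (simp add: EM_restrict_def restrict_def VV_face[OF u i] VV_out)
    then show ?thesis
      using u fc_arr[OF i u] ev_fc[OF i u] by (simp add: mk_def EM_simps del: lv_simps)
  qed
  show "mk n x (Suc m) (dg K m i u) = degen (EM K D n) m i (mk n x m u)"
    if i: "i \<le> m" and u: "u \<in> Arr (lv K (Suc m))" for m i u
  proof -
    have "VV n x (Suc m) (dg K m i u) = EM_restrict n (Suc m) (codegen i) (VV n x m u)"
      by (rule ext) (simp add: EM_restrict_def restrict_def VV_degen[OF x(2) u i] VV_out)
    then show ?thesis
      using u dg_arr[OF i u] ev_dg[OF i u] by (simp add: mk_def EM_simps del: lv_simps)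
  qed
qed

text \<open>Evaluation at the nondegenerate n-simplex of the standard n-simplex, from which
  \<open>scat_VV\<close> recovers all other values.\<close>

definition xF where "xF n F = (\<lambda>u. snd (F n u) [0..<Suc n])"

lemma good_upt: "good n [0..<Suc n]"
  by (auto simp: good_def strict_sorted_iff simp del: upt_Suc)

lemma upt_std: "[0..<Suc n] \<in> std_simplices n n"
  by (auto simp: std_simplices_def simp del: upt_Suc)

lemma res_upt: "res n [0..<Suc n] u = u"
  by (rule res_full[OF good_upt]) (simp add: atLeast0LessThan lessThan_Suc_atMost del: upt_Suc)

lemma xF_mk: "u \<in> Arr (lv K (Suc n)) \<Longrightarrow> xF n (mk n x) u = x u"
  by (simp add: xF_def mk_def VV_app[OF upt_std] res_upt del: lv_simps upt_Suc)

end

section \<open>Alternating sums: products, double sums and the boundary of a prism\<close>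

lemma delete_nth_upt: "i \<le> Suc n \<Longrightarrow> delete_nth i [0..<Suc (Suc n)] = map (coface i) [0..<Suc n]"
  by (rule nth_equalityI) (auto simp: delete_nth_def nth_append coface_def simp del: upt_Suc)

lemma upt_std: "[0..<Suc n] \<in> std_simplices n n"
  by (auto simp: std_simplices_def simp del: upt_Suc)

lemma EM_group_D:
  assumes "z \<in> carrier (EM_group A n m)"
  shows "xs \<in> std_simplices m n \<Longrightarrow> z xs \<in> carrier A"
    "xs \<in> std_simplices m n \<Longrightarrow> \<not> distinct xs \<Longrightarrow> z xs = \<one>\<^bsub>A\<^esub>"
    "ws \<in> std_simplices m (Suc n) \<Longrightarrow> alt_sum A (Suc n) (\<lambda>i. z (delete_nth i ws)) = \<one>\<^bsub>A\<^esub>"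
    "xs \<notin> std_simplices m n \<Longrightarrow> z xs = undefined"
  using assms by (auto simp: EM_group_def PiE_iff extensional_def)

lemma alt_sum_mult:
  assumes "comm_group A" "\<And>i. i \<le> n \<Longrightarrow> g i \<in> carrier A" "\<And>i. i \<le> n \<Longrightarrow> h i \<in> carrier A"
  shows "alt_sum A n (\<lambda>i. g i \<otimes>\<^bsub>A\<^esub> h i) = alt_sum A n g \<otimes>\<^bsub>A\<^esub> alt_sum A n h"
proof -
  interpret A: comm_group A by fact
  have "alt_sum A n (\<lambda>i. g i \<otimes>\<^bsub>A\<^esub> h i) = finprod A (\<lambda>i. (if even i then g i else inv\<^bsub>A\<^esub> g i) \<otimes>\<^bsub>A\<^esub> (if even i then h i else inv\<^bsub>A\<^esub> h i)) {..n}"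
    unfolding alt_sum_def by (rule A.finprod_cong') (use assms in \<open>auto simp: A.inv_mult\<close>)
  also have "\<dots> = alt_sum A n g \<otimes>\<^bsub>A\<^esub> alt_sum A n h"
    unfolding alt_sum_def by (rule A.finprod_multf) (use assms in auto)
  finally show ?thesis .
qed

lemma alt_sum_closed:
  assumes "comm_group A" "\<And>i. i \<le> n \<Longrightarrow> g i \<in> carrier A"
  shows "alt_sum A n g \<in> carrier A"
proof -
  interpret A: comm_group A by fact
  show ?thesis unfolding alt_sum_def by (rule A.finprod_closed) (use assms in auto)
qed

lemma alt_sum_one: "comm_group A \<Longrightarrow> (\<And>i. i \<le> n \<Longrightarrow> g i = \<one>\<^bsub>A\<^esub>) \<Longrightarrow> alt_sum A n g = \<one>\<^bsub>A\<^esub>"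
proof -
  assume "comm_group A" and g: "\<And>i. i \<le> n \<Longrightarrow> g i = \<one>\<^bsub>A\<^esub>"
  then interpret A: comm_group A by simp
  show ?thesis unfolding alt_sum_def by (rule A.finprod_one_eqI) (use g in auto)
qed

text \<open>Moves a double alternating sum into the free abelian group on the elements of A, where
  \<open>double_alt_sum_zero\<close> and \<open>prism_sum\<close> apply.\<close>

lemma double_alt_sum_lin:
  assumes A: "comm_group A" and g: "\<And>i j. i \<le> n \<Longrightarrow> j \<le> k \<Longrightarrow> g i j \<in> carrier A"
  shows "alt_sum A n (\<lambda>i. alt_sum A k (g i))
    = lin A (\<lambda>x. x) (\<Sum>i\<le>n. \<Sum>j\<le>k. frag_cmul ((-1) ^ (i + j)) (frag_of (g i j)))"
proof -
  interpret A: comm_group A by fact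
  have k: "x \<in> carrier A" if "i \<le> n" "x \<in> Poly_Mapping.keys (\<Sum>j\<le>k. frag_cmul ((-1) ^ j) (frag_of (g i j)))" for i x
  proof -
    have "(\<Sum>j\<le>k. frag_cmul ((-1) ^ j) (frag_of (g i j))) \<in> chn (carrier A)"
      by (rule chn_sum, rule chn_cmul) (use g that in auto)
    then show ?thesis using that by (auto simp: chn_def)
  qed
  have "(\<Sum>i\<le>n. \<Sum>j\<le>k. frag_cmul ((-1) ^ (i + j)) (frag_of (g i j)))
      = (\<Sum>i\<le>n. frag_cmul ((-1) ^ i) (\<Sum>j\<le>k. frag_cmul ((-1) ^ j) (frag_of (g i j))))"
    by (simp add: frag_cmul_sum power_add del: sum.atMost_Suc)
  also have "lin A (\<lambda>x. x) \<dots> = finprod A (\<lambda>i. lin A (\<lambda>x. x) (frag_cmul ((-1) ^ i) (\<Sum>j\<le>k. frag_cmul ((-1) ^ j) (frag_of (g i j))))) {..n}"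
    by (rule A.lin_sum) (use k in auto)
  also have "\<dots> = alt_sum A n (\<lambda>i. alt_sum A k (g i))"
    unfolding alt_sum_def[of A n]
  proof (rule A.finprod_cong'[OF refl])
    show "(\<lambda>i. if even i then alt_sum A k (g i) else inv\<^bsub>A\<^esub> alt_sum A k (g i)) \<in> {..n} \<rightarrow> carrier A"
      using alt_sum_closed[OF A, of k] g by auto
    fix i assume i: "i \<in> {..n}"
    then have "lin A (\<lambda>x. x) (\<Sum>j\<le>k. frag_cmul ((-1) ^ j) (frag_of (g i j))) = alt_sum A k (g i)"
      using alt_sum_lin[OF A, of k "\<lambda>x. x" "g i"] g by simp
    then show "lin A (\<lambda>x. x) (frag_cmul ((-1) ^ i) (\<Sum>j\<le>k. frag_cmul ((-1) ^ j) (frag_of (g i j))))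
        = (if even i then alt_sum A k (g i) else inv\<^bsub>A\<^esub> alt_sum A k (g i))"
      using A.lin_sign[of "\<Sum>j\<le>k. frag_cmul ((-1) ^ j) (frag_of (g i j))" "\<lambda>x. x" i] k i by simp
  qed
  finally show ?thesis by simp
qed

text \<open>The boundary of a prism, with \<open>a i j\<close> face i of its j-th simplex and
  \<open>b i j\<close> the j-th simplex of the prism over face i. The terms with i = j or i = j + 1
  telescope by \<open>di\<close> to the two ends; the remaining ones form the prisms over the faces,
  with one index shifted and hence the sign reversed.\<close>

lemma prism_sum:
  fixes a b :: "nat \<Rightarrow> nat \<Rightarrow> 'x \<Rightarrow>\<^sub>0 int"
  assumes lo: "\<And>i j. i < j \<Longrightarrow> j \<le> Suc k \<Longrightarrow> a i j = b i (j - 1)"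
    and di: "\<And>j. j < Suc k \<Longrightarrow> a (Suc j) (Suc j) = a (Suc j) j"
    and hi: "\<And>i j. Suc j < i \<Longrightarrow> i \<le> Suc (Suc k) \<Longrightarrow> a i j = b (i - 1) j"
  shows "(\<Sum>j\<le>Suc k. \<Sum>i\<le>Suc (Suc k). frag_cmul ((-1) ^ (j + i)) (a i j))
    = a 0 0 - a (Suc (Suc k)) (Suc k) - (\<Sum>i\<le>Suc k. \<Sum>j\<le>k. frag_cmul ((-1) ^ (i + j)) (b i j))"
proof -
  let ?t = "\<lambda>(j, i). frag_cmul ((-1) ^ (j + i)) (a i j)"
  let ?u = "\<lambda>(i, j). frag_cmul ((-1) ^ (i + j)) (b i j)"
  let ?S = "{..Suc k} \<times> {..Suc (Suc k)}"
  let ?L = "{(j, i) \<in> ?S. i < j}" and ?H = "{(j, i) \<in> ?S. Suc j < i}"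
  let ?D = "(\<lambda>j. (j, j)) ` {..Suc k}" and ?E = "(\<lambda>j. (j, Suc j)) ` {..Suc k}"
  have fL: "finite ?L" and fH: "finite ?H" by (rule finite_subset[of _ ?S]; force)+
  have fin: "finite ?L" "finite ?H" "finite ?D" "finite ?E" using fL fH by simp_all
  have "?S = (?L \<union> ?H) \<union> (?D \<union> ?E)" by (auto simp: image_iff)
  then have "sum ?t ?S = sum ?t ((?L \<union> ?H) \<union> (?D \<union> ?E))" by (rule arg_cong)
  also have "\<dots> = sum ?t (?L \<union> ?H) + sum ?t (?D \<union> ?E)"
    by (rule sum.union_disjoint[OF finite_UnI[OF fin(1,2)] finite_UnI[OF fin(3,4)]]) force
  also have "sum ?t (?L \<union> ?H) = sum ?t ?L + sum ?t ?H"
    by (rule sum.union_disjoint[OF fin(1,2)]) force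
  also have "sum ?t (?D \<union> ?E) = sum ?t ?D + sum ?t ?E"
    by (rule sum.union_disjoint[OF fin(3,4)]) force
  also have "sum ?t ?D = (\<Sum>j\<le>Suc k. a j j)"
    by (subst sum.reindex) (auto simp: inj_on_def simp flip: mult_2)
  also have "\<dots> = a 0 0 + (\<Sum>j\<le>k. a (Suc j) (Suc j))"
    by (rule sum.atMost_Suc_shift)
  also have "(\<Sum>j\<le>k. a (Suc j) (Suc j)) = (\<Sum>j\<le>k. a (Suc j) j)"
    by (rule sum.cong) (use di in auto)
  also have "sum ?t ?E = - (\<Sum>j\<le>Suc k. a (Suc j) j)"
    by (subst sum.reindex) (auto simp: inj_on_def sum_negf simp flip: mult_2)
  also have "sum ?t ?L = sum (\<lambda>x. - ?u x) {(i, j) \<in> {..Suc k} \<times> {..k}. i \<le> j}"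
  proof (rule sum.reindex_bij_witness[of _ "\<lambda>(i, j). (Suc j, i)" "\<lambda>(j, i). (i, j - 1)"])
    fix x assume "x \<in> ?L"
    then obtain j i where x: "x = (Suc j, i)" "i \<le> j" "j \<le> k" by (cases x; cases "fst x") auto
    then show "- ?u (case x of (j, i) \<Rightarrow> (i, j - 1)) = ?t x"
      using lo[of i "Suc j"] by (simp add: add.commute)
  qed auto
  also have "sum ?t ?H = sum (\<lambda>x. - ?u x) {(i, j) \<in> {..Suc k} \<times> {..k}. j < i}"
  proof (rule sum.reindex_bij_witness[of _ "\<lambda>(i, j). (j, Suc i)" "\<lambda>(j, i). (i - 1, j)"])
    fix x assume "x \<in> ?H"
    then obtain j i where x: "x = (j, Suc i)" "j < i" "i \<le> Suc k" by (cases x; cases "snd x") auto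
    then show "- ?u (case x of (j, i) \<Rightarrow> (i - 1, j)) = ?t x"
      using hi[of j "Suc i"] by (simp add: add.commute)
  qed auto
  finally have e: "sum ?t ?S = sum (\<lambda>x. - ?u x) {(i, j) \<in> {..Suc k} \<times> {..k}. i \<le> j}
      + sum (\<lambda>x. - ?u x) {(i, j) \<in> {..Suc k} \<times> {..k}. j < i} + (a 0 0 - a (Suc (Suc k)) (Suc k))" by simp
  have "{..Suc k} \<times> {..k} = {(i, j) \<in> {..Suc k} \<times> {..k}. i \<le> j} \<union> {(i, j) \<in> {..Suc k} \<times> {..k}. j < i}" by auto
  then have "sum ?u ({..Suc k} \<times> {..k}) = sum ?u ({(i, j) \<in> {..Suc k} \<times> {..k}. i \<le> j} \<union> {(i, j) \<in> {..Suc k} \<times> {..k}. j < i})"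
    by (rule arg_cong)
  also have "\<dots> = sum ?u {(i, j) \<in> {..Suc k} \<times> {..k}. i \<le> j} + sum ?u {(i, j) \<in> {..Suc k} \<times> {..k}. j < i}"
  proof (rule sum.union_disjoint)
    show "finite {(i, j) \<in> {..Suc k} \<times> {..k}. i \<le> j}" by (rule finite_subset[of _ "{..Suc k} \<times> {..k}"]) auto
    show "finite {(i, j) \<in> {..Suc k} \<times> {..k}. j < i}" by (rule finite_subset[of _ "{..Suc k} \<times> {..k}"]) auto
  qed auto
  finally have "sum ?t ?S = a 0 0 - a (Suc (Suc k)) (Suc k) - sum ?u ({..Suc k} \<times> {..k})"
    unfolding e by (simp add: sum_negf)
  then show ?thesis by (simp only: sum.cartesian_product)
qed

section \<open>Recovering a map into the Eilenberg-Mac Lane object from its derivation\<close>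

context nat_sys
begin

lemma snd_face: "snd (face (EM K D n) m i p) = EM_restrict n m (coface i) (snd p)"
  and snd_degen: "snd (degen (EM K D n) m i p) = EM_restrict n (Suc m) (codegen i) (snd p)"
  by (cases p; simp add: EM_simps)+

lemma scat_facts:
  assumes F: "F \<in> scat_maps (resolution K) (EM K D n)"
  shows "u \<in> Arr (lv K (Suc m)) \<Longrightarrow> F m u = (ev u, snd (F m u))"
    "u \<in> Arr (lv K (Suc m)) \<Longrightarrow> snd (F m u) \<in> carrier (EM_group (grp D (ev u)) n m)"
    "u \<in> Arr (lv K (Suc (Suc m))) \<Longrightarrow> i \<le> Suc m \<Longrightarrow> xs \<in> std_simplices m n \<Longrightarrow>
      snd (F m (fc K (Suc m) i u)) xs = snd (F (Suc m) u) (map (coface i) xs)"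
    "u \<in> Arr (lv K (Suc m)) \<Longrightarrow> i \<le> m \<Longrightarrow> xs \<in> std_simplices (Suc m) n \<Longrightarrow>
      snd (F (Suc m) (dg K m i u)) xs = snd (F m u) (map (codegen i) xs)"
    "F m \<in> functors (lv K (Suc m)) (total_cat K (EM_natsys D n m))"
proof -
  have f: "\<And>m. F m \<in> functors (lv K (Suc m)) (total_cat K (EM_natsys D n m))"
    and p: "\<And>m u. u \<in> Arr (lv K (Suc m)) \<Longrightarrow> fst (F m u) = ev u"
    and fa: "\<And>m i u. i \<le> Suc m \<Longrightarrow> u \<in> Arr (lv K (Suc (Suc m))) \<Longrightarrow> F m (fc K (Suc m) i u) = face (EM K D n) m i (F (Suc m) u)"
    and de: "\<And>m i u. i \<le> m \<Longrightarrow> u \<in> Arr (lv K (Suc m)) \<Longrightarrow> F (Suc m) (dg K m i u) = degen (EM K D n) m i (F m u)"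
    using F unfolding scat_maps_def mem_Collect_eq resolution_simps EM_simps(1,4) by blast+
  show "F m \<in> functors (lv K (Suc m)) (total_cat K (EM_natsys D n m))" by (rule f)
  show e: "F m u = (ev u, snd (F m u))" if "u \<in> Arr (lv K (Suc m))" for m u
    using p[OF that] by (simp add: prod_eq_iff)
  show "snd (F m u) \<in> carrier (EM_group (grp D (ev u)) n m)" if u: "u \<in> Arr (lv K (Suc m))"
  proof -
    have "F m u \<in> Arr (total_cat K (EM_natsys D n m))" using f[of m] u by (auto simp: functors_iff isfun_def)
    then have "(ev u, snd (F m u)) \<in> Arr (total_cat K (EM_natsys D n m))" by (subst e[OF u, symmetric])
    then show ?thesis by (simp add: total_simps grp_EM)
  qed
  show "snd (F m (fc K (Suc m) i u)) xs = snd (F (Suc m) u) (map (coface i) xs)"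
    if u: "u \<in> Arr (lv K (Suc (Suc m)))" and i: "i \<le> Suc m" and xs: "xs \<in> std_simplices m n"
    unfolding fa[OF i u] snd_face using xs by (simp add: EM_restrict_def)
  show "snd (F (Suc m) (dg K m i u)) xs = snd (F m u) (map (codegen i) xs)"
    if u: "u \<in> Arr (lv K (Suc m))" and i: "i \<le> m" and xs: "xs \<in> std_simplices (Suc m) n"
    unfolding de[OF i u] snd_degen using xs by (simp add: EM_restrict_def)
qed

lemma scat_fst: "F \<in> scat_maps (resolution K) (EM K D n) \<Longrightarrow> u \<in> Arr (lv K (Suc m)) \<Longrightarrow> fst (F m u) = ev u"
  by (subst scat_facts(1)) auto

lemma functor_EM_der:
  assumes f: "f \<in> functors (lv K l) (total_cat K (EM_natsys D n m))"
    and p: "\<And>u. u \<in> Arr (lv K l) \<Longrightarrow> fst (f u) = ev u" and xs: "xs \<in> std_simplices m n"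
  shows "der l (\<lambda>u. snd (f u) xs)"
  unfolding der_def
proof (intro conjI ballI impI)
  have e: "f u = (ev u, snd (f u))" if "u \<in> Arr (lv K l)" for u
    using p[OF that] by (simp add: prod_eq_iff)
  show "snd (f u) xs \<in> carrier (grp D (ev u))" if u: "u \<in> Arr (lv K l)" for u
  proof -
    have "f u \<in> Arr (total_cat K (EM_natsys D n m))" using f u by (auto simp: functors_iff isfun_def)
    then have "(ev u, snd (f u)) \<in> Arr (total_cat K (EM_natsys D n m))" by (subst e[OF u, symmetric])
    then have "snd (f u) \<in> carrier (EM_group (grp D (ev u)) n m)" by (simp add: total_simps grp_EM)
    then show ?thesis using xs by (rule EM_group_D)
  qed
  fix u v assume u: "u \<in> Arr (lv K l)" and v: "v \<in> Arr (lv K l)" and uv: "Cod K (ev u) = Dom K (ev v)"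
  have uv': "Cod (lv K l) u = Dom (lv K l) v" using uv by (simp add: ev_facts(2)[OF v] ev_facts(3)[OF u])
  have "f (Comp (lv K l) v u) = Comp (total_cat K (EM_natsys D n m)) (f v) (f u)"
    using f u v uv' unfolding functors_iff isfun_def by blast
  then have "f (wcmp K v u) = Comp (total_cat K (EM_natsys D n m)) (f v) (f u)"
    unfolding Comp_lv[OF u v] .
  also have "\<dots> = Comp (total_cat K (EM_natsys D n m)) (ev v, snd (f v)) (ev u, snd (f u))"
    by (rule arg_cong2[OF e[OF v] e[OF u]])
  finally show "snd (f (wcmp K v u)) xs = push K D (ev v) (ev u) (snd (f u) xs)
      \<otimes>\<^bsub>grp D (Comp K (ev v) (ev u))\<^esub> pull K D (ev u) (ev v) (snd (f v) xs)"
    using xs by (simp add: total_simps push_EM pull_EM grp_EM EM_group_simps)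
qed

text \<open>Compatibility with faces moves each nondegenerate value to the top simplex, and
  degenerate values are one because the cocycles are normalized.\<close>

lemma scat_VV:
  assumes F: "F \<in> scat_maps (resolution K) (EM K D n)" and u: "u \<in> Arr (lv K (Suc m))" and xs: "xs \<in> std_simplices m n"
  shows "snd (F m u) xs = VV n (xF n F) m u xs"
proof (cases "distinct xs")
  case True
  have "good m xs \<Longrightarrow> xs \<noteq> [] \<Longrightarrow> \<forall>u\<in>Arr (lv K (Suc m)). length xs = Suc n \<longrightarrow> snd (F m u) xs = snd (F n (res m xs u)) [0..<Suc n]"
    for m xs
  proof (induction rule: good_induct)
    case (full m xs)
    then have "length xs = Suc m" by simp
    then show ?case using res_full[OF full(1,2)] full(3) by auto
  next
    case (miss m xs j)
    show ?case
    proof (intro ballI impI)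
      fix u assume u: "u \<in> Arr (lv K (Suc (Suc m)))" and l: "length xs = Suc n"
      have c: "map (codegen j) xs \<in> std_simplices m n"
        using std_good[of "map (codegen j) xs" m n] miss(5) l by simp
      have "snd (F (Suc m) u) xs = snd (F (Suc m) u) (map (coface j) (map (codegen j) xs))"
        using good_codegen(2)[OF miss(1,4,3)] by simp
      also have "\<dots> = snd (F m (fc K (Suc m) j u)) (map (codegen j) xs)"
        by (rule scat_facts(3)[OF F u miss(3) c, symmetric])
      also have "\<dots> = snd (F n (res (Suc m) xs u)) [0..<Suc n]"
        using miss(6) fc_arr[OF miss(3) u] l res_any[OF miss(1-4) u] by simp
      finally show "snd (F (Suc m) u) xs = snd (F n (res (Suc m) xs u)) [0..<Suc n]" .
    qed
  qed
  then show ?thesis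
    using std_goodD[OF xs True] u True by (simp add: VV_app[OF xs] xF_def del: upt_Suc)
next
  case False
  then show ?thesis using EM_group_D(2)[OF scat_facts(2)[OF F u] xs] by (simp add: VV_app[OF xs])
qed

lemma scat_NZ:
  assumes F: "F \<in> scat_maps (resolution K) (EM K D n)"
  shows "NZ n (xF n F)"
  unfolding NZ_def
proof (intro conjI)
  show "der (Suc n) (xF n F)"
    unfolding xF_def using functor_EM_der[OF scat_facts(5)[OF F] _ upt_std] scat_fst[OF F] by blast
  show "nml n (xF n F)"
    unfolding nml_def
  proof (intro allI impI ballI)
    fix l j w assume n: "n = Suc l" and j: "j \<le> l" and w: "w \<in> Arr (lv K (Suc l))"
    have s: "[0..<Suc n] \<in> std_simplices (Suc l) n" unfolding n by (rule upt_std)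
    \<comment> \<open>Compatibility with degeneracies replaces the top simplex by a list in which j
      is repeated, where a normalized cocycle is one.\<close>
    have "xF n F (dg K l j w) = snd (F l w) (map (codegen j) [0..<Suc n])"
      unfolding xF_def using scat_facts(4)[OF F w j s] by (simp add: n del: upt_Suc)
    also have "\<dots> = \<one>\<^bsub>grp D (ev w)\<^esub>"
    proof (rule EM_group_D(2)[OF scat_facts(2)[OF F w] std_codegen[OF s j]])
      have "codegen j j = codegen j (Suc j)" "j \<in> set [0..<Suc n]" "Suc j \<in> set [0..<Suc n]"
        using j n by (auto simp: codegen_def)
      then show "\<not> distinct (map (codegen j) [0..<Suc n])"
        using inj_onD[of "codegen j" "set [0..<Suc n]" j "Suc j"] unfolding distinct_map by auto
    qed
    finally show "xF n F (dg K l j w) = \<one>\<^bsub>grp D (ev w)\<^esub>" .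
  qed
  show "clo n (xF n F)"
    unfolding clo_def
  proof
    fix u assume u: "u \<in> Arr (lv K (Suc (Suc n)))"
    have "alt_sum (grp D (ev u)) (Suc n) (\<lambda>i. xF n F (fc K (Suc n) i u))
        = alt_sum (grp D (ev u)) (Suc n) (\<lambda>i. snd (F (Suc n) u) (delete_nth i [0..<Suc (Suc n)]))"
    proof (rule alt_sum_cong[OF grp_D[OF ev_facts(1)[OF u]]])
      fix i assume i: "i \<le> Suc n"
      show "xF n F (fc K (Suc n) i u) = snd (F (Suc n) u) (delete_nth i [0..<Suc (Suc n)])"
        unfolding xF_def delete_nth_upt[OF i] by (rule scat_facts(3)[OF F u i upt_std])
      show "snd (F (Suc n) u) (delete_nth i [0..<Suc (Suc n)]) \<in> carrier (grp D (ev u))"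
        by (rule EM_group_D(1)[OF scat_facts(2)[OF F u] std_delete_nth[OF upt_std i]])
    qed
    also have "\<dots> = \<one>\<^bsub>grp D (ev u)\<^esub>"
      by (rule EM_group_D(3)[OF scat_facts(2)[OF F u] upt_std])
    finally show "alt_sum (grp D (ev u)) (Suc n) (\<lambda>i. xF n F (fc K (Suc n) i u)) = \<one>\<^bsub>grp D (ev u)\<^esub>" .
  qed
qed

lemma scat_eqI:
  assumes F: "F \<in> scat_maps (resolution K) (EM K D n)" and G: "G \<in> scat_maps (resolution K) (EM K D n)"
    and e: "\<And>u. u \<in> Arr (lv K (Suc n)) \<Longrightarrow> xF n F u = xF n G u"
  shows "F = G"
proof (rule ext, rule ext)
  fix m u
  show "F m u = G m u"
  proof (cases "u \<in> Arr (lv K (Suc m))")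
    case True
    have "snd (F m u) xs = snd (G m u) xs" for xs
    proof (cases "xs \<in> std_simplices m n")
      case xs: True
      then show ?thesis
        using e[of "res m xs u"] res_arr[of m xs n u] std_goodD[OF xs] True
        by (auto simp: scat_VV[OF F True xs] scat_VV[OF G True xs] VV_app[OF xs])
    next
      case False
      then show ?thesis
        using EM_group_D(4)[OF scat_facts(2)[OF F True]] EM_group_D(4)[OF scat_facts(2)[OF G True]] by simp
    qed
    then have "snd (F m u) = snd (G m u)" by (rule ext)
    then show ?thesis by (subst scat_facts(1)[OF F True], subst scat_facts(1)[OF G True]) simp
  next
    case False
    have "F m \<in> extensional (Arr (lv K (Suc m)))" "G m \<in> extensional (Arr (lv K (Suc m)))"
      using scat_facts(5)[OF F, of m] scat_facts(5)[OF G, of m] unfolding functors_iff by blast+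
    then show ?thesis using False by (simp add: extensional_def del: lv_simps)
  qed
qed

end

section \<open>Homotopies\<close>

lemma nth_delete_nth: "i < length xs \<Longrightarrow> delete_nth i xs ! t = (if t < i then xs ! t else xs ! Suc t)"
  by (simp add: delete_nth_def nth_append)

lemma delete_nth_swap:
  assumes "i < j" "j < length xs"
  shows "delete_nth i (delete_nth j xs) = delete_nth (j - 1) (delete_nth i xs)"
proof (rule nth_equalityI)
  have l: "length (delete_nth j xs) = length xs - 1" "length (delete_nth i xs) = length xs - 1"
    using assms by (simp_all add: length_delete_nth)
  show "length (delete_nth i (delete_nth j xs)) = length (delete_nth (j - 1) (delete_nth i xs))"
    using assms l by (simp add: length_delete_nth)
  fix t
  have "i < length (delete_nth j xs)" "j - 1 < length (delete_nth i xs)" using assms l by auto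
  then show "delete_nth i (delete_nth j xs) ! t = delete_nth (j - 1) (delete_nth i xs) ! t"
    using assms by (auto simp: nth_delete_nth)
qed

lemma (in comm_group) three_term_solve:
  assumes "a \<in> carrier G" "b \<in> carrier G" "d \<in> carrier G" "a \<otimes> inv b \<otimes> inv d = \<one>"
  shows "a = b \<otimes> d"
proof -
  have "a = a \<otimes> (inv b \<otimes> b) \<otimes> (inv d \<otimes> d)" using assms by simp
  also have "\<dots> = (a \<otimes> inv b \<otimes> inv d) \<otimes> (b \<otimes> d)" using assms(1-3) by (simp add: m_ac)
  also have "\<dots> = b \<otimes> d" using assms by simp
  finally show ?thesis .
qed

text \<open>In the j-th simplex of a prism the vertices up to j lie at the lower end and the later
  ones at the upper end. \<open>codegen j\<close> projects them to the base and comparison with j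
  tells the end; the rules describe how faces and degeneracies act on these two data.\<close>

lemma coface_codegen:
  "i < j \<Longrightarrow> codegen j (coface i t) = coface i (codegen (j - 1) t)"
  "i < j \<Longrightarrow> j < coface i t \<longleftrightarrow> j - 1 < t"
  "Suc j < i \<Longrightarrow> codegen j (coface i t) = coface (i - 1) (codegen j t)"
  "Suc j < i \<Longrightarrow> j < coface i t \<longleftrightarrow> j < t"
  "i \<le> j \<Longrightarrow> codegen j (codegen i t) = codegen i (codegen (Suc j) t)"
  "i \<le> j \<Longrightarrow> j < codegen i t \<longleftrightarrow> Suc j < t"
  "j < i \<Longrightarrow> codegen j (codegen i t) = codegen (i - 1) (codegen j t)"
  "j < i \<Longrightarrow> j < codegen i t \<longleftrightarrow> j < t"
  "codegen j (coface j t) = t" "codegen j (coface (Suc j) t) = t"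
  "j < coface (Suc j) t \<longleftrightarrow> Suc j < coface (Suc j) t"
  by (auto simp: coface_def codegen_def)

context nat_sys
begin

lemma derW: "der l x \<Longrightarrow> u \<in> Arr (lv K l) \<Longrightarrow> v \<in> Arr (lv K l) \<Longrightarrow> Cod K (ev u) = Dom K (ev v) \<Longrightarrow>
    x (wcmp K v u) = push K D (ev v) (ev u) (x u) \<otimes>\<^bsub>grp D (Comp K (ev v) (ev u))\<^esub> pull K D (ev u) (ev v) (x v)"
  unfolding der_def by blast

lemma der_mult:
  assumes x: "der l x" and z: "der l z"
  shows "der l (\<lambda>u. x u \<otimes>\<^bsub>grp D (ev u)\<^esub> z u)"
  unfolding der_def
proof (intro conjI ballI impI)
  show "x u \<otimes>\<^bsub>grp D (ev u)\<^esub> z u \<in> carrier (grp D (ev u))" if u: "u \<in> Arr (lv K l)" for u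
  proof -
    interpret A: comm_group "grp D (ev u)" by (rule grp_D[OF ev_facts(1)[OF u]])
    show ?thesis using derD[OF x u] derD[OF z u] by simp
  qed
  fix u v assume u: "u \<in> Arr (lv K l)" and v: "v \<in> Arr (lv K l)" and uv: "Cod K (ev u) = Dom K (ev v)"
  note U = ev_facts(1)[OF u] and V = ev_facts(1)[OF v]
  interpret C: comm_group "grp D (Comp K (ev v) (ev u))" by (rule grp_D[OF Comp_in[OF U V uv]])
  interpret P: group_hom "grp D (ev u)" "grp D (Comp K (ev v) (ev u))" "push K D (ev v) (ev u)"
    by (rule push_pull_hom(1)[OF U V uv])
  interpret Q: group_hom "grp D (ev v)" "grp D (Comp K (ev v) (ev u))" "pull K D (ev u) (ev v)"
    by (rule push_pull_hom(2)[OF U V uv])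
  note xu = derD[OF x u] and zu = derD[OF z u] and xv = derD[OF x v] and zv = derD[OF z v]
  show "x (wcmp K v u) \<otimes>\<^bsub>grp D (ev (wcmp K v u))\<^esub> z (wcmp K v u)
      = push K D (ev v) (ev u) (x u \<otimes>\<^bsub>grp D (ev u)\<^esub> z u)
        \<otimes>\<^bsub>grp D (Comp K (ev v) (ev u))\<^esub> pull K D (ev u) (ev v) (x v \<otimes>\<^bsub>grp D (ev v)\<^esub> z v)"
    unfolding wcmp_facts(2)[OF u v uv] derW[OF x u v uv] derW[OF z u v uv] P.hom_mult[OF xu zu] Q.hom_mult[OF xv zv]
    using P.hom_closed[OF xu] P.hom_closed[OF zu] Q.hom_closed[OF xv] Q.hom_closed[OF zv] by (simp add: C.m_ac)
qed

lemma der_one: "der l (\<lambda>u. \<one>\<^bsub>grp D (ev u)\<^esub>)"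
  unfolding der_def
proof (intro conjI ballI impI)
  show "\<one>\<^bsub>grp D (ev u)\<^esub> \<in> carrier (grp D (ev u))" if u: "u \<in> Arr (lv K l)" for u
  proof -
    interpret A: comm_group "grp D (ev u)" by (rule grp_D[OF ev_facts(1)[OF u]])
    show ?thesis by simp
  qed
  fix u v assume u: "u \<in> Arr (lv K l)" and v: "v \<in> Arr (lv K l)" and uv: "Cod K (ev u) = Dom K (ev v)"
  note U = ev_facts(1)[OF u] and V = ev_facts(1)[OF v]
  interpret P: group_hom "grp D (ev u)" "grp D (Comp K (ev v) (ev u))" "push K D (ev v) (ev u)"
    by (rule push_pull_hom(1)[OF U V uv])
  interpret Q: group_hom "grp D (ev v)" "grp D (Comp K (ev v) (ev u))" "pull K D (ev u) (ev v)"
    by (rule push_pull_hom(2)[OF U V uv])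
  show "\<one>\<^bsub>grp D (ev (wcmp K v u))\<^esub> = push K D (ev v) (ev u) \<one>\<^bsub>grp D (ev u)\<^esub>
      \<otimes>\<^bsub>grp D (Comp K (ev v) (ev u))\<^esub> pull K D (ev u) (ev v) \<one>\<^bsub>grp D (ev v)\<^esub>"
    unfolding wcmp_facts(2)[OF u v uv] by simp
qed

lemma der_alt_sum:
  assumes x: "\<And>i. i \<le> n \<Longrightarrow> der l (x i)"
  shows "der l (\<lambda>u. alt_sum (grp D (ev u)) n (\<lambda>i. x i u))"
  unfolding der_def
proof (intro conjI ballI impI)
  show "alt_sum (grp D (ev u)) n (\<lambda>i. x i u) \<in> carrier (grp D (ev u))" if u: "u \<in> Arr (lv K l)" for u
    by (rule alt_sum_closed[OF grp_D[OF ev_facts(1)[OF u]]]) (rule derD[OF x u])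
  fix u v assume u: "u \<in> Arr (lv K l)" and v: "v \<in> Arr (lv K l)" and uv: "Cod K (ev u) = Dom K (ev v)"
  note U = ev_facts(1)[OF u] and V = ev_facts(1)[OF v]
  interpret C: comm_group "grp D (Comp K (ev v) (ev u))" by (rule grp_D[OF Comp_in[OF U V uv]])
  interpret P: group_hom "grp D (ev u)" "grp D (Comp K (ev v) (ev u))" "push K D (ev v) (ev u)"
    by (rule push_pull_hom(1)[OF U V uv])
  interpret Q: group_hom "grp D (ev v)" "grp D (Comp K (ev v) (ev u))" "pull K D (ev u) (ev v)"
    by (rule push_pull_hom(2)[OF U V uv])
  note xu = derD[OF x u] and xv = derD[OF x v]
  have "alt_sum (grp D (ev (wcmp K v u))) n (\<lambda>i. x i (wcmp K v u))
      = alt_sum (grp D (Comp K (ev v) (ev u))) n (\<lambda>i. push K D (ev v) (ev u) (x i u)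
        \<otimes>\<^bsub>grp D (Comp K (ev v) (ev u))\<^esub> pull K D (ev u) (ev v) (x i v))"
    unfolding wcmp_facts(2)[OF u v uv]
    by (rule alt_sum_cong[OF C.comm_group_axioms]) (use derW[OF x u v uv] xu xv in auto)
  also have "\<dots> = alt_sum (grp D (Comp K (ev v) (ev u))) n (\<lambda>i. push K D (ev v) (ev u) (x i u))
      \<otimes>\<^bsub>grp D (Comp K (ev v) (ev u))\<^esub> alt_sum (grp D (Comp K (ev v) (ev u))) n (\<lambda>i. pull K D (ev u) (ev v) (x i v))"
    by (rule alt_sum_mult[OF C.comm_group_axioms]) (use xu xv in auto)
  also have "alt_sum (grp D (Comp K (ev v) (ev u))) n (\<lambda>i. push K D (ev v) (ev u) (x i u))
      = push K D (ev v) (ev u) (alt_sum (grp D (ev u)) n (\<lambda>i. x i u))"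
    by (rule alt_sum_hom[OF P.homh grp_D[OF U] C.comm_group_axioms xu, symmetric])
  also have "alt_sum (grp D (Comp K (ev v) (ev u))) n (\<lambda>i. pull K D (ev u) (ev v) (x i v))
      = pull K D (ev u) (ev v) (alt_sum (grp D (ev v)) n (\<lambda>i. x i v))"
    by (rule alt_sum_hom[OF Q.homh grp_D[OF V] C.comm_group_axioms xv, symmetric])
  finally show "alt_sum (grp D (ev (wcmp K v u))) n (\<lambda>i. x i (wcmp K v u))
      = push K D (ev v) (ev u) (alt_sum (grp D (ev u)) n (\<lambda>i. x i u))
        \<otimes>\<^bsub>grp D (Comp K (ev v) (ev u))\<^esub> pull K D (ev u) (ev v) (alt_sum (grp D (ev v)) n (\<lambda>i. x i v))" .
qed

section \<open>From a coboundary to a homotopy\<close>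

lemma der_VV: "der (Suc n) x \<Longrightarrow> xs \<in> std_simplices m n \<Longrightarrow> der (Suc m) (\<lambda>u. VV n x m u xs)"
  unfolding der_def[of "Suc m"]
  by (intro conjI ballI impI) (rule VV_carrier VV_wcmp; assumption)+

text \<open>The cochain of v at the upper end of the prism, extended trivially to the other
  simplices.\<close>

definition cut where
  "cut k v j m u zs = (if \<forall>t\<in>set zs. j < t then VV k v m u (map (codegen j) zs) else \<one>\<^bsub>grp D (ev u)\<^esub>)"

text \<open>The coboundary of \<open>cut\<close>. In degree 0 there are no cochains of degree -1,
  hence the value one.\<close>

definition HE where
  "HE n v j m u xs = (case n of 0 \<Rightarrow> \<one>\<^bsub>grp D (ev u)\<^esub>
     | Suc k \<Rightarrow> alt_sum (grp D (ev u)) n (\<lambda>i. cut k v j m u (delete_nth i xs)))"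

text \<open>The cocycle on the prism over \<open>u\<close> that is \<open>y\<close> pulled back from \<open>u\<close> plus the coboundary of \<open>v\<close>
  restricted to the upper end of the prism.\<close>

definition HH where
  "HH n y v j m u = (\<lambda>xs\<in>std_simplices (Suc m) n. VV n y m u (map (codegen j) xs) \<otimes>\<^bsub>grp D (ev u)\<^esub> HE n v j m u xs)"

definition pre where "pre n v \<longleftrightarrow> (\<forall>k. n = Suc k \<longrightarrow> der (Suc k) v \<and> nml k v)"

definition dlt where
  "dlt n v u = (case n of 0 \<Rightarrow> \<one>\<^bsub>grp D (ev u)\<^esub> | Suc k \<Rightarrow> alt_sum (grp D (ev u)) n (\<lambda>i. v (fc K n i u)))"

lemma cut_der:
  assumes "der (Suc k) v" "zs \<in> std_simplices (Suc m) k" "j \<le> m"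
  shows "der (Suc m) (\<lambda>u. cut k v j m u zs)"
proof (cases "\<forall>t\<in>set zs. j < t")
  case True
  then have "(\<lambda>u. cut k v j m u zs) = (\<lambda>u. VV k v m u (map (codegen j) zs))" unfolding cut_def by (intro ext) (rule if_P)
  then show ?thesis using der_VV[OF assms(1) std_codegen[OF assms(2,3)]] by (simp only:)
next
  case False
  then have "(\<lambda>u. cut k v j m u zs) = (\<lambda>u. \<one>\<^bsub>grp D (ev u)\<^esub>)" unfolding cut_def by (intro ext) (rule if_not_P)
  then show ?thesis using der_one by (simp only:)
qed

lemma HE_der:
  assumes v: "pre n v" and xs: "xs \<in> std_simplices (Suc m) n" and j: "j \<le> m"
  shows "der (Suc m) (\<lambda>u. HE n v j m u xs)"
proof (cases n)
  case 0 then show ?thesis unfolding HE_def using der_one[of "Suc m"] by simp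
next
  case (Suc k)
  have "der (Suc m) (\<lambda>u. alt_sum (grp D (ev u)) n (\<lambda>i. cut k v j m u (delete_nth i xs)))"
    by (rule der_alt_sum, rule cut_der[of k]) (use v xs j Suc std_delete_nth[of xs "Suc m" k] in \<open>auto simp: pre_def simp del: lv_simps\<close>)
  then show ?thesis unfolding HE_def Suc by simp
qed

lemma cut_one: "zs \<in> std_simplices (Suc m) k \<Longrightarrow> j \<le> m \<Longrightarrow> \<not> distinct zs \<Longrightarrow> cut k v j m u zs = \<one>\<^bsub>grp D (ev u)\<^esub>"
  using std_codegen[of zs m k j] distinct_map[of "codegen j" zs] by (auto simp: cut_def VV_app)

lemma HE_one:
  assumes v: "pre n v" and u: "u \<in> Arr (lv K (Suc m))" and xs: "xs \<in> std_simplices (Suc m) n" and j: "j \<le> m"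
    and nd: "\<not> distinct xs"
  shows "HE n v j m u xs = \<one>\<^bsub>grp D (ev u)\<^esub>"
proof (cases n)
  case 0 then show ?thesis by (simp add: HE_def)
next
  case (Suc k)
  have s: "delete_nth i xs \<in> std_simplices (Suc m) k" if "i \<le> n" for i
    using std_delete_nth xs that Suc by simp
  have "sorted xs" "length xs = Suc n" using xs by (auto simp: std_simplices_def)
  then obtain r where r: "Suc r < length xs" "xs ! r = xs ! Suc r" using sorted_not_distinct nd by blast
  then have rn: "r < n" using \<open>length xs = Suc n\<close> by simp
  have "alt_sum (grp D (ev u)) n (\<lambda>i. cut k v j m u (delete_nth i xs)) = \<one>\<^bsub>grp D (ev u)\<^esub>"
  proof (rule alt_sum_one_pair[OF grp_D[OF ev_facts(1)[OF u]] rn])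
    show "cut k v j m u (delete_nth r xs) \<in> carrier (grp D (ev u))"
      by (rule derD[OF cut_der[OF _ s j] u]) (use v Suc rn in \<open>auto simp: pre_def simp del: lv_simps\<close>)
    show "cut k v j m u (delete_nth (Suc r) xs) = cut k v j m u (delete_nth r xs)"
      by (rule arg_cong[OF delete_nth_same[OF r, symmetric]])
    show "cut k v j m u (delete_nth i xs) = \<one>\<^bsub>grp D (ev u)\<^esub>" if "i \<le> n" "i \<noteq> r" "i \<noteq> Suc r" for i
      by (rule cut_one[OF s[OF that(1)] j delete_nth_notdistinct[of r i]]) (use that r in auto)
  qed
  then show ?thesis unfolding HE_def Suc by simp
qed

lemma HE_closed:
  assumes v: "pre n v" and u: "u \<in> Arr (lv K (Suc m))" and ws: "ws \<in> std_simplices (Suc m) (Suc n)" and j: "j \<le> m"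
  shows "alt_sum (grp D (ev u)) (Suc n) (\<lambda>i. HE n v j m u (delete_nth i ws)) = \<one>\<^bsub>grp D (ev u)\<^esub>"
proof -
  interpret A: comm_group "grp D (ev u)" by (rule grp_D[OF ev_facts(1)[OF u]])
  show ?thesis
  proof (cases n)
    case 0 then show ?thesis using alt_sum_one[OF A.comm_group_axioms] by (simp add: HE_def)
  next
    case (Suc k)
    have w: "length ws = Suc (Suc n)" using ws by (simp add: std_simplices_def)
    have c: "cut k v j m u (delete_nth i' (delete_nth i ws)) \<in> carrier (grp D (ev u))" if "i \<le> Suc n" "i' \<le> n" for i i'
      by (rule derD[OF cut_der[OF _ std_delete_nth[OF std_delete_nth[OF ws that(1), unfolded Suc]] j] u])
        (use v Suc that in \<open>auto simp: pre_def simp del: lv_simps\<close>)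
    have "(\<Sum>i\<le>Suc n. \<Sum>i'\<le>n. frag_cmul ((-1) ^ (i' + i)) (frag_of (cut k v j m u (delete_nth i' (delete_nth i ws))))) = 0"
      by (rule double_alt_sum_zero, subst delete_nth_swap) (use w in auto)
    then have "(\<Sum>i\<le>Suc n. \<Sum>i'\<le>n. frag_cmul ((-1) ^ (i + i')) (frag_of (cut k v j m u (delete_nth i' (delete_nth i ws))))) = 0"
      by (subst add.commute)
    then have "alt_sum (grp D (ev u)) (Suc n) (\<lambda>i. alt_sum (grp D (ev u)) n (\<lambda>i'. cut k v j m u (delete_nth i' (delete_nth i ws)))) = \<one>\<^bsub>grp D (ev u)\<^esub>"
      using double_alt_sum_lin[OF A.comm_group_axioms, of "Suc n" n "\<lambda>i i'. cut k v j m u (delete_nth i' (delete_nth i ws))"] c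
      by (simp del: sum.atMost_Suc)
    then show ?thesis unfolding HE_def Suc by simp
  qed
qed

text \<open>Treats faces and degeneracies together: w acts on the vertices of the prism simplex, w'
  is the operator that it covers on the base, and the comparison with j and j' ensures that the ends
  are respected.\<close>

lemma HE_rel:
  assumes w: "\<And>t. codegen j (w t) = w' (codegen j' t)" "\<And>t. j < w t \<longleftrightarrow> j' < t" and e: "ev u1 = ev u2"
    and V: "\<And>k zs. n = Suc k \<Longrightarrow> zs \<in> std_simplices m2 k \<Longrightarrow> VV k v m1 u1 (map w' zs) = VV k v m2 u2 zs"
    and v: "pre n v" and xs: "xs \<in> std_simplices (Suc m2) n" and j': "j' \<le> m2" and u2: "u2 \<in> Arr (lv K (Suc m2))"
  shows "HE n v j m1 u1 (map w xs) = HE n v j' m2 u2 xs"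
proof (cases n)
  case 0 then show ?thesis using e by (simp add: HE_def)
next
  case (Suc k)
  have s: "delete_nth i xs \<in> std_simplices (Suc m2) k" if "i \<le> n" for i
    using std_delete_nth xs that Suc by simp
  have "alt_sum (grp D (ev u2)) n (\<lambda>i. cut k v j m1 u1 (delete_nth i (map w xs)))
      = alt_sum (grp D (ev u2)) n (\<lambda>i. cut k v j' m2 u2 (delete_nth i xs))"
  proof (rule alt_sum_cong[OF grp_D[OF ev_facts(1)[OF u2]]])
    fix i assume i: "i \<le> n"
    have "map (codegen j) (map w (delete_nth i xs)) = map w' (map (codegen j') (delete_nth i xs))" by (simp add: w(1))
    then show "cut k v j m1 u1 (delete_nth i (map w xs)) = cut k v j' m2 u2 (delete_nth i xs)"
      using V[OF Suc std_codegen[OF s[OF i] j']] by (simp add: cut_def delete_nth_map w(2) e del: map_map)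
    show "cut k v j' m2 u2 (delete_nth i xs) \<in> carrier (grp D (ev u2))"
      by (rule derD[OF cut_der[OF _ s[OF i] j'] u2]) (use v Suc in \<open>auto simp: pre_def simp del: lv_simps\<close>)
  qed
  then show ?thesis unfolding HE_def Suc e by simp
qed

lemma HH_restrict:
  assumes w: "\<And>t. codegen j (w t) = w' (codegen j' t)" "\<And>t. j < w t \<longleftrightarrow> j' < t" and e: "ev u1 = ev u2"
    and V: "\<And>k zs. n = Suc k \<Longrightarrow> zs \<in> std_simplices m2 k \<Longrightarrow> VV k v m1 u1 (map w' zs) = VV k v m2 u2 zs"
    and Y: "\<And>zs. zs \<in> std_simplices m2 n \<Longrightarrow> VV n y m1 u1 (map w' zs) = VV n y m2 u2 zs"
    and s: "\<And>xs. xs \<in> std_simplices (Suc m2) n \<Longrightarrow> map w xs \<in> std_simplices (Suc m1) n"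
    and v: "pre n v" and j': "j' \<le> m2" and u2: "u2 \<in> Arr (lv K (Suc m2))"
  shows "EM_restrict n (Suc m2) w (HH n y v j m1 u1) = HH n y v j' m2 u2"
proof (rule ext)
  fix xs
  show "EM_restrict n (Suc m2) w (HH n y v j m1 u1) xs = HH n y v j' m2 u2 xs"
  proof (cases "xs \<in> std_simplices (Suc m2) n")
    case True
    have "map (codegen j) (map w xs) = map w' (map (codegen j') xs)" by (simp add: w(1))
    then show ?thesis
      using Y[OF std_codegen[OF True j']] HE_rel[OF w e V v True j' u2] s[OF True] True
      by (simp add: EM_restrict_def HH_def e del: map_map)
  qed (simp add: EM_restrict_def HH_def)
qed

text \<open>The simplices j and j + 1 of the prism share the face opposite to the vertex j + 1; on
  it the projections agree and so do the ends.\<close>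

lemma HH_middle:
  "EM_restrict n m (coface (Suc j)) (HH n y v (Suc j) m u) = EM_restrict n m (coface (Suc j)) (HH n y v j m u)"
proof (rule ext)
  fix xs
  have c: "cut k v (Suc j) m u (map (coface (Suc j)) zs) = cut k v j m u (map (coface (Suc j)) zs)" for k zs
    by (simp add: cut_def coface_codegen(9,10) coface_codegen(11)[of j] o_def)
  show "EM_restrict n m (coface (Suc j)) (HH n y v (Suc j) m u) xs = EM_restrict n m (coface (Suc j)) (HH n y v j m u) xs"
    using std_coface[of xs m n "Suc j"]
    by (cases n) (simp_all add: EM_restrict_def HH_def HE_def delete_nth_map c coface_codegen(9,10) o_def restrict_def)
qed

text \<open>Face 0 of simplex 0 is the upper end, where \<open>cut\<close> is all of v; the sum is y
  plus the coboundary of v, which is x.\<close>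

lemma HH_first:
  assumes v: "pre n v" and u: "u \<in> Arr (lv K (Suc m))"
    and x: "\<And>u. u \<in> Arr (lv K (Suc n)) \<Longrightarrow> x u = y u \<otimes>\<^bsub>grp D (ev u)\<^esub> dlt n v u"
  shows "EM_restrict n m (coface 0) (HH n y v 0 m u) = VV n x m u"
proof (rule ext)
  fix xs
  interpret A: comm_group "grp D (ev u)" by (rule grp_D[OF ev_facts(1)[OF u]])
  show "EM_restrict n m (coface 0) (HH n y v 0 m u) xs = VV n x m u xs"
  proof (cases "xs \<in> std_simplices m n")
    case True
    have "HE n v 0 m u (map (coface 0) xs) = (if distinct xs then dlt n v (res m xs u) else \<one>\<^bsub>grp D (ev u)\<^esub>)"
    proof (cases n)
      case 0 then show ?thesis using res_arr[of m xs n u] std_goodD[OF True] u by (auto simp: HE_def dlt_def)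
    next
      case (Suc k)
      have "cut k v 0 m u (map (coface 0) zs) = VV k v m u zs" for zs
        by (simp add: cut_def coface_codegen(9) o_def) (simp add: coface_def)
      then have "HE n v 0 m u (map (coface 0) xs) = alt_sum (grp D (ev u)) (Suc k) (\<lambda>i. VV k v m u (delete_nth i xs))"
        by (simp add: HE_def Suc delete_nth_map)
      also have "\<dots> = (if distinct xs then alt_sum (grp D (ev u)) (Suc k) (\<lambda>i. v (fc K (Suc k) i (res m xs u))) else \<one>\<^bsub>grp D (ev u)\<^esub>)"
        by (rule VV_delete[OF _ u]) (use v True Suc in \<open>auto simp: pre_def simp del: lv_simps\<close>)
      also have "\<dots> = (if distinct xs then dlt n v (res m xs u) else \<one>\<^bsub>grp D (ev u)\<^esub>)"
        using res_arr[of m xs n u] std_goodD[OF True] u by (simp add: dlt_def Suc)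
      finally show ?thesis .
    qed
    then show ?thesis
      using std_coface[OF True, of 0] True x[of "res m xs u"] res_arr[of m xs n u] std_goodD[OF True] u
      by (simp add: EM_restrict_def HH_def VV_app coface_codegen(9) o_def del: lv_simps)
  qed (simp add: EM_restrict_def VV_out)
qed

text \<open>Face m + 1 of simplex m is the lower end, where every value of \<open>cut\<close> is one
  and only y remains.\<close>

lemma HH_last:
  assumes y: "der (Suc n) y" and u: "u \<in> Arr (lv K (Suc m))"
  shows "EM_restrict n m (coface (Suc m)) (HH n y v m m u) = VV n y m u"
proof (rule ext)
  fix xs
  interpret A: comm_group "grp D (ev u)" by (rule grp_D[OF ev_facts(1)[OF u]])
  show "EM_restrict n m (coface (Suc m)) (HH n y v m m u) xs = VV n y m u xs"
  proof (cases "xs \<in> std_simplices m n")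
    case True
    then have sub: "set xs \<subseteq> {..m}" and len: "length xs = Suc n" by (auto simp: std_simplices_def)
    have m: "map (coface (Suc m)) xs = xs" by (rule map_idI) (use sub in \<open>auto simp: coface_def\<close>)
    have m': "map (codegen m) xs = xs" by (rule map_idI) (use sub in \<open>auto simp: codegen_def\<close>)
    have "HE n v m m u xs = \<one>\<^bsub>grp D (ev u)\<^esub>"
    proof (cases n)
      case (Suc k)
      have "cut k v m m u (delete_nth i xs) = \<one>\<^bsub>grp D (ev u)\<^esub>" if i: "i \<le> n" for i
      proof -
        \<comment> \<open>The length matters: on the empty list the condition in \<open>cut\<close>
          would hold vacuously.\<close>
        have "length (delete_nth i xs) = Suc k" using i len Suc by (simp add: length_delete_nth)
        then obtain t where "t \<in> set (delete_nth i xs)" by (cases "delete_nth i xs") auto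
        moreover from this have "t \<le> m" using set_delete_nth[of i xs] sub by auto
        ultimately show ?thesis by (auto simp: cut_def)
      qed
      then show ?thesis using alt_sum_one[OF A.comm_group_axioms] Suc by (simp add: HE_def)
    qed (simp add: HE_def)
    then show ?thesis
      using std_coface[OF True, of "Suc m"] True VV_carrier[OF y u True] by (simp add: EM_restrict_def HH_def m m')
  qed (simp add: EM_restrict_def VV_out)
qed

lemma HH_functor:
  assumes y: "NZ n y" and v: "pre n v" and j: "j \<le> m"
  shows "(\<lambda>u\<in>Arr (lv K (Suc m)). (ev u, HH n y v j m u)) \<in> functors (lv K (Suc m)) (total_cat K (EM_natsys D n (Suc m)))"
proof (rule functor_EM)
  have Y: "der (Suc n) y" "clo n y" using y by (auto simp: NZ_def)
  have d: "der (Suc m) (\<lambda>u. VV n y m u (map (codegen j) xs) \<otimes>\<^bsub>grp D (ev u)\<^esub> HE n v j m u xs)" if "xs \<in> std_simplices (Suc m) n" for xs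
    by (rule der_mult[OF der_VV[OF Y(1) std_codegen[OF that j]] HE_der[OF v that j]])
  show "HH n y v j m (wcmp K w u) xs = push K D (ev w) (ev u) (HH n y v j m u xs)
      \<otimes>\<^bsub>grp D (Comp K (ev w) (ev u))\<^esub> pull K D (ev u) (ev w) (HH n y v j m w xs)"
    if "u \<in> Arr (lv K (Suc m))" "w \<in> Arr (lv K (Suc m))" "Cod K (ev u) = Dom K (ev w)" "xs \<in> std_simplices (Suc m) n" for u w xs
    using derW[OF d[OF that(4)] that(1-3)] that(4) by (simp add: HH_def)
  fix u assume u: "u \<in> Arr (lv K (Suc m))"
  interpret A: comm_group "grp D (ev u)" by (rule grp_D[OF ev_facts(1)[OF u]])
  have c: "HH n y v j m u xs \<in> carrier (grp D (ev u))" if "xs \<in> std_simplices (Suc m) n" for xs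
    using derD[OF d[OF that] u] that by (simp add: HH_def)
  have o: "HH n y v j m u xs = \<one>\<^bsub>grp D (ev u)\<^esub>" if "xs \<in> std_simplices (Suc m) n" "\<not> distinct xs" for xs
    using that HE_one[OF v u that(1) j that(2)] std_codegen[OF that(1) j] distinct_map[of "codegen j" xs]
    by (simp add: HH_def VV_app)
  have z: "alt_sum (grp D (ev u)) (Suc n) (\<lambda>i. HH n y v j m u (delete_nth i ws)) = \<one>\<^bsub>grp D (ev u)\<^esub>"
    if ws: "ws \<in> std_simplices (Suc m) (Suc n)" for ws
  proof -
    have s: "delete_nth i ws \<in> std_simplices (Suc m) n" if "i \<le> Suc n" for i by (rule std_delete_nth[OF ws that])
    have a: "VV n y m u (delete_nth i (map (codegen j) ws)) \<in> carrier (grp D (ev u))" if "i \<le> Suc n" for i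
      by (rule VV_carrier[OF Y(1) u std_delete_nth[OF std_codegen[OF ws j] that]])
    have b: "HE n v j m u (delete_nth i ws) \<in> carrier (grp D (ev u))" if "i \<le> Suc n" for i
      by (rule derD[OF HE_der[OF v s[OF that] j] u])
    have "alt_sum (grp D (ev u)) (Suc n) (\<lambda>i. HH n y v j m u (delete_nth i ws))
        = alt_sum (grp D (ev u)) (Suc n) (\<lambda>i. VV n y m u (delete_nth i (map (codegen j) ws)) \<otimes>\<^bsub>grp D (ev u)\<^esub> HE n v j m u (delete_nth i ws))"
      by (rule alt_sum_cong[OF A.comm_group_axioms]) (use s a b in \<open>auto simp: HH_def delete_nth_map\<close>)
    also have "\<dots> = \<one>\<^bsub>grp D (ev u)\<^esub>"
      using alt_sum_mult[OF A.comm_group_axioms, of "Suc n" "\<lambda>i. VV n y m u (delete_nth i (map (codegen j) ws))" "\<lambda>i. HE n v j m u (delete_nth i ws)"]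
        a b VV_closed[OF Y u std_codegen[OF ws j]] HE_closed[OF v u ws j] by simp
    finally show ?thesis .
  qed
  have "HH n y v j m u \<in> std_simplices (Suc m) n \<rightarrow>\<^sub>E carrier (grp D (ev u))"
    using c by (auto simp: HH_def)
  then show "HH n y v j m u \<in> carrier (EM_group (grp D (ev u)) n (Suc m))" using o z by (simp add: EM_group_def)
qed

lemma homotopic_mk:
  assumes x: "NZ n x" and y: "NZ n y" and v: "pre n v"
    and r: "\<And>u. u \<in> Arr (lv K (Suc n)) \<Longrightarrow> x u = y u \<otimes>\<^bsub>grp D (ev u)\<^esub> dlt n v u"
  shows "(mk n x, mk n y) \<in> homotopic (resolution K) (EM K D n)"
proof -
  let ?h = "\<lambda>m j. \<lambda>u\<in>Arr (lv K (Suc m)). (ev u, HH n y v j m u)"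
  have Y: "der (Suc n) y" "nml n y" "clo n y" using y by (auto simp: NZ_def)
  have nv: "nml k v" if "n = Suc k" for k using v that by (auto simp: pre_def)
  \<comment> \<open>\<open>fcH\<close> and \<open>dgH\<close> reduce the identities for the
    remaining faces and for the degeneracies to the index rules of
    \<open>coface_codegen\<close>.\<close>
  have fcH: "EM_restrict n (Suc m) (coface i) (HH n y v j (Suc m) u) = HH n y v j' m (fc K (Suc m) i' u)"
    if u: "u \<in> Arr (lv K (Suc (Suc m)))" and i: "i' \<le> Suc m" "j' \<le> m"
      "\<And>t. codegen j (coface i t) = coface i' (codegen j' t)" "\<And>t. j < coface i t \<longleftrightarrow> j' < t" for m i j i' j' u
    by (rule HH_restrict[where w' = "coface i'"])
      (use i VV_face[OF u i(1)] ev_fc[OF i(1) u] fc_arr[OF i(1) u] std_coface v in \<open>auto simp del: lv_simps\<close>)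
  have dgH: "EM_restrict n (Suc (Suc m)) (codegen i) (HH n y v j m u) = HH n y v j' (Suc m) (dg K m i' u)"
    if u: "u \<in> Arr (lv K (Suc m))" and i: "i' \<le> m" "j' \<le> Suc m" "i \<le> Suc m"
      "\<And>t. codegen j (codegen i t) = codegen i' (codegen j' t)" "\<And>t. j < codegen i t \<longleftrightarrow> j' < t" for m i j i' j' u
    by (rule HH_restrict[where w' = "codegen i'"])
      (use i VV_degen[OF _ u i(1)] Y(2) nv ev_dg[OF i(1) u] dg_arr[OF i(1) u] std_codegen v in \<open>auto simp del: lv_simps\<close>)
  have "scat_homotopy (resolution K) (EM K D n) (mk n x) (mk n y) ?h"
    unfolding scat_homotopy_def resolution_simps EM_simps(1,4)
  proof (intro conjI allI ballI impI)
    fix m j :: nat assume "j \<le> m"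
    then show "?h m j \<in> functors (lv K (Suc m)) (total_cat K (EM_natsys D n (Suc m)))" by (rule HH_functor[OF y v])
    show "fst (?h m j u) = ev u" if "u \<in> Arr (lv K (Suc m))" for u using that by simp
  next
    fix m :: nat and u assume u: "u \<in> Arr (lv K (Suc m))"
    show "face (EM K D n) m 0 (?h m 0 u) = mk n x m u"
      using u HH_first[OF v u r] by (simp add: EM_simps mk_def del: lv_simps)
    show "face (EM K D n) m (Suc m) (?h m m u) = mk n y m u"
      using u HH_last[OF Y(1) u] by (simp add: EM_simps mk_def del: lv_simps)
  next
    fix m i j :: nat and u assume u: "u \<in> Arr (lv K (Suc (Suc m)))" and ij: "i < j" "j \<le> Suc m"
    have i: "i \<le> Suc m" using ij by simp
    show "face (EM K D n) (Suc m) i (?h (Suc m) j u) = ?h m (j - 1) (fc K (Suc m) i u)"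
      using fcH[OF u i, of "j - 1" j i] ij coface_codegen(1,2)[OF ij(1)] u fc_arr[OF i u] ev_fc[OF i u]
      by (simp add: EM_simps del: lv_simps)
  next
    fix m j :: nat and u assume u: "u \<in> Arr (lv K (Suc m))" and "j < m"
    show "face (EM K D n) m (Suc j) (?h m (Suc j) u) = face (EM K D n) m (Suc j) (?h m j u)"
      using u by (simp add: EM_simps HH_middle del: lv_simps)
  next
    fix m i j :: nat and u assume u: "u \<in> Arr (lv K (Suc (Suc m)))" and ij: "Suc j < i" "i \<le> Suc (Suc m)"
    have i: "i - 1 \<le> Suc m" "j \<le> m" using ij by auto
    show "face (EM K D n) (Suc m) i (?h (Suc m) j u) = ?h m j (fc K (Suc m) (i - 1) u)"
      using fcH[OF u i, of j i] coface_codegen(3,4)[OF ij(1)] u fc_arr[OF i(1) u] ev_fc[OF i(1) u]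
      by (simp add: EM_simps del: lv_simps)
  next
    fix m i j :: nat and u assume u: "u \<in> Arr (lv K (Suc m))" and ij: "i \<le> j" "j \<le> m"
    have i: "i \<le> m" "Suc j \<le> Suc m" "i \<le> Suc m" using ij by auto
    show "degen (EM K D n) (Suc m) i (?h m j u) = ?h (Suc m) (Suc j) (dg K m i u)"
      using dgH[OF u i, of j] coface_codegen(5,6)[OF ij(1)] u dg_arr[OF i(1) u] ev_dg[OF i(1) u]
      by (simp add: EM_simps del: lv_simps)
  next
    fix m i j :: nat and u assume u: "u \<in> Arr (lv K (Suc m))" and ij: "j < i" "i \<le> Suc m"
    have i: "i - 1 \<le> m" "j \<le> Suc m" "i \<le> Suc m" using ij by auto
    show "degen (EM K D n) (Suc m) i (?h m j u) = ?h (Suc m) j (dg K m (i - 1) u)"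
      using dgH[OF u i, of j] coface_codegen(7,8)[OF ij(1)] u dg_arr[OF i(1) u] ev_dg[OF i(1) u]
      by (simp add: EM_simps del: lv_simps)
  qed
  then show ?thesis using mk_scat[OF x] mk_scat[OF y] by (auto simp: homotopic_def)
qed

end

section \<open>From a homotopy to a coboundary, and the normalization of the latter\<close>

lemma alt_sum_two:
  assumes "comm_group A" "\<And>i. i \<le> 1 \<Longrightarrow> g i \<in> carrier A"
  shows "alt_sum A (Suc 0) g = g 0 \<otimes>\<^bsub>A\<^esub> inv\<^bsub>A\<^esub> g (Suc 0)"
proof -
  interpret A: comm_group A by fact
  have "g 0 \<in> carrier A" "g (Suc 0) \<in> carrier A" using assms(2) by auto
  then show ?thesis by (simp add: alt_sum_def atMost_Suc A.m_comm)
qed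

context nat_sys
begin

text \<open>Cohomologous derivations, through a cochain v that need not be normalized. This relation
  is easy to produce and to compose; \<open>homotopic_iff\<close> shows that it amounts to homotopy
  of the corresponding maps.\<close>

definition dif where
  "dif n x y \<longleftrightarrow> (\<exists>v. (\<forall>k. n = Suc k \<longrightarrow> der (Suc k) v) \<and>
     (\<forall>u\<in>Arr (lv K (Suc n)). x u = y u \<otimes>\<^bsub>grp D (ev u)\<^esub> dlt n v u))"

lemma functor_EM_carrier:
  assumes f: "f \<in> functors (lv K l) (total_cat K (EM_natsys D n m))"
    and p: "fst (f u) = ev u" and u: "u \<in> Arr (lv K l)"
  shows "snd (f u) \<in> carrier (EM_group (grp D (ev u)) n m)"
proof -
  have "f u \<in> Arr (total_cat K (EM_natsys D n m))" using f u by (auto simp: functors_iff isfun_def)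
  moreover have "f u = (ev u, snd (f u))" using p by (simp add: prod_eq_iff)
  ultimately have "(ev u, snd (f u)) \<in> Arr (total_cat K (EM_natsys D n m))" by (rule back_subst[where P = "\<lambda>z. z \<in> Arr (total_cat K (EM_natsys D n m))"])
  then show ?thesis by (simp add: total_simps grp_EM)
qed

lemma homotopic_dif:
  assumes FG: "(F, G) \<in> homotopic (resolution K) (EM K D n)"
  shows "dif n (xF n F) (xF n G)"
proof -
  obtain h where F: "F \<in> scat_maps (resolution K) (EM K D n)" and G: "G \<in> scat_maps (resolution K) (EM K D n)"
    and H: "scat_homotopy (resolution K) (EM K D n) F G h" using FG unfolding homotopic_def by blast
  note H1 = H[unfolded scat_homotopy_def resolution_simps EM_simps(1,4)]
  note H2 = conjunct2[OF H1] note H3 = conjunct2[OF H2] note H4 = conjunct2[OF H3] note H5 = conjunct2[OF H4]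
  have hf: "\<And>m j. j \<le> m \<Longrightarrow> h m j \<in> functors (lv K (Suc m)) (total_cat K (EM_natsys D n (Suc m)))" using conjunct1[OF H1] by blast
  have hp: "\<And>m j u. j \<le> m \<Longrightarrow> u \<in> Arr (lv K (Suc m)) \<Longrightarrow> fst (h m j u) = ev u" using conjunct1[OF H1] by blast
  have h0: "\<And>m u. u \<in> Arr (lv K (Suc m)) \<Longrightarrow> face (EM K D n) m 0 (h m 0 u) = F m u" using conjunct1[OF H2] by blast
  have h1: "\<And>m u. u \<in> Arr (lv K (Suc m)) \<Longrightarrow> face (EM K D n) m (Suc m) (h m m u) = G m u" using conjunct1[OF H2] by blast
  have lo: "\<And>m i j u. u \<in> Arr (lv K (Suc (Suc m))) \<Longrightarrow> i < j \<Longrightarrow> j \<le> Suc m \<Longrightarrow>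
        face (EM K D n) (Suc m) i (h (Suc m) j u) = h m (j - 1) (fc K (Suc m) i u)" using conjunct1[OF H3] by blast
  have mid: "\<And>m j u. u \<in> Arr (lv K (Suc m)) \<Longrightarrow> j < m \<Longrightarrow>
        face (EM K D n) m (Suc j) (h m (Suc j) u) = face (EM K D n) m (Suc j) (h m j u)" using conjunct1[OF H4] by blast
  have hi: "\<And>m i j u. u \<in> Arr (lv K (Suc (Suc m))) \<Longrightarrow> Suc j < i \<Longrightarrow> i \<le> Suc (Suc m) \<Longrightarrow>
        face (EM K D n) (Suc m) i (h (Suc m) j u) = h m j (fc K (Suc m) (i - 1) u)" using conjunct1[OF H5] by blast
  have fa: "snd p (map (coface i) [0..<Suc n]) = snd (face (EM K D n) n i p) [0..<Suc n]" for p i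
    unfolding snd_face EM_restrict_def using upt_std by simp
  let ?g = "\<lambda>u i j. snd (h n j u) (map (coface i) [0..<Suc n])"
  have gc: "?g u i j \<in> carrier (grp D (ev u))" if "u \<in> Arr (lv K (Suc n))" "j \<le> n" for u i j
    by (rule EM_group_D(1)[OF functor_EM_carrier[OF hf[OF that(2)] hp[OF that(2,1)] that(1)] std_coface[OF upt_std]])
  have z: "alt_sum (grp D (ev u)) (Suc n) (\<lambda>i. ?g u i j) = \<one>\<^bsub>grp D (ev u)\<^esub>"
    if u: "u \<in> Arr (lv K (Suc n))" and j: "j \<le> n" for u j
  proof -
    have "alt_sum (grp D (ev u)) (Suc n) (\<lambda>i. ?g u i j)
        = alt_sum (grp D (ev u)) (Suc n) (\<lambda>i. snd (h n j u) (delete_nth i [0..<Suc (Suc n)]))"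
      by (rule alt_sum_cong[OF grp_D[OF ev_facts(1)[OF u]]]) (simp_all only: delete_nth_upt gc[OF u j])
    also have "\<dots> = \<one>\<^bsub>grp D (ev u)\<^esub>"
      by (rule EM_group_D(3)[OF functor_EM_carrier[OF hf[OF j] hp[OF j u] u] upt_std])
    finally show ?thesis .
  qed
  have g0: "?g u 0 0 = xF n F u" and g1: "?g u (Suc n) n = xF n G u" if "u \<in> Arr (lv K (Suc n))" for u
    unfolding fa xF_def h0[OF that] h1[OF that] by simp_all
  show ?thesis
  proof (cases n)
    case 0
    have "xF n F u = xF n G u \<otimes>\<^bsub>grp D (ev u)\<^esub> dlt n v u" if u: "u \<in> Arr (lv K (Suc n))" for u v
    proof -
      interpret A: comm_group "grp D (ev u)" by (rule grp_D[OF ev_facts(1)[OF u]])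
      have c: "xF n F u \<in> carrier (grp D (ev u))" "xF n G u \<in> carrier (grp D (ev u))"
        using gc[OF u, of 0 0] gc[OF u, of n "Suc n"] g0[OF u] g1[OF u] by simp_all
      have "xF n F u \<otimes>\<^bsub>grp D (ev u)\<^esub> inv\<^bsub>grp D (ev u)\<^esub> xF n G u = \<one>\<^bsub>grp D (ev u)\<^esub>"
        using alt_sum_two[OF A.comm_group_axioms, of "\<lambda>i. ?g u i 0"] z[OF u, of 0] gc[OF u, of 0] g0[OF u] g1[OF u]
        by (simp add: 0 del: upt_Suc)
      then show ?thesis using A.three_term_solve[of "xF n F u" "xF n G u" "\<one>\<^bsub>grp D (ev u)\<^esub>"] c 0
        by (simp add: dlt_def)
    qed
    then show ?thesis unfolding dif_def using 0 by blast
  next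
    case (Suc k)
    \<comment> \<open>The usual cochain attached to a simplicial homotopy: the alternating sum of
      its components, evaluated at the top simplex.\<close>
    define v where "v w = alt_sum (grp D (ev w)) k (\<lambda>j. snd (h k j w) [0..<Suc n])" for w
    have s: "[0..<Suc n] \<in> std_simplices (Suc k) n" unfolding Suc by (rule upt_std)
    have hd: "der (Suc k) (\<lambda>w. snd (h k j w) [0..<Suc n])" if "j \<le> k" for j
      by (rule functor_EM_der[OF hf[OF that] hp[OF that] s])
    have v: "der (Suc k) v" unfolding v_def by (rule der_alt_sum[OF hd])
    have "xF n F u = xF n G u \<otimes>\<^bsub>grp D (ev u)\<^esub> dlt n v u" if u: "u \<in> Arr (lv K (Suc n))" for u
    proof -
      interpret A: comm_group "grp D (ev u)" by (rule grp_D[OF ev_facts(1)[OF u]])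
      have u': "u \<in> Arr (lv K (Suc (Suc k)))" using u unfolding Suc .
      let ?b = "\<lambda>i j. snd (h k j (fc K n i u)) [0..<Suc n]"
      have f: "fc K n i u \<in> Arr (lv K (Suc k))" "ev (fc K n i u) = ev u" if "i \<le> n" for i
        using fc_arr[OF that u] ev_fc[OF that u] unfolding Suc by simp_all
      have bc: "?b i j \<in> carrier (grp D (ev u))" if "i \<le> n" "j \<le> k" for i j
        using derD[OF hd[OF that(2)] f(1)[OF that(1)]] f(2)[OF that(1)] by simp
      have c: "xF n F u \<in> carrier (grp D (ev u))" "xF n G u \<in> carrier (grp D (ev u))"
        using gc[OF u, of 0 0] gc[OF u, of n "Suc n"] g0[OF u] g1[OF u] by simp_all
      let ?B = "\<Sum>i\<le>n. \<Sum>j\<le>k. frag_cmul ((-1) ^ (i + j)) (frag_of (?b i j))"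
      have B: "?B \<in> chn (carrier (grp D (ev u)))" by (intro chn_sum chn_cmul) (use bc in auto)
      have P: "frag_of (xF n F u) - frag_of (xF n G u) \<in> chn (carrier (grp D (ev u)))"
        by (rule chn_diff) (use c in auto)
      \<comment> \<open>The cocycle condition of every component at the top simplex, summed with
        signs over the components. \<open>prism_sum\<close> then leaves the two ends and the
        coboundary of v.\<close>
      have "\<one>\<^bsub>grp D (ev u)\<^esub> = alt_sum (grp D (ev u)) n (\<lambda>j. alt_sum (grp D (ev u)) (Suc n) (\<lambda>i. ?g u i j))"
        by (rule alt_sum_one[OF A.comm_group_axioms z[OF u], symmetric])
      also have "\<dots> = linD (ev u) (\<lambda>x. x) (\<Sum>j\<le>n. \<Sum>i\<le>Suc n. frag_cmul ((-1) ^ (j + i)) (frag_of (?g u i j)))"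
        by (rule double_alt_sum_lin[OF A.comm_group_axioms]) (rule gc[OF u])
      also have "(\<Sum>j\<le>n. \<Sum>i\<le>Suc n. frag_cmul ((-1) ^ (j + i)) (frag_of (?g u i j)))
          = frag_of (?g u 0 0) - frag_of (?g u (Suc n) n) - ?B"
        unfolding Suc
      proof (rule prism_sum)
        fix i j assume ij: "i < j" "j \<le> Suc k"
        show "frag_of (snd (h (Suc k) j u) (map (coface i) [0..<Suc (Suc k)])) = frag_of (snd (h k (j - 1) (fc K (Suc k) i u)) [0..<Suc (Suc k)])"
          using fa[of "h n j u" i] lo[OF u' ij] unfolding Suc by (simp only:)
      next
        fix j assume j: "j < Suc k"
        show "frag_of (snd (h (Suc k) (Suc j) u) (map (coface (Suc j)) [0..<Suc (Suc k)])) = frag_of (snd (h (Suc k) j u) (map (coface (Suc j)) [0..<Suc (Suc k)]))"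
          using fa[of "h n j u" "Suc j"] fa[of "h n (Suc j) u" "Suc j"] mid[OF u' j] unfolding Suc by (simp only:)
      next
        fix i j assume ij: "Suc j < i" "i \<le> Suc (Suc k)"
        show "frag_of (snd (h (Suc k) j u) (map (coface i) [0..<Suc (Suc k)])) = frag_of (snd (h k j (fc K (Suc k) (i - 1) u)) [0..<Suc (Suc k)])"
          using fa[of "h n j u" i] hi[OF u' ij] unfolding Suc by (simp only:)
      qed
      also have "\<dots> = (frag_of (xF n F u) - frag_of (xF n G u)) - ?B" unfolding g0[OF u] g1[OF u] ..
      also have "linD (ev u) (\<lambda>x. x) \<dots> = linD (ev u) (\<lambda>x. x) (frag_of (xF n F u) - frag_of (xF n G u))
          \<otimes>\<^bsub>grp D (ev u)\<^esub> inv\<^bsub>grp D (ev u)\<^esub> (linD (ev u) (\<lambda>x. x) ?B)"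
        by (rule A.lin_diff) (use P B in \<open>auto simp: chn_def\<close>)
      also have "linD (ev u) (\<lambda>x. x) (frag_of (xF n F u) - frag_of (xF n G u)) = xF n F u \<otimes>\<^bsub>grp D (ev u)\<^esub> inv\<^bsub>grp D (ev u)\<^esub> xF n G u"
        by (subst A.lin_diff) (use c in auto)
      also have "linD (ev u) (\<lambda>x. x) ?B = alt_sum (grp D (ev u)) n (\<lambda>i. alt_sum (grp D (ev u)) k (?b i))"
        by (rule double_alt_sum_lin[OF A.comm_group_axioms, symmetric]) (rule bc)
      also have "\<dots> = alt_sum (grp D (ev u)) n (\<lambda>i. v (fc K n i u))"
        by (rule alt_sum_cong[OF A.comm_group_axioms]) (use f derD[OF v f(1)] in \<open>auto simp: v_def simp del: lv_simps upt_Suc\<close>)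
      also have "\<dots> = dlt n v u" by (simp add: dlt_def Suc)
      finally have "xF n F u \<otimes>\<^bsub>grp D (ev u)\<^esub> inv\<^bsub>grp D (ev u)\<^esub> xF n G u \<otimes>\<^bsub>grp D (ev u)\<^esub> inv\<^bsub>grp D (ev u)\<^esub> dlt n v u = \<one>\<^bsub>grp D (ev u)\<^esub>" ..
      moreover have "dlt n v u \<in> carrier (grp D (ev u))"
        unfolding dlt_def Suc nat.case
        by (rule alt_sum_closed[OF A.comm_group_axioms]) (use f derD[OF v f(1)] Suc in \<open>auto simp del: lv_simps\<close>)
      ultimately show ?thesis by (intro A.three_term_solve c)
    qed
    then show ?thesis unfolding dif_def using v Suc by blast
  qed
qed

lemma sdg_iota: "j \<le> l \<Longrightarrow> w \<in> Arr (lv K (Suc l)) \<Longrightarrow> sdg l j (frag_of (iota w)) = frag_of (iota (dg K l j w))"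
  by (simp add: sdg_def mapg_def iota_def ev_dg del: lv_simps)

lemma nrm_iota:
  assumes c: "c \<in> coch 1 (Suc n)"
  shows "nrm 1 (Suc n) c \<longleftrightarrow> nml n (\<lambda>u. c (iota u))"
proof
  assume n: "nrm 1 (Suc n) c"
  show "nml n (\<lambda>u. c (iota u))"
    unfolding nml_def
  proof (intro allI impI ballI)
    fix l j w assume l: "n = Suc l" and j: "j \<le> l" and w: "w \<in> Arr (lv K (Suc l))"
    have i: "iota (dg K l j w) \<in> X 1 (Suc n) (ev w)"
      using iota_X[OF dg_arr[OF j w]] ev_dg[OF j w] l by simp
    have "linD (ev w) c (sdg l j (frag_of (iota w))) = \<one>\<^bsub>grp D (ev w)\<^esub>"
      using n l j ev_facts(1)[OF w] iota_X[OF w] unfolding nrm_def by auto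
    then show "c (iota (dg K l j w)) = \<one>\<^bsub>grp D (ev w)\<^esub>"
      unfolding sdg_iota[OF j w] linD_of[OF c i] .
  qed
next
  assume n: "nml n (\<lambda>u. c (iota u))"
  show "nrm 1 (Suc n) c"
    unfolding nrm_def
  proof (intro allI impI)
    fix l j f \<zeta> assume l: "Suc n = Suc (Suc l)" and j: "j \<le> l" and f: "f \<in> Arr K" and z: "\<zeta> \<in> ch 1 (Suc l) f"
    have c': "c \<in> coch 1 (Suc (Suc l))" using c l by simp
    have "linD f c (sdg l j \<zeta>) = linD f (pb (sdg l j) c) \<zeta>"
      by (rule linD_pb[OF isop_sdg[OF j] c' z f, symmetric])
    also have "\<dots> = linD f cone \<zeta>"
    proof (rule linD_ext[OF f z pb_coch[OF isop_sdg[OF j] c'] coch_ops(1)])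
      fix w assume w: "w \<in> Arr (lv K (Suc l))"
      have i: "iota (dg K l j w) \<in> X 1 (Suc (Suc l)) (ev w)"
        using iota_X[OF dg_arr[OF j w]] ev_dg[OF j w] by simp
      show "pb (sdg l j) c (iota w) = cone (iota w)"
        unfolding pb_X[OF iota_X[OF w]] cone_X[OF iota_X[OF w]] sdg_iota[OF j w] linD_of[OF c' i]
        using n l j w unfolding nml_def by simp
    qed
    also have "\<dots> = \<one>\<^bsub>grp D f\<^esub>" by (rule linD_cone[OF z f])
    finally show "linD f c (sdg l j \<zeta>) = \<one>\<^bsub>grp D f\<^esub>" .
  qed
qed

lemma vcyc_iota:
  assumes c: "c \<in> coch 1 (Suc n)"
  shows "vcyc 1 (Suc n) c \<longleftrightarrow> clo n (\<lambda>u. c (iota u))"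
proof
  assume v: "vcyc 1 (Suc n) c"
  show "clo n (\<lambda>u. c (iota u))"
    unfolding clo_def
  proof
    fix u assume u: "u \<in> Arr (lv K (Suc (Suc n)))"
    show "alt_sum (grp D (ev u)) (Suc n) (\<lambda>i. c (iota (fc K (Suc n) i u))) = \<one>\<^bsub>grp D (ev u)\<^esub>"
      unfolding linD_vd_iota[OF c u, symmetric]
      by (rule vcycD[OF v _ ev_facts(1)[OF u]]) (use iota_X[OF u] in simp)
  qed
next
  assume n: "clo n (\<lambda>u. c (iota u))"
  show "vcyc 1 (Suc n) c"
    unfolding vcyc_def
  proof (intro conjI c ballI)
    fix f \<zeta> assume f: "f \<in> Arr K" and z: "\<zeta> \<in> ch 1 (Suc (Suc n)) f"
    have "linD f c (vd (Suc n) \<zeta>) = linD f (pb (vd (Suc n)) c) \<zeta>"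
      by (rule linD_pb[OF isop_vd c z f, symmetric])
    also have "\<dots> = linD f cone \<zeta>"
    proof (rule linD_ext[OF f z pb_coch[OF isop_vd c] coch_ops(1)])
      fix w assume w: "w \<in> Arr (lv K (Suc (Suc n)))"
      show "pb (vd (Suc n)) c (iota w) = cone (iota w)"
        unfolding pb_X[OF iota_X[OF w]] cone_X[OF iota_X[OF w]] linD_vd_iota[OF c w]
        using n w unfolding clo_def by blast
    qed
    also have "\<dots> = \<one>\<^bsub>grp D f\<^esub>" by (rule linD_cone[OF z f])
    finally show "linD f c (vd (Suc n) \<zeta>) = \<one>\<^bsub>grp D f\<^esub>" .
  qed
qed

lemma NZ_iota:
  assumes "rcyc 1 (Suc n) c" "vcyc 1 (Suc n) c" "nrm 1 (Suc n) c"
  shows "NZ n (\<lambda>u. c (iota u))"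
  using assms rcyc_der nrm_iota vcyc_iota rcyc_coch[OF assms(1)] by (simp add: NZ_def)

lemma NZ_cong:
  assumes x: "NZ n x" and e: "\<And>u. u \<in> Arr (lv K (Suc n)) \<Longrightarrow> y u = x u"
  shows "NZ n y"
  unfolding NZ_def
proof (intro conjI)
  have X: "der (Suc n) x" "nml n x" "clo n x" using x by (auto simp: NZ_def)
  show "der (Suc n) y"
    unfolding der_def
  proof (intro conjI ballI impI)
    show "y u \<in> carrier (grp D (ev u))" if "u \<in> Arr (lv K (Suc n))" for u using derD[OF X(1) that] e[OF that] by simp
    fix u v assume u: "u \<in> Arr (lv K (Suc n))" and v: "v \<in> Arr (lv K (Suc n))" and uv: "Cod K (ev u) = Dom K (ev v)"
    show "y (wcmp K v u) = push K D (ev v) (ev u) (y u) \<otimes>\<^bsub>grp D (Comp K (ev v) (ev u))\<^esub> pull K D (ev u) (ev v) (y v)"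
      unfolding e[OF u] e[OF v] e[OF wcmp_facts(1)[OF u v uv]] by (rule derW[OF X(1) u v uv])
  qed
  show "nml n y"
    unfolding nml_def
  proof (intro allI impI ballI)
    fix l j w assume l: "n = Suc l" and j: "j \<le> l" and w: "w \<in> Arr (lv K (Suc l))"
    have "dg K l j w \<in> Arr (lv K (Suc n))" using dg_arr[OF j w] l by simp
    from e[OF this] show "y (dg K l j w) = \<one>\<^bsub>grp D (ev w)\<^esub>" using X(2) l j w unfolding nml_def by simp
  qed
  show "clo n y"
    unfolding clo_def
  proof
    fix u assume u: "u \<in> Arr (lv K (Suc (Suc n)))"
    have "alt_sum (grp D (ev u)) (Suc n) (\<lambda>i. y (fc K (Suc n) i u)) = alt_sum (grp D (ev u)) (Suc n) (\<lambda>i. x (fc K (Suc n) i u))"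
    proof (rule alt_sum_cong[OF grp_D[OF ev_facts(1)[OF u]]])
      fix i assume i: "i \<le> Suc n"
      show "y (fc K (Suc n) i u) = x (fc K (Suc n) i u)" by (rule e[OF fc_arr[OF i u]])
      show "x (fc K (Suc n) i u) \<in> carrier (grp D (ev u))" using derD[OF X(1) fc_arr[OF i u]] ev_fc[OF i u] by simp
    qed
    also have "\<dots> = \<one>\<^bsub>grp D (ev u)\<^esub>" using X(3) u unfolding clo_def by blast
    finally show "alt_sum (grp D (ev u)) (Suc n) (\<lambda>i. y (fc K (Suc n) i u)) = \<one>\<^bsub>grp D (ev u)\<^esub>" .
  qed
qed

lemma NZ_toc:
  assumes x: "NZ n x"
  shows "rcyc 1 (Suc n) (toc x)" "vcyc 1 (Suc n) (toc x)" "nrm 1 (Suc n) (toc x)"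
    "u \<in> Arr (lv K (Suc n)) \<Longrightarrow> toc x (iota u) = x u"
proof -
  have d: "der (Suc n) x" using x by (simp add: NZ_def)
  show e: "toc x (iota u) = x u" if "u \<in> Arr (lv K (Suc n))" for u
    by (rule toc_iota, rule ev_facts(1)[OF that], rule derD[OF d that])
  show r: "rcyc 1 (Suc n) (toc x)" by (rule toc_rcyc[OF d])
  have "NZ n (\<lambda>u. toc x (iota u))" by (rule NZ_cong[OF x e])
  then show "vcyc 1 (Suc n) (toc x)" "nrm 1 (Suc n) (toc x)"
    using nrm_iota[OF rcyc_coch[OF r]] vcyc_iota[OF rcyc_coch[OF r]] by (simp_all add: NZ_def)
qed

lemma dlt_linD:
  assumes "c \<in> coch 1 (Suc k)" "u \<in> Arr (lv K (Suc (Suc k)))"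
  shows "dlt (Suc k) (\<lambda>u. c (iota u)) u = linD (ev u) c (vd (Suc k) (frag_of (iota u)))"
  unfolding linD_vd_iota[OF assms] by (simp add: dlt_def)

lemma dlt_closed:
  assumes v: "\<And>k. n = Suc k \<Longrightarrow> der (Suc k) v" and u: "u \<in> Arr (lv K (Suc n))"
  shows "dlt n v u \<in> carrier (grp D (ev u))"
proof -
  interpret A: comm_group "grp D (ev u)" by (rule grp_D[OF ev_facts(1)[OF u]])
  show ?thesis
  proof (cases n)
    case (Suc k)
    have "v (fc K n i u) \<in> carrier (grp D (ev u))" if i: "i \<le> n" for i
      using derD[OF v[OF Suc], of "fc K n i u"] fc_arr[OF i u] ev_fc[OF i u] Suc by (simp del: lv_simps)
    then show ?thesis unfolding dlt_def Suc nat.case by (intro alt_sum_closed[OF A.comm_group_axioms]) simp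
  qed (simp add: dlt_def)
qed

lemma dlt_cong:
  assumes v: "\<And>k. n = Suc k \<Longrightarrow> der (Suc k) v" and u: "u \<in> Arr (lv K (Suc n))"
    and e: "\<And>k w. n = Suc k \<Longrightarrow> w \<in> Arr (lv K (Suc k)) \<Longrightarrow> v' w = v w"
  shows "dlt n v' u = dlt n v u"
proof (cases n)
  case (Suc k)
  have "v (fc K n i u) \<in> carrier (grp D (ev u)) \<and> v' (fc K n i u) = v (fc K n i u)" if i: "i \<le> n" for i
    using derD[OF v[OF Suc], of "fc K n i u"] e[OF Suc, of "fc K n i u"] fc_arr[OF i u] ev_fc[OF i u] Suc by (simp del: lv_simps)
  then show ?thesis unfolding dlt_def Suc nat.case by (intro alt_sum_cong[OF grp_D[OF ev_facts(1)[OF u]]]) auto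
qed (simp add: dlt_def)

text \<open>The coboundary of v is the difference of two normalized cocycles, hence normalized, as
  \<open>normalize\<close> requires. Normalizing changes v by a coboundary, so
  \<open>dlt n v\<close> stays the same. For n < 2 there are no degenerate elements to consider in
  the degree of v.\<close>

lemma dif_normal:
  assumes x: "NZ n x" and y: "NZ n y" and d: "dif n x y"
  obtains v where "pre n v" "\<And>u. u \<in> Arr (lv K (Suc n)) \<Longrightarrow> x u = y u \<otimes>\<^bsub>grp D (ev u)\<^esub> dlt n v u"
proof -
  obtain v where v: "\<And>k. n = Suc k \<Longrightarrow> der (Suc k) v"
    and e: "\<And>u. u \<in> Arr (lv K (Suc n)) \<Longrightarrow> x u = y u \<otimes>\<^bsub>grp D (ev u)\<^esub> dlt n v u"
    using d unfolding dif_def by blast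
  show ?thesis
  proof (cases "\<exists>l. n = Suc (Suc l)")
    case False
    then have "pre n v" using v by (auto simp: pre_def nml_def)
    then show ?thesis using e by (rule that)
  next
    case True
    then obtain l where l: "n = Suc (Suc l)" by blast
    let ?c = "toc v"
    have vd: "der (Suc (Suc l)) v" by (rule v[OF l])
    have r: "rcyc 1 (Suc (Suc l)) ?c" by (rule toc_rcyc[OF vd])
    note C = rcyc_coch[OF r]
    have cv: "?c (iota w) = v w" if "w \<in> Arr (lv K (Suc (Suc l)))" for w
      by (rule toc_iota, rule ev_facts(1)[OF that], rule derD[OF vd that])
    have dl: "dlt n (\<lambda>u. ?c (iota u)) u = dlt n v u" if u: "u \<in> Arr (lv K (Suc n))" for u
      by (rule dlt_cong[OF v u]) (use cv l in auto)
    have pc: "pb (vd (Suc (Suc l))) ?c \<in> coch 1 (Suc n)" unfolding l by (rule pb_coch[OF isop_vd C])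
    have pe: "pb (vd (Suc (Suc l))) ?c (iota u) = dlt n v u" if u: "u \<in> Arr (lv K (Suc n))" for u
      using dlt_linD[OF C, of u] dl[OF u] u pb_X[OF iota_X[OF u]] unfolding l by simp
    have "nml n (\<lambda>u. pb (vd (Suc (Suc l))) ?c (iota u))"
      unfolding nml_def
    proof (intro allI impI ballI)
      fix l' j w assume l': "n = Suc l'" and j: "j \<le> l'" and w: "w \<in> Arr (lv K (Suc l'))"
      interpret A: comm_group "grp D (ev w)" by (rule grp_D[OF ev_facts(1)[OF w]])
      have dw: "dg K l' j w \<in> Arr (lv K (Suc n))" using dg_arr[OF j w] l' by simp
      have xy: "x (dg K l' j w) = \<one>\<^bsub>grp D (ev w)\<^esub>" "y (dg K l' j w) = \<one>\<^bsub>grp D (ev w)\<^esub>"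
        using x y l' j w unfolding NZ_def nml_def by blast+
      have "dlt n v (dg K l' j w) \<in> carrier (grp D (ev w))"
        using dlt_closed[OF v dw] ev_dg[OF j w] by simp
      then show "pb (vd (Suc (Suc l))) ?c (iota (dg K l' j w)) = \<one>\<^bsub>grp D (ev w)\<^esub>"
        using e[OF dw] xy ev_dg[OF j w] unfolding pe[OF dw] by simp
    qed
    then have "nrm 1 (Suc (Suc (Suc l))) (pb (vd (Suc (Suc l))) ?c)" using nrm_iota[OF pc] l by simp
    from normalize[OF r this] obtain v' w where v': "rcyc 1 (Suc (Suc l)) v'" "rcyc 1 (Suc l) w" "nrm 1 (Suc (Suc l)) v'"
      and ve: "\<And>f \<zeta>. f \<in> Arr K \<Longrightarrow> \<zeta> \<in> ch 1 (Suc (Suc l)) f \<Longrightarrow>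
        linD f v' \<zeta> = linD f ?c \<zeta> \<otimes>\<^bsub>grp D f\<^esub> linD f w (vd (Suc l) \<zeta>)" by blast
    have p: "pre n (\<lambda>u. v' (iota u))"
      unfolding pre_def l using rcyc_der[OF v'(1)] nrm_iota[OF rcyc_coch[OF v'(1)]] v'(3) by simp
    have "dlt n (\<lambda>u. v' (iota u)) u = dlt n v u" if u: "u \<in> Arr (lv K (Suc n))" for u
    proof -
      note U = ev_facts(1)[OF u]
      interpret A: comm_group "grp D (ev u)" by (rule grp_D[OF U])
      have u': "u \<in> Arr (lv K (Suc (Suc (Suc l))))" using u unfolding l .
      have i: "frag_of (iota u) \<in> ch 1 (Suc (Suc (Suc l))) (ev u)" using iota_X[OF u'] by simp
      have "dlt n (\<lambda>u. v' (iota u)) u = linD (ev u) v' (vd (Suc (Suc l)) (frag_of (iota u)))"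
        unfolding l by (rule dlt_linD[OF rcyc_coch[OF v'(1)] u'])
      also have "\<dots> = linD (ev u) ?c (vd (Suc (Suc l)) (frag_of (iota u)))"
        unfolding ve[OF U vd_ch[OF i]] vd_vd[OF i] linD_zero[OF U]
        by (rule A.r_one[OF linD_closed[OF C vd_ch[OF i] U]])
      also have "\<dots> = dlt n v u" unfolding dl[OF u, symmetric] unfolding l by (rule dlt_linD[OF C u', symmetric])
      finally show ?thesis .
    qed
    then show ?thesis using e p that[of "\<lambda>u. v' (iota u)"] by simp
  qed
qed

lemma mk_xF:
  assumes F: "F \<in> scat_maps (resolution K) (EM K D n)"
  shows "mk n (xF n F) = F"
  by (rule scat_eqI[OF mk_scat[OF scat_NZ[OF F]] F]) (rule xF_mk)

lemma homotopic_iff: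
  "(F, G) \<in> homotopic (resolution K) (EM K D n) \<longleftrightarrow>
    F \<in> scat_maps (resolution K) (EM K D n) \<and> G \<in> scat_maps (resolution K) (EM K D n) \<and> dif n (xF n F) (xF n G)"
proof (intro iffI conjI)
  assume "F \<in> scat_maps (resolution K) (EM K D n) \<and> G \<in> scat_maps (resolution K) (EM K D n) \<and> dif n (xF n F) (xF n G)"
  then have F: "F \<in> scat_maps (resolution K) (EM K D n)" and G: "G \<in> scat_maps (resolution K) (EM K D n)"
    and d: "dif n (xF n F) (xF n G)" by auto
  from dif_normal[OF scat_NZ[OF F] scat_NZ[OF G] d] obtain v where v: "pre n v"
    "\<And>u. u \<in> Arr (lv K (Suc n)) \<Longrightarrow> xF n F u = xF n G u \<otimes>\<^bsub>grp D (ev u)\<^esub> dlt n v u" by blast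
  from homotopic_mk[OF scat_NZ[OF F] scat_NZ[OF G] v]
  show "(F, G) \<in> homotopic (resolution K) (EM K D n)" unfolding mk_xF[OF F] mk_xF[OF G] .
next
  assume h: "(F, G) \<in> homotopic (resolution K) (EM K D n)"
  then show "F \<in> scat_maps (resolution K) (EM K D n)" "G \<in> scat_maps (resolution K) (EM K D n)" by (auto simp: homotopic_def)
  show "dif n (xF n F) (xF n G)" by (rule homotopic_dif[OF h])
qed

end

section \<open>The cohomology groups and the comparison map\<close>

context nat_sys
begin

text \<open>The form of \<open>NZ\<close> for 1-cochains; \<open>toc\<close> and evaluation at
  \<open>iota\<close> translate between the two.\<close>

definition ncoc where "ncoc n c \<longleftrightarrow> rcyc 1 (Suc n) c \<and> vcyc 1 (Suc n) c \<and> nrm 1 (Suc n) c"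

lemma ncoc_coch: "ncoc n c \<Longrightarrow> c \<in> coch 1 (Suc n)"
  by (simp add: ncoc_def rcyc_coch)

lemma vcyc_ops:
  "vcyc p l cone" "vcyc p l b \<Longrightarrow> vcyc p l c \<Longrightarrow> vcyc p l (cmult b c)" "vcyc p l c \<Longrightarrow> vcyc p l (cinv c)"
proof -
  show "vcyc p l cone" unfolding vcyc_def using coch_ops(1) linD_cone[OF vd_ch] by blast
  show "vcyc p l (cmult b c)" if b: "vcyc p l b" and c: "vcyc p l c"
    unfolding vcyc_def
  proof (intro conjI ballI)
    have B: "b \<in> coch p l" and C: "c \<in> coch p l" using b c by (auto simp: vcyc_def)
    show "cmult b c \<in> coch p l" by (rule coch_ops(2)[OF B C])
    fix f \<zeta> assume f: "f \<in> Arr K" and z: "\<zeta> \<in> ch p (Suc l) f"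
    interpret A: comm_group "grp D f" by (rule grp_D[OF f])
    show "linD f (cmult b c) (vd l \<zeta>) = \<one>\<^bsub>grp D f\<^esub>"
      unfolding linD_cmult[OF B C vd_ch[OF z] f] vcycD[OF b z f] vcycD[OF c z f] by simp
  qed
  show "vcyc p l (cinv c)" if c: "vcyc p l c"
    unfolding vcyc_def
  proof (intro conjI ballI)
    have C: "c \<in> coch p l" using c by (auto simp: vcyc_def)
    show "cinv c \<in> coch p l" by (rule coch_ops(3)[OF C])
    fix f \<zeta> assume f: "f \<in> Arr K" and z: "\<zeta> \<in> ch p (Suc l) f"
    interpret A: comm_group "grp D f" by (rule grp_D[OF f])
    show "linD f (cinv c) (vd l \<zeta>) = \<one>\<^bsub>grp D f\<^esub>"
      unfolding linD_cinv[OF C vd_ch[OF z] f] vcycD[OF c z f] by simp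
  qed
qed

lemma nrmD: "nrm p (Suc (Suc l)) c \<Longrightarrow> j \<le> l \<Longrightarrow> f \<in> Arr K \<Longrightarrow> \<zeta> \<in> ch p (Suc l) f \<Longrightarrow> linD f c (sdg l j \<zeta>) = \<one>\<^bsub>grp D f\<^esub>"
  unfolding nrm_def by blast

lemma nrmI: "(\<And>l' j f \<zeta>. l = Suc (Suc l') \<Longrightarrow> j \<le> l' \<Longrightarrow> f \<in> Arr K \<Longrightarrow> \<zeta> \<in> ch p (Suc l') f \<Longrightarrow>
     linD f c (sdg l' j \<zeta>) = \<one>\<^bsub>grp D f\<^esub>) \<Longrightarrow> nrm p l c"
  unfolding nrm_def by blast

lemma nrm_ops:
  "nrm p l cone" "b \<in> coch p l \<Longrightarrow> c \<in> coch p l \<Longrightarrow> nrm p l b \<Longrightarrow> nrm p l c \<Longrightarrow> nrm p l (cmult b c)"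
  "c \<in> coch p l \<Longrightarrow> nrm p l c \<Longrightarrow> nrm p l (cinv c)"
proof -
  show "nrm p l cone" by (rule nrmI, rule linD_cone[OF sdg_ch])
  show "nrm p l (cmult b c)" if B: "b \<in> coch p l" and C: "c \<in> coch p l" and b: "nrm p l b" and c: "nrm p l c"
  proof (rule nrmI)
    fix l' j f \<zeta> assume l: "l = Suc (Suc l')" and j: "j \<le> l'" and f: "f \<in> Arr K" and z: "\<zeta> \<in> ch p (Suc l') f"
    interpret A: comm_group "grp D f" by (rule grp_D[OF f])
    show "linD f (cmult b c) (sdg l' j \<zeta>) = \<one>\<^bsub>grp D f\<^esub>"
      unfolding linD_cmult[OF B[unfolded l] C[unfolded l] sdg_ch[OF j z] f] nrmD[OF b[unfolded l] j f z] nrmD[OF c[unfolded l] j f z] by simp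
  qed
  show "nrm p l (cinv c)" if C: "c \<in> coch p l" and c: "nrm p l c"
  proof (rule nrmI)
    fix l' j f \<zeta> assume l: "l = Suc (Suc l')" and j: "j \<le> l'" and f: "f \<in> Arr K" and z: "\<zeta> \<in> ch p (Suc l') f"
    interpret A: comm_group "grp D f" by (rule grp_D[OF f])
    show "linD f (cinv c) (sdg l' j \<zeta>) = \<one>\<^bsub>grp D f\<^esub>"
      unfolding linD_cinv[OF C[unfolded l] sdg_ch[OF j z] f] nrmD[OF c[unfolded l] j f z] by simp
  qed
qed

lemma ncoc_ops:
  "ncoc n cone" "ncoc n b \<Longrightarrow> ncoc n c \<Longrightarrow> ncoc n (cmult b c)" "ncoc n c \<Longrightarrow> ncoc n (cinv c)"
proof -
  show "ncoc n cone" unfolding ncoc_def by (intro conjI rcyc_ops(1) vcyc_ops(1) nrm_ops(1))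
  show "ncoc n (cmult b c)" if b: "ncoc n b" and c: "ncoc n c"
    using rcyc_ops(2) vcyc_ops(2) nrm_ops(2)[OF ncoc_coch[OF b] ncoc_coch[OF c]] b c by (simp add: ncoc_def)
  show "ncoc n (cinv c)" if c: "ncoc n c"
    using rcyc_ops(3) vcyc_ops(3) nrm_ops(3)[OF ncoc_coch[OF c]] c by (simp add: ncoc_def)
qed

lemma NZ_ncoc: "NZ n x \<Longrightarrow> ncoc n (toc x)"
  using NZ_toc(1-3) by (simp add: ncoc_def)

lemma ncoc_NZ: "ncoc n c \<Longrightarrow> (\<And>u. u \<in> Arr (lv K (Suc n)) \<Longrightarrow> x u = c (iota u)) \<Longrightarrow> NZ n x"
  by (rule NZ_cong[OF NZ_iota[of n c]]) (simp_all add: ncoc_def del: lv_simps One_nat_def)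

section \<open>The group structure on homotopy classes\<close>

abbreviation xone where "xone \<equiv> (\<lambda>u. \<one>\<^bsub>grp D (ev u)\<^esub>)"
abbreviation xmult where "xmult x y \<equiv> (\<lambda>u. x u \<otimes>\<^bsub>grp D (ev u)\<^esub> y u)"
abbreviation xinv where "xinv x \<equiv> (\<lambda>u. inv\<^bsub>grp D (ev u)\<^esub> x u)"

lemma NZ_ops:
  "NZ n xone" "NZ n x \<Longrightarrow> NZ n y \<Longrightarrow> NZ n (xmult x y)" "NZ n x \<Longrightarrow> NZ n (xinv x)"
proof -
  show "NZ n xone" by (rule ncoc_NZ[OF ncoc_ops(1)]) (simp only: cone_X[OF iota_X])
  show "NZ n (xmult x y)" if "NZ n x" "NZ n y"
    by (rule ncoc_NZ[OF ncoc_ops(2)[OF NZ_ncoc[OF that(1)] NZ_ncoc[OF that(2)]]])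
      (simp only: cmult_X[OF iota_X] NZ_toc(4)[OF that(1)] NZ_toc(4)[OF that(2)])
  show "NZ n (xinv x)" if "NZ n x"
    by (rule ncoc_NZ[OF ncoc_ops(3)[OF NZ_ncoc[OF that]]]) (simp only: cinv_X[OF iota_X] NZ_toc(4)[OF that])
qed

lemma NZ_carrier: "NZ n x \<Longrightarrow> u \<in> Arr (lv K (Suc n)) \<Longrightarrow> x u \<in> carrier (grp D (ev u))"
  using derD unfolding NZ_def by blast

lemma grp_ev: "u \<in> Arr (lv K l) \<Longrightarrow> comm_group (grp D (ev u))"
  by (rule grp_D[OF ev_facts(1)])

lemma der_inv:
  assumes x: "der l x"
  shows "der l (xinv x)"
  unfolding der_def
proof (intro conjI ballI impI)
  show "xinv x u \<in> carrier (grp D (ev u))" if u: "u \<in> Arr (lv K l)" for u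
  proof -
    interpret A: comm_group "grp D (ev u)" by (rule grp_ev[OF u])
    show ?thesis using derD[OF x u] by simp
  qed
  fix u v assume u: "u \<in> Arr (lv K l)" and v: "v \<in> Arr (lv K l)" and uv: "Cod K (ev u) = Dom K (ev v)"
  note U = ev_facts(1)[OF u] and V = ev_facts(1)[OF v]
  interpret C: comm_group "grp D (Comp K (ev v) (ev u))" by (rule grp_D[OF Comp_in[OF U V uv]])
  interpret P: group_hom "grp D (ev u)" "grp D (Comp K (ev v) (ev u))" "push K D (ev v) (ev u)"
    by (rule push_pull_hom(1)[OF U V uv])
  interpret Q: group_hom "grp D (ev v)" "grp D (Comp K (ev v) (ev u))" "pull K D (ev u) (ev v)"
    by (rule push_pull_hom(2)[OF U V uv])
  note xu = derD[OF x u] and xv = derD[OF x v]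
  show "xinv x (wcmp K v u) = push K D (ev v) (ev u) (xinv x u)
        \<otimes>\<^bsub>grp D (Comp K (ev v) (ev u))\<^esub> pull K D (ev u) (ev v) (xinv x v)"
    unfolding wcmp_facts(2)[OF u v uv] derW[OF x u v uv] P.hom_inv[OF xu] Q.hom_inv[OF xv]
    using P.hom_closed[OF xu] Q.hom_closed[OF xv] by (simp add: C.inv_mult)
qed

definition pder where "pder n v \<longleftrightarrow> (\<forall>k. n = Suc k \<longrightarrow> der (Suc k) v)"

lemma pder_ops: "pder n xone" "pder n v \<Longrightarrow> pder n v' \<Longrightarrow> pder n (xmult v v')" "pder n v \<Longrightarrow> pder n (xinv v)"
  unfolding pder_def using der_one der_mult der_inv by blast+

lemma dlt_ops:
  assumes u: "u \<in> Arr (lv K (Suc n))"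
  shows "dlt n xone u = \<one>\<^bsub>grp D (ev u)\<^esub>"
    "pder n v \<Longrightarrow> pder n v' \<Longrightarrow> dlt n (xmult v v') u = dlt n v u \<otimes>\<^bsub>grp D (ev u)\<^esub> dlt n v' u"
    "pder n v \<Longrightarrow> dlt n v u \<in> carrier (grp D (ev u))"
    "pder n v \<Longrightarrow> dlt n (xinv v) u = inv\<^bsub>grp D (ev u)\<^esub> dlt n v u"
proof -
  interpret A: comm_group "grp D (ev u)" by (rule grp_ev[OF u])
  have f: "ev (fc K n i u) = ev u" if "i \<le> n" for i by (rule ev_fc[OF that u])
  have c: "v (fc K n i u) \<in> carrier (grp D (ev u))" if "pder n v" "n = Suc k" "i \<le> n" for v k i
    using derD[of "Suc k" v "fc K n i u"] fc_arr[OF that(3) u] f[OF that(3)] that unfolding pder_def by (simp del: lv_simps)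
  show one: "dlt n xone u = \<one>\<^bsub>grp D (ev u)\<^esub>"
  proof (cases n)
    case (Suc k)
    show ?thesis unfolding dlt_def Suc nat.case
      by (rule alt_sum_one[OF A.comm_group_axioms]) (simp only: f[unfolded Suc])
  qed (simp add: dlt_def)
  show mult: "dlt n (xmult v v') u = dlt n v u \<otimes>\<^bsub>grp D (ev u)\<^esub> dlt n v' u" if v: "pder n v" and v': "pder n v'" for v v'
  proof (cases n)
    case (Suc k)
    have "alt_sum (grp D (ev u)) n (\<lambda>i. xmult v v' (fc K n i u)) = alt_sum (grp D (ev u)) n (\<lambda>i. v (fc K n i u) \<otimes>\<^bsub>grp D (ev u)\<^esub> v' (fc K n i u))"
      by (rule alt_sum_cong[OF A.comm_group_axioms]) (use f c[OF v Suc] c[OF v' Suc] in auto)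
    also have "\<dots> = alt_sum (grp D (ev u)) n (\<lambda>i. v (fc K n i u)) \<otimes>\<^bsub>grp D (ev u)\<^esub> alt_sum (grp D (ev u)) n (\<lambda>i. v' (fc K n i u))"
      by (rule alt_sum_mult[OF A.comm_group_axioms c[OF v Suc] c[OF v' Suc]])
    finally show ?thesis unfolding dlt_def Suc by simp
  qed (simp add: dlt_def)
  show cl: "dlt n v u \<in> carrier (grp D (ev u))" if v: "pder n v" for v
    by (rule dlt_closed[OF _ u]) (use v in \<open>simp add: pder_def\<close>)
  show "dlt n (xinv v) u = inv\<^bsub>grp D (ev u)\<^esub> dlt n v u" if v: "pder n v"
  proof -
    \<comment> \<open>The rule for inverses is deduced from the rule for products.\<close>
    have "dlt n (xmult (xinv v) v) u = dlt n xone u"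
    proof (rule dlt_cong[OF _ u])
      show "der (Suc k) xone" for k by (rule der_one)
      fix k w assume n: "n = Suc k" and w: "w \<in> Arr (lv K (Suc k))"
      interpret W: comm_group "grp D (ev w)" by (rule grp_ev[OF w])
      show "xmult (xinv v) v w = xone w" using derD[of "Suc k" v w] v n w unfolding pder_def by (simp del: lv_simps)
    qed
    then have "dlt n (xinv v) u \<otimes>\<^bsub>grp D (ev u)\<^esub> dlt n v u = \<one>\<^bsub>grp D (ev u)\<^esub>"
      unfolding one mult[OF pder_ops(3)[OF v] v] .
    then show ?thesis using A.inv_equality cl[OF v] cl[OF pder_ops(3)[OF v]] by metis
  qed
qed

lemma difI: "pder n v \<Longrightarrow> (\<And>u. u \<in> Arr (lv K (Suc n)) \<Longrightarrow> x u = y u \<otimes>\<^bsub>grp D (ev u)\<^esub> dlt n v u) \<Longrightarrow> dif n x y"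
  unfolding dif_def pder_def by blast

lemma difE:
  assumes "dif n x y"
  obtains v where "pder n v" "\<And>u. u \<in> Arr (lv K (Suc n)) \<Longrightarrow> x u = y u \<otimes>\<^bsub>grp D (ev u)\<^esub> dlt n v u"
  using assms unfolding dif_def pder_def by blast

lemma dif_refl:
  assumes "NZ n y" "\<And>u. u \<in> Arr (lv K (Suc n)) \<Longrightarrow> x u = y u"
  shows "dif n x y"
proof (rule difI[OF pder_ops(1)])
  fix u assume u: "u \<in> Arr (lv K (Suc n))"
  interpret A: comm_group "grp D (ev u)" by (rule grp_ev[OF u])
  show "x u = y u \<otimes>\<^bsub>grp D (ev u)\<^esub> dlt n xone u"
    unfolding dlt_ops(1)[OF u] assms(2)[OF u] using NZ_carrier[OF assms(1) u] by simp
qed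

lemma dif_sym:
  assumes "NZ n x" "NZ n y" "dif n x y" shows "dif n y x"
proof -
  obtain v where v: "pder n v" and e: "\<And>u. u \<in> Arr (lv K (Suc n)) \<Longrightarrow> x u = y u \<otimes>\<^bsub>grp D (ev u)\<^esub> dlt n v u"
    using difE[OF assms(3)] by blast
  show ?thesis
  proof (rule difI[OF pder_ops(3)[OF v]])
    fix u assume u: "u \<in> Arr (lv K (Suc n))"
    interpret A: comm_group "grp D (ev u)" by (rule grp_ev[OF u])
    show "y u = x u \<otimes>\<^bsub>grp D (ev u)\<^esub> dlt n (xinv v) u"
      unfolding dlt_ops(4)[OF u v] e[OF u] using NZ_carrier[OF assms(2) u] dlt_ops(3)[OF u v] by (simp add: A.m_assoc)
  qed
qed

lemma dif_trans:
  assumes "NZ n z" "dif n x y" "dif n y z" shows "dif n x z"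
proof -
  obtain v where v: "pder n v" and e: "\<And>u. u \<in> Arr (lv K (Suc n)) \<Longrightarrow> x u = y u \<otimes>\<^bsub>grp D (ev u)\<^esub> dlt n v u"
    using difE[OF assms(2)] by blast
  obtain w where w: "pder n w" and e': "\<And>u. u \<in> Arr (lv K (Suc n)) \<Longrightarrow> y u = z u \<otimes>\<^bsub>grp D (ev u)\<^esub> dlt n w u"
    using difE[OF assms(3)] by blast
  show ?thesis
  proof (rule difI[OF pder_ops(2)[OF w v]])
    fix u assume u: "u \<in> Arr (lv K (Suc n))"
    interpret A: comm_group "grp D (ev u)" by (rule grp_ev[OF u])
    show "x u = z u \<otimes>\<^bsub>grp D (ev u)\<^esub> dlt n (xmult w v) u"
      unfolding dlt_ops(2)[OF u w v] e[OF u] e'[OF u]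
      using NZ_carrier[OF assms(1) u] dlt_ops(3)[OF u v] dlt_ops(3)[OF u w] by (simp add: A.m_assoc)
  qed
qed

lemma dif_mult:
  assumes "NZ n y" "NZ n y'" "dif n x y" "dif n x' y'" shows "dif n (xmult x x') (xmult y y')"
proof -
  obtain v where v: "pder n v" and e: "\<And>u. u \<in> Arr (lv K (Suc n)) \<Longrightarrow> x u = y u \<otimes>\<^bsub>grp D (ev u)\<^esub> dlt n v u"
    using difE[OF assms(3)] by blast
  obtain w where w: "pder n w" and e': "\<And>u. u \<in> Arr (lv K (Suc n)) \<Longrightarrow> x' u = y' u \<otimes>\<^bsub>grp D (ev u)\<^esub> dlt n w u"
    using difE[OF assms(4)] by blast
  show ?thesis
  proof (rule difI[OF pder_ops(2)[OF v w]])
    fix u assume u: "u \<in> Arr (lv K (Suc n))"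
    interpret A: comm_group "grp D (ev u)" by (rule grp_ev[OF u])
    show "x u \<otimes>\<^bsub>grp D (ev u)\<^esub> x' u = y u \<otimes>\<^bsub>grp D (ev u)\<^esub> y' u \<otimes>\<^bsub>grp D (ev u)\<^esub> dlt n (xmult v w) u"
      unfolding dlt_ops(2)[OF u v w] e[OF u] e'[OF u]
      using NZ_carrier[OF assms(1) u] NZ_carrier[OF assms(2) u] dlt_ops(3)[OF u v] dlt_ops(3)[OF u w] by (simp add: A.m_ac)
  qed
qed

definition cl where "cl n x = so_class K D n (mk n x)"

lemma scat_iff: "F \<in> scat_maps (resolution K) (EM K D n) \<longleftrightarrow> (\<exists>x. NZ n x \<and> F = mk n x)"
proof
  assume F: "F \<in> scat_maps (resolution K) (EM K D n)"
  show "\<exists>x. NZ n x \<and> F = mk n x" by (rule exI[of _ "xF n F"]) (simp add: scat_NZ[OF F] mk_xF[OF F])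
qed (auto simp: mk_scat)

lemma homotopic_mk_iff:
  assumes x: "NZ n x" and y: "NZ n y"
  shows "(mk n x, mk n y) \<in> homotopic (resolution K) (EM K D n) \<longleftrightarrow> dif n x y"
proof -
  have dx: "dif n (xF n (mk n x)) x" "dif n x (xF n (mk n x))"
    using dif_refl[OF x] dif_refl[OF scat_NZ[OF mk_scat[OF x]]] xF_mk by simp_all
  have dy: "dif n (xF n (mk n y)) y" "dif n y (xF n (mk n y))"
    using dif_refl[OF y] dif_refl[OF scat_NZ[OF mk_scat[OF y]]] xF_mk by simp_all
  have "dif n (xF n (mk n x)) (xF n (mk n y)) \<longleftrightarrow> dif n x y"
    using dif_trans[OF scat_NZ[OF mk_scat[OF y]] dif_trans[OF y dx(1)] dy(2)]
      dif_trans[OF y dif_trans[OF scat_NZ[OF mk_scat[OF y]] dx(2)] dy(1)] by blast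
  then show ?thesis unfolding homotopic_iff using mk_scat[OF x] mk_scat[OF y] by simp
qed

lemma cl_members: "NZ n x \<Longrightarrow> F \<in> cl n x \<longleftrightarrow> (\<exists>y. NZ n y \<and> F = mk n y \<and> dif n x y)"
proof
  assume x: "NZ n x" and F: "F \<in> cl n x"
  then have "(mk n x, F) \<in> homotopic (resolution K) (EM K D n)" by (simp add: cl_def so_class_def)
  moreover from this obtain y where "NZ n y" "F = mk n y" unfolding homotopic_iff scat_iff by blast
  ultimately show "\<exists>y. NZ n y \<and> F = mk n y \<and> dif n x y" using homotopic_mk_iff[OF x] by blast
next
  assume "NZ n x" "\<exists>y. NZ n y \<and> F = mk n y \<and> dif n x y"
  then show "F \<in> cl n x" using homotopic_mk_iff[of n x] by (auto simp: cl_def so_class_def)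
qed

text \<open>Homotopies are not composed or reversed directly. Equality of classes is obtained from
  \<open>dif\<close>, for which symmetry and transitivity are computations with
  coboundaries.\<close>

lemma cl_eq_iff:
  assumes x: "NZ n x" and y: "NZ n y"
  shows "cl n x = cl n y \<longleftrightarrow> dif n x y"
proof
  assume "cl n x = cl n y"
  moreover have "mk n y \<in> cl n y" unfolding cl_members[OF y] using y dif_refl[OF y] by blast
  ultimately have "mk n y \<in> cl n x" by simp
  then have "(mk n x, mk n y) \<in> homotopic (resolution K) (EM K D n)" by (simp add: cl_def so_class_def)
  then show "dif n x y" using homotopic_mk_iff[OF x y] by simp
next
  assume d: "dif n x y"
  show "cl n x = cl n y"
  proof (rule Set.set_eqI)
    fix F
    have "dif n x z \<longleftrightarrow> dif n y z" if z: "NZ n z" for z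
      using dif_trans[OF z d] dif_trans[OF z dif_sym[OF x y d]] by blast
    then show "F \<in> cl n x \<longleftrightarrow> F \<in> cl n y" unfolding cl_members[OF x] cl_members[OF y] by blast
  qed
qed

lemma VV_mult:
  assumes u: "u \<in> Arr (lv K (Suc m))"
  shows "VV n x m u \<otimes>\<^bsub>EM_group (grp D (ev u)) n m\<^esub> VV n y m u = VV n (xmult x y) m u"
    "\<one>\<^bsub>EM_group (grp D (ev u)) n m\<^esub> = VV n xone m u"
proof -
  interpret A: comm_group "grp D (ev u)" by (rule grp_ev[OF u])
  have r: "ev (res m xs u) = ev u" if "xs \<in> std_simplices m n" "distinct xs" for xs
    using res_arr[of m xs n u] std_goodD[OF that] u by blast
  show "VV n x m u \<otimes>\<^bsub>EM_group (grp D (ev u)) n m\<^esub> VV n y m u = VV n (xmult x y) m u"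
    unfolding EM_group_simps VV_def by (rule restrict_ext) (simp add: r)
  show "\<one>\<^bsub>EM_group (grp D (ev u)) n m\<^esub> = VV n xone m u"
    unfolding EM_group_simps VV_def by (rule restrict_ext) (simp add: r)
qed

lemma so_add_mk: "so_add K D n (mk n x) (mk n y) = mk n (xmult x y)"
  unfolding so_add_def resolution_simps mk_def grp_EM
  by (rule ext, rule restrict_ext) (simp add: VV_mult del: lv_simps)

lemma so_zero_mk: "so_zero K D n = mk n xone"
  unfolding so_zero_def resolution_simps mk_def grp_EM
  by (rule ext, rule restrict_ext) (simp only: VV_mult(2))

lemma H_SO_simps:
  "carrier (H_SO K D n) = cl n ` {x. NZ n x}" "\<one>\<^bsub>H_SO K D n\<^esub> = cl n xone"
  "NZ n x \<Longrightarrow> NZ n y \<Longrightarrow> cl n x \<otimes>\<^bsub>H_SO K D n\<^esub> cl n y = cl n (xmult x y)"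
proof -
  show "carrier (H_SO K D n) = cl n ` {x. NZ n x}"
  proof -
    have "scat_maps (resolution K) (EM K D n) = mk n ` {x. NZ n x}" by (auto simp: scat_iff)
    then have "scat_maps (resolution K) (EM K D n) // homotopic (resolution K) (EM K D n)
        = (\<lambda>F. so_class K D n F) ` mk n ` {x. NZ n x}" by (auto simp: quotient_def so_class_def)
    then show ?thesis by (simp add: H_SO_def cl_def image_image)
  qed
  show "\<one>\<^bsub>H_SO K D n\<^esub> = cl n xone" by (simp add: H_SO_def cl_def so_zero_mk)
  assume x: "NZ n x" and y: "NZ n y"
  have e: "so_class K D n (so_add K D n F G) = cl n (xmult x y)" if F: "F \<in> cl n x" and G: "G \<in> cl n y" for F G
  proof -
    obtain x' where x': "NZ n x'" "F = mk n x'" "dif n x x'" using F unfolding cl_members[OF x] by blast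
    obtain y' where y': "NZ n y'" "G = mk n y'" "dif n y y'" using G unfolding cl_members[OF y] by blast
    have "cl n (xmult x y) = cl n (xmult x' y')"
      using cl_eq_iff[OF NZ_ops(2)[OF x y] NZ_ops(2)[OF x'(1) y'(1)]] dif_mult[OF x'(1) y'(1) x'(3) y'(3)] by simp
    then show ?thesis by (simp add: x' y' so_add_mk cl_def)
  qed
  have ne: "mk n x \<in> cl n x" "mk n y \<in> cl n y"
    unfolding cl_members[OF x] cl_members[OF y] using x y dif_refl[OF x] dif_refl[OF y] by blast+
  have "cl n x \<otimes>\<^bsub>H_SO K D n\<^esub> cl n y = (\<Union>F\<in>cl n x. \<Union>G\<in>cl n y. so_class K D n (so_add K D n F G))"
    by (simp add: H_SO_def)
  also have "\<dots> = (\<Union>F\<in>cl n x. \<Union>G\<in>cl n y. cl n (xmult x y))"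
    by (intro SUP_cong refl e)
  also have "\<dots> = cl n (xmult x y)" using ne by blast
  finally show "cl n x \<otimes>\<^bsub>H_SO K D n\<^esub> cl n y = cl n (xmult x y)" .
qed

lemma comm_group_H_SO: "comm_group (H_SO K D n)"
proof (rule comm_groupI, unfold H_SO_simps(1,2))
  have eq: "cl n x = cl n y" if "NZ n x" "NZ n y" "\<And>u. u \<in> Arr (lv K (Suc n)) \<Longrightarrow> x u = y u" for x y
    using cl_eq_iff[OF that(1,2)] dif_refl[OF that(2,3)] by simp
  fix X Y assume "X \<in> cl n ` {x. NZ n x}" "Y \<in> cl n ` {x. NZ n x}"
  then obtain x y where x: "NZ n x" "X = cl n x" and y: "NZ n y" "Y = cl n y" by blast
  note X = NZ_carrier[OF x(1)] and Y = NZ_carrier[OF y(1)]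
  show "X \<otimes>\<^bsub>H_SO K D n\<^esub> Y \<in> cl n ` {x. NZ n x}"
    using H_SO_simps(3)[OF x(1) y(1)] NZ_ops(2)[OF x(1) y(1)] x y by blast
  show "X \<otimes>\<^bsub>H_SO K D n\<^esub> Y = Y \<otimes>\<^bsub>H_SO K D n\<^esub> X"
    unfolding x y H_SO_simps(3)[OF x(1) y(1)] H_SO_simps(3)[OF y(1) x(1)]
    by (rule eq[OF NZ_ops(2)[OF x(1) y(1)] NZ_ops(2)[OF y(1) x(1)]])
      (use comm_groupE(4)[OF grp_ev] X Y in blast)
  show "cl n xone \<otimes>\<^bsub>H_SO K D n\<^esub> X = X"
    unfolding x H_SO_simps(3)[OF NZ_ops(1) x(1)]
    by (rule eq[OF NZ_ops(2)[OF NZ_ops(1) x(1)] x(1)]) (use comm_groupE(5)[OF grp_ev] X in blast)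
  have "cl n (xinv x) \<otimes>\<^bsub>H_SO K D n\<^esub> X = cl n xone"
    unfolding x H_SO_simps(3)[OF NZ_ops(3)[OF x(1)] x(1)]
    by (rule eq[OF NZ_ops(2)[OF NZ_ops(3)[OF x(1)] x(1)] NZ_ops(1)])
      (use group.l_inv[OF comm_group.axioms(2)[OF grp_ev]] X in blast)
  then show "\<exists>Y\<in>cl n ` {x. NZ n x}. Y \<otimes>\<^bsub>H_SO K D n\<^esub> X = cl n xone" using NZ_ops(3)[OF x(1)] by blast
  fix Z assume "Z \<in> cl n ` {x. NZ n x}"
  then obtain z where z: "NZ n z" "Z = cl n z" by blast
  note Z = NZ_carrier[OF z(1)]
  show "X \<otimes>\<^bsub>H_SO K D n\<^esub> Y \<otimes>\<^bsub>H_SO K D n\<^esub> Z = X \<otimes>\<^bsub>H_SO K D n\<^esub> (Y \<otimes>\<^bsub>H_SO K D n\<^esub> Z)"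
    unfolding x y z H_SO_simps(3)[OF x(1) y(1)] H_SO_simps(3)[OF y(1) z(1)]
      H_SO_simps(3)[OF NZ_ops(2)[OF x(1) y(1)] z(1)] H_SO_simps(3)[OF x(1) NZ_ops(2)[OF y(1) z(1)]]
    by (rule eq[OF NZ_ops(2)[OF NZ_ops(2)[OF x(1) y(1)] z(1)] NZ_ops(2)[OF x(1) NZ_ops(2)[OF y(1) z(1)]]])
      (use comm_groupE(3)[OF grp_ev] X Y Z in blast)
next
  show "cl n xone \<in> cl n ` {x. NZ n x}" using NZ_ops(1) by blast
qed

end

lemma (in comm_group) r_coset_mult_left:
  assumes "subgroup H G" "h \<in> H" "x \<in> carrier G"
  shows "H #> (h \<otimes> x) = H #> x"
proof -
  have "h \<in> carrier G" by (rule subgroup.mem_carrier[OF assms(1,2)])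
  then have "H #> (h \<otimes> x) = (H #> h) #> x"
    using coset_mult_assoc[OF subgroup.subset[OF assms(1)] _ assms(3)] by simp
  also have "H #> h = H" by (rule subgroup.rcos_const[OF assms(1) is_group assms(2)])
  finally show ?thesis .
qed

section \<open>The comparison map on classes\<close>

context nat_sys
begin

text \<open>The comparison on cocycles: the value at a Baues-Wirsching generator is that of c on its
  zigzag.\<close>

definition theta where "theta n c = tobw (Suc n) (pb (TT n) c)"

abbreviation B where "B n \<equiv> bw_cochains K D (Suc n)"
abbreviation Zs where "Zs n \<equiv> cocycles (bw_cochains K D) (bw_coface K) (Suc n)"
abbreviation Cs where "Cs n \<equiv> coboundaries (bw_cochains K D) (bw_coface K) (Suc n)"

lemma tobw_eqI: "(\<And>f s. s \<in> X p 0 f \<Longrightarrow> b s = c s) \<Longrightarrow> tobw p b = tobw p c"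
  unfolding tobw_eq_iff by blast

lemma pb_rowd_ops:
  "tobw (Suc n) (pb rowd cone) = \<one>\<^bsub>B n\<^esub>"
  "b \<in> coch n 0 \<Longrightarrow> c \<in> coch n 0 \<Longrightarrow> tobw (Suc n) (pb rowd (cmult b c)) = tobw (Suc n) (pb rowd b) \<otimes>\<^bsub>B n\<^esub> tobw (Suc n) (pb rowd c)"
  "c \<in> coch n 0 \<Longrightarrow> tobw (Suc n) (pb rowd (cinv c)) = inv\<^bsub>B n\<^esub> tobw (Suc n) (pb rowd c)"
proof -
  have r: "rowd (frag_of s) \<in> ch n 0 f" if "s \<in> X (Suc n) 0 f" for s f
    by (rule rowd_ch) (use that in simp)
  show "tobw (Suc n) (pb rowd cone) = \<one>\<^bsub>B n\<^esub>"
    unfolding tobw_one[symmetric]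
    by (rule tobw_eqI) (simp only: pb_X cone_X linD_cone[OF r X_Arr])
  show "tobw (Suc n) (pb rowd (cmult b c)) = tobw (Suc n) (pb rowd b) \<otimes>\<^bsub>B n\<^esub> tobw (Suc n) (pb rowd c)"
    if b: "b \<in> coch n 0" and c: "c \<in> coch n 0"
    unfolding tobw_mult[symmetric]
    by (rule tobw_eqI) (simp only: pb_X cmult_X linD_cmult[OF b c r X_Arr])
  show "tobw (Suc n) (pb rowd (cinv c)) = inv\<^bsub>B n\<^esub> tobw (Suc n) (pb rowd c)" if c: "c \<in> coch n 0"
    unfolding tobw_inv[OF pb_coch[OF isop_rowd c], symmetric]
    by (rule tobw_eqI) (simp only: pb_X cinv_X linD_cinv[OF c r X_Arr])
qed

lemma subgroup_Zs: "subgroup (Zs n) (B n)"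
proof -
  interpret comm_group "B n" by (rule comm_group_bw)
  show ?thesis
    unfolding cocycles_bw
  proof (rule subgroupI)
    show "tobw (Suc n) ` {c. rcyc (Suc n) 0 c} \<subseteq> carrier (B n)" using tobw_carrier[OF rcyc_coch] by auto
    show "tobw (Suc n) ` {c. rcyc (Suc n) 0 c} \<noteq> {}" using rcyc_ops(1) by blast
    fix a b assume "a \<in> tobw (Suc n) ` {c. rcyc (Suc n) 0 c}" "b \<in> tobw (Suc n) ` {c. rcyc (Suc n) 0 c}"
    then obtain c d where c: "rcyc (Suc n) 0 c" "a = tobw (Suc n) c" and d: "rcyc (Suc n) 0 d" "b = tobw (Suc n) d" by blast
    show "inv\<^bsub>B n\<^esub> a \<in> tobw (Suc n) ` {c. rcyc (Suc n) 0 c}"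
      unfolding c tobw_inv[OF rcyc_coch[OF c(1)], symmetric] using rcyc_ops(3)[OF c(1)] by blast
    show "a \<otimes>\<^bsub>B n\<^esub> b \<in> tobw (Suc n) ` {c. rcyc (Suc n) 0 c}"
      unfolding c d tobw_mult[symmetric] using rcyc_ops(2)[OF c(1) d(1)] by blast
  qed
qed

lemma rcyc_pb_rowd:
  assumes "w \<in> coch n 0" shows "rcyc (Suc n) 0 (pb rowd w)"
  unfolding rcyc_def
proof (intro conjI ballI pb_coch[OF isop_rowd assms])
  fix f \<zeta> assume f: "f \<in> Arr K" and z: "\<zeta> \<in> ch (Suc (Suc n)) 0 f"
  show "linD f (pb rowd w) (rowd \<zeta>) = \<one>\<^bsub>grp D f\<^esub>"
    unfolding linD_pb[OF isop_rowd assms rowd_ch[OF z] f] rowd_rowd[OF z] by (rule linD_zero[OF f])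
qed

lemma subgroup_Cs: "subgroup (Cs n) (B n)" "Cs n \<subseteq> Zs n"
proof -
  interpret comm_group "B n" by (rule comm_group_bw)
  show "Cs n \<subseteq> Zs n" unfolding coboundaries_bw cocycles_bw using rcyc_pb_rowd by auto
  show "subgroup (Cs n) (B n)"
    unfolding coboundaries_bw
  proof (rule subgroupI)
    show "(\<lambda>w. tobw (Suc n) (pb rowd w)) ` coch n 0 \<subseteq> carrier (B n)" using tobw_carrier[OF pb_coch[OF isop_rowd]] by auto
    show "(\<lambda>w. tobw (Suc n) (pb rowd w)) ` coch n 0 \<noteq> {}" using coch_ops(1) by blast
    fix a b assume "a \<in> (\<lambda>w. tobw (Suc n) (pb rowd w)) ` coch n 0" "b \<in> (\<lambda>w. tobw (Suc n) (pb rowd w)) ` coch n 0"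
    then obtain c d where c: "c \<in> coch n 0" "a = tobw (Suc n) (pb rowd c)" and d: "d \<in> coch n 0" "b = tobw (Suc n) (pb rowd d)" by blast
    show "inv\<^bsub>B n\<^esub> a \<in> (\<lambda>w. tobw (Suc n) (pb rowd w)) ` coch n 0"
      unfolding c(2) pb_rowd_ops(3)[OF c(1), symmetric] using coch_ops(3)[OF c(1)] by blast
    show "a \<otimes>\<^bsub>B n\<^esub> b \<in> (\<lambda>w. tobw (Suc n) (pb rowd w)) ` coch n 0"
      unfolding c(2) d(2) pb_rowd_ops(2)[OF c(1) d(1), symmetric] using coch_ops(2)[OF c(1) d(1)] by blast
  qed
qed

lemma H_BW_simps:
  "carrier (H_BW K D (Suc n)) = (\<lambda>z. Cs n #>\<^bsub>B n\<^esub> z) ` Zs n"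
  "\<one>\<^bsub>H_BW K D (Suc n)\<^esub> = Cs n"
  "a \<in> Zs n \<Longrightarrow> b \<in> Zs n \<Longrightarrow> (Cs n #>\<^bsub>B n\<^esub> a) \<otimes>\<^bsub>H_BW K D (Suc n)\<^esub> (Cs n #>\<^bsub>B n\<^esub> b) = Cs n #>\<^bsub>B n\<^esub> (a \<otimes>\<^bsub>B n\<^esub> b)"
  "comm_group (H_BW K D (Suc n))"
proof -
  interpret comm_group "B n" by (rule comm_group_bw)
  let ?Q = "(B n)\<lparr>carrier := Zs n\<rparr>"
  have "comm_group ?Q"
    by (rule group.group_comm_groupI[OF subgroup.subgroup_is_group[OF subgroup_Zs is_group]])
      (simp add: m_comm subgroup.mem_carrier[OF subgroup_Zs])
  then interpret Q: comm_group ?Q .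
  have C: "subgroup (Cs n) ?Q" by (rule subgroup_incl[OF subgroup_Cs(1) subgroup_Zs subgroup_Cs(2)])
  have H: "H_BW K D (Suc n) = ?Q Mod Cs n" by (simp add: H_BW_def cohomotopy_def)
  show "comm_group (H_BW K D (Suc n))" unfolding H by (rule Q.abelian_FactGroup[OF C])
  show "carrier (H_BW K D (Suc n)) = (\<lambda>z. Cs n #>\<^bsub>B n\<^esub> z) ` Zs n"
    unfolding H FactGroup_def by (auto simp: RCOSETS_def r_coset_def)
  show "\<one>\<^bsub>H_BW K D (Suc n)\<^esub> = Cs n" unfolding H by (simp add: FactGroup_def)
  assume a: "a \<in> Zs n" and b: "b \<in> Zs n"
  have ac: "a \<in> carrier (B n)" "b \<in> carrier (B n)" using a b subgroup.mem_carrier[OF subgroup_Zs] by auto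
  have nm: "Cs n \<lhd> B n" by (rule subgroup_imp_normal[OF subgroup_Cs(1)])
  show "(Cs n #>\<^bsub>B n\<^esub> a) \<otimes>\<^bsub>H_BW K D (Suc n)\<^esub> (Cs n #>\<^bsub>B n\<^esub> b) = Cs n #>\<^bsub>B n\<^esub> (a \<otimes>\<^bsub>B n\<^esub> b)"
    unfolding H FactGroup_def using normal.rcos_sum[OF nm ac] by (simp add: set_mult_def)
qed

lemma coset_one_iff: "z \<in> Zs n \<Longrightarrow> Cs n #>\<^bsub>B n\<^esub> z = Cs n \<longleftrightarrow> z \<in> Cs n"
proof -
  interpret comm_group "B n" by (rule comm_group_bw)
  assume "z \<in> Zs n"
  then have z: "z \<in> carrier (B n)" by (rule subgroup.mem_carrier[OF subgroup_Zs])
  show ?thesis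
    by (rule iffI, rule coset_join1[OF _ z subgroup_Cs(1)], assumption) (rule subgroup.rcos_const[OF subgroup_Cs(1) is_group])
qed

lemma theta_mult:
  assumes b: "b \<in> coch 1 (Suc n)" and c: "c \<in> coch 1 (Suc n)" and d: "d \<in> coch 1 (Suc n)"
    and e: "\<And>u. u \<in> Arr (lv K (Suc n)) \<Longrightarrow> d (iota u) = b (iota u) \<otimes>\<^bsub>grp D (ev u)\<^esub> c (iota u)"
  shows "theta n d = theta n b \<otimes>\<^bsub>B n\<^esub> theta n c"
  unfolding theta_def tobw_mult[symmetric]
proof (rule tobw_eqI)
  fix f s assume s: "s \<in> X (Suc n) 0 f"
  note f = X_Arr[OF s]
  have t: "TT n (frag_of s) \<in> ch 1 (Suc n) f" by (rule isop_ch[OF isop_TT']) (use s in simp)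
  have "linD f d (TT n (frag_of s)) = linD f (cmult b c) (TT n (frag_of s))"
    by (rule linD_ext[OF f t d coch_ops(2)[OF b c]]) (simp only: e cmult_X[OF iota_X])
  then show "pb (TT n) d s = cmult (pb (TT n) b) (pb (TT n) c) s"
    by (simp only: pb_X[OF s] cmult_X[OF s] linD_cmult[OF b c t f])
qed

lemma theta_cong:
  assumes c: "c \<in> coch 1 (Suc n)" and d: "d \<in> coch 1 (Suc n)"
    and e: "\<And>u. u \<in> Arr (lv K (Suc n)) \<Longrightarrow> d (iota u) = c (iota u)"
  shows "theta n d = theta n c"
  unfolding theta_def
proof (rule tobw_eqI)
  fix f s assume s: "s \<in> X (Suc n) 0 f"
  have t: "TT n (frag_of s) \<in> ch 1 (Suc n) f" by (rule isop_ch[OF isop_TT']) (use s in simp)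
  show "pb (TT n) d s = pb (TT n) c s"
    unfolding pb_X[OF s] by (rule linD_ext[OF X_Arr[OF s] t d c e])
qed

lemma theta_Zs: "ncoc n c \<Longrightarrow> theta n c \<in> Zs n"
  unfolding cocycles_bw theta_def ncoc_def using TT_cocycle[of n c] by auto

lemma theta_vd:
  assumes "rcyc 1 (Suc k) y"
  shows "theta (Suc k) (pb (vd (Suc k)) y) \<in> Cs (Suc k)"
proof -
  obtain w where w: "w \<in> coch (Suc k) 0" and e: "\<forall>f\<in>Arr K. \<forall>\<zeta>\<in>ch (Suc (Suc k)) 0 f.
    linD f (pb (TT (Suc k)) (pb (vd (Suc k)) y)) \<zeta> = linD f w (rowd \<zeta>)" using TT_coboundary[OF assms] by blast
  have c: "pb (TT (Suc k)) (pb (vd (Suc k)) y) \<in> coch (Suc (Suc k)) 0"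
    by (rule pb_coch[OF isop_TT' pb_coch[OF isop_vd rcyc_coch[OF assms]]])
  have "theta (Suc k) (pb (vd (Suc k)) y) = tobw (Suc (Suc k)) (pb rowd w)"
    unfolding theta_def
  proof (rule tobw_eqI)
    fix f s assume s: "s \<in> X (Suc (Suc k)) 0 f"
    have "linD f (pb (TT (Suc k)) (pb (vd (Suc k)) y)) (frag_of s) = linD f w (rowd (frag_of s))"
      using e X_Arr[OF s] s by simp
    then show "pb (TT (Suc k)) (pb (vd (Suc k)) y) s = pb rowd w s" unfolding linD_of[OF c s] pb_X[OF s, of rowd] .
  qed
  then show ?thesis unfolding coboundaries_bw using w by blast
qed

text \<open>A homotopy changes the cocycle by the coboundary provided by \<open>TT_coboundary\<close>.\<close>

lemma theta_dif:
  assumes x: "NZ n x" and y: "NZ n y" and d: "dif n x y"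
  shows "Cs n #>\<^bsub>B n\<^esub> theta n (toc x) = Cs n #>\<^bsub>B n\<^esub> theta n (toc y)"
proof -
  interpret comm_group "B n" by (rule comm_group_bw)
  note X = ncoc_coch[OF NZ_ncoc[OF x]] and Y = ncoc_coch[OF NZ_ncoc[OF y]]
  obtain v where v: "pder n v" and e: "\<And>u. u \<in> Arr (lv K (Suc n)) \<Longrightarrow> x u = y u \<otimes>\<^bsub>grp D (ev u)\<^esub> dlt n v u"
    using difE[OF d] by blast
  show ?thesis
  proof (cases n)
    case 0
    have "theta n (toc x) = theta n (toc y)"
    proof (rule theta_cong[OF Y X])
      fix u assume u: "u \<in> Arr (lv K (Suc n))"
      interpret A: comm_group "grp D (ev u)" by (rule grp_ev[OF u])
      show "toc x (iota u) = toc y (iota u)"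
        unfolding NZ_toc(4)[OF x u] NZ_toc(4)[OF y u] e[OF u] using NZ_carrier[OF y u] by (simp add: dlt_def 0)
    qed
    then show ?thesis by simp
  next
    case (Suc k)
    have vd: "der (Suc k) v" using v Suc by (simp add: pder_def)
    note r = toc_rcyc[OF vd]
    have P: "pb (vd (Suc k)) (toc v) \<in> coch 1 (Suc n)" unfolding Suc by (rule pb_coch[OF isop_vd rcyc_coch[OF r]])
    have "theta n (toc x) = theta n (pb (vd (Suc k)) (toc v)) \<otimes>\<^bsub>B n\<^esub> theta n (toc y)"
    proof (rule theta_mult[OF P Y X])
      fix u assume u: "u \<in> Arr (lv K (Suc n))"
      interpret A: comm_group "grp D (ev u)" by (rule grp_ev[OF u])
      have u': "u \<in> Arr (lv K (Suc (Suc k)))" using u unfolding Suc .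
      have "pb (vd (Suc k)) (toc v) (iota u) = dlt n (\<lambda>u. toc v (iota u)) u"
        unfolding Suc dlt_linD[OF rcyc_coch[OF r] u'] pb_X[OF iota_X[OF u']] ..
      also have "\<dots> = dlt n v u"
      proof (rule dlt_cong[OF _ u])
        show "der (Suc l) v" if "n = Suc l" for l using v that by (simp add: pder_def)
        show "toc v (iota w) = v w" if "n = Suc l" "w \<in> Arr (lv K (Suc l))" for l w
        proof -
          have w: "w \<in> Arr (lv K (Suc k))" using that Suc by simp
          show ?thesis by (rule toc_iota, rule ev_facts(1)[OF w], rule derD[OF vd w])
        qed
      qed
      finally show "toc x (iota u) = pb (vd (Suc k)) (toc v) (iota u) \<otimes>\<^bsub>grp D (ev u)\<^esub> toc y (iota u)"
        using NZ_carrier[OF y u] dlt_ops(3)[OF u v]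
        by (simp only: NZ_toc(4)[OF x u] NZ_toc(4)[OF y u] e[OF u] A.m_comm)
    qed
    then show ?thesis
      using r_coset_mult_left[OF subgroup_Cs(1), of "theta n (pb (vd (Suc k)) (toc v))" "theta n (toc y)"]
        theta_vd[OF r] subgroup.mem_carrier[OF subgroup_Zs theta_Zs[OF NZ_ncoc[OF y]]] Suc by simp
  qed
qed

text \<open>Indexed by the Baues-Wirsching degree p, one more than the degree of the class. For a
  class V all cosets in the union agree by \<open>theta_dif\<close>, so no representative has to be
  chosen.\<close>

definition Ph where
  "Ph p V = (\<Union>F\<in>V. coboundaries (bw_cochains K D) (bw_coface K) p #>\<^bsub>bw_cochains K D p\<^esub> theta (p - 1) (toc (xF (p - 1) F)))"

lemma theta_mk:
  assumes "NZ n x" shows "theta n (toc (xF n (mk n x))) = theta n (toc x)"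
proof -
  note y = scat_NZ[OF mk_scat[OF assms]]
  show ?thesis
    by (rule theta_cong[OF ncoc_coch[OF NZ_ncoc[OF assms]] ncoc_coch[OF NZ_ncoc[OF y]]])
      (simp only: NZ_toc(4)[OF assms] NZ_toc(4)[OF y] xF_mk)
qed

lemma Ph_cl:
  assumes x: "NZ n x"
  shows "Ph (Suc n) (cl n x) = Cs n #>\<^bsub>B n\<^esub> theta n (toc x)"
proof -
  have e: "Cs n #>\<^bsub>B n\<^esub> theta n (toc (xF n F)) = Cs n #>\<^bsub>B n\<^esub> theta n (toc x)" if F: "F \<in> cl n x" for F
  proof -
    obtain y where y: "NZ n y" "F = mk n y" "dif n x y" using F unfolding cl_members[OF x] by blast
    show ?thesis unfolding y(2) theta_mk[OF y(1)] by (rule theta_dif[OF x y(1,3), symmetric])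
  qed
  have ne: "mk n x \<in> cl n x" unfolding cl_members[OF x] by (intro exI[of _ x] conjI x refl dif_refl[OF x])
  have "Ph (Suc n) (cl n x) = (\<Union>F\<in>cl n x. Cs n #>\<^bsub>B n\<^esub> theta n (toc (xF n F)))" by (simp add: Ph_def)
  also have "\<dots> = (\<Union>F\<in>cl n x. Cs n #>\<^bsub>B n\<^esub> theta n (toc x))" by (intro SUP_cong refl e)
  also have "\<dots> = Cs n #>\<^bsub>B n\<^esub> theta n (toc x)" using ne by blast
  finally show ?thesis .
qed

lemma Ph_hom: "Ph (Suc n) \<in> hom (H_SO K D n) (H_BW K D (Suc n))"
proof (rule homI)
  fix X assume "X \<in> carrier (H_SO K D n)"
  then obtain x where x: "NZ n x" "X = cl n x" unfolding H_SO_simps by blast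
  show "Ph (Suc n) X \<in> carrier (H_BW K D (Suc n))"
    unfolding x(2) Ph_cl[OF x(1)] H_BW_simps using theta_Zs[OF NZ_ncoc[OF x(1)]] by blast
  fix Y assume "Y \<in> carrier (H_SO K D n)"
  then obtain y where y: "NZ n y" "Y = cl n y" unfolding H_SO_simps by blast
  note xy = NZ_ops(2)[OF x(1) y(1)]
  have "theta n (toc (xmult x y)) = theta n (toc x) \<otimes>\<^bsub>B n\<^esub> theta n (toc y)"
    by (rule theta_mult[OF ncoc_coch[OF NZ_ncoc[OF x(1)]] ncoc_coch[OF NZ_ncoc[OF y(1)]] ncoc_coch[OF NZ_ncoc[OF xy]]])
      (simp only: NZ_toc(4)[OF x(1)] NZ_toc(4)[OF y(1)] NZ_toc(4)[OF xy])
  then show "Ph (Suc n) (X \<otimes>\<^bsub>H_SO K D n\<^esub> Y) = Ph (Suc n) X \<otimes>\<^bsub>H_BW K D (Suc n)\<^esub> Ph (Suc n) Y"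
    unfolding x(2) y(2) H_SO_simps(3)[OF x(1) y(1)] Ph_cl[OF x(1)] Ph_cl[OF y(1)] Ph_cl[OF xy]
      H_BW_simps(3)[OF theta_Zs[OF NZ_ncoc[OF x(1)]] theta_Zs[OF NZ_ncoc[OF y(1)]]] by simp
qed

lemma Ph_surj: "Ph (Suc n) ` carrier (H_SO K D n) = carrier (H_BW K D (Suc n))"
proof
  show "Ph (Suc n) ` carrier (H_SO K D n) \<subseteq> carrier (H_BW K D (Suc n))"
    using Ph_hom[of n] unfolding hom_def by blast
  interpret comm_group "B n" by (rule comm_group_bw)
  show "carrier (H_BW K D (Suc n)) \<subseteq> Ph (Suc n) ` carrier (H_SO K D n)"
  proof
    fix Z assume "Z \<in> carrier (H_BW K D (Suc n))"
    then obtain y where y: "rcyc (Suc n) 0 y" and Z: "Z = Cs n #>\<^bsub>B n\<^esub> tobw (Suc n) y"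
      unfolding H_BW_simps cocycles_bw by blast
    from TT_surj[OF y] obtain x w where x: "rcyc 1 (Suc n) x" "vcyc 1 (Suc n) x" and w: "w \<in> coch n 0"
      and e: "\<And>f \<zeta>. f \<in> Arr K \<Longrightarrow> \<zeta> \<in> ch (Suc n) 0 f \<Longrightarrow>
        linD f (pb (TT n) x) \<zeta> = linD f y \<zeta> \<otimes>\<^bsub>grp D f\<^esub> linD f w (rowd \<zeta>)" by metis
    note Y = rcyc_coch[OF y]
    have yc: "tobw (Suc n) y \<in> carrier (B n)" by (rule tobw_carrier[OF Y])
    have wC: "tobw (Suc n) (pb rowd w) \<in> Cs n" unfolding coboundaries_bw using w by blast
    have "theta n x = tobw (Suc n) y \<otimes>\<^bsub>B n\<^esub> tobw (Suc n) (pb rowd w)"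
      unfolding theta_def tobw_mult[symmetric]
    proof (rule tobw_eqI)
      fix f s assume s: "s \<in> X (Suc n) 0 f"
      have "linD f (pb (TT n) x) (frag_of s) = linD f y (frag_of s) \<otimes>\<^bsub>grp D f\<^esub> linD f w (rowd (frag_of s))"
        by (rule e[OF X_Arr[OF s]]) (use s in simp)
      then show "pb (TT n) x s = cmult y (pb rowd w) s"
        unfolding linD_of[OF pb_coch[OF isop_TT' rcyc_coch[OF x(1)]] s] linD_of[OF Y s] cmult_X[OF s] pb_X[OF s, of rowd] .
    qed
    also have "\<dots> = tobw (Suc n) (pb rowd w) \<otimes>\<^bsub>B n\<^esub> tobw (Suc n) y"
      by (rule m_comm[OF yc subgroup.mem_carrier[OF subgroup_Cs(1) wC]])
    finally have tx: "Cs n #>\<^bsub>B n\<^esub> theta n x = Z" unfolding Z using r_coset_mult_left[OF subgroup_Cs(1) wC yc] by simp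
    \<comment> \<open>The cocycle from \<open>TT_surj\<close> need not be normalized. Normalization
      changes it by the coboundary of a row cocycle, which \<open>theta_vd\<close> carries to a
      Baues-Wirsching coboundary.\<close>
    obtain x' where x': "ncoc n x'" and tx': "Cs n #>\<^bsub>B n\<^esub> theta n x' = Cs n #>\<^bsub>B n\<^esub> theta n x"
    proof (cases n)
      case 0
      then have "ncoc n x" using x by (simp add: ncoc_def nrm_def)
      then show ?thesis using that by blast
    next
      case (Suc l)
      note x2 = x[unfolded Suc]
      have "nrm 1 (Suc (Suc (Suc l))) (pb (vd (Suc (Suc l))) x)"
      proof (rule nrmI)
        fix l' j f \<zeta> assume l': "Suc (Suc (Suc l)) = Suc (Suc l')" and j: "j \<le> l'" and f: "f \<in> Arr K" and z: "\<zeta> \<in> ch 1 (Suc l') f"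
        have s: "sdg l' j \<zeta> \<in> ch 1 (Suc (Suc (Suc l))) f" using sdg_ch[OF j z] l' by simp
        show "linD f (pb (vd (Suc (Suc l))) x) (sdg l' j \<zeta>) = \<one>\<^bsub>grp D f\<^esub>"
          unfolding linD_pb[OF isop_vd rcyc_coch[OF x2(1)] s f] by (rule vcycD[OF x2(2) s f])
      qed
      from normalize[OF x2(1) this] obtain v' w' where v': "rcyc 1 (Suc (Suc l)) v'" "rcyc 1 (Suc l) w'" "nrm 1 (Suc (Suc l)) v'"
        and ve: "\<And>f \<zeta>. f \<in> Arr K \<Longrightarrow> \<zeta> \<in> ch 1 (Suc (Suc l)) f \<Longrightarrow>
          linD f v' \<zeta> = linD f x \<zeta> \<otimes>\<^bsub>grp D f\<^esub> linD f w' (vd (Suc l) \<zeta>)" by blast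
      have V: "v' \<in> coch 1 (Suc n)" and X: "x \<in> coch 1 (Suc n)" using rcyc_coch[OF v'(1)] rcyc_coch[OF x2(1)] Suc by auto
      have vc: "vcyc 1 (Suc (Suc l)) v'"
        unfolding vcyc_def
      proof (intro conjI ballI rcyc_coch[OF v'(1)])
        fix f \<zeta> assume f: "f \<in> Arr K" and z: "\<zeta> \<in> ch 1 (Suc (Suc (Suc l))) f"
        interpret A: comm_group "grp D f" by (rule grp_D[OF f])
        show "linD f v' (vd (Suc (Suc l)) \<zeta>) = \<one>\<^bsub>grp D f\<^esub>"
          unfolding ve[OF f vd_ch[OF z]] vd_vd[OF z] vcycD[OF x2(2) z f] linD_zero[OF f] by simp
      qed
      have P: "pb (vd (Suc l)) w' \<in> coch 1 (Suc n)" unfolding Suc by (rule pb_coch[OF isop_vd rcyc_coch[OF v'(2)]])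
      have "theta n v' = theta n (pb (vd (Suc l)) w') \<otimes>\<^bsub>B n\<^esub> theta n x"
      proof (rule theta_mult[OF P X V])
        fix u assume u: "u \<in> Arr (lv K (Suc n))"
        interpret A: comm_group "grp D (ev u)" by (rule grp_ev[OF u])
        have i: "iota u \<in> X 1 (Suc (Suc l)) (ev u)" using iota_X[OF u] unfolding Suc .
        have i': "frag_of (iota u) \<in> ch 1 (Suc (Suc l)) (ev u)" using i by simp
        note U = ev_facts(1)[OF u]
        have "v' (iota u) = x (iota u) \<otimes>\<^bsub>grp D (ev u)\<^esub> linD (ev u) w' (vd (Suc l) (frag_of (iota u)))"
          using ve[OF U i'] unfolding linD_of[OF rcyc_coch[OF v'(1)] i] linD_of[OF rcyc_coch[OF x2(1)] i] .
        also have "\<dots> = linD (ev u) w' (vd (Suc l) (frag_of (iota u))) \<otimes>\<^bsub>grp D (ev u)\<^esub> x (iota u)"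
          by (rule A.m_comm[OF coch_carrier[OF rcyc_coch[OF x2(1)] i] linD_closed[OF rcyc_coch[OF v'(2)] vd_ch[OF i'] U]])
        finally show "v' (iota u) = pb (vd (Suc l)) w' (iota u) \<otimes>\<^bsub>grp D (ev u)\<^esub> x (iota u)" unfolding pb_X[OF i] .
      qed
      moreover have "theta n x \<in> carrier (B n)"
        unfolding theta_def by (rule tobw_carrier[OF pb_coch[OF isop_TT' X]])
      ultimately have "Cs n #>\<^bsub>B n\<^esub> theta n v' = Cs n #>\<^bsub>B n\<^esub> theta n x"
        using r_coset_mult_left[OF subgroup_Cs(1), of "theta n (pb (vd (Suc l)) w')" "theta n x"] theta_vd[OF v'(2)] Suc by simp
      moreover have "ncoc n v'" using v' vc Suc by (simp add: ncoc_def)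
      ultimately show ?thesis using that by blast
    qed
    let ?x = "\<lambda>u. x' (iota u)"
    have nx: "NZ n ?x" by (rule ncoc_NZ[OF x' refl])
    have "theta n (toc ?x) = theta n x'"
      by (rule theta_cong[OF ncoc_coch[OF x'] ncoc_coch[OF NZ_ncoc[OF nx]]]) (rule NZ_toc(4)[OF nx])
    then have "Ph (Suc n) (cl n ?x) = Z" unfolding Ph_cl[OF nx] using tx tx' by simp
    then show "Z \<in> Ph (Suc n) ` carrier (H_SO K D n)" unfolding H_SO_simps using nx by blast
  qed
qed

lemma Ph_kernel:
  assumes x: "NZ n x"
  shows "Ph (Suc n) (cl n x) = \<one>\<^bsub>H_BW K D (Suc n)\<^esub> \<longleftrightarrow> theta n (toc x) \<in> Cs n"
  unfolding Ph_cl[OF x] H_BW_simps(2) by (rule coset_one_iff[OF theta_Zs[OF NZ_ncoc[OF x]]])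

text \<open>Restricted to positive degree because the cochain v from \<open>TT_inj\<close> lives one
  degree below x on the resolution.\<close>

lemma Ph_inj:
  assumes x: "NZ (Suc m) x" and t: "theta (Suc m) (toc x) \<in> Cs (Suc m)"
  shows "dif (Suc m) x xone"
proof -
  note c = NZ_ncoc[OF x, unfolded ncoc_def]
  obtain w where w: "w \<in> coch (Suc m) 0" and e: "theta (Suc m) (toc x) = tobw (Suc (Suc m)) (pb rowd w)"
    using t unfolding coboundaries_bw by blast
  have P: "pb (TT (Suc m)) (toc x) \<in> coch (Suc (Suc m)) 0" by (rule pb_coch[OF isop_TT' ncoc_coch[OF NZ_ncoc[OF x]]])
  have "linD f (pb (TT (Suc m)) (toc x)) \<zeta> = linD f w (rowd \<zeta>)" if f: "f \<in> Arr K" and z: "\<zeta> \<in> ch (Suc (Suc m)) 0 f" for f \<zeta>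
  proof -
    have "linD f (pb (TT (Suc m)) (toc x)) \<zeta> = linD f (pb rowd w) \<zeta>"
      by (rule linD_cong[OF f z pb_coch[OF isop_rowd w]]) (use e[unfolded theta_def tobw_eq_iff] in blast)
    then show ?thesis unfolding linD_pb[OF isop_rowd w z f] .
  qed
  from TT_inj[OF conjunct1[OF c] conjunct1[OF conjunct2[OF c]] w this] obtain v where v: "rcyc 1 (Suc m) v"
    and ve: "\<And>f \<zeta>. f \<in> Arr K \<Longrightarrow> \<zeta> \<in> ch 1 (Suc (Suc m)) f \<Longrightarrow> linD f (toc x) \<zeta> = linD f v (vd (Suc m) \<zeta>)" by blast
  show ?thesis
  proof (rule difI)
    show "pder (Suc m) (\<lambda>u. v (iota u))" using rcyc_der[OF v] by (simp add: pder_def)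
    fix u assume u: "u \<in> Arr (lv K (Suc (Suc m)))"
    interpret A: comm_group "grp D (ev u)" by (rule grp_ev[OF u])
    note U = ev_facts(1)[OF u]
    have i: "frag_of (iota u) \<in> ch 1 (Suc (Suc m)) (ev u)" using iota_X[OF u] by simp
    have "x u = linD (ev u) v (vd (Suc m) (frag_of (iota u)))"
      using ve[OF U i] unfolding linD_of[OF ncoc_coch[OF NZ_ncoc[OF x]] iota_X[OF u]] NZ_toc(4)[OF x u] .
    also have "\<dots> = dlt (Suc m) (\<lambda>u. v (iota u)) u" by (rule dlt_linD[OF rcyc_coch[OF v] u, symmetric])
    finally have "x u = dlt (Suc m) (\<lambda>u. v (iota u)) u" .
    then show "x u = \<one>\<^bsub>grp D (ev u)\<^esub> \<otimes>\<^bsub>grp D (ev u)\<^esub> dlt (Suc m) (\<lambda>u. v (iota u)) u"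
      using NZ_carrier[OF x u] by simp
  qed
qed

lemma Ph_epi: "Ph (Suc n) \<in> epi (H_SO K D n) (H_BW K D (Suc n))"
  unfolding epi_def using Ph_hom Ph_surj by blast

lemma Ph_iso: "Ph (Suc (Suc m)) \<in> iso (H_SO K D (Suc m)) (H_BW K D (Suc (Suc m)))"
proof -
  interpret S: comm_group "H_SO K D (Suc m)" by (rule comm_group_H_SO)
  interpret W: comm_group "H_BW K D (Suc (Suc m))" by (rule H_BW_simps(4))
  interpret h: group_hom "H_SO K D (Suc m)" "H_BW K D (Suc (Suc m))" "Ph (Suc (Suc m))"
    by (intro group_hom.intro S.is_group W.is_group group_hom_axioms.intro Ph_hom)
  have "X = \<one>\<^bsub>H_SO K D (Suc m)\<^esub>" if X: "X \<in> carrier (H_SO K D (Suc m))" and o: "Ph (Suc (Suc m)) X = \<one>\<^bsub>H_BW K D (Suc (Suc m))\<^esub>" for X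
  proof -
    obtain x where x: "NZ (Suc m) x" "X = cl (Suc m) x" using X unfolding H_SO_simps by blast
    have "dif (Suc m) x xone" by (rule Ph_inj[OF x(1)]) (use o x Ph_kernel[OF x(1)] in simp)
    then show ?thesis unfolding x(2) H_SO_simps(2) using cl_eq_iff[OF x(1) NZ_ops(1)] by simp
  qed
  then have "inj_on (Ph (Suc (Suc m))) (carrier (H_SO K D (Suc m)))"
    using h.inj_on_one_iff by blast
  then show ?thesis unfolding iso_def bij_betw_def using Ph_hom Ph_surj by blast
qed

end

section \<open>Inner derivations\<close>

context nat_sys
begin

text \<open>\<open>vd 0\<close> is the augmentation, so this is the Baues-Wirsching coboundary of
  the 0-cochain w, pulled back to level 0 of the resolution.\<close>

definition innr where "innr w = pb (\<lambda>\<zeta>. rowd (vd 0 \<zeta>)) w"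

lemma isop_innr: "isop 1 (Suc 0) 0 0 (\<lambda>\<zeta>. rowd (vd 0 \<zeta>))"
  unfolding One_nat_def by (rule isop_comp[OF isop_vd isop_rowd])

lemma X0_mem: "f \<in> Arr K \<Longrightarrow> (f, [], Idn K (Cod K f)) \<in> X 0 0 f" "f \<in> Arr K \<Longrightarrow> (Idn K (Dom K f), [], f) \<in> X 0 0 f"
  by (simp_all add: X_def Cod_Idn Dom_Idn Idn_in Dom_in Cod_in Comp_Idn_left Comp_Idn_right)

lemma coch0_ends:
  assumes w: "w \<in> coch 0 0" and f: "f \<in> Arr K"
  shows "w (f, [], Idn K (Cod K f)) = pull K D f (Idn K (Cod K f)) (w (Idn K (Cod K f), [], Idn K (Cod K f)))"
    "w (Idn K (Dom K f), [], f) = push K D f (Idn K (Dom K f)) (w (Idn K (Dom K f), [], Idn K (Dom K f)))"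
proof -
  let ?b = "Cod K f" and ?a = "Dom K f"
  have b: "Idn K ?b \<in> Arr K" "Dom K (Idn K ?b) = ?b" "Cod K (Idn K ?b) = ?b" and a: "Idn K ?a \<in> Arr K" "Dom K (Idn K ?a) = ?a" "Cod K (Idn K ?a) = ?a"
    using f by (simp_all add: Idn_in Dom_in Cod_in Dom_Idn Cod_Idn)
  have sb: "(Idn K ?b, [], Idn K ?b) \<in> X 0 0 (Idn K ?b)" using X0_mem(1)[OF b(1)] b(3) by simp
  have sa: "(Idn K ?a, [], Idn K ?a) \<in> X 0 0 (Idn K ?a)" using X0_mem(1)[OF a(1)] a(3) by simp
  have F: "(f, Idn K ?b, Idn K ?b) \<in> Arr (Fac K)" by (rule FacI) (use f b in auto)
  have G: "(Idn K ?a, Idn K ?a, f) \<in> Arr (Fac K)" by (rule FacI) (use f a in auto)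
  have gb: "gact f (Idn K ?b) (Idn K ?b, [], Idn K ?b) = (f, [], Idn K ?b)"
    using Comp_Idn_left[OF f] Comp_Idn_left[OF b(1)] b(3) by (simp add: gact_def)
  have ga: "gact (Idn K ?a) f (Idn K ?a, [], Idn K ?a) = (Idn K ?a, [], f)"
    using Comp_Idn_right[OF f] Comp_Idn_right[OF a(1)] a(2) by (simp add: gact_def)
  show "w (f, [], Idn K ?b) = pull K D f (Idn K ?b) (w (Idn K ?b, [], Idn K ?b))"
    using coch_gact[OF w sb F] unfolding gb by (simp add: pull_def b(3))
  show "w (Idn K ?a, [], f) = push K D f (Idn K ?a) (w (Idn K ?a, [], Idn K ?a))"
    using coch_gact[OF w sa G] unfolding ga by (simp add: push_def a(2))
qed

lemma innr_iota:
  assumes w: "w \<in> coch 0 0" and u: "u \<in> Arr (lv K (Suc 0))"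
  shows "innr w (iota u) = w (ev u, [], Idn K (Cod K (ev u))) \<otimes>\<^bsub>grp D (ev u)\<^esub> inv\<^bsub>grp D (ev u)\<^esub> w (Idn K (Dom K (ev u)), [], ev u)"
proof -
  note U = ev_facts(1)[OF u]
  let ?g = "fc K 0 0 u"
  have g: "ev ?g = ev u" by (rule ev_fc[OF le_refl u])
  have "vd 0 (frag_of (iota u)) = frag_of (iota ?g)" using vd_iota[OF u] by simp
  then have "rowd (vd 0 (frag_of (iota u))) = frag_of (ev u, [], Idn K (Cod K (ev u))) - frag_of (Idn K (Dom K (ev u)), [], ev u)"
    by (simp add: iota_def g Comp_Idn_left[OF U] Comp_Idn_right[OF U])
  then have "innr w (iota u) = linD (ev u) w (frag_of (ev u, [], Idn K (Cod K (ev u))) - frag_of (Idn K (Dom K (ev u)), [], ev u))"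
    unfolding innr_def pb_X[OF iota_X[OF u]] by simp
  also have "\<dots> = linD (ev u) w (frag_of (ev u, [], Idn K (Cod K (ev u)))) \<otimes>\<^bsub>grp D (ev u)\<^esub> inv\<^bsub>grp D (ev u)\<^esub> linD (ev u) w (frag_of (Idn K (Dom K (ev u)), [], ev u))"
    by (rule linD_diff[OF w _ _ U]) (simp_all add: X0_mem[OF U])
  finally show ?thesis unfolding linD_of[OF w X0_mem(1)[OF U]] linD_of[OF w X0_mem(2)[OF U]] .
qed

definition dera where
  "dera a u = push K D (ev u) (Idn K (Dom K (ev u))) (a (Dom K (ev u))) \<otimes>\<^bsub>grp D (ev u)\<^esub>
     inv\<^bsub>grp D (ev u)\<^esub> (pull K D (ev u) (Idn K (Cod K (ev u))) (a (Cod K (ev u))))"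

text \<open>An inner derivation depends on an arrow only through its evaluation, which faces
  preserve; the cocycle \<open>VV\<close> is therefore constant on the vertices.\<close>

lemma inner_map_mk: "inner_map K D a = mk 0 (dera a)"
proof (rule ext)
  fix m
  show "inner_map K D a m = mk 0 (dera a) m"
    unfolding inner_map_def mk_def resolution_simps Let_def
  proof (rule restrict_ext)
    fix u assume u: "u \<in> Arr (lv K (Suc m))"
    have "VV 0 (dera a) m u = (\<lambda>xs\<in>std_simplices m 0. dera a u)"
      unfolding VV_def
    proof (rule restrict_ext)
      fix xs assume xs: "xs \<in> std_simplices m 0"
      \<comment> \<open>A simplex of dimension 0 has one vertex, so the degenerate case of
        \<open>VV\<close> does not arise.\<close>
      then have d: "distinct xs" by (cases xs) (auto simp: std_simplices_def)
      have "ev (res m xs u) = ev u" using res_arr[of m xs 0 u] std_goodD[OF xs d] u by blast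
      then show "(if distinct xs then dera a (res m xs u) else \<one>\<^bsub>grp D (ev u)\<^esub>) = dera a u" using d by (simp add: dera_def)
    qed
    then show "(ev u, \<lambda>xs\<in>std_simplices m 0. push K D (ev u) (Idn K (Dom K (ev u))) (a (Dom K (ev u))) \<otimes>\<^bsub>grp D (ev u)\<^esub>
        inv\<^bsub>grp D (ev u)\<^esub> (pull K D (ev u) (Idn K (Cod K (ev u))) (a (Cod K (ev u))))) = (ev u, VV 0 (dera a) m u)"
      by (simp add: dera_def)
  qed
qed

text \<open>The row boundary gives the value pulled back from the target minus the value pushed
  forward from the source, opposite to the sign in \<open>inner_map\<close>; hence the inverse in
  the relation between a and w.\<close>

lemma dera_innr:
  assumes w: "w \<in> coch 0 0" and u: "u \<in> Arr (lv K (Suc 0))"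
    and a: "\<And>y. y \<in> Ob K \<Longrightarrow> a y = inv\<^bsub>grp D (Idn K y)\<^esub> w (Idn K y, [], Idn K y)"
  shows "dera a u = innr w (iota u)"
proof -
  let ?f = "ev u" let ?a = "Dom K (ev u)" and ?b = "Cod K (ev u)"
  note f = ev_facts(1)[OF u]
  have ob: "?a \<in> Ob K" "?b \<in> Ob K" using f by (simp_all add: Dom_in Cod_in)
  have I: "Idn K ?a \<in> Arr K" "Idn K ?b \<in> Arr K" using ob by (simp_all add: Idn_in)
  interpret A: comm_group "grp D ?f" by (rule grp_D[OF f])
  have ca: "w (Idn K ?a, [], Idn K ?a) \<in> carrier (grp D (Idn K ?a))"
    using coch_carrier[OF w X0_mem(1)[OF I(1)]] ob by (simp add: Cod_Idn)
  have cb: "w (Idn K ?b, [], Idn K ?b) \<in> carrier (grp D (Idn K ?b))"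
    using coch_carrier[OF w X0_mem(1)[OF I(2)]] ob by (simp add: Cod_Idn)
  have "group_hom (grp D (Idn K ?a)) (grp D ?f) (push K D ?f (Idn K ?a))"
    using push_pull_hom(1)[OF I(1) f] ob Comp_Idn_right[OF f] by (simp add: Cod_Idn)
  then interpret P: group_hom "grp D (Idn K ?a)" "grp D ?f" "push K D ?f (Idn K ?a)" .
  have "group_hom (grp D (Idn K ?b)) (grp D ?f) (pull K D ?f (Idn K ?b))"
    using push_pull_hom(2)[OF f I(2)] ob Comp_Idn_left[OF f] by (simp add: Dom_Idn)
  then interpret Q: group_hom "grp D (Idn K ?b)" "grp D ?f" "pull K D ?f (Idn K ?b)" .
  show ?thesis
    unfolding dera_def innr_iota[OF w u] coch0_ends[OF w f] a[OF ob(1)] a[OF ob(2)] P.hom_inv[OF ca] Q.hom_inv[OF cb]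
    using P.hom_closed[OF ca] Q.hom_closed[OF cb] by (simp add: A.m_comm)
qed

text \<open>The two boundaries commute and each squares to zero; in degree 0 there are no degenerate
  elements.\<close>

lemma innr_ncoc:
  assumes w: "w \<in> coch 0 0"
  shows "ncoc 0 (innr w)"
  unfolding ncoc_def
proof (intro conjI)
  have c: "innr w \<in> coch 1 (Suc 0)" unfolding innr_def by (rule pb_coch[OF isop_innr w])
  show "rcyc 1 (Suc 0) (innr w)"
    unfolding rcyc_def
  proof (intro conjI ballI c)
    fix f \<zeta> assume f: "f \<in> Arr K" and z: "\<zeta> \<in> ch (Suc 1) (Suc 0) f"
    have r: "rowd \<zeta> \<in> ch 1 (Suc 0) f" by (rule rowd_ch[OF z])
    have "rowd (vd 0 (rowd \<zeta>)) = rowd (rowd (vd 0 \<zeta>))" unfolding rowd_vd[OF z] ..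
    also have "\<dots> = 0" by (rule rowd_rowd[OF vd_ch[OF z]])
    finally show "linD f (innr w) (rowd \<zeta>) = \<one>\<^bsub>grp D f\<^esub>"
      unfolding innr_def linD_pb[OF isop_innr w r f] by (simp only: linD_zero[OF f])
  qed
  show "vcyc 1 (Suc 0) (innr w)"
    unfolding vcyc_def
  proof (intro conjI ballI c)
    fix f \<zeta> assume f: "f \<in> Arr K" and z: "\<zeta> \<in> ch 1 (Suc (Suc 0)) f"
    show "linD f (innr w) (vd (Suc 0) \<zeta>) = \<one>\<^bsub>grp D f\<^esub>"
      unfolding innr_def linD_pb[OF isop_innr w vd_ch[OF z] f] vd_vd[OF z] rowd_simps(1) by (rule linD_zero[OF f])
  qed
  show "nrm 1 (Suc 0) (innr w)" by (rule nrmI) simp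
qed

text \<open>\<open>TT 0\<close> is \<open>sd\<close>, which the augmentation \<open>vd 0\<close>
  undoes.\<close>

lemma theta_innr:
  assumes w: "w \<in> coch 0 0"
  shows "theta 0 (innr w) = tobw (Suc 0) (pb rowd w)"
  unfolding theta_def
proof (rule tobw_eqI)
  fix f s assume s: "s \<in> X (Suc 0) 0 f"
  have z: "frag_of s \<in> ch (Suc 0) 0 f" using s by simp
  have t: "TT 0 (frag_of s) \<in> ch 1 (Suc 0) f" by (rule isop_ch[OF isop_TT' z])
  show "pb (TT 0) (innr w) s = pb rowd w s"
    unfolding pb_X[OF s] unfolding innr_def linD_pb[OF isop_innr w t X_Arr[OF s]] by (simp only: TT.simps(1) vd_sd_0[OF z])
qed

text \<open>In degree 0 a cocycle can be recovered from its image: as x kills simplicial boundaries,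
  \<open>vd_sd\<close> gives x at a generator as x on \<open>sd\<close> of its augmentation, and
  this is the image cochain at the augmentation.\<close>

lemma theta_innr_conv:
  assumes x: "NZ 0 x" and w: "w \<in> coch 0 0" and e: "theta 0 (toc x) = tobw (Suc 0) (pb rowd w)" and u: "u \<in> Arr (lv K (Suc 0))"
  shows "x u = innr w (iota u)"
proof -
  note f = ev_facts(1)[OF u]
  interpret A: comm_group "grp D (ev u)" by (rule grp_D[OF f])
  let ?z = "frag_of (iota u)"
  have z: "?z \<in> ch 1 (Suc 0) (ev u)" using iota_X[OF u] by simp
  have z': "vd 0 ?z \<in> ch (Suc 0) 0 (ev u)" using vd_ch[OF z] by simp
  note C = ncoc_coch[OF NZ_ncoc[OF x]]
  have v: "vcyc 1 (Suc 0) (toc x)" using NZ_ncoc[OF x] by (simp add: ncoc_def)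
  have "linD (ev u) (toc x) (?z - sd (vd 0 ?z)) = \<one>\<^bsub>grp D (ev u)\<^esub>"
    using vcycD[OF v sd_ch[OF z] f] unfolding vd_sd[OF z] .
  then have o: "x u \<otimes>\<^bsub>grp D (ev u)\<^esub> inv\<^bsub>grp D (ev u)\<^esub> linD (ev u) (toc x) (sd (vd 0 ?z)) = \<one>\<^bsub>grp D (ev u)\<^esub>"
    unfolding linD_diff[OF C z sd_ch[OF vd_ch[OF z]] f] linD_of[OF C iota_X[OF u]] NZ_toc(4)[OF x u] .
  have c: "linD (ev u) (toc x) (sd (vd 0 ?z)) \<in> carrier (grp D (ev u))"
    by (rule linD_closed[OF C sd_ch[OF vd_ch[OF z]] f])
  have "x u = linD (ev u) (toc x) (sd (vd 0 ?z))"
    using A.three_term_solve[OF NZ_carrier[OF x u] c A.one_closed] o c NZ_carrier[OF x u] by simp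
  also have "\<dots> = linD (ev u) (pb (TT 0) (toc x)) (vd 0 ?z)"
    unfolding linD_pb[OF isop_TT' C z' f] by simp
  also have "\<dots> = linD (ev u) (pb rowd w) (vd 0 ?z)"
    by (rule linD_cong[OF f z' pb_coch[OF isop_rowd w]]) (use e[unfolded theta_def tobw_eq_iff] in blast)
  also have "\<dots> = innr w (iota u)"
    unfolding linD_pb[OF isop_rowd w z' f] innr_def pb_X[OF iota_X[OF u]] ..
  finally show ?thesis .
qed

text \<open>A 0-cochain is free on its values at identities, since the generator with outer arrows
  \<alpha> and \<beta> arises by the action from the identity of the object where they meet. The
  inverse is the sign of \<open>dera_innr\<close>.\<close>

definition wdera where
  "wdera a s = (case s of (\<alpha>, \<sigma>, \<beta>) \<Rightarrow> act D (\<alpha>, Idn K (Cod K \<alpha>), \<beta>) (inv\<^bsub>grp D (Idn K (Cod K \<alpha>))\<^esub> a (Cod K \<alpha>)))"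

lemma wdera:
  assumes a: "\<And>y. y \<in> Ob K \<Longrightarrow> a y \<in> carrier (grp D (Idn K y))"
  shows "wdera a \<in> coch 0 0" "y \<in> Ob K \<Longrightarrow> a y = inv\<^bsub>grp D (Idn K y)\<^esub> wdera a (Idn K y, [], Idn K y)"
proof -
  have ia: "inv\<^bsub>grp D (Idn K y)\<^esub> a y \<in> carrier (grp D (Idn K y))" "inv\<^bsub>grp D (Idn K y)\<^esub> (inv\<^bsub>grp D (Idn K y)\<^esub> a y) = a y"
    if y: "y \<in> Ob K" for y
  proof -
    interpret A: comm_group "grp D (Idn K y)" by (rule grp_D[OF Idn_in[OF y]])
    show "inv\<^bsub>grp D (Idn K y)\<^esub> a y \<in> carrier (grp D (Idn K y))" "inv\<^bsub>grp D (Idn K y)\<^esub> (inv\<^bsub>grp D (Idn K y)\<^esub> a y) = a y"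
      using a[OF y] by simp_all
  qed
  show "a y = inv\<^bsub>grp D (Idn K y)\<^esub> wdera a (Idn K y, [], Idn K y)" if y: "y \<in> Ob K"
    using act_Idn[OF Idn_in[OF y] ia(1)[OF y]] ia(2)[OF y] y by (simp add: wdera_def Dom_Idn Cod_Idn)
  show "wdera a \<in> coch 0 0"
    unfolding coch_def mem_Collect_eq
  proof (intro allI ballI conjI impI)
    fix f s assume s: "s \<in> X 0 0 f"
    then obtain \<alpha> \<beta> where S: "s = (\<alpha>, [], \<beta>)" and al: "\<alpha> \<in> Arr K" and be: "\<beta> \<in> Arr K" and ab: "Cod K \<alpha> = Dom K \<beta>" and f: "f = Comp K \<beta> \<alpha>"
      by (auto simp: X_def)
    have y: "Cod K \<alpha> \<in> Ob K" by (rule Cod_in[OF al])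
    have F: "(\<alpha>, Idn K (Cod K \<alpha>), \<beta>) \<in> Arr (Fac K)"
      by (rule FacI) (use al be ab y in \<open>auto simp: Idn_in Dom_Idn Cod_Idn\<close>)
    have tg: "Comp K \<beta> (Comp K (Idn K (Cod K \<alpha>)) \<alpha>) = f" unfolding f Comp_Idn_left[OF al] ..
    show "wdera a s \<in> carrier (grp D f)"
      using hom_in_carrier[OF act_hom[OF F] ia(1)[OF y]] unfolding tg by (simp add: wdera_def S)
    fix \<alpha>' \<beta>' assume F': "(\<alpha>', f, \<beta>') \<in> Arr (Fac K)"
    then have c: "\<alpha>' \<in> Arr K" "Cod K \<alpha>' = Dom K \<alpha>" using al be ab f by (auto simp: Fac_def Dom_Comp)
    have "Cod K (Comp K \<alpha> \<alpha>') = Cod K \<alpha>" by (rule Cod_Comp[OF c(1) al c(2)])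
    then show "wdera a (gact \<alpha>' \<beta>' s) = act D (\<alpha>', f, \<beta>') (wdera a s)"
      using act_act[OF F F'[folded tg] ia(1)[OF y]] unfolding tg by (simp add: wdera_def S gact_def)
  qed
qed

lemma Ph_kernel_inner: "kernel (H_SO K D 0) (H_BW K D (Suc 0)) (Ph (Suc 0)) = inner_classes K D"
proof
  show "kernel (H_SO K D 0) (H_BW K D (Suc 0)) (Ph (Suc 0)) \<subseteq> inner_classes K D"
  proof
    fix V assume "V \<in> kernel (H_SO K D 0) (H_BW K D (Suc 0)) (Ph (Suc 0))"
    then obtain x where x: "NZ 0 x" "V = cl 0 x" "Ph (Suc 0) V = \<one>\<^bsub>H_BW K D (Suc 0)\<^esub>"
      unfolding kernel_def H_SO_simps by blast
    have "theta 0 (toc x) \<in> Cs 0" using x(3) Ph_kernel[OF x(1)] unfolding x(2) by simp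
    then obtain w where w: "w \<in> coch 0 0" and e: "theta 0 (toc x) = tobw (Suc 0) (pb rowd w)"
      unfolding coboundaries_bw by blast
    let ?a = "\<lambda>y\<in>Ob K. inv\<^bsub>grp D (Idn K y)\<^esub> w (Idn K y, [], Idn K y)"
    have xe: "dera ?a u = x u" if u: "u \<in> Arr (lv K (Suc 0))" for u
      unfolding theta_innr_conv[OF x(1) w e u] by (rule dera_innr[OF w u]) simp
    have "NZ 0 (dera ?a)" by (rule NZ_cong[OF x(1) xe])
    then have "cl 0 x = cl 0 (dera ?a)" using cl_eq_iff[OF x(1)] dif_refl[of 0 "dera ?a" x] xe by simp
    then have V: "V = so_class K D 0 (inner_map K D ?a)" unfolding x(2) inner_map_mk cl_def .
    have "?a y \<in> carrier (grp D (Idn K y))" if y: "y \<in> Ob K" for y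
    proof -
      interpret A: comm_group "grp D (Idn K y)" by (rule grp_D[OF Idn_in[OF y]])
      show ?thesis using coch_carrier[OF w X0_mem(1)[OF Idn_in[OF y]]] y by (simp add: Cod_Idn)
    qed
    then have "?a \<in> (\<Pi>\<^sub>E y\<in>Ob K. carrier (grp D (Idn K y)))" by (intro PiE_I) (simp_all del: restrict_apply')
    then show "V \<in> inner_classes K D" unfolding inner_classes_def V by blast
  qed
  show "inner_classes K D \<subseteq> kernel (H_SO K D 0) (H_BW K D (Suc 0)) (Ph (Suc 0))"
  proof
    fix V assume "V \<in> inner_classes K D"
    then obtain a where a: "a \<in> (\<Pi>\<^sub>E y\<in>Ob K. carrier (grp D (Idn K y)))" and V: "V = cl 0 (dera a)"
      unfolding inner_classes_def inner_map_mk cl_def by blast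
    have ac: "a y \<in> carrier (grp D (Idn K y))" if "y \<in> Ob K" for y using a that by (rule PiE_mem)
    have w: "wdera a \<in> coch 0 0" by (rule wdera(1)) (rule ac)
    have a_eq: "a y = inv\<^bsub>grp D (Idn K y)\<^esub> wdera a (Idn K y, [], Idn K y)" if "y \<in> Ob K" for y
      by (rule wdera(2)[OF _ that]) (rule ac)
    have d: "dera a u = innr (wdera a) (iota u)" if "u \<in> Arr (lv K (Suc 0))" for u
      by (rule dera_innr[OF w that a_eq])
    have n: "NZ 0 (dera a)" by (rule ncoc_NZ[OF innr_ncoc[OF w] d])
    have "theta 0 (toc (dera a)) = theta 0 (innr (wdera a))"
      by (rule theta_cong[OF ncoc_coch[OF innr_ncoc[OF w]] ncoc_coch[OF NZ_ncoc[OF n]]]) (simp only: NZ_toc(4)[OF n] d)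
    then have "theta 0 (toc (dera a)) \<in> Cs 0" unfolding theta_innr[OF w] coboundaries_bw using w by simp
    then have "Ph (Suc 0) V = \<one>\<^bsub>H_BW K D (Suc 0)\<^esub>" unfolding V Ph_kernel[OF n] .
    then show "V \<in> kernel (H_SO K D 0) (H_BW K D (Suc 0)) (Ph (Suc 0))"
      unfolding kernel_def H_SO_simps V using n by blast
  qed
qed

end

section \<open>Naturality\<close>

lemma wlk_set: "wlk C x ts \<Longrightarrow> set ts \<subseteq> Arr C"
  by (induction ts arbitrary: x) auto

lemma (in small_cat) okc_set: "okc l \<sigma> \<alpha> \<beta> \<Longrightarrow> set \<sigma> \<subseteq> Arr (lv K l)"
  by (induction \<sigma> arbitrary: \<alpha>) (auto simp del: lv_simps)

text \<open>K and K' have the same types, and so have D and D', because \<Phi> in the theorem is a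
  bound variable and hence monomorphic. P runs from K' to K, so classes are pulled back from K to
  K'.\<close>

locale nat_map = N: nat_sys K D + M: nat_sys K' D'
  for K :: "('o, 'a) cat" and D :: "('a, 'd) natsys" and K' :: "('o, 'a) cat" and D' :: "('a, 'd) natsys" +
  fixes P :: "'a \<Rightarrow> 'a" and t :: "'a \<Rightarrow> 'd \<Rightarrow> 'd"
  assumes P: "isfun K' K P" and t: "t \<in> natsys_maps K' P D D'"
begin

definition mw :: "('o, 'a) walks \<Rightarrow> ('o, 'a) walks" where "mw = map_walks id P"

lemma mw_simps [simp]: "mw (Gen f) = Gen (P f)" "mw (Path x ts) = Path x (map mw ts)"
  by (simp_all add: mw_def)

lemma P_simps:
  "f \<in> Arr K' \<Longrightarrow> P f \<in> Arr K" "f \<in> Arr K' \<Longrightarrow> Dom K (P f) = Dom K' f" "f \<in> Arr K' \<Longrightarrow> Cod K (P f) = Cod K' f"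
  "a \<in> Ob K' \<Longrightarrow> P (Idn K' a) = Idn K a"
  "f \<in> Arr K' \<Longrightarrow> g \<in> Arr K' \<Longrightarrow> Cod K' f = Dom K' g \<Longrightarrow> P (Comp K' g f) = Comp K (P g) (P f)"
  using P unfolding isfun_def by auto

lemma mw_fun: "isfun (lv K' l) (lv K l) mw"
proof (induction l)
  case 0 then show ?case using P by (auto simp: isfun_def gen_cat_def)
next
  case (Suc l)
  show ?case unfolding lv_simps
    by (rule isfun_cong[OF isfun_FU_map[OF M.cat_lv N.cat_lv Suc] category_FU[OF M.cat_lv]])
      (auto simp: Arr_FU[OF M.cat_lv] FU_map_def)
qed

lemma mw_arr: "u \<in> Arr (lv K' l) \<Longrightarrow> mw u \<in> Arr (lv K l)"
  using mw_fun unfolding isfun_def by blast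

lemma mw_FU: "u \<in> Arr (lv K' (Suc l)) \<Longrightarrow> mw u = FU_map mw u"
  by (auto simp: M.Arr_lv_Suc FU_map_def simp del: lv_simps)

lemma mw_fc: "i \<le> l \<Longrightarrow> u \<in> Arr (lv K' (Suc l)) \<Longrightarrow> mw (fc K' l i u) = fc K l i (mw u)"
proof (induction i arbitrary: l u)
  case 0
  have "u \<in> Arr (FU (lv K' l))" using 0 by simp
  from counit_natural[OF M.cat_lv mw_fun this] show ?case unfolding fc_simps mw_FU[OF 0(2)] .
next
  case (Suc i)
  then obtain k where l: "l = Suc k" by (cases l) auto
  have i: "i \<le> k" and u: "u \<in> Arr (lv K' (Suc (Suc k)))" using Suc l by auto
  have "fc K' (Suc k) (Suc i) u \<in> Arr (lv K' (Suc k))" by (rule M.fc_arr[OF _ u]) (use i in simp)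
  from mw_FU[OF this] have "mw (fc K' (Suc k) (Suc i) u) = FU_map (\<lambda>x. mw (fc K' k i x)) u"
    unfolding fc_simps FU_map_comp .
  also have "\<dots> = FU_map (\<lambda>x. fc K k i (mw x)) u" by (rule M.FU_map_eq[OF u Suc.IH[OF i]])
  also have "\<dots> = fc K (Suc k) (Suc i) (mw u)" unfolding fc_simps mw_FU[OF u] FU_map_comp ..
  finally show ?case unfolding l .
qed

lemma mw_dg: "i \<le> l \<Longrightarrow> u \<in> Arr (lv K' (Suc l)) \<Longrightarrow> mw (dg K' l i u) = dg K l i (mw u)"
proof (induction i arbitrary: l u)
  case 0
  have u: "u \<in> Arr (FU (lv K' l))" using 0 by simp
  have d: "dg K' l 0 u \<in> Arr (lv K' (Suc (Suc l)))" by (rule M.dg_arr[OF 0])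
  have "mw (dg K' l 0 u) = FU_map mw (dg K' l 0 u)" by (rule mw_FU[OF d])
  also have "\<dots> = FU_map (FU_map mw) (dg K' l 0 u)" by (rule M.FU_map_eq[OF d mw_FU])
  also have "\<dots> = dg K l 0 (mw u)"
    unfolding dg_simps mw_FU[OF 0(2)] by (rule comult_natural[OF M.cat_lv mw_fun u])
  finally show ?case .
next
  case (Suc i)
  then obtain k where l: "l = Suc k" by (cases l) auto
  have i: "i \<le> k" and u: "u \<in> Arr (lv K' (Suc (Suc k)))" using Suc l by auto
  have "dg K' (Suc k) (Suc i) u \<in> Arr (lv K' (Suc (Suc (Suc k))))" by (rule M.dg_arr[OF _ u]) (use i in simp)
  from mw_FU[OF this] have "mw (dg K' (Suc k) (Suc i) u) = FU_map (\<lambda>x. mw (dg K' k i x)) u"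
    unfolding dg_simps FU_map_comp .
  also have "\<dots> = FU_map (\<lambda>x. dg K k i (mw x)) u" by (rule M.FU_map_eq[OF u Suc.IH[OF i]])
  also have "\<dots> = dg K (Suc k) (Suc i) (mw u)" unfolding dg_simps mw_FU[OF u] FU_map_comp ..
  finally show ?case unfolding l .
qed

lemma mw_ev: "u \<in> Arr (lv K' l) \<Longrightarrow> eval_walks K (mw u) = P (eval_walks K' u)"
proof (induction l arbitrary: u)
  case 0 then show ?case by (auto simp: gen_cat_def)
next
  case (Suc l)
  then obtain x ts where u: "u = Path x ts" and w: "wlk (lv K' l) x ts" unfolding M.Arr_lv_Suc by blast
  have E: "eval_walks K (mw t) = P (eval_walks K' t)" if "t \<in> set ts" for t
    by (rule Suc.IH) (use wlk_set[OF w] that in blast)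
  have e: "map (eval_walks K) (map mw ts) = map P (map (eval_walks K') ts)"
    unfolding map_map by (rule map_cong[OF refl]) (simp only: comp_apply E)
  have w': "wlk K' x (map (eval_walks K') ts)" using isfun_wlk[OF M.isfun_ev w] by (rule conjunct1)
  have "P (comp_path K' x (map (eval_walks K') ts)) = comp_path K x (map P (map (eval_walks K') ts))"
    by (rule isfun_comp_path[OF P M.category_axioms w'])
  then show ?case unfolding e[symmetric] by (simp add: u)
qed

lemma mw_wcmp:
  assumes u: "u \<in> Arr (lv K' l)" and v: "v \<in> Arr (lv K' l)" and uv: "Cod K' (eval_walks K' u) = Dom K' (eval_walks K' v)"
  shows "mw (wcmp K' v u) = wcmp K (mw v) (mw u)"
proof -
  have "Cod (lv K' l) u = Dom (lv K' l) v" using uv M.ev_facts(3)[OF u] M.ev_facts(2)[OF v] by simp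
  then have "mw (Comp (lv K' l) v u) = Comp (lv K l) (mw v) (mw u)" using mw_fun[of l] u v unfolding isfun_def by blast
  then show ?thesis unfolding M.Comp_lv[OF u v] N.Comp_lv[OF mw_arr[OF u] mw_arr[OF v]] .
qed

lemma mw_sg:
  assumes e: "e \<in> Arr (lv K' l)" shows "mw (sg K' e) = sg K (mw e)"
proof -
  have "Dom (lv K l) (mw e) = Dom (lv K' l) e" using mw_fun[of l] e unfolding isfun_def by blast
  then have "wdom K (mw e) = wdom K' e" unfolding M.ev_facts(4)[OF e] N.ev_facts(4)[OF mw_arr[OF e]] .
  then show ?thesis by (simp add: sg_def)
qed

text \<open>The map of generators induced by P. Boundaries, degeneracies and \<open>sd\<close> are
  built from operations that commute with \<open>mw\<close>, so the zigzag is strictly natural and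
  no homotopy enters the comparison.\<close>

definition qg where "qg s = (P (fst s), map mw (fst (snd s)), P (snd (snd s)))"

lemma okc_split:
  assumes "M.okc l (u # \<tau>) \<alpha> \<beta>"
  shows "u \<in> Arr (lv K' l)" "eval_walks K' u \<in> Arr K'" "\<alpha> \<in> Arr K'" "\<beta> \<in> Arr K'" "Cod K' \<alpha> = Dom K' (eval_walks K' u)"
    "Cod K' (Comp K' (eval_walks K' u) \<alpha>) = Cod K' (eval_walks K' u)" "M.okc l \<tau> (Comp K' (eval_walks K' u) \<alpha>) \<beta>"
    "P (Comp K' (eval_walks K' u) \<alpha>) = Comp K (P (eval_walks K' u)) (P \<alpha>)"
proof -
  note d = M.okc_ConsD[OF assms]
  show u: "u \<in> Arr (lv K' l)" "eval_walks K' u \<in> Arr K'" "\<alpha> \<in> Arr K'" "\<beta> \<in> Arr K'" "Cod K' \<alpha> = Dom K' (eval_walks K' u)"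
    "Cod K' (Comp K' (eval_walks K' u) \<alpha>) = Cod K' (eval_walks K' u)" "M.okc l \<tau> (Comp K' (eval_walks K' u) \<alpha>) \<beta>"
    using d by blast+
  show "P (Comp K' (eval_walks K' u) \<alpha>) = Comp K (P (eval_walks K' u)) (P \<alpha>)" by (rule P_simps(5)[OF u(3) u(2) u(5)])
qed

lemma qg_okc: "M.okc l \<sigma> \<alpha> \<beta> \<Longrightarrow> N.okc l (map mw \<sigma>) (P \<alpha>) (P \<beta>) \<and> N.tot (map mw \<sigma>) (P \<alpha>) (P \<beta>) = P (M.tot \<sigma> \<alpha> \<beta>)"
proof (induction \<sigma> arbitrary: \<alpha>)
  case Nil then show ?case by (simp add: P_simps)
next
  case (Cons u \<sigma>)
  note d = okc_split[OF Cons.prems]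
  show ?case using Cons.IH[OF d(7)] P_simps(1)[OF d(3)] P_simps(3)[OF d(3)] P_simps(2)[OF d(2)]
    by (simp add: d(5,8) mw_arr[OF d(1)] mw_ev[OF d(1)] del: lv_simps)
qed

lemma qg_X: "s \<in> M.X p l f \<Longrightarrow> qg s \<in> N.X p l (P f)"
  unfolding M.X_def N.X_def qg_def using qg_okc by auto

lemma qg_gact:
  assumes s: "s \<in> M.X p l f" and F: "(\<alpha>', f, \<beta>') \<in> Arr (Fac K')"
  shows "qg (M.gact \<alpha>' \<beta>' s) = N.gact (P \<alpha>') (P \<beta>') (qg s)"
proof -
  obtain \<alpha> \<sigma> \<beta> where S: "s = (\<alpha>, \<sigma>, \<beta>)" and o: "M.okc l \<sigma> \<alpha> \<beta>" "M.tot \<sigma> \<alpha> \<beta> = f" using s unfolding M.X_def by blast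
  show ?thesis using M.okc_ends[OF o F] M.okc_arr[OF o(1)] by (simp add: S qg_def M.gact_def N.gact_def P_simps)
qed

lemma qg_rem: "M.okc l \<sigma> \<alpha> \<beta> \<Longrightarrow> N.rem (map mw \<sigma>) (P \<beta>) = pmap (\<lambda>x. (map mw (fst x), P (snd x))) (M.rem \<sigma> \<beta>)"
proof (induction \<sigma> arbitrary: \<alpha>)
  case (Cons u \<tau>)
  note d = okc_split[OF Cons.prems]
  note IH = Cons.IH[OF d(7)]
  show ?case
  proof (cases \<tau>)
    case Nil
    have "Cod K' (Comp K' (eval_walks K' u) \<alpha>) = Dom K' \<beta>" using d(7) unfolding Nil by simp
    then have "Cod K' (eval_walks K' u) = Dom K' \<beta>" unfolding d(6) .
    from P_simps(5)[OF d(2,4) this] show ?thesis by (simp add: Nil mw_ev[OF d(1)])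
  next
    case (Cons v \<rho>)
    note o = d(7)[unfolded Cons]
    note d2 = okc_split[OF o]
    have "mw (wcmp K' v u) = wcmp K (mw v) (mw u)"
      by (rule mw_wcmp[OF d(1) d2(1)]) (use d2(5) d(6) in simp)
    then show ?thesis using IH Cons
      by (simp add: M.rem_Cons N.rem_Cons pmap_pmap)
  qed
qed simp

lemma qg_rowg:
  assumes "s \<in> M.X (Suc p) l f" shows "N.rowg (qg s) = pmap qg (M.rowg s)"
proof -
  obtain \<alpha> u \<tau> \<beta> where S: "s = (\<alpha>, u # \<tau>, \<beta>)" and o: "M.okc l (u # \<tau>) \<alpha> \<beta>"
    using assms unfolding M.X_def by (auto simp: length_Suc_conv simp del: M.okc.simps)
  note d = okc_split[OF o]
  show ?thesis using qg_rem[OF o] by (simp add: S qg_def pmap_pmap d(8) mw_ev[OF d(1)])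
qed

lemma qg_ch: "\<zeta> \<in> M.ch p l f \<Longrightarrow> pmap qg \<zeta> \<in> N.ch p l (P f)"
  by (rule chn_pmap[OF _ qg_X])

lemma qg_rowd:
  assumes z: "\<zeta> \<in> M.ch (Suc p) l f" shows "pmap qg (M.rowd \<zeta>) = N.rowd (pmap qg \<zeta>)"
proof (rule chn_ext[OF z, where T = "\<lambda>\<zeta>. pmap qg (M.rowd \<zeta>)" and T' = "\<lambda>\<zeta>. N.rowd (pmap qg \<zeta>)"])
  fix s assume s: "s \<in> M.X (Suc p) l f"
  show "pmap qg (M.rowd (frag_of s)) = N.rowd (pmap qg (frag_of s))" using qg_rowg[OF s] by simp
qed simp_all

lemma qg_mapg:
  assumes k: "\<And>e. e \<in> Arr (lv K' l) \<Longrightarrow> mw (k' e) = k (mw e)" and z: "\<zeta> \<in> M.ch p l f"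
  shows "pmap qg (pmap (M.mapg k') \<zeta>) = pmap (N.mapg k) (pmap qg \<zeta>)"
  unfolding pmap_pmap
proof (rule pmap_cong[OF z])
  fix s assume "s \<in> M.X p l f"
  then obtain \<alpha> \<sigma> \<beta> where S: "s = (\<alpha>, \<sigma>, \<beta>)" and o: "M.okc l \<sigma> \<alpha> \<beta>" unfolding M.X_def by blast
  show "qg (M.mapg k' s) = N.mapg k (qg s)" using M.okc_set[OF o] k by (auto simp: S qg_def M.mapg_def N.mapg_def simp del: lv_simps)
qed

lemma qg_sd: "\<zeta> \<in> M.ch p l f \<Longrightarrow> pmap qg (M.sd \<zeta>) = N.sd (pmap qg \<zeta>)"
  unfolding M.sd_def N.sd_def by (rule qg_mapg[where l = l], erule mw_sg, assumption)

lemma qg_vd: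
  assumes z: "\<zeta> \<in> M.ch p (Suc l) f" shows "pmap qg (M.vd l \<zeta>) = N.vd l (pmap qg \<zeta>)"
  unfolding M.vd_def N.vd_def pmap_sum
proof (rule sum.cong[OF refl])
  fix i assume i: "i \<in> {..l}"
  have "pmap qg (pmap (M.mapg (fc K' l i)) \<zeta>) = pmap (N.mapg (fc K l i)) (pmap qg \<zeta>)"
    by (rule qg_mapg[where l = "Suc l", OF _ z], rule mw_fc) (use i in auto)
  then show "pmap qg (frag_cmul ((- 1) ^ i) (pmap (M.mapg (fc K' l i)) \<zeta>)) = frag_cmul ((- 1) ^ i) (pmap (N.mapg (fc K l i)) (pmap qg \<zeta>))"
    by simp
qed

lemma qg_sdg: "j \<le> l \<Longrightarrow> \<zeta> \<in> M.ch p (Suc l) f \<Longrightarrow> pmap qg (M.sdg l j \<zeta>) = N.sdg l j (pmap qg \<zeta>)"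
  unfolding M.sdg_def N.sdg_def by (rule qg_mapg[where l = "Suc l"], rule mw_dg, assumption+)

lemma qg_TT: "\<zeta> \<in> M.ch (p + n) l f \<Longrightarrow> pmap qg (M.TT n \<zeta>) = N.TT n (pmap qg \<zeta>)"
proof (induction n arbitrary: p)
  case 0 then show ?case by (simp add: qg_sd)
next
  case (Suc n)
  have z: "\<zeta> \<in> M.ch (Suc p + n) l f" using Suc.prems by simp
  have c: "M.TT n \<zeta> \<in> M.ch (Suc p) (l + Suc n) f" by (rule M.isop_ch[OF M.isop_TT z])
  show ?case unfolding M.TT.simps N.TT.simps qg_sd[OF M.rowd_ch[OF c]] qg_rowd[OF c] Suc.IH[OF z] ..
qed

section \<open>Pulling back cochains and cohomology classes along P and t\<close>

lemma t_hom: "f \<in> Arr K' \<Longrightarrow> group_hom (grp D (P f)) (grp D' f) (t f)"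
  using t P_simps(1) N.grp_D M.grp_D
  by (auto simp: natsys_maps_def group_hom_def group_hom_axioms_def comm_group.axioms(2))

lemma t_act: "(\<alpha>, f, \<beta>) \<in> Arr (Fac K') \<Longrightarrow> x \<in> carrier (grp D (P f)) \<Longrightarrow>
    t (Comp K' \<beta> (Comp K' f \<alpha>)) (act D (P \<alpha>, P f, P \<beta>) x) = act D' (\<alpha>, f, \<beta>) (t f x)"
  using t unfolding natsys_maps_def M.Fac_Dom_Cod by blast

definition star where "star c s = t (M.tot (fst (snd s)) (fst s) (snd (snd s))) (c (qg s))"

lemma star_X: "s \<in> M.X p l f \<Longrightarrow> star c s = t f (c (qg s))"
  by (auto simp: star_def M.X_def)

lemma star_coch:
  assumes c: "c \<in> N.coch p l" shows "star c \<in> M.coch p l"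
  unfolding M.coch_def mem_Collect_eq
proof (intro allI ballI conjI impI)
  fix f s assume s: "s \<in> M.X p l f"
  note f = M.X_Arr[OF s]
  interpret T: group_hom "grp D (P f)" "grp D' f" "t f" by (rule t_hom[OF f])
  note cs = N.coch_carrier[OF c qg_X[OF s]]
  show "star c s \<in> carrier (grp D' f)" unfolding star_X[OF s] by (rule T.hom_closed[OF cs])
  fix \<alpha>' \<beta>' assume F: "(\<alpha>', f, \<beta>') \<in> Arr (Fac K')"
  then have F': "(P \<alpha>', P f, P \<beta>') \<in> Arr (Fac K)" by (auto simp: Fac_def P_simps)
  show "star c (M.gact \<alpha>' \<beta>' s) = act D' (\<alpha>', f, \<beta>') (star c s)"
    unfolding star_X[OF M.gact_X[OF s F]] star_X[OF s] qg_gact[OF s F] N.coch_gact[OF c qg_X[OF s] F'] by (rule t_act[OF F cs])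
qed

lemma linD_star:
  assumes c: "c \<in> N.coch p l" and z: "\<zeta> \<in> M.ch p l f" and f: "f \<in> Arr K'"
  shows "lin (grp D' f) (star c) \<zeta> = t f (lin (grp D (P f)) c (pmap qg \<zeta>))"
proof -
  interpret A: comm_group "grp D (P f)" by (rule N.grp_D[OF P_simps(1)[OF f]])
  interpret B: comm_group "grp D' f" by (rule M.grp_D[OF f])
  interpret T: group_hom "grp D (P f)" "grp D' f" "t f" by (rule t_hom[OF f])
  have k: "s \<in> M.X p l f" if "s \<in> Poly_Mapping.keys \<zeta>" for s using z that by (auto simp: chn_def)
  have ck: "c (qg s) \<in> carrier (grp D (P f))" if "s \<in> Poly_Mapping.keys \<zeta>" for s
    by (rule N.coch_carrier[OF c qg_X[OF k[OF that]]])
  have "lin (grp D (P f)) c (pmap qg \<zeta>) = lin (grp D (P f)) (\<lambda>s. lin (grp D (P f)) c (frag_of (qg s))) \<zeta>"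
    unfolding pmap_def by (rule A.lin_frag_extend) (use ck in auto)
  also have "\<dots> = lin (grp D (P f)) (\<lambda>s. c (qg s)) \<zeta>" by (rule A.lin_cong) (use ck in auto)
  finally have "t f (lin (grp D (P f)) c (pmap qg \<zeta>)) = t f (lin (grp D (P f)) (\<lambda>s. c (qg s)) \<zeta>)" by simp
  also have "\<dots> = lin (grp D' f) (\<lambda>s. t f (c (qg s))) \<zeta>" by (rule A.hom_lin[OF T.homh B.comm_group_axioms ck])
  also have "\<dots> = lin (grp D' f) (star c) \<zeta>" by (rule B.lin_cong) (use star_X[OF k] ck in auto)
  finally show ?thesis ..
qed

lemma pb_star:
  assumes c: "c \<in> N.coch p' l'" and s: "s \<in> M.X p l f" and Q: "Q' (frag_of s) \<in> M.ch p' l' f"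
    and q: "pmap qg (Q' (frag_of s)) = Q (frag_of (qg s))"
  shows "M.pb Q' (star c) s = star (N.pb Q c) s"
  unfolding M.pb_X[OF s] star_X[OF s] N.pb_X[OF qg_X[OF s]] linD_star[OF c Q M.X_Arr[OF s]] q ..

lemma star_one:
  assumes c: "c \<in> N.coch p l" and z: "\<zeta> \<in> M.ch p l f" and f: "f \<in> Arr K'"
    and o: "lin (grp D (P f)) c (pmap qg \<zeta>) = \<one>\<^bsub>grp D (P f)\<^esub>"
  shows "lin (grp D' f) (star c) \<zeta> = \<one>\<^bsub>grp D' f\<^esub>"
  unfolding linD_star[OF c z f] o by (rule group_hom.hom_one[OF t_hom[OF f]])

lemma ncoc_star:
  assumes c: "N.ncoc n c" shows "M.ncoc n (star c)"
  unfolding M.ncoc_def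
proof (intro conjI)
  note C = N.ncoc_coch[OF c]
  have r: "N.rcyc 1 (Suc n) c" and v: "N.vcyc 1 (Suc n) c" and m: "N.nrm 1 (Suc n) c" using c by (auto simp: N.ncoc_def)
  show "M.rcyc 1 (Suc n) (star c)"
    unfolding M.rcyc_def
  proof (intro conjI ballI star_coch C)
    fix f \<zeta> assume f: "f \<in> Arr K'" and z: "\<zeta> \<in> M.ch (Suc 1) (Suc n) f"
    show "lin (grp D' f) (star c) (M.rowd \<zeta>) = \<one>\<^bsub>grp D' f\<^esub>"
      by (rule star_one[OF C M.rowd_ch[OF z] f], unfold qg_rowd[OF z]) (rule N.rcycD[OF r qg_ch[OF z] P_simps(1)[OF f]])
  qed
  show "M.vcyc 1 (Suc n) (star c)"
    unfolding M.vcyc_def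
  proof (intro conjI ballI star_coch C)
    fix f \<zeta> assume f: "f \<in> Arr K'" and z: "\<zeta> \<in> M.ch 1 (Suc (Suc n)) f"
    show "lin (grp D' f) (star c) (M.vd (Suc n) \<zeta>) = \<one>\<^bsub>grp D' f\<^esub>"
      by (rule star_one[OF C M.vd_ch[OF z] f], unfold qg_vd[OF z]) (rule N.vcycD[OF v qg_ch[OF z] P_simps(1)[OF f]])
  qed
  show "M.nrm 1 (Suc n) (star c)"
  proof (rule M.nrmI)
    fix l j f \<zeta> assume l: "Suc n = Suc (Suc l)" and j: "j \<le> l" and f: "f \<in> Arr K'" and z: "\<zeta> \<in> M.ch 1 (Suc l) f"
    show "lin (grp D' f) (star c) (M.sdg l j \<zeta>) = \<one>\<^bsub>grp D' f\<^esub>"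
      by (rule star_one[OF C[unfolded l] M.sdg_ch[OF j z] f], unfold qg_sdg[OF j z])
        (rule N.nrmD[OF m[unfolded l] j P_simps(1)[OF f] qg_ch[OF z]])
  qed
qed

lemma bw_pullback_tobw: "bw_pullback K' P t p (N.tobw p c) = M.tobw p (star c)"
  unfolding bw_pullback_def M.tobw_def
proof (rule restrict_ext, rule restrict_ext)
  fix f s assume f: "f \<in> Arr K'" and s: "s \<in> elts (bw_nerve K' p) f"
  obtain \<alpha> x fs \<beta> where S: "s = (\<alpha>, (x, fs), \<beta>)" by (metis prod.exhaust)
  have e: "M.emb s \<in> M.X p 0 f" and x: "x = Cod K' \<alpha>" using s unfolding M.bw_elts by (auto simp: S)
  have al: "\<alpha> \<in> Arr K'" using e M.okc_arr by (auto simp: M.X_def M.emb_def S)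
  have q: "N.emb (P \<alpha>, (x, map P fs), P \<beta>) = qg (M.emb s)" by (simp add: S N.emb_def M.emb_def qg_def)
  have s2: "(P \<alpha>, (x, map P fs), P \<beta>) \<in> elts (bw_nerve K p) (P f)"
    unfolding N.bw_elts q using qg_X[OF e] x P_simps(3)[OF al] by simp
  show "(case s of (\<alpha>, (x, fs), \<beta>) \<Rightarrow> t f (N.tobw p c (P f) (P \<alpha>, (x, map P fs), P \<beta>))) = star c (M.emb s)"
    unfolding star_X[OF e] by (simp add: S N.tobw_app[OF P_simps(1)[OF f] s2] q)
qed

lemma star_theta:
  assumes c: "c \<in> N.coch 1 (Suc n)"
  shows "M.tobw (Suc n) (star (N.pb (N.TT n) c)) = M.theta n (star c)"
  unfolding M.theta_def
proof (rule M.tobw_eqI)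
  fix f s assume s: "s \<in> M.X (Suc n) 0 f"
  have z: "frag_of s \<in> M.ch (Suc n) 0 f" using s by simp
  have "M.pb (M.TT n) (star c) s = star (N.pb (N.TT n) c) s"
    by (rule pb_star[where Q' = "M.TT n" and Q = "N.TT n", OF c s M.isop_ch[OF M.isop_TT' z]]) (use qg_TT[of "frag_of s" 1 n 0 f] z in simp)
  then show "star (N.pb (N.TT n) c) s = M.pb (M.TT n) (star c) s" ..
qed

text \<open>Members of the coset differ from \<open>theta n c\<close> by coboundaries, which
  \<open>star\<close> carries to coboundaries; so the union in \<open>H_BW_map\<close> has equal
  members.\<close>

lemma H_BW_map_theta:
  assumes c: "c \<in> N.coch 1 (Suc n)"
  shows "H_BW_map K' P D' t (Suc n) (N.Cs n #>\<^bsub>N.B n\<^esub> N.theta n c) = M.Cs n #>\<^bsub>M.B n\<^esub> M.theta n (star c)"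
proof -
  interpret B: comm_group "M.B n" by (rule M.comm_group_bw)
  interpret A: comm_group "N.B n" by (rule N.comm_group_bw)
  note y = N.pb_coch[OF N.isop_TT' c]
  have e: "M.Cs n #>\<^bsub>M.B n\<^esub> bw_pullback K' P t (Suc n) b = M.Cs n #>\<^bsub>M.B n\<^esub> M.theta n (star c)"
    if b: "b \<in> N.Cs n #>\<^bsub>N.B n\<^esub> N.theta n c" for b
  proof -
    obtain w where w: "w \<in> N.coch n 0" and bw: "b = N.tobw (Suc n) (N.pb N.rowd w) \<otimes>\<^bsub>N.B n\<^esub> N.theta n c"
      using b unfolding r_coset_def N.coboundaries_bw by blast
    note W = N.pb_coch[OF N.isop_rowd w]
    have "b = N.tobw (Suc n) (N.cmult (N.pb N.rowd w) (N.pb (N.TT n) c))"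
      unfolding bw N.theta_def N.tobw_mult ..
    then have "bw_pullback K' P t (Suc n) b = M.tobw (Suc n) (star (N.cmult (N.pb N.rowd w) (N.pb (N.TT n) c)))"
      by (simp only: bw_pullback_tobw)
    also have "\<dots> = M.tobw (Suc n) (M.cmult (M.pb M.rowd (star w)) (star (N.pb (N.TT n) c)))"
    proof (rule M.tobw_eqI)
      fix f s assume s: "s \<in> M.X (Suc n) 0 f"
      have z: "frag_of s \<in> M.ch (Suc n) 0 f" using s by simp
      interpret T: group_hom "grp D (P f)" "grp D' f" "t f" by (rule t_hom[OF M.X_Arr[OF s]])
      have "M.pb M.rowd (star w) s = star (N.pb N.rowd w) s"
        by (rule pb_star[where Q' = M.rowd and Q = N.rowd, OF w s M.rowd_ch[OF z]]) (use qg_rowd[OF z] in simp)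
      then show "star (N.cmult (N.pb N.rowd w) (N.pb (N.TT n) c)) s = M.cmult (M.pb M.rowd (star w)) (star (N.pb (N.TT n) c)) s"
        unfolding M.cmult_X[OF s] star_X[OF s] N.cmult_X[OF qg_X[OF s]]
        using T.hom_mult[OF N.coch_carrier[OF W qg_X[OF s]] N.coch_carrier[OF y qg_X[OF s]]] by simp
    qed
    also have "\<dots> = M.tobw (Suc n) (M.pb M.rowd (star w)) \<otimes>\<^bsub>M.B n\<^esub> M.theta n (star c)"
      unfolding M.tobw_mult star_theta[OF c] ..
    finally have p: "bw_pullback K' P t (Suc n) b = M.tobw (Suc n) (M.pb M.rowd (star w)) \<otimes>\<^bsub>M.B n\<^esub> M.theta n (star c)" .
    have m: "M.tobw (Suc n) (M.pb M.rowd (star w)) \<in> M.Cs n" unfolding M.coboundaries_bw using star_coch[OF w] by blast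
    have th: "M.theta n (star c) \<in> carrier (M.B n)"
      unfolding M.theta_def by (rule M.tobw_carrier[OF M.pb_coch[OF M.isop_TT' star_coch[OF c]]])
    show ?thesis unfolding p by (rule B.r_coset_mult_left[OF M.subgroup_Cs(1) m th])
  qed
  have "N.theta n c \<in> carrier (N.B n)" unfolding N.theta_def by (rule N.tobw_carrier[OF y])
  then have ne: "N.theta n c \<in> N.Cs n #>\<^bsub>N.B n\<^esub> N.theta n c" by (rule A.rcos_self[OF _ N.subgroup_Cs(1)])
  have "H_BW_map K' P D' t (Suc n) (N.Cs n #>\<^bsub>N.B n\<^esub> N.theta n c) =
      (\<Union>b\<in>N.Cs n #>\<^bsub>N.B n\<^esub> N.theta n c. M.Cs n #>\<^bsub>M.B n\<^esub> M.theta n (star c))"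
    unfolding H_BW_map_def by (intro SUP_cong refl e)
  then show ?thesis using ne by blast
qed

definition xstar where "xstar x u = t (eval_walks K' u) (x (mw u))"

lemma qg_iota: "u \<in> Arr (lv K' l) \<Longrightarrow> qg (M.iota u) = N.iota (mw u)"
  using M.ev_facts(1)[of u l] mw_ev[of u l] by (simp add: qg_def M.iota_def N.iota_def P_simps M.Dom_in M.Cod_in del: lv_simps)

lemma xstar_iota:
  assumes x: "N.NZ n x" and u: "u \<in> Arr (lv K' (Suc n))"
  shows "xstar x u = star (N.toc x) (M.iota u)"
  unfolding star_X[OF M.iota_X[OF u]] qg_iota[OF u] N.NZ_toc(4)[OF x mw_arr[OF u]] xstar_def ..

lemma NZ_xstar: "N.NZ n x \<Longrightarrow> M.NZ n (xstar x)"
  by (rule M.ncoc_NZ[OF ncoc_star[OF N.NZ_ncoc] xstar_iota])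

lemma mw_res: "u \<in> Arr (lv K' (Suc m)) \<Longrightarrow> N.res m xs (mw u) = mw (M.res m xs u)"
proof (induction m arbitrary: xs u)
  case (Suc m)
  show ?case
  proof (cases "{..Suc m} \<subseteq> set xs")
    case False
    let ?j = "LEAST j. j \<notin> set xs"
    have j: "?j \<le> Suc m" by (rule M.least_missing(2)[OF False])
    show ?thesis
      using False Suc.IH[OF M.fc_arr[OF j Suc.prems], of "map (codegen ?j) xs"] mw_fc[OF j Suc.prems]
      unfolding N.res.simps(2) M.res.simps(2) Let_def by (simp only: if_False)
  qed (simp add: N.res.simps(2) M.res.simps(2))
qed simp

lemma so_pullback_mk: "so_pullback K' P t n (N.mk n x) = M.mk n (xstar x)"
proof (rule ext)
  fix m
  show "so_pullback K' P t n (N.mk n x) m = M.mk n (xstar x) m"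
    unfolding so_pullback_def M.mk_def resolution_simps mw_def[symmetric]
  proof (rule restrict_ext)
    fix u assume u: "u \<in> Arr (lv K' (Suc m))"
    interpret T: group_hom "grp D (P (eval_walks K' u))" "grp D' (eval_walks K' u)" "t (eval_walks K' u)"
      by (rule t_hom[OF M.ev_facts(1)[OF u]])
    have "(\<lambda>xs\<in>std_simplices m n. t (eval_walks K' u) (snd (N.mk n x m (mw u)) xs)) = M.VV n (xstar x) m u"
      unfolding M.VV_def
    proof (rule restrict_ext)
      fix xs assume xs: "xs \<in> std_simplices m n"
      have "snd (N.mk n x m (mw u)) xs = N.VV n x m (mw u) xs" using mw_arr[OF u] by (simp add: N.mk_def del: lv_simps)
      also have "\<dots> = (if distinct xs then x (mw (M.res m xs u)) else \<one>\<^bsub>grp D (P (eval_walks K' u))\<^esub>)"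
        unfolding N.VV_app[OF xs] mw_res[OF u] mw_ev[OF u] ..
      finally show "t (eval_walks K' u) (snd (N.mk n x m (mw u)) xs) = (if distinct xs then xstar x (M.res m xs u) else \<one>\<^bsub>grp D' (eval_walks K' u)\<^esub>)"
        using M.res_arr[of m xs n u] std_goodD[OF xs] u by (simp add: xstar_def del: lv_simps)
    qed
    then show "(eval_walks K' u, \<lambda>xs\<in>std_simplices m n. t (eval_walks K' u) (snd (N.mk n x m (mw u)) xs)) = (eval_walks K' u, M.VV n (xstar x) m u)" by simp
  qed
qed

lemma Ph_natural:
  assumes V: "V \<in> carrier (H_SO K D n)"
  shows "M.Ph (Suc n) (H_SO_map K' P D' t n V) = H_BW_map K' P D' t (Suc n) (N.Ph (Suc n) V)"
proof -
  obtain x where x: "N.NZ n x" "V = N.cl n x" using V unfolding N.H_SO_simps by blast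
  have e: "M.Ph (Suc n) (so_class K' D' n (so_pullback K' P t n F)) = H_BW_map K' P D' t (Suc n) (N.Ph (Suc n) V)"
    if F: "F \<in> V" for F
  proof -
    obtain y where y: "N.NZ n y" "F = N.mk n y" "N.dif n x y" using F unfolding x(2) N.cl_members[OF x(1)] by blast
    note yc = N.ncoc_coch[OF N.NZ_ncoc[OF y(1)]]
    have "M.Ph (Suc n) (so_class K' D' n (so_pullback K' P t n F)) = M.Ph (Suc n) (M.cl n (xstar y))"
      unfolding y(2) so_pullback_mk M.cl_def ..
    also have "\<dots> = M.Cs n #>\<^bsub>M.B n\<^esub> M.theta n (M.toc (xstar y))" by (rule M.Ph_cl[OF NZ_xstar[OF y(1)]])
    also have "M.theta n (M.toc (xstar y)) = M.theta n (star (N.toc y))"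
      by (rule M.theta_cong[OF star_coch[OF yc] M.ncoc_coch[OF M.NZ_ncoc[OF NZ_xstar[OF y(1)]]]])
        (simp only: M.NZ_toc(4)[OF NZ_xstar[OF y(1)]] xstar_iota[OF y(1)])
    also have "M.Cs n #>\<^bsub>M.B n\<^esub> \<dots> = H_BW_map K' P D' t (Suc n) (N.Cs n #>\<^bsub>N.B n\<^esub> N.theta n (N.toc y))"
      by (rule H_BW_map_theta[OF yc, symmetric])
    also have "N.Cs n #>\<^bsub>N.B n\<^esub> N.theta n (N.toc y) = N.Ph (Suc n) V"
      unfolding x(2) N.Ph_cl[OF x(1)] by (rule N.theta_dif[OF x(1) y(1,3), symmetric])
    finally show ?thesis .
  qed
  have ne: "N.mk n x \<in> V" unfolding x(2) N.cl_members[OF x(1)] by (intro exI[of _ x] conjI x(1) refl N.dif_refl[OF x(1)])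
  \<comment> \<open>\<open>Ph\<close> is itself a union over the members of its argument, hence
    distributes over the union that defines \<open>H_SO_map\<close>.\<close>
  have "M.Ph (Suc n) (H_SO_map K' P D' t n V) = (\<Union>F\<in>V. M.Ph (Suc n) (so_class K' D' n (so_pullback K' P t n F)))"
    by (simp only: H_SO_map_def M.Ph_def UN_UN_flatten)
  also have "\<dots> = (\<Union>F\<in>V. H_BW_map K' P D' t (Suc n) (N.Ph (Suc n) V))" by (intro SUP_cong refl e)
  also have "\<dots> = H_BW_map K' P D' t (Suc n) (N.Ph (Suc n) V)" using ne by blast
  finally show ?thesis .
qed

end

lemma nat_sysI: "pointed_category K \<Longrightarrow> natural_system K D \<Longrightarrow> nat_sys K D"
  by (intro nat_sys.intro small_cat.intro nat_sys_axioms.intro) (auto simp: pointed_category_def)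

theorem theorem3p10:
  "\<exists>\<Phi> :: ('o, 'a) cat \<Rightarrow> ('a, 'd) natsys \<Rightarrow> nat \<Rightarrow>
         ('o, 'a, 'd) so_map set \<Rightarrow> ('o, 'a, 'd) bw_cochain set.
     (\<forall>K D. pointed_category K \<and> natural_system K D \<longrightarrow>
        (\<forall>n\<ge>1. comm_group (H_BW K D n) \<and> comm_group (H_SO K D (n - 1)) \<and>
           \<Phi> K D n \<in> epi (H_SO K D (n - 1)) (H_BW K D n)) \<and>
        (\<forall>n\<ge>2. \<Phi> K D n \<in> iso (H_SO K D (n - 1)) (H_BW K D n)) \<and>
        kernel (H_SO K D 0) (H_BW K D 1) (\<Phi> K D 1) = inner_classes K D) \<and>
     (\<forall>K K' D D' P t n.
        pointed_category K \<and> natural_system K D \<and> pointed_category K' \<and> natural_system K' D' \<and>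
        P \<in> pointed_functors K' K \<and> t \<in> natsys_maps K' P D D' \<and> n \<ge> 1 \<longrightarrow>
        (\<forall>X\<in>carrier (H_SO K D (n - 1)).
           \<Phi> K' D' n (H_SO_map K' P D' t (n - 1) X) = H_BW_map K' P D' t n (\<Phi> K D n X)))"
\<comment> \<open>Outside its locale \<open>nat_sys.Ph\<close> takes K and D as arguments, so one
  \<Phi> serves all pairs, as naturality demands.\<close>
proof (intro exI[of _ "\<lambda>K D. nat_sys.Ph K D"] conjI allI impI ballI)
  fix K :: "('o, 'a) cat" and D :: "('a, 'd) natsys" and n :: nat
  assume h: "pointed_category K \<and> natural_system K D" and "1 \<le> n"
  then obtain m where n: "n = Suc m" by (cases n) auto
  interpret nat_sys K D by (rule nat_sysI) (use h in auto)
  show "comm_group (H_BW K D n)" unfolding n by (rule H_BW_simps(4))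
  show "comm_group (H_SO K D (n - 1))" by (rule comm_group_H_SO)
  show "Ph n \<in> epi (H_SO K D (n - 1)) (H_BW K D n)" unfolding n using Ph_epi[of m] by simp
next
  fix K :: "('o, 'a) cat" and D :: "('a, 'd) natsys" and n :: nat
  assume h: "pointed_category K \<and> natural_system K D" and "2 \<le> n"
  then obtain m where n: "n = Suc (Suc m)" by (metis Suc_le_D Suc_le_mono numeral_2_eq_2)
  interpret nat_sys K D by (rule nat_sysI) (use h in auto)
  show "Ph n \<in> iso (H_SO K D (n - 1)) (H_BW K D n)" unfolding n using Ph_iso[of m] by simp
next
  fix K :: "('o, 'a) cat" and D :: "('a, 'd) natsys"
  assume h: "pointed_category K \<and> natural_system K D"
  interpret nat_sys K D by (rule nat_sysI) (use h in auto)
  show "kernel (H_SO K D 0) (H_BW K D 1) (Ph 1) = inner_classes K D" using Ph_kernel_inner by simp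
next
  fix K K' :: "('o, 'a) cat" and D D' :: "('a, 'd) natsys" and P t and n :: nat and V
  assume h: "pointed_category K \<and> natural_system K D \<and> pointed_category K' \<and> natural_system K' D' \<and>
      P \<in> pointed_functors K' K \<and> t \<in> natsys_maps K' P D D' \<and> 1 \<le> n"
    and V: "V \<in> carrier (H_SO K D (n - 1))"
  obtain m where n: "n = Suc m" using h by (cases n) auto
  interpret nat_map K D K' D' P t
  proof (intro nat_map.intro nat_map_axioms.intro)
    show "nat_sys K D" "nat_sys K' D'" using h by (auto intro: nat_sysI)
    show "isfun K' K P" using h by (simp add: pointed_functors_def functors_iff)
    show "t \<in> natsys_maps K' P D D'" using h by simp
  qed
  show "nat_sys.Ph K' D' n (H_SO_map K' P D' t (n - 1) V) = H_BW_map K' P D' t n (nat_sys.Ph K D n V)"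
    using Ph_natural[of V m] V unfolding n by simp
qed

end
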